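(* Let $\mathfrak g_L$ be a finite-dimensional Lie algebra over a field $k$ with basis $X_1,\dots,X_n$, and let $\mathfrak g_R$ be the opposite Lie algebra with corresponding basis $Y_1,\dots,Y_n$. Let $\mathcal H$ be a subalgebra of $U(\mathfrak g_L)^*$ that is a Hopf algebra in a Hopf pairing with $U(\mathfrak g_L)$ by evaluation, and assume $U(\mathfrak g_L)^{min}\subset\mathcal H$. Then: (1) $U(\mathfrak g_R)\#\mathcal H\to\mathcal H\# U(\mathfrak g_L)$, $Y\# f\mapsto\lambda(\psi(Y))\cdot(f\#1)$, is an isomorphism of algebras, and $\mathcal H\# U(\mathfrak g_L)\cong U(\mathfrak g_R)\#\mathcal H$ with the scalar extension structure maps (A) listed in the context is a Hopf algebroid over the base algebras $U(\mathfrak g_R),U(\mathfrak g_L)$ (left bialgebroid over $U(\mathfrak g_R)$, right bialgebroid over $U(\mathfrak g_L)$). (2) $U(\mathfrak g_L)\#\mathcal H^{\mathrm{co}}\to\mathcal H^{\mathrm{co}}\# U(\mathfrak g_R)$, $X\# f\mapsto\lambda_R(\varphi(X))\cdot(f\#1)$, is an isomorphism of algebras; $\mathcal H^{\mathrm{co}}\# U(\mathfrak g_R)$ is isomorphic to $\mathcal H\# U(\mathfrak g_L)$ (via $f\#1\mapsto f\#1$, $1\# X_j\mapsto\sum_i\mathcal U^i_j\# Y_i$ from $\mathcal H\# U(\mathfrak g_L)$ to $\mathcal H^{\mathrm{co}}\# U(\mathfrak g_R)$); and $\mathcal H^{\mathrm{co}}\# U(\mathfrak g_R)\cong U(\mathfrak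 g_L)\#\mathcal H^{\mathrm{co}}$ with the scalar extension structure maps (B) listed in the context is a Hopf algebroid over the base algebras $U(\mathfrak g_L),U(\mathfrak g_R)$ (left bialgebroid over $U(\mathfrak g_L)$, right bialgebroid over $U(\mathfrak g_R)$).
   Context: Let $[X_i,X_j]=\sum_kC_{ij}^kX_k$, so that $[Y_i,Y_j]=-\sum_kC_{ij}^kY_k$ in $\mathfrak g_R$. Let $\varphi\colon U(\mathfrak g_L)\to U(\mathfrak g_R)$ be the algebra antiisomorphism with $X_i\mapsto Y_i$, and $\psi=\varphi^{-1}$; thus $U(\mathfrak g_R)\cong U(\mathfrak g_L)^{\mathrm{op}}$. $U(\mathfrak g_L)^*$ is the convolution algebra dual to $U(\mathfrak g_L)$, and $U(\mathfrak g_L)^\circ$ the finite dual Hopf algebra; the assumption on $\mathcal H$ says that it is a Hopf subalgebra of $U(\mathfrak g_L)^\circ$, paired with $U(\mathfrak g_L)$ by evaluation $\langle\,,\rangle$. The functionals $\mathcal U^i_j,\bar{\mathcal U}^i_j\in U(\mathfrak g_L)^\circ$ are the unique ones satisfying $\langle X_k,\mathcal U^i_j\rangle=C^i_{kj}$, $\Delta(\mathcal U^i_j)=\sum_k\mathcal U^i_k\otimes\mathcal U^k_j$, $\Delta(\bar{\mathcal U}^i_j)=\sum_k\bar{\mathcal U}^k_j\otimes\bar{\mathcal U}^i_k$, $\epsilon(\mathcal U^i_j)=\delta^i_j=\epsilon(\bar{\mathcal U}^i_j)$, $S(\mathcal U^i_j)=\bar{\mathcal U}^i_j$, $S(\bar{\mathcal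 U}^i_j)=\mathcal U^i_j$. $U(\mathfrak g_L)^{min}$ is the subalgebra of $U(\mathfrak g_L)^*$ generated by all of them, a Hopf subalgebra of $U(\mathfrak g_L)^\circ$. $\mathcal H^{\mathrm{co}}$ is $\mathcal H$ with opposite comultiplication; it is paired with $U(\mathfrak g_R)$ by $\langle Y,f\rangle=\langle\psi(Y),f\rangle$. Below $f_{(1)}\otimes f_{(2)}$ always denotes the comultiplication of $\mathcal H$. The right Hopf actions of $\mathcal H$ on $U(\mathfrak g_L)$ and of $\mathcal H^{\mathrm{co}}$ on $U(\mathfrak g_R)$ are $D\blacktriangleleft f=\sum\langle D_{(1)},f\rangle D_{(2)}$. For a right $H$-module algebra $A$, $H\# A$ is $H\otimes A$ with $(h\# a)(h'\# a')=\sum hh'_{(1)}\#(a\blacktriangleleft h'_{(2)})a'$; for a left $H$-module algebra $A$, $A\# H$ is $A\otimes H$ with $(a\# h)(a'\# h')=\sum a(h_{(1)}\blacktriangleright a')\# h_{(2)}h'$ (Sweedler notation of the Hopf algebra in question). $U(\mathfrak g_R)\#\mathcal H$ is formed with $f\blacktriangleright Y=\varphi(\psi(Y)\blacktriangleleft S(f))$, and $U(\mathfrak g_L)\#\mathcal H^{\mathrm{co}}$ with $f\blacktriangleright X=\psi(\varphi(X)\blacktriangleleft S(f))$. $\lambda\colon U(\mathfrak g_L)\to\mathcal H\# U(\mathfrak g_L)$ and $\lambda_R\colon U(\mathfrak g_R)\to\mathcal H^{\mathrm{co}}\# U(\mathfrak g_R)$ are the antimultiplicative unital linear maps with $\lambda(X_j)=\sum_i\bar{\mathcal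 U}^i_j\# X_i$, $\lambda_R(Y_j)=\sum_i\mathcal U^i_j\# Y_i$. Structure maps (A) on $K=\mathcal H\# U(\mathfrak g_L)$: identify $f$, $X$, $Y$ ($f\in\mathcal H$, $X\in U(\mathfrak g_L)$, $Y\in U(\mathfrak g_R)$) with $f\#1$, $1\# X$, $\lambda(\psi(Y))$ in $K$. $\alpha_L(Y)=Y$, $\alpha_R(X)=X$; $\beta_L,\beta_R$ are the antimultiplicative unital maps with $\beta_L(Y_j)=X_j+\sum_iC_{ij}^i$, $\beta_R(X_j)=Y_j$; $\Delta_L(Yf)=\sum Yf_{(1)}\otimes f_{(2)}$; $\Delta_R(fX)=\sum f_{(1)}\otimes f_{(2)}X$; $\epsilon_L(Yf)=\epsilon(f)Y$, $\epsilon_R(fX)=\epsilon(f)X$; the antipode $\tau$ is the algebra antihomomorphism with $\tau(Y_j)=X_j$, $\tau(f)=S(f)$. Structure maps (B) on $K=\mathcal H^{\mathrm{co}}\# U(\mathfrak g_R)$: identify $f$, $Y$, $X$ with $f\#1$, $1\# Y$, $\lambda_R(\varphi(X))$. $\alpha_L(X)=X$, $\alpha_R(Y)=Y$; $\beta_L,\beta_R$ antimultiplicative unital with $\beta_L(X_j)=Y_j-\sum_iC_{ij}^i$, $\beta_R(Y_j)=X_j$; $\Delta_L(Xf)=\sum Xf_{(2)}\otimes f_{(1)}$; $\Delta_R(fY)=\sum f_{(2)}\otimes f_{(1)}Y$; $\epsilon_L(Xf)=\epsilon(f)X$, $\epsilon_R(fY)=\epsilon(f)Y$; $\tau$ is the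 algebra antihomomorphism with $\tau(X_j)=Y_j$, $\tau(f)=S(f)$. Hopf algebroid (symmetric version). A left bialgebroid over an algebra $L$ is an algebra $K$ with algebra maps $\alpha_L\colon L\to K$, $\beta_L\colon L^{\mathrm{op}}\to K$ with commuting images, making $K$ an $L$-bimodule by $l.b.l'=\alpha_L(l)\beta_L(l')b$, and $L$-bimodule maps $\Delta_L\colon K\to K\otimes_LK$ (coassociative), $\epsilon_L\colon K\to L$ (counit), such that $\Delta_L$ lands in $\{\sum b\otimes b':\sum b\beta_L(l)\otimes b'=\sum b\otimes b'\alpha_L(l)\ \forall l\}$ and is a unital algebra map into it, and $\epsilon_L(1)=1$, $\epsilon_L(b\alpha_L(\epsilon_L(b')))=\epsilon_L(bb')=\epsilon_L(b\beta_L(\epsilon_L(b')))$. A right bialgebroid over $R$ is defined symmetrically: $r.b.r'=b\beta_R(r)\alpha_R(r')$, $\Delta_R\colon K\to K\otimes_RK$ multiplicative with image in $\{\sum b\otimes b':\sum\alpha_R(r)b\otimes b'=\sum b\otimes\beta_R(r)b'\ \forall r\}$, $\epsilon_R(1)=1$, $\epsilon_R(\alpha_R(\epsilon_R(b))b')=\epsilon_R(bb')=\epsilon_R(\beta_R(\epsilon_R(b))b')$. A Hopf algebroid over $L,R$ is an algebra $K$ with a left bialgebroid structure over $L$, a right bialgebroid structure over $R$ and an algebra antihomomorphism $\tau\colon K\to K$ such that $\alpha_L\epsilon_L\beta_R=\beta_R$, $\beta_L\epsilon_L\alpha_R=\alpha_R$, $\alpha_R\epsilon_R\beta_L=\beta_L$,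 $\beta_R\epsilon_R\alpha_L=\alpha_L$; $(\Delta_R\otimes_L\mathrm{id})\Delta_L=(\mathrm{id}\otimes_R\Delta_L)\Delta_R$, $(\Delta_L\otimes_R\mathrm{id})\Delta_R=(\mathrm{id}\otimes_L\Delta_R)\Delta_L$; $\tau\beta_L=\alpha_L$, $\tau\beta_R=\alpha_R$; and, with $\mu$ the multiplication, $\mu(\tau\otimes_L\mathrm{id})\Delta_L=\alpha_R\epsilon_R$, $\mu(\mathrm{id}\otimes_R\tau)\Delta_R=\alpha_L\epsilon_L$. *)

theory Defs
  imports
    "HOL-Algebra.QuotRing"
    "HOL-Algebra.Subrings"
    "HOL-Algebra.Module"
    "HOL-Algebra.Algebraic_Closure_Type"
    "HOL-Library.Poly_Mapping"
begin

section \<open>Algebras over a field\<close>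

text \<open>
  The ground field is a type \<open>'k\<close> of class \<open>field\<close>. Vector spaces and (noncommutative) algebras
  over it are records of type \<open>('k, 'a) module\<close> from HOL-Algebra, viewed over the ring record
  \<^const>\<open>ring_of_type_algebra\<close> of \<open>'k\<close>; for mere vector spaces \<open>mult\<close> and \<open>one\<close> are not used.
  (The locale \<open>algebra\<close> of HOL-Algebra is restricted to commutative algebras.)
\<close>

definition scalars :: "('k::field, 'k) module" where
  "scalars = ring.extend ring_of_type_algebra (module.fields (*))"

definition k_algebra :: "('k::field, 'a, 'm) module_scheme \<Rightarrow> bool" where
  "k_algebra A \<longleftrightarrow> ring A \<and> module (ring_of_type_algebra :: 'k ring) A \<and>
     (\<forall>c. \<forall>x\<in>carrier A. \<forall>y\<in>carrier A.
        (c \<odot>\<^bsub>A\<^esub> x) \<otimes>\<^bsub>A\<^esub> y = c \<odot>\<^bsub>A\<^esub> (x \<otimes>\<^bsub>A\<^esub> y) \<and>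
        x \<otimes>\<^bsub>A\<^esub> (c \<odot>\<^bsub>A\<^esub> y) = c \<odot>\<^bsub>A\<^esub> (x \<otimes>\<^bsub>A\<^esub> y))"

definition k_subalgebra :: "'a set \<Rightarrow> ('k::field, 'a, 'm) module_scheme \<Rightarrow> bool" where
  "k_subalgebra S A \<longleftrightarrow> subring S A \<and> (\<forall>c. \<forall>x\<in>S. c \<odot>\<^bsub>A\<^esub> x \<in> S)"

definition linear_map ::
  "('k::field, 'a, 'm) module_scheme \<Rightarrow> ('k, 'b, 'n) module_scheme \<Rightarrow> ('a \<Rightarrow> 'b) \<Rightarrow> bool" where
  "linear_map V W f \<longleftrightarrow> f \<in> carrier V \<rightarrow> carrier W \<and>
     (\<forall>x\<in>carrier V. \<forall>y\<in>carrier V. f (x \<oplus>\<^bsub>V\<^esub> y) = f x \<oplus>\<^bsub>W\<^esub> f y) \<and>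
     (\<forall>c. \<forall>x\<in>carrier V. f (c \<odot>\<^bsub>V\<^esub> x) = c \<odot>\<^bsub>W\<^esub> f x)"

definition alg_hom ::
  "('k::field, 'a, 'm) module_scheme \<Rightarrow> ('k, 'b, 'n) module_scheme \<Rightarrow> ('a \<Rightarrow> 'b) \<Rightarrow> bool" where
  "alg_hom A B f \<longleftrightarrow> linear_map A B f \<and> f \<one>\<^bsub>A\<^esub> = \<one>\<^bsub>B\<^esub> \<and>
     (\<forall>x\<in>carrier A. \<forall>y\<in>carrier A. f (x \<otimes>\<^bsub>A\<^esub> y) = f x \<otimes>\<^bsub>B\<^esub> f y)"

definition alg_antihom ::
  "('k::field, 'a, 'm) module_scheme \<Rightarrow> ('k, 'b, 'n) module_scheme \<Rightarrow> ('a \<Rightarrow> 'b) \<Rightarrow> bool" where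
  "alg_antihom A B f \<longleftrightarrow> linear_map A B f \<and> f \<one>\<^bsub>A\<^esub> = \<one>\<^bsub>B\<^esub> \<and>
     (\<forall>x\<in>carrier A. \<forall>y\<in>carrier A. f (x \<otimes>\<^bsub>A\<^esub> y) = f y \<otimes>\<^bsub>B\<^esub> f x)"

definition alg_iso ::
  "('k::field, 'a, 'm) module_scheme \<Rightarrow> ('k, 'b, 'n) module_scheme \<Rightarrow> ('a \<Rightarrow> 'b) \<Rightarrow> bool" where
  "alg_iso A B f \<longleftrightarrow> alg_hom A B f \<and> bij_betw f (carrier A) (carrier B)"

text \<open>
  The (anti)homomorphism \<open>A \<rightarrow> B\<close> with values \<open>f i\<close> on the elements \<open>g i\<close>, \<open>i \<in> I\<close>; it is only
  used when the \<open>g i\<close> generate \<open>A\<close>, so that it is unique on the carrier if it exists.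
\<close>

definition hom_ext ::
  "('k::field, 'a, 'm) module_scheme \<Rightarrow> ('k, 'b, 'n) module_scheme \<Rightarrow> 'i set \<Rightarrow>
    ('i \<Rightarrow> 'a) \<Rightarrow> ('i \<Rightarrow> 'b) \<Rightarrow> 'a \<Rightarrow> 'b" where
  "hom_ext A B I g f = (SOME F. alg_hom A B F \<and> (\<forall>i\<in>I. F (g i) = f i))"

definition antihom_ext ::
  "('k::field, 'a, 'm) module_scheme \<Rightarrow> ('k, 'b, 'n) module_scheme \<Rightarrow> 'i set \<Rightarrow>
    ('i \<Rightarrow> 'a) \<Rightarrow> ('i \<Rightarrow> 'b) \<Rightarrow> 'a \<Rightarrow> 'b" where
  "antihom_ext A B I g f = (SOME F. alg_antihom A B F \<and> (\<forall>i\<in>I. F (g i) = f i))"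


section \<open>Tensor products\<close>

text \<open>
  All tensor products are quotients of the free vector space on a set \<open>S\<close> (of pairs or triples),
  realised inside the finitely supported functions \<open>'s \<Rightarrow>\<^sub>0 'k\<close>, by the span of a set of relations.
\<close>

definition fscale :: "'k::field \<Rightarrow> ('s \<Rightarrow>\<^sub>0 'k) \<Rightarrow> ('s \<Rightarrow>\<^sub>0 'k)" where
  "fscale c = Poly_Mapping.map ((*) c)"

lemma lookup_fscale [simp]: "Poly_Mapping.lookup (fscale c x) s = c * Poly_Mapping.lookup x s"
  unfolding fscale_def by (simp add: Poly_Mapping.map.rep_eq when_def)

lemma vector_space_fscale: "Vector_Spaces.vector_space fscale"
  by unfold_locales (auto intro!: poly_mapping_eqI simp: lookup_add algebra_simps)

abbreviation delta :: "'s \<Rightarrow> ('s \<Rightarrow>\<^sub>0 'k::field)" where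
  "delta s \<equiv> Poly_Mapping.single s 1"

type_synonym ('k, 's) formal = "('s \<Rightarrow>\<^sub>0 'k) set"

definition fclass :: "('s \<Rightarrow>\<^sub>0 'k::field) set \<Rightarrow> ('s \<Rightarrow>\<^sub>0 'k) \<Rightarrow> ('k, 's) formal" where
  "fclass rels x = {x + w | w. w \<in> Modules.module.span fscale rels}"

definition free_quot :: "'s set \<Rightarrow> ('s \<Rightarrow>\<^sub>0 'k::field) set \<Rightarrow> ('k, ('k, 's) formal) module" where
  "free_quot S rels =
     \<lparr>carrier = fclass rels ` {x. Poly_Mapping.keys x \<subseteq> S}, monoid.mult = undefined, one = undefined,
      zero = fclass rels 0, add = (\<lambda>P Q. fclass rels ((SOME x. x \<in> P) + (SOME y. y \<in> Q))),
      module.smult = (\<lambda>c P. fclass rels (fscale c (SOME x. x \<in> P)))\<rparr>"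

text \<open>
  The linear map on a quotient of a free vector space which is induced by a map \<open>b\<close> on the basis,
  computed on a representative. Writing \<open>t = \<Sum> x \<otimes> y\<close>, the value of \<open>\<Sum> b x y\<close> (in particular
  any expression in Sweedler notation) is \<open>tensor_lift B (\<lambda>(x, y). b x y) t\<close>.
\<close>

definition tensor_lift ::
  "('k::field, 'z, 'm) module_scheme \<Rightarrow> ('s \<Rightarrow> 'z) \<Rightarrow> ('k, 's) formal \<Rightarrow> 'z" where
  "tensor_lift B b t =
     (let x = SOME x. x \<in> t
      in finsum B (\<lambda>s. Poly_Mapping.lookup x s \<odot>\<^bsub>B\<^esub> b s) (Poly_Mapping.keys x))"

definition lin_rels ::
  "('k::field, 'a, 'm) module_scheme \<Rightarrow> ('a \<Rightarrow> 's) \<Rightarrow> ('s \<Rightarrow>\<^sub>0 'k) set" where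
  "lin_rels A s =
     {delta (s (x \<oplus>\<^bsub>A\<^esub> y)) - delta (s x) - delta (s y) | x y. x \<in> carrier A \<and> y \<in> carrier A} \<union>
     {delta (s (c \<odot>\<^bsub>A\<^esub> x)) - fscale c (delta (s x)) | c x. x \<in> carrier A}"

text \<open>
  A tensor product over a noncommutative algebra is the quotient of the tensor product over \<open>'k\<close>
  by the relations \<open>f m \<otimes> n = m \<otimes> g n\<close> where \<open>(f, g)\<close> ranges over the set \<open>E\<close> of pairs
  (right multiplication by \<open>l\<close>, left multiplication by \<open>l\<close>). For \<open>E = {}\<close> this is the tensor
  product over \<open>'k\<close>.
\<close>

type_synonym ('m, 'n) balancing = "(('m \<Rightarrow> 'm) \<times> ('n \<Rightarrow> 'n)) set"

definition tensor_rels ::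
  "('m, 'n) balancing \<Rightarrow> ('k::field, 'm, 'p) module_scheme \<Rightarrow> ('k, 'n, 'q) module_scheme \<Rightarrow>
    ('m \<times> 'n \<Rightarrow>\<^sub>0 'k) set" where
  "tensor_rels E M N =
     (\<Union>n\<in>carrier N. lin_rels M (\<lambda>m. (m, n))) \<union> (\<Union>m\<in>carrier M. lin_rels N (\<lambda>n. (m, n))) \<union>
     {delta (f m, n) - delta (m, g n) | f g m n. (f, g) \<in> E \<and> m \<in> carrier M \<and> n \<in> carrier N}"

definition tensor_over ::
  "('m, 'n) balancing \<Rightarrow> ('k::field, 'm, 'p) module_scheme \<Rightarrow> ('k, 'n, 'q) module_scheme \<Rightarrow>
    ('k, ('k, 'm \<times> 'n) formal) module" where
  "tensor_over E M N = free_quot (carrier M \<times> carrier N) (tensor_rels E M N)"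

definition ten_over ::
  "('m, 'n) balancing \<Rightarrow> ('k::field, 'm, 'p) module_scheme \<Rightarrow> ('k, 'n, 'q) module_scheme \<Rightarrow>
    'm \<Rightarrow> 'n \<Rightarrow> ('k, 'm \<times> 'n) formal" where
  "ten_over E M N m n = fclass (tensor_rels E M N) (delta (m, n))"

abbreviation "tensor \<equiv> tensor_over {}"
abbreviation "ten \<equiv> ten_over {}"

text \<open>
  Threefold tensor products of \<open>K\<close> with itself are formed without brackets; \<open>E\<close> balances the first
  two factors, \<open>F\<close> the last two.
\<close>

definition tensor3_rels ::
  "('a, 'a) balancing \<Rightarrow> ('a, 'a) balancing \<Rightarrow> ('k::field, 'a, 'm) module_scheme \<Rightarrow>
    ('a \<times> 'a \<times> 'a \<Rightarrow>\<^sub>0 'k) set" where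
  "tensor3_rels E F K =
     (\<Union>y\<in>carrier K. \<Union>z\<in>carrier K. lin_rels K (\<lambda>x. (x, y, z)) \<union> lin_rels K (\<lambda>x. (y, x, z)) \<union>
        lin_rels K (\<lambda>x. (y, z, x))) \<union>
     {delta (f x, y, z) - delta (x, g y, z) | f g x y z.
        (f, g) \<in> E \<and> x \<in> carrier K \<and> y \<in> carrier K \<and> z \<in> carrier K} \<union>
     {delta (x, f y, z) - delta (x, y, g z) | f g x y z.
        (f, g) \<in> F \<and> x \<in> carrier K \<and> y \<in> carrier K \<and> z \<in> carrier K}"

definition tensor3 ::
  "('a, 'a) balancing \<Rightarrow> ('a, 'a) balancing \<Rightarrow> ('k::field, 'a, 'm) module_scheme \<Rightarrow>
    ('k, ('k, 'a \<times> 'a \<times> 'a) formal) module" where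
  "tensor3 E F K = free_quot (carrier K \<times> carrier K \<times> carrier K) (tensor3_rels E F K)"

definition ten3 ::
  "('a, 'a) balancing \<Rightarrow> ('a, 'a) balancing \<Rightarrow> ('k::field, 'a, 'm) module_scheme \<Rightarrow>
    'a \<Rightarrow> 'a \<Rightarrow> 'a \<Rightarrow> ('k, 'a \<times> 'a \<times> 'a) formal" where
  "ten3 E F K x y z = fclass (tensor3_rels E F K) (delta (x, y, z))"

text \<open>The maps \<open>\<Delta> \<otimes> id\<close> and \<open>id \<otimes> \<Delta>\<close> into the threefold tensor product.\<close>

definition comult_id ::
  "('a, 'a) balancing \<Rightarrow> ('a, 'a) balancing \<Rightarrow> ('k::field, 'a, 'm) module_scheme \<Rightarrow>
    ('a \<Rightarrow> ('k, 'a \<times> 'a) formal) \<Rightarrow> ('k, 'a \<times> 'a) formal \<Rightarrow> ('k, 'a \<times> 'a \<times> 'a) formal" where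
  "comult_id E F K \<Delta> =
     tensor_lift (tensor3 E F K)
       (\<lambda>(x, y). tensor_lift (tensor3 E F K) (\<lambda>(x1, x2). ten3 E F K x1 x2 y) (\<Delta> x))"

definition id_comult ::
  "('a, 'a) balancing \<Rightarrow> ('a, 'a) balancing \<Rightarrow> ('k::field, 'a, 'm) module_scheme \<Rightarrow>
    ('a \<Rightarrow> ('k, 'a \<times> 'a) formal) \<Rightarrow> ('k, 'a \<times> 'a) formal \<Rightarrow> ('k, 'a \<times> 'a \<times> 'a) formal" where
  "id_comult E F K \<Delta> =
     tensor_lift (tensor3 E F K)
       (\<lambda>(x, y). tensor_lift (tensor3 E F K) (\<lambda>(y1, y2). ten3 E F K x y1 y2) (\<Delta> y))"

definition tensor_alg ::
  "('k::field, 'a, 'm) module_scheme \<Rightarrow> ('k, 'b, 'n) module_scheme \<Rightarrow>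
    ('k, ('k, 'a \<times> 'b) formal) module" where
  "tensor_alg A B = (tensor A B)
     \<lparr>monoid.mult := (\<lambda>s t. tensor_lift (tensor A B) (\<lambda>(a, b).
                 tensor_lift (tensor A B) (\<lambda>(a', b'). ten A B (a \<otimes>\<^bsub>A\<^esub> a') (b \<otimes>\<^bsub>B\<^esub> b')) t) s),
      one := ten A B \<one>\<^bsub>A\<^esub> \<one>\<^bsub>B\<^esub>\<rparr>"


section \<open>Hopf algebras, duals, smash products\<close>

record (overloaded) ('k::zero, 'a) hopf = "('k, 'a) module" +
  comult :: "'a \<Rightarrow> ('k, 'a \<times> 'a) formal"
  counit :: "'a \<Rightarrow> 'k"
  antipode :: "'a \<Rightarrow> 'a"

definition hopf_algebra :: "('k::field, 'a) hopf \<Rightarrow> bool" where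
  "hopf_algebra H \<longleftrightarrow>
     k_algebra H \<and>
     alg_hom H (tensor_alg H H) (comult H) \<and>
     alg_hom H scalars (counit H) \<and>
     (\<forall>h\<in>carrier H. comult_id {} {} H (comult H) (comult H h) =
                    id_comult {} {} H (comult H) (comult H h)) \<and>
     (\<forall>h\<in>carrier H. tensor_lift H (\<lambda>(x, y). counit H x \<odot>\<^bsub>H\<^esub> y) (comult H h) = h \<and>
                    tensor_lift H (\<lambda>(x, y). counit H y \<odot>\<^bsub>H\<^esub> x) (comult H h) = h) \<and>
     linear_map H H (antipode H) \<and>
     (\<forall>h\<in>carrier H.
        tensor_lift H (\<lambda>(x, y). antipode H x \<otimes>\<^bsub>H\<^esub> y) (comult H h) = counit H h \<odot>\<^bsub>H\<^esub> \<one>\<^bsub>H\<^esub> \<and>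
        tensor_lift H (\<lambda>(x, y). x \<otimes>\<^bsub>H\<^esub> antipode H y) (comult H h) = counit H h \<odot>\<^bsub>H\<^esub> \<one>\<^bsub>H\<^esub>)"

text \<open>The antipode of the co-opposite is the inverse of the antipode.\<close>

definition coop :: "('k::field, 'a) hopf \<Rightarrow> ('k, 'a) hopf" where
  "coop H = H
     \<lparr>comult := (\<lambda>h. tensor_lift (tensor H H) (\<lambda>(x, y). ten H H y x) (comult H h)),
      antipode := inv_into (carrier H) (antipode H)\<rparr>"

definition hopf_pairing ::
  "('k::field, 'a) hopf \<Rightarrow> ('k, 'b) hopf \<Rightarrow> ('a \<Rightarrow> 'b \<Rightarrow> 'k) \<Rightarrow> bool" where
  "hopf_pairing U H p \<longleftrightarrow>
     (\<forall>h\<in>carrier H. linear_map U scalars (\<lambda>u. p u h)) \<and>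
     (\<forall>u\<in>carrier U. linear_map H scalars (p u)) \<and>
     (\<forall>u\<in>carrier U. \<forall>v\<in>carrier U. \<forall>h\<in>carrier H.
        p (u \<otimes>\<^bsub>U\<^esub> v) h = tensor_lift scalars (\<lambda>(x, y). p u x * p v y) (comult H h)) \<and>
     (\<forall>u\<in>carrier U. \<forall>h\<in>carrier H. \<forall>g\<in>carrier H.
        p u (h \<otimes>\<^bsub>H\<^esub> g) = tensor_lift scalars (\<lambda>(x, y). p x h * p y g) (comult U u)) \<and>
     (\<forall>h\<in>carrier H. p \<one>\<^bsub>U\<^esub> h = counit H h) \<and>
     (\<forall>u\<in>carrier U. p u \<one>\<^bsub>H\<^esub> = counit U u) \<and>
     (\<forall>u\<in>carrier U. \<forall>h\<in>carrier H. p (antipode U u) h = p u (antipode H h))"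

text \<open>
  The convolution algebra of linear functionals. So that functionals are determined by their values
  on the carrier, they are required to vanish outside of it.
\<close>

definition dual_algebra :: "('k::field, 'a) hopf \<Rightarrow> ('k, 'a \<Rightarrow> 'k) module" where
  "dual_algebra U =
     \<lparr>carrier = {f. linear_map U scalars f \<and> (\<forall>u. u \<notin> carrier U \<longrightarrow> f u = 0)},
      monoid.mult = (\<lambda>f g u. if u \<in> carrier U
                then tensor_lift scalars (\<lambda>(x, y). f x * g y) (comult U u) else 0),
      one = (\<lambda>u. if u \<in> carrier U then counit U u else 0),
      zero = (\<lambda>u. 0), add = (\<lambda>f g u. f u + g u), module.smult = (\<lambda>c f u. c * f u)\<rparr>"

text \<open>\<open>t = \<Sum> g \<otimes> h\<close> represents the functional \<open>u \<otimes> v \<mapsto> f (uv)\<close>.\<close>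

definition splits :: "('k::field, 'a) hopf \<Rightarrow> ('a \<Rightarrow> 'k) \<Rightarrow>
    ('k, ('a \<Rightarrow> 'k) \<times> ('a \<Rightarrow> 'k)) formal \<Rightarrow> bool" where
  "splits U f t \<longleftrightarrow> (\<forall>u\<in>carrier U. \<forall>v\<in>carrier U.
     f (u \<otimes>\<^bsub>U\<^esub> v) = tensor_lift scalars (\<lambda>(g, h). g u * h v) t)"

definition finite_dual_algebra :: "('k::field, 'a) hopf \<Rightarrow> ('k, 'a \<Rightarrow> 'k) module" where
  "finite_dual_algebra U = (dual_algebra U)
     \<lparr>carrier := {f \<in> carrier (dual_algebra U).
        \<exists>t\<in>carrier (tensor (dual_algebra U) (dual_algebra U)). splits U f t}\<rparr>"

definition finite_dual :: "('k::field, 'a) hopf \<Rightarrow> ('k, 'a \<Rightarrow> 'k) hopf" where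
  "finite_dual U = module.extend (finite_dual_algebra U) (hopf.fields
     (\<lambda>f. SOME t. t \<in> carrier (tensor (finite_dual_algebra U) (finite_dual_algebra U)) \<and>
            splits U f t)
     (\<lambda>f. f \<one>\<^bsub>U\<^esub>)
     (\<lambda>f u. if u \<in> carrier U then f (antipode U u) else 0))"

text \<open>The right Hopf action \<open>u \<triangleleft> h = \<Sum> \<langle>u\<^sub>1, h\<rangle> u\<^sub>2\<close> given by a pairing \<open>p\<close>.\<close>

definition hopf_action :: "('k::field, 'a) hopf \<Rightarrow> ('a \<Rightarrow> 'b \<Rightarrow> 'k) \<Rightarrow> 'a \<Rightarrow> 'b \<Rightarrow> 'a" where
  "hopf_action U p u h = tensor_lift U (\<lambda>(x, y). p x h \<odot>\<^bsub>U\<^esub> y) (comult U u)"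

text \<open>\<open>H # A\<close> for a right action \<open>act a h\<close>, and \<open>A # H\<close> for a left action \<open>act h a\<close>.\<close>

definition smash_right ::
  "('k::field, 'h) hopf \<Rightarrow> ('k, 'a, 'm) module_scheme \<Rightarrow> ('a \<Rightarrow> 'h \<Rightarrow> 'a) \<Rightarrow>
    ('k, ('k, 'h \<times> 'a) formal) module" where
  "smash_right H A act = (tensor H A)
     \<lparr>monoid.mult := (\<lambda>s t. tensor_lift (tensor H A) (\<lambda>(h, a).
                 tensor_lift (tensor H A) (\<lambda>(h', a').
                   tensor_lift (tensor H A) (\<lambda>(h1, h2).
                     ten H A (h \<otimes>\<^bsub>H\<^esub> h1) (act a h2 \<otimes>\<^bsub>A\<^esub> a')) (comult H h')) t) s),
      one := ten H A \<one>\<^bsub>H\<^esub> \<one>\<^bsub>A\<^esub>\<rparr>"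

definition smash_left ::
  "('k::field, 'a, 'm) module_scheme \<Rightarrow> ('k, 'h) hopf \<Rightarrow> ('h \<Rightarrow> 'a \<Rightarrow> 'a) \<Rightarrow>
    ('k, ('k, 'a \<times> 'h) formal) module" where
  "smash_left A H act = (tensor A H)
     \<lparr>monoid.mult := (\<lambda>s t. tensor_lift (tensor A H) (\<lambda>(a, h).
                 tensor_lift (tensor A H) (\<lambda>(a', h').
                   tensor_lift (tensor A H) (\<lambda>(h1, h2).
                     ten A H (a \<otimes>\<^bsub>A\<^esub> act h1 a') (h2 \<otimes>\<^bsub>H\<^esub> h')) (comult H h)) t) s),
      one := ten A H \<one>\<^bsub>A\<^esub> \<one>\<^bsub>H\<^esub>\<rparr>"


section \<open>Hopf algebroids\<close>

definition left_balancing ::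
  "('k::field, 'a, 'm) module_scheme \<Rightarrow> ('k, 'l, 'n) module_scheme \<Rightarrow> ('l \<Rightarrow> 'a) \<Rightarrow> ('l \<Rightarrow> 'a) \<Rightarrow>
    ('a, 'a) balancing" where
  "left_balancing K L \<alpha> \<beta> = {(\<lambda>b. \<beta> l \<otimes>\<^bsub>K\<^esub> b, \<lambda>b. \<alpha> l \<otimes>\<^bsub>K\<^esub> b) | l. l \<in> carrier L}"

definition right_balancing ::
  "('k::field, 'a, 'm) module_scheme \<Rightarrow> ('k, 'r, 'n) module_scheme \<Rightarrow> ('r \<Rightarrow> 'a) \<Rightarrow> ('r \<Rightarrow> 'a) \<Rightarrow>
    ('a, 'a) balancing" where
  "right_balancing K R \<alpha> \<beta> = {(\<lambda>b. b \<otimes>\<^bsub>K\<^esub> \<alpha> r, \<lambda>b. b \<otimes>\<^bsub>K\<^esub> \<beta> r) | r. r \<in> carrier R}"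

text \<open>
  The componentwise product of two elements of \<open>K \<otimes>\<^bsub>E\<^esub> K\<close>, formed on representatives. It is
  well defined when the factors lie in the Takeuchi product, as required in the bialgebroid axioms.
\<close>

definition takeuchi_mult ::
  "('a, 'a) balancing \<Rightarrow> ('k::field, 'a, 'm) module_scheme \<Rightarrow>
    ('k, 'a \<times> 'a) formal \<Rightarrow> ('k, 'a \<times> 'a) formal \<Rightarrow> ('k, 'a \<times> 'a) formal" where
  "takeuchi_mult E K s t = tensor_lift (tensor_over E K K) (\<lambda>(x, y).
     tensor_lift (tensor_over E K K) (\<lambda>(x', y').
       ten_over E K K (x \<otimes>\<^bsub>K\<^esub> x') (y \<otimes>\<^bsub>K\<^esub> y')) t) s"

definition left_bialgebroid ::
  "('k::field, 'a, 'm) module_scheme \<Rightarrow> ('k, 'l, 'n) module_scheme \<Rightarrow> ('l \<Rightarrow> 'a) \<Rightarrow> ('l \<Rightarrow> 'a) \<Rightarrow>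
    ('a \<Rightarrow> ('k, 'a \<times> 'a) formal) \<Rightarrow> ('a \<Rightarrow> 'l) \<Rightarrow> bool" where
  "left_bialgebroid K L \<alpha> \<beta> \<Delta> \<epsilon> \<longleftrightarrow>
     (let E = left_balancing K L \<alpha> \<beta>; KK = tensor_over E K K; t = ten_over E K K in
      k_algebra K \<and> k_algebra L \<and> alg_hom L K \<alpha> \<and> alg_antihom L K \<beta> \<and>
      (\<forall>l\<in>carrier L. \<forall>l'\<in>carrier L. \<alpha> l \<otimes>\<^bsub>K\<^esub> \<beta> l' = \<beta> l' \<otimes>\<^bsub>K\<^esub> \<alpha> l) \<and>
      linear_map K KK \<Delta> \<and>
      (\<forall>l\<in>carrier L. \<forall>l'\<in>carrier L. \<forall>b\<in>carrier K.
         \<Delta> (\<alpha> l \<otimes>\<^bsub>K\<^esub> \<beta> l' \<otimes>\<^bsub>K\<^esub> b) =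
         tensor_lift KK (\<lambda>(x, y). t (\<alpha> l \<otimes>\<^bsub>K\<^esub> x) (\<beta> l' \<otimes>\<^bsub>K\<^esub> y)) (\<Delta> b)) \<and>
      linear_map K L \<epsilon> \<and>
      (\<forall>l\<in>carrier L. \<forall>l'\<in>carrier L. \<forall>b\<in>carrier K.
         \<epsilon> (\<alpha> l \<otimes>\<^bsub>K\<^esub> \<beta> l' \<otimes>\<^bsub>K\<^esub> b) = l \<otimes>\<^bsub>L\<^esub> \<epsilon> b \<otimes>\<^bsub>L\<^esub> l') \<and>
      (\<forall>b\<in>carrier K. comult_id E E K \<Delta> (\<Delta> b) = id_comult E E K \<Delta> (\<Delta> b)) \<and>
      (\<forall>b\<in>carrier K. tensor_lift K (\<lambda>(x, y). \<alpha> (\<epsilon> x) \<otimes>\<^bsub>K\<^esub> y) (\<Delta> b) = b \<and>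
                     tensor_lift K (\<lambda>(x, y). \<beta> (\<epsilon> y) \<otimes>\<^bsub>K\<^esub> x) (\<Delta> b) = b) \<and>
      (\<forall>b\<in>carrier K. \<forall>l\<in>carrier L.
         tensor_lift KK (\<lambda>(x, y). t (x \<otimes>\<^bsub>K\<^esub> \<beta> l) y) (\<Delta> b) =
         tensor_lift KK (\<lambda>(x, y). t x (y \<otimes>\<^bsub>K\<^esub> \<alpha> l)) (\<Delta> b)) \<and>
      \<Delta> \<one>\<^bsub>K\<^esub> = t \<one>\<^bsub>K\<^esub> \<one>\<^bsub>K\<^esub> \<and>
      (\<forall>b\<in>carrier K. \<forall>b'\<in>carrier K. \<Delta> (b \<otimes>\<^bsub>K\<^esub> b') = takeuchi_mult E K (\<Delta> b) (\<Delta> b')) \<and>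
      \<epsilon> \<one>\<^bsub>K\<^esub> = \<one>\<^bsub>L\<^esub> \<and>
      (\<forall>b\<in>carrier K. \<forall>b'\<in>carrier K.
         \<epsilon> (b \<otimes>\<^bsub>K\<^esub> \<alpha> (\<epsilon> b')) = \<epsilon> (b \<otimes>\<^bsub>K\<^esub> b') \<and> \<epsilon> (b \<otimes>\<^bsub>K\<^esub> b') = \<epsilon> (b \<otimes>\<^bsub>K\<^esub> \<beta> (\<epsilon> b'))))"

definition right_bialgebroid ::
  "('k::field, 'a, 'm) module_scheme \<Rightarrow> ('k, 'r, 'n) module_scheme \<Rightarrow> ('r \<Rightarrow> 'a) \<Rightarrow> ('r \<Rightarrow> 'a) \<Rightarrow>
    ('a \<Rightarrow> ('k, 'a \<times> 'a) formal) \<Rightarrow> ('a \<Rightarrow> 'r) \<Rightarrow> bool" where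
  "right_bialgebroid K R \<alpha> \<beta> \<Delta> \<epsilon> \<longleftrightarrow>
     (let E = right_balancing K R \<alpha> \<beta>; KK = tensor_over E K K; t = ten_over E K K in
      k_algebra K \<and> k_algebra R \<and> alg_hom R K \<alpha> \<and> alg_antihom R K \<beta> \<and>
      (\<forall>r\<in>carrier R. \<forall>r'\<in>carrier R. \<alpha> r \<otimes>\<^bsub>K\<^esub> \<beta> r' = \<beta> r' \<otimes>\<^bsub>K\<^esub> \<alpha> r) \<and>
      linear_map K KK \<Delta> \<and>
      (\<forall>r\<in>carrier R. \<forall>r'\<in>carrier R. \<forall>b\<in>carrier K.
         \<Delta> (b \<otimes>\<^bsub>K\<^esub> \<beta> r \<otimes>\<^bsub>K\<^esub> \<alpha> r') =
         tensor_lift KK (\<lambda>(x, y). t (x \<otimes>\<^bsub>K\<^esub> \<beta> r) (y \<otimes>\<^bsub>K\<^esub> \<alpha> r')) (\<Delta> b)) \<and>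
      linear_map K R \<epsilon> \<and>
      (\<forall>r\<in>carrier R. \<forall>r'\<in>carrier R. \<forall>b\<in>carrier K.
         \<epsilon> (b \<otimes>\<^bsub>K\<^esub> \<beta> r \<otimes>\<^bsub>K\<^esub> \<alpha> r') = r \<otimes>\<^bsub>R\<^esub> \<epsilon> b \<otimes>\<^bsub>R\<^esub> r') \<and>
      (\<forall>b\<in>carrier K. comult_id E E K \<Delta> (\<Delta> b) = id_comult E E K \<Delta> (\<Delta> b)) \<and>
      (\<forall>b\<in>carrier K. tensor_lift K (\<lambda>(x, y). y \<otimes>\<^bsub>K\<^esub> \<beta> (\<epsilon> x)) (\<Delta> b) = b \<and>
                     tensor_lift K (\<lambda>(x, y). x \<otimes>\<^bsub>K\<^esub> \<alpha> (\<epsilon> y)) (\<Delta> b) = b) \<and>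
      (\<forall>b\<in>carrier K. \<forall>r\<in>carrier R.
         tensor_lift KK (\<lambda>(x, y). t (\<alpha> r \<otimes>\<^bsub>K\<^esub> x) y) (\<Delta> b) =
         tensor_lift KK (\<lambda>(x, y). t x (\<beta> r \<otimes>\<^bsub>K\<^esub> y)) (\<Delta> b)) \<and>
      \<Delta> \<one>\<^bsub>K\<^esub> = t \<one>\<^bsub>K\<^esub> \<one>\<^bsub>K\<^esub> \<and>
      (\<forall>b\<in>carrier K. \<forall>b'\<in>carrier K. \<Delta> (b \<otimes>\<^bsub>K\<^esub> b') = takeuchi_mult E K (\<Delta> b) (\<Delta> b')) \<and>
      \<epsilon> \<one>\<^bsub>K\<^esub> = \<one>\<^bsub>R\<^esub> \<and>
      (\<forall>b\<in>carrier K. \<forall>b'\<in>carrier K.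
         \<epsilon> (\<alpha> (\<epsilon> b) \<otimes>\<^bsub>K\<^esub> b') = \<epsilon> (b \<otimes>\<^bsub>K\<^esub> b') \<and> \<epsilon> (b \<otimes>\<^bsub>K\<^esub> b') = \<epsilon> (\<beta> (\<epsilon> b) \<otimes>\<^bsub>K\<^esub> b')))"

record (overloaded) ('k::zero, 'l, 'r, 'a) algebroid_maps =
  alphaL :: "'l \<Rightarrow> 'a"
  betaL :: "'l \<Rightarrow> 'a"
  DeltaL :: "'a \<Rightarrow> ('k, 'a \<times> 'a) formal"
  epsL :: "'a \<Rightarrow> 'l"
  alphaR :: "'r \<Rightarrow> 'a"
  betaR :: "'r \<Rightarrow> 'a"
  DeltaR :: "'a \<Rightarrow> ('k, 'a \<times> 'a) formal"
  epsR :: "'a \<Rightarrow> 'r"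
  tau :: "'a \<Rightarrow> 'a"

abbreviation balL where
  "balL K L M \<equiv> left_balancing K L (alphaL M) (betaL M)"

abbreviation balR where
  "balR K R M \<equiv> right_balancing K R (alphaR M) (betaR M)"

definition hopf_algebroid ::
  "('k::field, 'a, 'm) module_scheme \<Rightarrow> ('k, 'l, 'n) module_scheme \<Rightarrow> ('k, 'r, 'p) module_scheme \<Rightarrow>
    ('k, 'l, 'r, 'a) algebroid_maps \<Rightarrow> bool" where
  "hopf_algebroid K L R M \<longleftrightarrow>
     left_bialgebroid K L (alphaL M) (betaL M) (DeltaL M) (epsL M) \<and>
     right_bialgebroid K R (alphaR M) (betaR M) (DeltaR M) (epsR M) \<and>
     alg_antihom K K (tau M) \<and>
     (\<forall>r\<in>carrier R. alphaL M (epsL M (betaR M r)) = betaR M r \<and>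
                    betaL M (epsL M (alphaR M r)) = alphaR M r) \<and>
     (\<forall>l\<in>carrier L. alphaR M (epsR M (betaL M l)) = betaL M l \<and>
                    betaR M (epsR M (alphaL M l)) = alphaL M l) \<and>
     (\<forall>b\<in>carrier K.
        comult_id (balR K R M) (balL K L M) K (DeltaR M) (DeltaL M b) =
        id_comult (balR K R M) (balL K L M) K (DeltaL M) (DeltaR M b)) \<and>
     (\<forall>b\<in>carrier K.
        comult_id (balL K L M) (balR K R M) K (DeltaL M) (DeltaR M b) =
        id_comult (balL K L M) (balR K R M) K (DeltaR M) (DeltaL M b)) \<and>
     (\<forall>l\<in>carrier L. tau M (betaL M l) = alphaL M l) \<and>
     (\<forall>r\<in>carrier R. tau M (betaR M r) = alphaR M r) \<and>
     (\<forall>b\<in>carrier K.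
        tensor_lift K (\<lambda>(x, y). tau M x \<otimes>\<^bsub>K\<^esub> y) (DeltaL M b) = alphaR M (epsR M b) \<and>
        tensor_lift K (\<lambda>(x, y). x \<otimes>\<^bsub>K\<^esub> tau M y) (DeltaR M b) = alphaL M (epsL M b))"


section \<open>Lie algebras and their enveloping algebras\<close>

locale lie_algebra = Vector_Spaces.vector_space scale
  for scale :: "'k::field \<Rightarrow> 'g::ab_group_add \<Rightarrow> 'g" +
  fixes bracket :: "'g \<Rightarrow> 'g \<Rightarrow> 'g"
  assumes bracket_add_left: "bracket (x + y) z = bracket x z + bracket y z"
    and bracket_add_right: "bracket x (y + z) = bracket x y + bracket x z"
    and bracket_scale_left: "bracket (scale c x) y = scale c (bracket x y)"
    and bracket_scale_right: "bracket x (scale c y) = scale c (bracket x y)"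
    and bracket_self: "bracket x x = 0"
    and jacobi: "bracket x (bracket y z) + bracket y (bracket z x) + bracket z (bracket x y) = 0"

record ('k, 'g) based_lie =
  lie_scale :: "'k \<Rightarrow> 'g \<Rightarrow> 'g"
  lie_bracket :: "'g \<Rightarrow> 'g \<Rightarrow> 'g"
  lie_dim :: nat
  lie_basis :: "nat \<Rightarrow> 'g"

abbreviation idx :: "('k, 'g) based_lie \<Rightarrow> nat set" where
  "idx g \<equiv> {1..lie_dim g}"

definition based_lie_algebra :: "('k::field, 'g::ab_group_add) based_lie \<Rightarrow> bool" where
  "based_lie_algebra g \<longleftrightarrow>
     lie_algebra (lie_scale g) (lie_bracket g) \<and>
     inj_on (lie_basis g) (idx g) \<and>
     \<not> Modules.module.dependent (lie_scale g) (lie_basis g ` idx g) \<and>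
     Modules.module.span (lie_scale g) (lie_basis g ` idx g) = UNIV"

text \<open>\<open>struct_const g i j k\<close> is the coefficient of the \<open>k\<close>-th basis vector in the bracket of the
  \<open>i\<close>-th and the \<open>j\<close>-th one.\<close>

definition struct_const ::
  "('k::field, 'g::ab_group_add) based_lie \<Rightarrow> nat \<Rightarrow> nat \<Rightarrow> nat \<Rightarrow> 'k" where
  "struct_const g i j k =
     Modules.module.representation (lie_scale g) (lie_basis g ` idx g)
       (lie_bracket g (lie_basis g i) (lie_basis g j)) (lie_basis g k)"

text \<open>The opposite Lie algebra has the same underlying vector space and the same basis.\<close>

definition opp :: "('k, 'g) based_lie \<Rightarrow> ('k, 'g) based_lie" where
  "opp g = g\<lparr>lie_bracket := (\<lambda>x y. lie_bracket g y x)\<rparr>"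

datatype 'a word = Word (letters: "'a list")

instantiation word :: (type) monoid_add
begin
definition zero_word :: "'a word" where "0 = Word []"
definition plus_word :: "'a word \<Rightarrow> 'a word \<Rightarrow> 'a word" where
  "v + w = Word (letters v @ letters w)"
instance by standard (simp_all add: zero_word_def plus_word_def)
end

text \<open>
  The monoid algebra \<open>'g word \<Rightarrow>\<^sub>0 'k\<close> of the free monoid is the free algebra on the set \<open>'g\<close>. The
  enveloping algebra is its quotient by the relations that make \<open>'g\<close> embed linearly and turn
  commutators into brackets.
\<close>

type_synonym ('k, 'g) env = "('g word \<Rightarrow>\<^sub>0 'k) set"

definition free_const :: "'k::field \<Rightarrow> ('g word \<Rightarrow>\<^sub>0 'k)" where
  "free_const c = Poly_Mapping.single 0 c"

definition free_gen :: "'g \<Rightarrow> ('g word \<Rightarrow>\<^sub>0 'k::field)" where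
  "free_gen x = Poly_Mapping.single (Word [x]) 1"

definition env_ideal :: "('k::field, 'g::ab_group_add) based_lie \<Rightarrow> ('g word \<Rightarrow>\<^sub>0 'k) set" where
  "env_ideal g = Idl\<^bsub>ring_of_type_algebra\<^esub>
     (range (\<lambda>(x, y). free_gen (x + y) - free_gen x - free_gen y) \<union>
      range (\<lambda>(c, x). free_gen (lie_scale g c x) - free_const c * free_gen x) \<union>
      range (\<lambda>(x, y). free_gen x * free_gen y - free_gen y * free_gen x
                        - free_gen (lie_bracket g x y)))"

definition env_class ::
  "('k::field, 'g::ab_group_add) based_lie \<Rightarrow> ('g word \<Rightarrow>\<^sub>0 'k) \<Rightarrow> ('k, 'g) env" where
  "env_class g a = env_ideal g +>\<^bsub>ring_of_type_algebra\<^esub> a"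

definition env_algebra ::
  "('k::field, 'g::ab_group_add) based_lie \<Rightarrow> ('k, ('k, 'g) env) module" where
  "env_algebra g =
     (let Q = ring_of_type_algebra Quot (env_ideal g)
      in ring.extend Q (module.fields (\<lambda>c u. env_class g (free_const c) \<otimes>\<^bsub>Q\<^esub> u)))"

definition env_incl :: "('k::field, 'g::ab_group_add) based_lie \<Rightarrow> 'g \<Rightarrow> ('k, 'g) env" where
  "env_incl g x = env_class g (free_gen x)"

definition env :: "('k::field, 'g::ab_group_add) based_lie \<Rightarrow> ('k, ('k, 'g) env) hopf" where
  "env g =
     (let U = env_algebra g; \<iota> = env_incl g
      in module.extend U (hopf.fields
           (hom_ext U (tensor_alg U U) UNIV \<iota> (\<lambda>x. ten U U (\<iota> x) \<one>\<^bsub>U\<^esub> \<oplus>\<^bsub>tensor U U\<^esub> ten U U \<one>\<^bsub>U\<^esub> (\<iota> x)))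
           (hom_ext U scalars UNIV \<iota> (\<lambda>x. 0))
           (antihom_ext U U UNIV \<iota> (\<lambda>x. \<ominus>\<^bsub>U\<^esub> \<iota> x))))"

definition env_gen :: "('k::field, 'g::ab_group_add) based_lie \<Rightarrow> nat \<Rightarrow> ('k, 'g) env" where
  "env_gen g i = env_incl g (lie_basis g i)"

definition phi :: "('k::field, 'g::ab_group_add) based_lie \<Rightarrow> ('k, 'g) env \<Rightarrow> ('k, 'g) env" where
  "phi g = antihom_ext (env g) (env (opp g)) (idx g) (env_gen g) (env_gen (opp g))"

definition psi :: "('k::field, 'g::ab_group_add) based_lie \<Rightarrow> ('k, 'g) env \<Rightarrow> ('k, 'g) env" where
  "psi g = inv_into (carrier (env g)) (phi g)"


section \<open>The minimal Hopf algebra of functionals\<close>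

type_synonym ('k, 'g) functional = "('k, 'g) env \<Rightarrow> 'k"

text \<open>\<open>u i j\<close> and \<open>v i j\<close> stand for the functionals with upper index \<open>i\<close> and lower index \<open>j\<close>.\<close>

definition adjoint_functionals ::
  "('k::field, 'g::ab_group_add) based_lie \<Rightarrow>
    (nat \<Rightarrow> nat \<Rightarrow> ('k, 'g) functional) \<Rightarrow> (nat \<Rightarrow> nat \<Rightarrow> ('k, 'g) functional) \<Rightarrow> bool" where
  "adjoint_functionals g u v \<longleftrightarrow>
     (let F = finite_dual (env g); I = idx g in
      \<forall>i\<in>I. \<forall>j\<in>I.
        u i j \<in> carrier F \<and> v i j \<in> carrier F \<and>
        (\<forall>k\<in>I. u i j (env_gen g k) = struct_const g k j i) \<and>
        comult F (u i j) = finsum (tensor F F) (\<lambda>k. ten F F (u i k) (u k j)) I \<and>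
        comult F (v i j) = finsum (tensor F F) (\<lambda>k. ten F F (v k j) (v i k)) I \<and>
        counit F (u i j) = (if i = j then 1 else 0) \<and>
        counit F (v i j) = (if i = j then 1 else 0) \<and>
        antipode F (u i j) = v i j \<and> antipode F (v i j) = u i j)"

definition adjoint_pair where
  "adjoint_pair g = (SOME (u, v). adjoint_functionals g u v)"

definition adj :: "('k::field, 'g::ab_group_add) based_lie \<Rightarrow> nat \<Rightarrow> nat \<Rightarrow> ('k, 'g) functional"
  where "adj g = fst (adjoint_pair g)"

definition adj_bar :: "('k::field, 'g::ab_group_add) based_lie \<Rightarrow> nat \<Rightarrow> nat \<Rightarrow> ('k, 'g) functional"
  where "adj_bar g = snd (adjoint_pair g)"

definition env_min :: "('k::field, 'g::ab_group_add) based_lie \<Rightarrow> ('k, 'g) functional set" where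
  "env_min g = \<Inter>{S. k_subalgebra S (dual_algebra (env g)) \<and>
     (\<forall>i\<in>idx g. \<forall>j\<in>idx g. adj g i j \<in> S \<and> adj_bar g i j \<in> S)}"


section \<open>The smash product algebras\<close>

definition act_L :: "('k::field, 'g::ab_group_add) based_lie \<Rightarrow>
    ('k, 'g) env \<Rightarrow> ('k, 'g) functional \<Rightarrow> ('k, 'g) env" where
  "act_L g = hopf_action (env g) (\<lambda>D f. f D)"

definition act_R :: "('k::field, 'g::ab_group_add) based_lie \<Rightarrow>
    ('k, 'g) env \<Rightarrow> ('k, 'g) functional \<Rightarrow> ('k, 'g) env" where
  "act_R g = hopf_action (env (opp g)) (\<lambda>Y f. f (psi g Y))"

definition left_act_on_R :: "('k::field, 'g::ab_group_add) based_lie \<Rightarrow>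
    ('k, ('k, 'g) functional) hopf \<Rightarrow> ('k, 'g) functional \<Rightarrow> ('k, 'g) env \<Rightarrow> ('k, 'g) env" where
  "left_act_on_R g H f u = phi g (act_L g (psi g u) (antipode H f))"

definition left_act_on_L :: "('k::field, 'g::ab_group_add) based_lie \<Rightarrow>
    ('k, ('k, 'g) functional) hopf \<Rightarrow> ('k, 'g) functional \<Rightarrow> ('k, 'g) env \<Rightarrow> ('k, 'g) env" where
  "left_act_on_L g H f u = psi g (act_R g (phi g u) (antipode H f))"

type_synonym ('k, 'g) smash = "('k, ('k, 'g) functional \<times> ('k, 'g) env) formal"

definition H_UL :: "('k::field, 'g::ab_group_add) based_lie \<Rightarrow>
    ('k, ('k, 'g) functional) hopf \<Rightarrow> ('k, ('k, 'g) smash) module" where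
  "H_UL g H = smash_right H (env g) (act_L g)"

definition UR_H where
  "UR_H g H = smash_left (env (opp g)) H (left_act_on_R g H)"

definition Hco_UR :: "('k::field, 'g::ab_group_add) based_lie \<Rightarrow>
    ('k, ('k, 'g) functional) hopf \<Rightarrow> ('k, ('k, 'g) smash) module" where
  "Hco_UR g H = smash_right (coop H) (env (opp g)) (act_R g)"

definition UL_Hco where
  "UL_Hco g H = smash_left (env g) (coop H) (left_act_on_L g H)"

definition lam :: "('k::field, 'g::ab_group_add) based_lie \<Rightarrow>
    ('k, ('k, 'g) functional) hopf \<Rightarrow> ('k, 'g) env \<Rightarrow> ('k, 'g) smash" where
  "lam g H = antihom_ext (env g) (H_UL g H) (idx g) (env_gen g)
     (\<lambda>j. finsum (H_UL g H) (\<lambda>i. ten H (env g) (adj_bar g i j) (env_gen g i)) (idx g))"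

definition lam_R :: "('k::field, 'g::ab_group_add) based_lie \<Rightarrow>
    ('k, ('k, 'g) functional) hopf \<Rightarrow> ('k, 'g) env \<Rightarrow> ('k, 'g) smash" where
  "lam_R g H = antihom_ext (env (opp g)) (Hco_UR g H) (idx g) (env_gen (opp g))
     (\<lambda>j. finsum (Hco_UR g H) (\<lambda>i. ten (coop H) (env (opp g)) (adj g i j) (env_gen (opp g) i))
            (idx g))"


section \<open>The scalar extension structure maps\<close>

text \<open>
  \<open>iH\<close>, \<open>iX\<close>, \<open>iY\<close> are the maps by which \<open>H\<close>, the enveloping algebra and that of the opposite
  Lie algebra are identified with subsets of \<open>K\<close>. The predicates do not presuppose that such
  structure maps exist.
\<close>

definition structure_maps_A ::
  "('k::field, 'g::ab_group_add) based_lie \<Rightarrow> ('k, ('k, 'g) functional) hopf \<Rightarrow>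
    ('k, ('k, 'g) env, ('k, 'g) env, ('k, 'g) smash) algebroid_maps \<Rightarrow> bool" where
  "structure_maps_A g H M \<longleftrightarrow>
     (let K = H_UL g H; UL = env g; UR = env (opp g);
          iH = (\<lambda>h. ten H UL h \<one>\<^bsub>UL\<^esub>); iX = ten H UL \<one>\<^bsub>H\<^esub>; iY = (\<lambda>D. lam g H (psi g D));
          EL = balL K UR M; ER = balR K UL M in
      (\<forall>D\<in>carrier UR. alphaL M D = iY D) \<and>
      (\<forall>D\<in>carrier UL. alphaR M D = iX D) \<and>
      alg_antihom UR K (betaL M) \<and>
      (\<forall>j\<in>idx g. betaL M (env_gen (opp g) j) =
         iX (env_gen g j) \<oplus>\<^bsub>K\<^esub> (\<Sum>i\<in>idx g. struct_const g i j i) \<odot>\<^bsub>K\<^esub> \<one>\<^bsub>K\<^esub>) \<and>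
      alg_antihom UL K (betaR M) \<and>
      (\<forall>j\<in>idx g. betaR M (env_gen g j) = iY (env_gen (opp g) j)) \<and>
      linear_map K (tensor_over EL K K) (DeltaL M) \<and>
      (\<forall>D\<in>carrier UR. \<forall>h\<in>carrier H. DeltaL M (iY D \<otimes>\<^bsub>K\<^esub> iH h) =
         tensor_lift (tensor_over EL K K)
           (\<lambda>(h1, h2). ten_over EL K K (iY D \<otimes>\<^bsub>K\<^esub> iH h1) (iH h2)) (comult H h)) \<and>
      linear_map K (tensor_over ER K K) (DeltaR M) \<and>
      (\<forall>D\<in>carrier UL. \<forall>h\<in>carrier H. DeltaR M (iH h \<otimes>\<^bsub>K\<^esub> iX D) =
         tensor_lift (tensor_over ER K K)
           (\<lambda>(h1, h2). ten_over ER K K (iH h1) (iH h2 \<otimes>\<^bsub>K\<^esub> iX D)) (comult H h)) \<and>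
      linear_map K UR (epsL M) \<and>
      (\<forall>D\<in>carrier UR. \<forall>h\<in>carrier H. epsL M (iY D \<otimes>\<^bsub>K\<^esub> iH h) = counit H h \<odot>\<^bsub>UR\<^esub> D) \<and>
      linear_map K UL (epsR M) \<and>
      (\<forall>D\<in>carrier UL. \<forall>h\<in>carrier H. epsR M (iH h \<otimes>\<^bsub>K\<^esub> iX D) = counit H h \<odot>\<^bsub>UL\<^esub> D) \<and>
      alg_antihom K K (tau M) \<and>
      (\<forall>j\<in>idx g. tau M (iY (env_gen (opp g) j)) = iX (env_gen g j)) \<and>
      (\<forall>h\<in>carrier H. tau M (iH h) = iH (antipode H h)))"

definition structure_maps_B ::
  "('k::field, 'g::ab_group_add) based_lie \<Rightarrow> ('k, ('k, 'g) functional) hopf \<Rightarrow>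
    ('k, ('k, 'g) env, ('k, 'g) env, ('k, 'g) smash) algebroid_maps \<Rightarrow> bool" where
  "structure_maps_B g H M \<longleftrightarrow>
     (let K = Hco_UR g H; UL = env g; UR = env (opp g);
          iH = (\<lambda>h. ten (coop H) UR h \<one>\<^bsub>UR\<^esub>); iY = ten (coop H) UR \<one>\<^bsub>H\<^esub>;
          iX = (\<lambda>D. lam_R g H (phi g D));
          EL = balL K UL M; ER = balR K UR M in
      (\<forall>D\<in>carrier UL. alphaL M D = iX D) \<and>
      (\<forall>D\<in>carrier UR. alphaR M D = iY D) \<and>
      alg_antihom UL K (betaL M) \<and>
      (\<forall>j\<in>idx g. betaL M (env_gen g j) =
         iY (env_gen (opp g) j) \<ominus>\<^bsub>K\<^esub> (\<Sum>i\<in>idx g. struct_const g i j i) \<odot>\<^bsub>K\<^esub> \<one>\<^bsub>K\<^esub>) \<and>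
      alg_antihom UR K (betaR M) \<and>
      (\<forall>j\<in>idx g. betaR M (env_gen (opp g) j) = iX (env_gen g j)) \<and>
      linear_map K (tensor_over EL K K) (DeltaL M) \<and>
      (\<forall>D\<in>carrier UL. \<forall>h\<in>carrier H. DeltaL M (iX D \<otimes>\<^bsub>K\<^esub> iH h) =
         tensor_lift (tensor_over EL K K)
           (\<lambda>(h1, h2). ten_over EL K K (iX D \<otimes>\<^bsub>K\<^esub> iH h2) (iH h1)) (comult H h)) \<and>
      linear_map K (tensor_over ER K K) (DeltaR M) \<and>
      (\<forall>D\<in>carrier UR. \<forall>h\<in>carrier H. DeltaR M (iH h \<otimes>\<^bsub>K\<^esub> iY D) =
         tensor_lift (tensor_over ER K K)
           (\<lambda>(h1, h2). ten_over ER K K (iH h2) (iH h1 \<otimes>\<^bsub>K\<^esub> iY D)) (comult H h)) \<and>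
      linear_map K UL (epsL M) \<and>
      (\<forall>D\<in>carrier UL. \<forall>h\<in>carrier H. epsL M (iX D \<otimes>\<^bsub>K\<^esub> iH h) = counit H h \<odot>\<^bsub>UL\<^esub> D) \<and>
      linear_map K UR (epsR M) \<and>
      (\<forall>D\<in>carrier UR. \<forall>h\<in>carrier H. epsR M (iH h \<otimes>\<^bsub>K\<^esub> iY D) = counit H h \<odot>\<^bsub>UR\<^esub> D) \<and>
      alg_antihom K K (tau M) \<and>
      (\<forall>j\<in>idx g. tau M (iX (env_gen g j)) = iY (env_gen (opp g) j)) \<and>
      (\<forall>h\<in>carrier H. tau M (iH h) = iH (antipode H h)))"

end

theory Submission
 imports Defs
begin

text \<open>
  All calculations in the smash products are done with operators. Let \<open>U\<close> be the enveloping algebra.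
  An element \<open>h # a\<close> of \<open>H # U\<close> acts on \<open>U\<close> by \<open>D \<mapsto> (D \<triangleleft> h) a\<close>, products act by composition in the
  reverse order, and the action is faithful because the elements of \<open>H\<close> are separated by the pairing
  with \<open>U\<close> (\<open>T_inject\<close>). So an identity in \<open>H # U\<close>, associativity included, is an identity between
  operators on \<open>U\<close>. Here \<open>1 # b\<close> is right multiplication by \<open>b\<close>, and \<open>\<lambda>\<close> becomes transparent:
  \<open>\<lambda>(a)\<close> is left multiplication by \<open>a\<close> (\<open>T_lm\<close>). Hence the images of \<open>U(g\<^sub>R)\<close> and \<open>U(g\<^sub>L)\<close> commute, a
  generator moves past \<open>f \<in> H\<close> at the cost of the transpose of a multiplication by it (\<open>iX_iH\<close>,
  \<open>lm_iH\<close>), and the two sets of generators are related by the adjoint matrices (\<open>lm_gen\<close>, \<open>iX_gen\<close>).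
  Moving \<open>Y\<^sub>i\<close> to the left of the matrix coefficients produces the traces of the adjoint
  representation (\<open>iX_shift_gen\<close>), which explains the constants in \<open>\<beta>\<^sub>L\<close>. They vanish on brackets, so
  \<open>X\<^sub>j \<mapsto> X\<^sub>j - tr\<^sub>j\<close> is an automorphism, and with it the antipode can be written down as
  \<open>h # a \<mapsto> \<lambda>(a') S(h)\<close>. It also proves that \<open>Y # f \<mapsto> Y f\<close> is injective.

  A right bialgebroid is a left bialgebroid over the opposite algebra with the roles of source and
  target exchanged (\<open>right_bialgebroid_op\<close>), so both structures come from one set of axioms
  (\<open>bialgebroid_frame\<close>). The Takeuchi condition need only be checked on generators, where it says
  \<open>\<Sum> f\<^sub>1(- X\<^sub>j) \<otimes> f\<^sub>2 = \<Sum> f\<^sub>1 \<otimes> f\<^sub>2(X\<^sub>j -)\<close>. Once it is known, the product \<open>\<Delta>(b) \<Delta>(c)\<close> is linear in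
  \<open>\<Delta>(c)\<close>, and multiplicativity follows by induction on \<open>c\<close>.

  The second half of the theorem is the first one for the opposite Lie algebra and the co-opposite
  Hopf algebra: everything is proved for a pairing of \<open>U\<close> with a Hopf algebra (\<open>dual_pair\<close>), which is
  then taken to be evaluation, and evaluation after \<open>\<psi>\<close>.
\<close>

text \<open>Notation for the operations and the carrier of a structure, and for the value of a sum
 \<open>\<Sum> b x y\<close> over a representative of a tensor.\<close>

abbreviation (input) mult_in ("(_ *[_]/ _)" [70, 0, 71] 70) where "x *[G] y \<equiv> x \<otimes>\<^bsub>G\<^esub> y"
abbreviation (input) add_in ("(_ +[_]/ _)" [65, 0, 66] 65) where "x +[G] y \<equiv> x \<oplus>\<^bsub>G\<^esub> y"
abbreviation (input) smult_in ("(_ .[_]/ _)" [70, 0, 71] 70) where "c .[G] y \<equiv> c \<odot>\<^bsub>G\<^esub> y"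
abbreviation (input) one_in ("\<one>[_]") where "\<one>[G] \<equiv> \<one>\<^bsub>G\<^esub>"
abbreviation (input) zero_in ("\<zero>[_]") where "\<zero>[G] \<equiv> \<zero>\<^bsub>G\<^esub>"
abbreviation (input) mem_carrier ("(_/ :. _)" [51, 51] 50) where "x :. V \<equiv> x \<in> carrier V"
abbreviation (input) lift2 where "lift2 B b \<equiv> tensor_lift B (case_prod b)"


section \<open>Vector spaces and finite sums\<close>

abbreviation vspace :: "('k::field, 'a, 'm) module_scheme => bool" where
 "vspace V \<equiv> module (ring_of_type_algebra :: 'k ring) V"

lemma base_field_simps [simp]:
 "carrier ring_of_type_algebra = UNIV"
 "x +[ring_of_type_algebra] y = x + y"
 "x *[ring_of_type_algebra] y = x * y"
 "\<one>[ring_of_type_algebra] = 1"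
 "\<zero>[ring_of_type_algebra] = 0"
 by (simp_all add: ring_of_type_algebra_def)

lemma vspaceI:
 fixes V :: "('k::field, 'a, 'm) module_scheme"
 assumes "abelian_group V"
  and "!!c x. x :. V ==> c .[V] x :. V"
  and "!!c d x. x :. V ==> (c + d) .[V] x = c .[V] x +[V] d .[V] x"
  and "!!c x y. x :. V ==> y :. V ==> c .[V] (x +[V] y) = c .[V] x +[V] c .[V] y"
  and "!!c d x. x :. V ==> (c * d) .[V] x = c .[V] (d .[V] x)"
  and "!!x. x :. V ==> 1 .[V] x = x"
 shows "vspace V"
 using assms by (intro moduleI) (auto intro: cring_from_type_algebra)

context
 fixes V :: "('k::field, 'a, 'm) module_scheme"
 assumes V: "vspace V"
begin

interpretation module ring_of_type_algebra V by (rule V)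

lemma vs_abelian_group [simp]: "abelian_group V" by unfold_locales
lemma vs_abelian_monoid [simp]: "abelian_monoid V" by unfold_locales

lemma vs_closed [simp]:
 "x :. V ==> y :. V ==> x +[V] y :. V"
 "x :. V ==> c .[V] x :. V"
 "x :. V ==> \<ominus>\<^bsub>V\<^esub> x :. V"
 "x :. V ==> y :. V ==> x \<ominus>\<^bsub>V\<^esub> y :. V"
 "\<zero>[V] :. V"
 by simp_all

lemma vs_finsum_closed [simp]: "(!!i. i \<in> A ==> f i :. V) ==> finsum V f A :. V"
 by (rule M.finsum_closed) auto

lemma vs_smult [simp]:
 "x :. V ==> 1 .[V] x = x"
 "x :. V ==> 0 .[V] x = \<zero>[V]"
 "c .[V] \<zero>[V] = \<zero>[V]"
 "x :. V ==> c .[V] (d .[V] x) = (c * d) .[V] x"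
 using smult_one[of x] smult_l_null[of x] smult_r_null[of c] smult_assoc1[of c d x] by simp_all

lemma vs_smult_add:
 "x :. V ==> y :. V ==> c .[V] (x +[V] y) = c .[V] x +[V] c .[V] y"
 "x :. V ==> (c + d) .[V] x = c .[V] x +[V] d .[V] x"
 using smult_r_distr smult_l_distr by simp_all

lemma vs_minus_eq_smult: "x :. V ==> \<ominus>\<^bsub>V\<^esub> x = (- 1) .[V] x"
proof -
 assume x: "x :. V"
 have "(- 1) .[V] x +[V] x = ((- 1) + 1) .[V] x"
  using x by (subst vs_smult_add) auto
 also have "... = \<zero>[V]" using x by simp
 finally show ?thesis using x by (intro M.minus_equality) auto
qed

lemma vs_add_ac:
 "x :. V ==> y :. V ==> z :. V ==> (x +[V] y) +[V] z = x +[V] (y +[V] z)"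
 "x :. V ==> y :. V ==> x +[V] y = y +[V] x"
 "x :. V ==> y :. V ==> z :. V ==> x +[V] (y +[V] z) = y +[V] (x +[V] z)"
 by (simp_all add: M.a_ac)

lemma vs_zero [simp]:
 "x :. V ==> x +[V] \<zero>[V] = x"
 "x :. V ==> \<zero>[V] +[V] x = x"
 "x :. V ==> x \<ominus>\<^bsub>V\<^esub> x = \<zero>[V]"
 by (simp_all add: M.r_neg M.minus_eq)

lemma vs_eq_diff: "x :. V ==> y :. V ==> z :. V ==> x = y \<ominus>\<^bsub>V\<^esub> z \<longleftrightarrow> x +[V] z = y"
 by (metis M.minus_eq M.r_neg1 M.r_neg2 M.a_comm M.a_inv_closed M.a_closed M.a_assoc)

lemma vs_diff_eq_zero: "x :. V ==> y :. V ==> x \<ominus>\<^bsub>V\<^esub> y = \<zero>[V] \<longleftrightarrow> x = y"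
 by (metis vs_eq_diff vs_closed(5) vs_zero(2))

lemma vs_finsum_zero [simp]: "finsum V (%i. \<zero>[V]) A = \<zero>[V]"
 by (rule M.finsum_zero)

lemma vs_finsum_add:
 "(!!i. i \<in> A ==> f i :. V) ==> (!!i. i \<in> A ==> g i :. V) ==>
  finsum V (%i. f i +[V] g i) A = finsum V f A +[V] finsum V g A"
 by (rule M.finsum_addf) auto

lemma vs_finsum_smult:
 assumes "!!i. i \<in> A ==> f i :. V"
 shows "finsum V (%i. c .[V] f i) A = c .[V] finsum V f A"
 using assms
proof (induction A rule: infinite_finite_induct)
 case (insert x F)
 then show ?case by (simp add: Pi_def vs_smult_add)
qed (auto simp: M.finsum_infinite)

lemma vs_finsum_mono_neutral:
 "finite B ==> A \<subseteq> B ==> (!!i. i \<in> B - A ==> f i = \<zero>[V]) ==> (!!i. i \<in> A ==> f i :. V) ==>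
  finsum V f A = finsum V f B"
 by (intro M.add.finprod_mono_neutral_cong_left) (auto, metis DiffI vs_closed(5))

lemma vs_finsum_delta:
 assumes "finite A" "i \<in> A" "a :. V"
 shows "finsum V (%j. (if i = j then 1 else 0) .[V] a) A = a"
  and "finsum V (%j. (if j = i then 1 else 0) .[V] a) A = a"
proof -
 have "finsum V (%j. (if i = j then 1 else 0) .[V] a) A = finsum V (%j. if i = j then a else \<zero>[V]) A"
  using assms by (intro M.finsum_cong) (auto simp: simp_implies_def)
 also have "... = a" using M.finsum_singleton[of i A "%_. a"] assms by simp
 finally show 1: "finsum V (%j. (if i = j then 1 else 0) .[V] a) A = a" .
 then show "finsum V (%j. (if j = i then 1 else 0) .[V] a) A = a"
  by (simp add: eq_commute)
qed

lemma vs_finsum_swap: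
 assumes "finite A" "finite B" "!!i j. i \<in> A ==> j \<in> B ==> f i j :. V"
 shows "finsum V (%i. finsum V (f i) B) A = finsum V (%j. finsum V (%i. f i j) A) B"
 using assms(1,3)
proof (induction A rule: finite_induct)
 case (insert x F)
 have "finsum V (%j. finsum V (%i. f i j) (insert x F)) B =
   finsum V (%j. f x j +[V] finsum V (%i. f i j) F) B"
  using insert by (intro M.finsum_cong) (auto simp: Pi_def simp_implies_def)
 then show ?case using assms(2) insert by (simp add: Pi_def M.finsum_addf)
qed (use assms(2) in simp)

lemma vs_finsum_cong:
 "A = B ==> (!!i. i \<in> B ==> f i = g i) ==> (!!i. i \<in> B ==> g i :. V) ==> finsum V f A = finsum V g B"
 by (rule M.finsum_cong) (auto simp: simp_implies_def)

lemma vs_finsum_smult_left: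
 assumes "finite A" "x :. V"
 shows "finsum V (%i. c i .[V] x) A = (\<Sum>i\<in>A. c i) .[V] x"
 using assms(1) by (induction A rule: finite_induct) (use assms(2) in \<open>auto simp: vs_smult_add\<close>)

lemma vs_finsum_empty [simp]: "finsum V f {} = \<zero>[V]" by simp

lemma vs_finsum_insert:
 "finite A ==> i \<notin> A ==> (!!j. j \<in> insert i A ==> f j :. V) ==>
  finsum V f (insert i A) = f i +[V] finsum V f A"
 by (rule M.finsum_insert) auto

end

lemma k_algebra_vspace [simp]: "k_algebra A ==> vspace A"
 and k_algebra_ring: "k_algebra A ==> ring A"
 by (simp_all add: k_algebra_def)

lemma vspace_scalars [simp]: "vspace (scalars :: ('k::field, 'k) module)"
proof (rule vspaceI)
 show "abelian_group (scalars :: ('k, 'k) module)"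
  by (rule abelian_groupI)
   (auto simp: scalars_def ring.defs module.defs ring_of_type_algebra_def algebra_simps
    intro: exI[of _ "- x" for x])
qed (auto simp: scalars_def ring.defs module.defs ring_of_type_algebra_def algebra_simps)

lemma scalars_simps [simp]:
 "carrier scalars = UNIV" "x +[scalars] y = x + y" "c .[scalars] x = c * x"
 "\<zero>[scalars] = 0" "x *[scalars] y = x * y" "\<one>[scalars] = 1"
 by (auto simp: scalars_def ring.defs module.defs ring_of_type_algebra_def)

lemma finsum_scalars [simp]: "finsum scalars f A = sum f A"
proof (induction A rule: infinite_finite_induct)
 case (infinite A)
 interpret abelian_monoid "scalars :: ('a::field, 'a) module"
  by (rule vs_abelian_monoid) simp
 show ?case using infinite by (simp add: finsum_infinite)
next
 case empty
 show ?case by (simp add: abelian_monoid.finsum_empty)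
next
 case (insert x F)
 then show ?case by (subst vs_finsum_insert) auto
qed

section \<open>Linear and bilinear maps\<close>

lemma linear_mapI:
 "(!!x. x :. V ==> f x :. W) ==>
 (!!x y. x :. V ==> y :. V ==> f (x +[V] y) = f x +[W] f y) ==>
 (!!c x. x :. V ==> f (c .[V] x) = c .[W] f x) ==> linear_map V W f"
 by (auto simp: linear_map_def)

lemma lin_closed: "linear_map V W f ==> x :. V ==> f x :. W"
 and lin_add: "linear_map V W f ==> x :. V ==> y :. V ==> f (x +[V] y) = f x +[W] f y"
 and lin_smult: "linear_map V W f ==> x :. V ==> f (c .[V] x) = c .[W] f x"
 by (auto simp: linear_map_def)

context
 fixes V :: "('k::field, 'a, 'm) module_scheme" and W :: "('k, 'b, 'n) module_scheme"
 assumes V: "vspace V" and W: "vspace W"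
begin

lemma lin_zero: assumes "linear_map V W f" shows "f \<zero>[V] = \<zero>[W]"
proof -
 have "f (0 .[V] \<zero>[V]) = 0 .[W] f \<zero>[V]" using V by (intro lin_smult[OF assms]) simp
 then show ?thesis using V W lin_closed[OF assms, of "\<zero>[V]"] by simp
qed

lemma lin_minus: "linear_map V W f ==> x :. V ==> f (\<ominus>\<^bsub>V\<^esub> x) = \<ominus>\<^bsub>W\<^esub> f x"
 using V W by (simp add: vs_minus_eq_smult lin_smult lin_closed)

lemma lin_diff: "linear_map V W f ==> x :. V ==> y :. V ==>
  f (x \<ominus>\<^bsub>V\<^esub> y) = f x \<ominus>\<^bsub>W\<^esub> f y"
 using V W by (simp add: a_minus_def lin_add lin_minus)

lemma lin_finsum:
 assumes "linear_map V W f" "!!i. i \<in> A ==> a i :. V"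
 shows "f (finsum V a A) = finsum W (%i. f (a i)) A"
 using assms(2)
proof (induction A rule: infinite_finite_induct)
 case (infinite A)
 then show ?case
  using V W by (simp add: abelian_monoid.finsum_infinite[OF vs_abelian_monoid] lin_zero[OF assms(1)])
next
 case empty
 then show ?case using V W by (simp add: lin_zero[OF assms(1)])
next
 case (insert x F)
 have "f (finsum V a (insert x F)) = f (a x) +[W] f (finsum V a F)"
 proof -
  have cl: "a x :. V" "finsum V a F :. V" using V insert.prems by auto
  have "finsum V a (insert x F) = a x +[V] finsum V a F"
   using V insert by (intro vs_finsum_insert) auto
  then show ?thesis using lin_add[OF assms(1) cl] by simp
 qed
 then show ?case using W insert by (subst vs_finsum_insert) (auto intro!: lin_closed[OF assms(1)])
qed

lemma lin_fun_add:
 "linear_map V W f ==> linear_map V W g ==> linear_map V W (%x. f x +[W] g x)"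
 using V W by (intro linear_mapI) (auto simp: lin_closed lin_add lin_smult vs_add_ac vs_smult_add)

lemma lin_fun_smult: "linear_map V W f ==> linear_map V W (%x. c .[W] f x)"
 using V W by (intro linear_mapI) (auto simp: lin_closed lin_add lin_smult vs_smult_add mult.commute)

lemma lin_fun_minus: "linear_map V W f ==> linear_map V W (%x. \<ominus>\<^bsub>W\<^esub> f x)"
 using lin_fun_smult[of f "- 1"] W by (simp add: linear_map_def vs_minus_eq_smult Pi_def)

lemma lin_fun_scalar:
 "linear_map V scalars q ==> w :. W ==> linear_map V W (%x. q x .[W] w)"
 using V W by (intro linear_mapI) (auto simp: lin_add lin_smult vs_smult_add)

end

lemma lin_id: "linear_map V V (%x. x)"
 by (auto simp: linear_map_def)

lemma lin_comp: "linear_map V W f ==> linear_map U V g ==> linear_map U W (%x. f (g x))"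
 by (auto simp: linear_map_def Pi_def)

lemma lin_cong: "(!!x. x :. V ==> f x = g x) ==> vspace V ==> linear_map V W f \<longleftrightarrow> linear_map V W g"
 by (auto simp: linear_map_def Pi_def)

context
 fixes A :: "('k::field, 'a, 'm) module_scheme"
 assumes A: "k_algebra A"
begin

interpretation ring A by (rule k_algebra_ring[OF A])

lemma alg_closed [simp]:
 "x :. A ==> y :. A ==> x *[A] y :. A" "\<one>[A] :. A"
 by simp_all

lemma alg_one [simp]:
 "x :. A ==> \<one>[A] *[A] x = x" "x :. A ==> x *[A] \<one>[A] = x"
 by simp_all

lemma alg_zero [simp]:
 "x :. A ==> \<zero>[A] *[A] x = \<zero>[A]" "x :. A ==> x *[A] \<zero>[A] = \<zero>[A]"
 by simp_all

lemma alg_assoc: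
 "x :. A ==> y :. A ==> z :. A ==> (x *[A] y) *[A] z = x *[A] (y *[A] z)"
 by (rule m_assoc)

lemma alg_distr:
 "x :. A ==> y :. A ==> z :. A ==>
  (x +[A] y) *[A] z = x *[A] z +[A] y *[A] z"
 "x :. A ==> y :. A ==> z :. A ==>
  z *[A] (x +[A] y) = z *[A] x +[A] z *[A] y"
 by (simp_all add: l_distr r_distr)

lemma alg_smult:
 "x :. A ==> y :. A ==> (c .[A] x) *[A] y = c .[A] (x *[A] y)"
 "x :. A ==> y :. A ==> x *[A] (c .[A] y) = c .[A] (x *[A] y)"
 using A by (auto simp: k_algebra_def)

lemma lin_mult_left: "a :. A ==> linear_map A A (%x. a *[A] x)"
 and lin_mult_right: "a :. A ==> linear_map A A (%x. x *[A] a)"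
 by (auto intro!: linear_mapI simp: alg_distr alg_smult)

lemma lin_fun_mult_left: "a :. A ==> linear_map V A f ==> linear_map V A (%x. a *[A] f x)"
 and lin_fun_mult_right: "a :. A ==> linear_map V A f ==> linear_map V A (%x. f x *[A] a)"
 by (auto intro: lin_comp lin_mult_left lin_mult_right)

end

definition bilin ::
 "('k::field, 'a, 'm) module_scheme => ('k, 'b, 'n) module_scheme => ('k, 'c, 'p) module_scheme =>
  ('a => 'b => 'c) => bool" where
 "bilin V W B b \<longleftrightarrow> (\<forall>x\<in>carrier V. linear_map W B (b x)) \<and> (\<forall>y\<in>carrier W. linear_map V B (%x. b x y))"

lemma bilinI:
 "(!!x. x :. V ==> linear_map W B (%y. b x y)) ==>
 (!!y. y :. W ==> linear_map V B (%x. b x y)) ==> bilin V W B b"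
 by (auto simp: bilin_def)

lemma bilin_closed: "bilin V W B b ==> x :. V ==> y :. W ==> b x y :. B"
 by (auto simp: bilin_def intro: lin_closed)

lemma bilin_left: "bilin V W B b ==> y :. W ==> linear_map V B (%x. b x y)"
 and bilin_right: "bilin V W B b ==> x :. V ==> linear_map W B (%y. b x y)"
 by (auto simp: bilin_def)

section \<open>Quotients of free vector spaces\<close>

interpretation free: Vector_Spaces.vector_space fscale
 by (rule vector_space_fscale)

lemma fclass_eq_iff: "fclass R x = fclass R y \<longleftrightarrow> x - y \<in> free.span R"
proof
 assume "fclass R x = fclass R y"
 moreover have "x \<in> fclass R x" unfolding fclass_def using free.span_zero by force
 ultimately obtain w where "x = y + w" "w \<in> free.span R" by (auto simp: fclass_def)
 then show "x - y \<in> free.span R" by simp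
next
 assume *: "x - y \<in> free.span R"
 have "\<exists>w'. x + w = y + w' \<and> w' \<in> free.span R" if "w \<in> free.span R" for w
  using free.span_add[OF * that] by (intro exI[of _ "x - y + w"]) simp
 moreover have "\<exists>w'. y + w = x + w' \<and> w' \<in> free.span R" if "w \<in> free.span R" for w
  using free.span_diff[OF that *] by (intro exI[of _ "w - (x - y)"]) simp
 ultimately show "fclass R x = fclass R y" by (auto simp: fclass_def)
qed

lemma fclass_some: "fclass R (SOME y. y \<in> fclass R x) = fclass R x"
proof -
 define z where "z = (SOME y. y \<in> fclass R x)"
 have "x \<in> fclass R x" unfolding fclass_def using free.span_zero by force
 then have "z \<in> fclass R x" unfolding z_def by (rule someI)
 then obtain w where "z = x + w" "w \<in> free.span R" unfolding fclass_def by blast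
 then have "fclass R z = fclass R x" by (simp add: fclass_eq_iff)
 then show ?thesis by (simp only: z_def)
qed

abbreviation supported :: "'s set => ('s \<Rightarrow>\<^sub>0 'k::zero) set" where
 "supported S \<equiv> {x. Poly_Mapping.keys x \<subseteq> S}"

lemma keys_fscale_subset: "Poly_Mapping.keys (fscale c x) \<subseteq> Poly_Mapping.keys x"
 by (auto simp: in_keys_iff)

lemma supported_subspace: "free.subspace (supported S :: ('s \<Rightarrow>\<^sub>0 'k::field) set)"
proof (rule free.subspaceI)
 show "x + y \<in> supported S" if "x \<in> supported S" "y \<in> supported S" for x y :: "'s \<Rightarrow>\<^sub>0 'k"
  using that keys_add[of x y] by auto
 show "fscale c x \<in> supported S" if "x \<in> supported S" for c and x :: "'s \<Rightarrow>\<^sub>0 'k"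
  using that keys_fscale_subset[of c x] by auto
qed simp

lemma supported_add:
 "Poly_Mapping.keys x \<subseteq> S ==> Poly_Mapping.keys y \<subseteq> S ==> Poly_Mapping.keys (x + y :: 's \<Rightarrow>\<^sub>0 'k::field) \<subseteq> S"
 using keys_add[of x y] by (rule order_trans) simp

lemma supported_fscale:
 "Poly_Mapping.keys x \<subseteq> S ==> Poly_Mapping.keys (fscale c x) \<subseteq> S"
 using keys_fscale_subset by (rule order_trans)

lemma span_supported: "R \<subseteq> supported S ==> free.span R \<subseteq> supported S"
 by (rule free.span_minimal) (auto intro: supported_subspace)

lemma free_quot_simps:
 "carrier (free_quot S R) = fclass R ` supported S"
 "\<zero>[free_quot S R] = fclass R 0"
 "fclass R x +[free_quot S R] fclass R y = fclass R (x + y)"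
 "c .[free_quot S R] fclass R x = fclass R (fscale c x)"
proof -
 have *: "z - (SOME x. x \<in> fclass R z) \<in> free.span R" for z
  using fclass_some[of R z] by (metis fclass_eq_iff)
 show "fclass R x +[free_quot S R] fclass R y = fclass R (x + y)"
  using free.span_neg[OF free.span_add[OF *[of x] *[of y]]]
  by (simp add: free_quot_def fclass_eq_iff algebra_simps)
 show "c .[free_quot S R] fclass R x = fclass R (fscale c x)"
  using free.span_neg[OF free.span_scale[OF *[of x], of c]]
  by (simp add: free_quot_def fclass_eq_iff algebra_simps free.scale_right_diff_distrib)
qed (simp_all add: free_quot_def)

lemma vspace_free_quot [simp]: "vspace (free_quot (S :: 's set) (R :: ('s \<Rightarrow>\<^sub>0 'k::field) set))"
proof (rule vspaceI)
 show "abelian_group (free_quot S R)"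
 proof (rule abelian_groupI)
  fix P assume "P :. (free_quot S R)"
  then obtain x where x: "P = fclass R x" "x \<in> supported S" by (auto simp: free_quot_simps)
  show "\<exists>Q\<in>carrier (free_quot S R). Q +[free_quot S R] P = \<zero>[free_quot S R]"
   using x(1) free.subspace_neg[OF supported_subspace x(2)]
   by (intro bexI[of _ "fclass R (- x)"]) (auto simp: free_quot_simps simp del: mem_Collect_eq)
 next
  fix P Q assume "P :. (free_quot S R)" "Q :. (free_quot S R)"
  then obtain x y where "P = fclass R x" "Q = fclass R y" "x + y \<in> supported S"
   unfolding free_quot_simps using supported_add by blast
  then show "P +[free_quot S R] Q :. (free_quot S R)"
   unfolding free_quot_simps by (auto simp: free_quot_simps simp del: mem_Collect_eq)
 qed (auto simp: free_quot_simps algebra_simps)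
next
 fix c P assume "P :. (free_quot S R)"
 then obtain x where "P = fclass R x" "fscale c x \<in> supported S"
  unfolding free_quot_simps using supported_fscale by blast
 then show "c .[free_quot S R] P :. (free_quot S R)"
  unfolding free_quot_simps by (auto simp: free_quot_simps simp del: mem_Collect_eq)
qed (auto simp: free_quot_simps free.scale_left_distrib free.scale_right_distrib)

subsection \<open>Maps induced on representatives\<close>

definition rep :: "('k::field, 's) formal => ('s \<Rightarrow>\<^sub>0 'k)" where
 "rep t = (SOME x. x \<in> t)"

text \<open>The value of \<open>tensor_lift\<close> is a sum over one representative that does not depend on the map.
 So all rules that only move maps in and out of this sum hold without any balancing condition,
 provided that the representative is supported on the given set.\<close>

definition supp_in :: "'s set => ('k::field, 's) formal => bool" where
 "supp_in S t \<longleftrightarrow> Poly_Mapping.keys (rep t) \<subseteq> S"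

lemma tensor_lift_rep:
 "tensor_lift B b t = finsum B (%s. Poly_Mapping.lookup (rep t) s .[B] b s) (Poly_Mapping.keys (rep t))"
 by (simp add: tensor_lift_def rep_def Let_def)

lemma supp_in_free_quot:
 assumes "t :. (free_quot S R)" "R \<subseteq> supported S"
 shows "supp_in S t"
proof -
 obtain x where x: "t = fclass R x" "x \<in> supported S" using assms(1) by (auto simp: free_quot_simps)
 have "rep t - x \<in> free.span R"
  using fclass_some[of R x] x by (simp add: rep_def fclass_eq_iff)
 then have "rep t - x \<in> supported S" using span_supported[OF assms(2)] by blast
 from free.subspace_add[OF supported_subspace this x(2)] show ?thesis by (simp add: supp_in_def)
qed

context
 fixes B :: "('k::field, 'z, 'm) module_scheme" and S :: "'s set" and t :: "('k, 's) formal"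
 assumes B: "vspace B" and t: "supp_in S t"
begin

lemma tl_closed: "(!!s. s \<in> S ==> b s :. B) ==> tensor_lift B b t :. B"
 using B t by (auto simp: tensor_lift_rep supp_in_def intro!: vs_finsum_closed vs_closed)

lemma tl_cong:
 "(!!s. s \<in> S ==> b s = b' s) ==> (!!s. s \<in> S ==> b' s :. B) ==>
  tensor_lift B b t = tensor_lift B b' t"
 using B t unfolding tensor_lift_rep supp_in_def
 by (intro vs_finsum_cong) (auto simp: subset_iff)

lemma tl_add:
 "(!!s. s \<in> S ==> b s :. B) ==> (!!s. s \<in> S ==> b' s :. B) ==>
  tensor_lift B (%s. b s +[B] b' s) t = tensor_lift B b t +[B] tensor_lift B b' t"
 using B t unfolding tensor_lift_rep supp_in_def
 by (subst vs_finsum_add[symmetric]) (auto simp: subset_iff vs_smult_add intro!: vs_finsum_cong)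

lemma tl_linear:
 fixes C :: "('k, 'y, 'n) module_scheme"
 assumes "linear_map B C f" "vspace C" "!!s. s \<in> S ==> b s :. B"
 shows "f (tensor_lift B b t) = tensor_lift C (%s. f (b s)) t"
 using assms B t unfolding tensor_lift_rep supp_in_def
 by (subst lin_finsum[OF B assms(2,1)])
  (auto simp: subset_iff lin_smult[OF assms(1)] lin_closed[OF assms(1)] intro!: vs_finsum_cong)

lemma tl_finsum:
 assumes "finite A" "!!i s. i \<in> A ==> s \<in> S ==> b i s :. B"
 shows "tensor_lift B (%s. finsum B (%i. b i s) A) t = finsum B (%i. tensor_lift B (b i) t) A"
proof -
 have "tensor_lift B (%s. finsum B (%i. b i s) A) t =
  finsum B (%s. finsum B (%i. Poly_Mapping.lookup (rep t) s .[B] b i s) A) (Poly_Mapping.keys (rep t))"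
  unfolding tensor_lift_rep using B t assms
  by (intro vs_finsum_cong[OF B]) (auto simp: supp_in_def subset_iff vs_finsum_smult)
 also have "... = finsum B (%i. tensor_lift B (b i) t) A"
  unfolding tensor_lift_rep using B t assms
  by (subst vs_finsum_swap) (auto simp: supp_in_def subset_iff)
 finally show ?thesis .
qed

end

lemma tl_smult:
 "vspace B ==> supp_in S t ==> (!!s. s \<in> S ==> b s :. B) ==>
  tensor_lift B (%s. c .[B] b s) t = c .[B] tensor_lift B b t"
 by (rule tl_linear[symmetric]) (auto intro: lin_fun_smult lin_id)

lemma tl_swap:
 assumes B: "vspace B" and "supp_in S s" "supp_in T t"
  and "!!x y. x \<in> S ==> y \<in> T ==> b x y :. B"
 shows "tensor_lift B (%x. tensor_lift B (%y. b x y) t) s = tensor_lift B (%y. tensor_lift B (%x. b x y) s) t"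
proof -
 have "tensor_lift B (%x. tensor_lift B (%y. b x y) t) s =
   finsum B (%y. tensor_lift B (%x. Poly_Mapping.lookup (rep t) y .[B] b x y) s) (Poly_Mapping.keys (rep t))"
  unfolding tensor_lift_rep[of B _ t] using assms
  by (intro tl_finsum) (auto simp: supp_in_def subset_iff)
 also have "... = tensor_lift B (%y. tensor_lift B (%x. b x y) s) t"
  unfolding tensor_lift_rep[of B _ t] using assms
  by (intro vs_finsum_cong[OF B]) (auto simp: supp_in_def subset_iff intro!: tl_smult vs_closed tl_closed)
 finally show ?thesis .
qed

lemma tl_class:
 fixes B :: "('k::field, 'z, 'm) module_scheme" and S :: "'s set"
 assumes B: "vspace B" and R: "R \<subseteq> supported S" and b: "!!s. s \<in> S ==> b s :. B"
  and ker: "!!r. r \<in> R ==> finsum B (%s. Poly_Mapping.lookup r s .[B] b s) (Poly_Mapping.keys r) = \<zero>[B]"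
 shows tl_fclass: "x \<in> supported S ==> tensor_lift B b (fclass R x) =
   finsum B (%s. Poly_Mapping.lookup x s .[B] b s) (Poly_Mapping.keys x)"
  and tl_linear_free_quot: "linear_map (free_quot S R) B (tensor_lift B b)"
proof -
 define ev where "ev x = finsum B (%s. Poly_Mapping.lookup x s .[B] b s) (Poly_Mapping.keys x)" for x
 have ev: "ev x = finsum B (%s. Poly_Mapping.lookup x s .[B] b s) A"
  if "finite A" "Poly_Mapping.keys x \<subseteq> A" "A \<subseteq> S" for x A
 proof -
  have "Poly_Mapping.lookup x i .[B] b i = \<zero>[B]" if "i \<in> A - Poly_Mapping.keys x" for i
   using that \<open>A \<subseteq> S\<close> b B by (auto simp: in_keys_iff)
  then show ?thesis
   unfolding ev_def using that b B by (intro vs_finsum_mono_neutral[OF B]) auto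
 qed
 have ev_closed: "ev x :. B" if "x \<in> supported S" for x
  using that b B unfolding ev_def by (intro vs_finsum_closed) auto
 have ev_add: "ev (x + y) = ev x +[B] ev y" if "x \<in> supported S" "y \<in> supported S" for x y
 proof -
  let ?A = "Poly_Mapping.keys x \<union> Poly_Mapping.keys y"
  have A: "finite ?A" "?A \<subseteq> S" "Poly_Mapping.keys (x + y) \<subseteq> ?A" using that keys_add[of x y] by auto
  have "ev (x + y) = finsum B (%s. Poly_Mapping.lookup x s .[B] b s +[B] Poly_Mapping.lookup y s .[B] b s) ?A"
   using A b B by (subst ev[of ?A]) (auto simp: lookup_add vs_smult_add subset_iff intro!: vs_finsum_cong)
  also have "... = ev x +[B] ev y"
   using A b B that by (subst vs_finsum_add) (auto simp: ev[of ?A] subset_iff)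
  finally show ?thesis .
 qed
 have ev_scale: "ev (fscale c x) = c .[B] ev x" if "x \<in> supported S" for c x
 proof -
  have "ev (fscale c x) = finsum B (%s. c .[B] (Poly_Mapping.lookup x s .[B] b s)) (Poly_Mapping.keys x)"
   using that b B keys_fscale_subset[of c x]
   by (subst ev[of "Poly_Mapping.keys x"]) (auto simp: subset_iff intro!: vs_finsum_cong)
  also have "... = c .[B] ev x"
   unfolding ev_def using that b B by (intro vs_finsum_smult) (auto simp: subset_iff)
  finally show ?thesis .
 qed
 have span: "free.span R \<subseteq> supported S" using R by (rule span_supported)
 have ev_span: "ev w = \<zero>[B]" if "w \<in> free.span R" for w
 proof -
  have "w \<in> supported S \<and> ev w = \<zero>[B]"
   using that
  proof (induction rule: free.span_induct_alt)
   case base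
   show ?case using B by (simp add: ev_def)
  next
   case (step c x y)
   have x: "x \<in> supported S" using step R by auto
   have *: "fscale c x \<in> supported S" by (rule free.subspace_scale[OF supported_subspace x])
   have "ev (fscale c x + y) = c .[B] ev x"
    using * step x B by (subst ev_add) (auto simp: ev_scale ev_closed)
   moreover have "ev x = \<zero>[B]" using ker[OF step(1)] by (simp add: ev_def)
   ultimately show ?case using * step B free.subspace_add[OF supported_subspace *] by auto
  qed
  then show ?thesis by simp
 qed
 have cls: "tensor_lift B b (fclass R x) = ev x" if "x \<in> supported S" for x
 proof -
  have w: "rep (fclass R x) - x \<in> free.span R"
   using fclass_some[of R x] by (simp add: rep_def fclass_eq_iff)
  have "tensor_lift B b (fclass R x) = ev (x + (rep (fclass R x) - x))"
   by (simp add: tensor_lift_rep ev_def)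
  also have "... = ev x"
   using w that span ev_span[OF w] B ev_closed[OF that] by (subst ev_add) auto
  finally show ?thesis .
 qed
 then show "x \<in> supported S ==> tensor_lift B b (fclass R x) =
   finsum B (%s. Poly_Mapping.lookup x s .[B] b s) (Poly_Mapping.keys x)" by (simp add: ev_def)
 show "linear_map (free_quot S R) B (tensor_lift B b)"
 proof (rule linear_mapI)
  fix P assume "P :. (free_quot S R)"
  then obtain x where x: "P = fclass R x" "x \<in> supported S" by (auto simp: free_quot_simps)
  then show "tensor_lift B b P :. B" using ev_closed cls by simp
  show "tensor_lift B b (c .[free_quot S R] P) = c .[B] tensor_lift B b P" for c
   using x ev_scale free.subspace_scale[OF supported_subspace x(2), of c]
   by (auto simp: free_quot_simps cls simp del: mem_Collect_eq)
 next
  fix P Q assume "P :. (free_quot S R)" "Q :. (free_quot S R)"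
  then obtain x y where "P = fclass R x" "x \<in> supported S" "Q = fclass R y" "y \<in> supported S"
   by (auto simp: free_quot_simps)
  then show "tensor_lift B b (P +[free_quot S R] Q) = tensor_lift B b P +[B] tensor_lift B b Q"
   using ev_add free.subspace_add[OF supported_subspace, of x S y]
   by (auto simp: free_quot_simps cls simp del: mem_Collect_eq)
 qed
qed

lemma free_quot_induct:
 fixes t :: "('k::field, 's) formal"
 assumes "t :. (free_quot S R)" and "P (fclass R 0)"
  and "!!c s t. s \<in> S ==> t :. (free_quot S R) ==> P t ==> P (c .[free_quot S R] fclass R (delta s) +[free_quot S R] t)"
 shows "P t"
proof -
 obtain x where x: "t = fclass R x" "x \<in> supported S" using assms(1) by (auto simp: free_quot_simps)
 have "finite A ==> A \<subseteq> S ==> Poly_Mapping.keys x \<subseteq> A ==> P (fclass R x)" for A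
 proof (induction A arbitrary: x rule: finite_induct)
  case empty
  then have "x = 0" by simp
  then show ?case using assms(2) by simp
 next
  case (insert a A)
  define y where "y = x - Poly_Mapping.single a (Poly_Mapping.lookup x a)"
  have y: "Poly_Mapping.keys y \<subseteq> A"
   using insert.prems(2) by (auto simp: y_def in_keys_iff lookup_minus lookup_single when_def split: if_splits)
  have "x = fscale (Poly_Mapping.lookup x a) (delta a) + y"
   by (rule poly_mapping_eqI) (simp add: y_def lookup_minus lookup_add lookup_single when_def)
  then have "fclass R x = Poly_Mapping.lookup x a .[free_quot S R] fclass R (delta a) +[free_quot S R] fclass R y"
   by (simp add: free_quot_simps)
  moreover have "P (fclass R y)" by (rule insert.IH[OF _ y]) (use insert.prems in blast)
  moreover have "fclass R y :. (free_quot S R)" "a \<in> S"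
   using y insert.prems by (auto simp: free_quot_simps)
  ultimately show ?case using assms(3)[of a "fclass R y" "Poly_Mapping.lookup x a"] by simp
 qed
 from this[of "Poly_Mapping.keys x"] show ?thesis using x by simp
qed

text \<open>The value of a linear combination of elements of \<open>S\<close> under the linear extension of \<open>b\<close>.\<close>

definition formal_value :: "('k::field, 'z, 'm) module_scheme => ('s => 'z) => ('s \<Rightarrow>\<^sub>0 'k) => 'z" where
 "formal_value B b x = finsum B (%s. Poly_Mapping.lookup x s .[B] b s) (Poly_Mapping.keys x)"

lemma formal_value_delta:
 fixes B :: "('k::field, 'z, 'm) module_scheme"
 assumes "vspace B" "b s :. B"
 shows "formal_value B b (delta s) = b s"
 using assms by (simp add: formal_value_def, subst vs_finsum_insert) auto

lemma formal_value_diff: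
 fixes B :: "('k::field, 'z, 'm) module_scheme" and S :: "'s set"
 assumes B: "vspace B" and "x \<in> supported S" "y \<in> supported S" and b: "!!s. s \<in> S ==> b s :. B"
 shows "formal_value B b (x - y) =
  formal_value B b x \<ominus>\<^bsub>B\<^esub>
  formal_value B b y"
proof -
 have 0: "({} :: ('s \<Rightarrow>\<^sub>0 'k) set) \<subseteq> supported S" by simp
 have ev: "tensor_lift B b (fclass {} z) =
   formal_value B b z" if "z \<in> supported S" for z
  unfolding formal_value_def using B b that by (intro tl_fclass[OF _ 0]) auto
 have lin: "linear_map (free_quot S {}) B (tensor_lift B b)"
  using B b by (intro tl_linear_free_quot[OF _ 0]) auto
 have diff: "x - y \<in> supported S" by (rule free.subspace_diff[OF supported_subspace assms(2,3)])
 have "fclass {} (x - y) +[free_quot S {}] fclass {} y = fclass {} x" by (simp add: free_quot_simps)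
 then have "tensor_lift B b (fclass {} (x - y)) +[B] tensor_lift B b (fclass {} y) = tensor_lift B b (fclass {} x)"
  using lin_add[OF lin, of "fclass {} (x - y)" "fclass {} y"] assms(2,3) diff by (auto simp: free_quot_simps)
 then show ?thesis
  using assms(2,3) diff B b by (subst vs_eq_diff) (auto simp: ev subset_iff formal_value_def intro!: vs_finsum_closed)
qed

lemma formal_value_fscale:
 fixes B :: "('k::field, 'z, 'm) module_scheme" and S :: "'s set"
 assumes B: "vspace B" and x: "x \<in> supported S" and b: "!!s. s \<in> S ==> b s :. B"
 shows "formal_value B b (fscale c x) =
  c .[B] formal_value B b x"
proof -
 have 0: "({} :: ('s \<Rightarrow>\<^sub>0 'k) set) \<subseteq> supported S" by simp
 have ev: "tensor_lift B b (fclass {} z) =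
   formal_value B b z" if "z \<in> supported S" for z
  unfolding formal_value_def using B b that by (intro tl_fclass[OF _ 0]) auto
 have lin: "linear_map (free_quot S {}) B (tensor_lift B b)"
  using B b by (intro tl_linear_free_quot[OF _ 0]) auto
 show ?thesis
  using lin_smult[OF lin, of "fclass {} x" c] x free.subspace_scale[OF supported_subspace x, of c]
  by (simp add: free_quot_simps ev)
qed

section \<open>Tensor products\<close>

definition bal_maps :: "('m, 'n) balancing => ('k::field, 'm, 'p) module_scheme => ('k, 'n, 'q) module_scheme => bool" where
 "bal_maps E M N \<longleftrightarrow> (\<forall>(f, g)\<in>E. f \<in> carrier M \<rightarrow> carrier M \<and> g \<in> carrier N \<rightarrow> carrier N)"

definition balanced :: "('m, 'n) balancing => ('k::field, 'm, 'p) module_scheme => ('k, 'n, 'q) module_scheme =>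
  ('m => 'n => 'z) => bool" where
 "balanced E M N b \<longleftrightarrow> (\<forall>(f, g)\<in>E. \<forall>m\<in>carrier M. \<forall>n\<in>carrier N. b (f m) n = b m (g n))"

lemma bal_maps_empty [simp]: "bal_maps {} M N" by (simp add: bal_maps_def)
lemma balanced_empty [simp]: "balanced {} M N b" by (simp add: balanced_def)

lemma delta_supported: "s \<in> S ==> (delta s :: 's \<Rightarrow>\<^sub>0 'k::field) \<in> supported S"
 by simp

lemma lin_rels_supported:
 assumes A: "vspace A" and s: "!!x. x :. A ==> s x \<in> S"
 shows "lin_rels A s \<subseteq> (supported S :: ('s \<Rightarrow>\<^sub>0 'k::field) set)"
proof
 have d: "(delta (s x) :: 's \<Rightarrow>\<^sub>0 'k) \<in> supported S" if "x :. A" for x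
  by (rule delta_supported[OF s[OF that]])
 fix r :: "'s \<Rightarrow>\<^sub>0 'k" assume "r \<in> lin_rels A s"
 then show "r \<in> supported S"
  unfolding lin_rels_def
 proof (elim UnE CollectE exE conjE)
  fix x y assume "r = delta (s (x +[A] y)) - delta (s x) - delta (s y)" "x :. A" "y :. A"
  then show ?thesis using A by (simp only:) (intro free.subspace_diff[OF supported_subspace] d vs_closed)
 next
  fix c x assume "r = delta (s (c .[A] x)) - fscale c (delta (s x))" "x :. A"
  then show ?thesis using A
   by (simp only:) (intro free.subspace_diff[OF supported_subspace] free.subspace_scale[OF supported_subspace] d vs_closed)
 qed
qed

lemma lin_rels_kernel:
 fixes B :: "('k::field, 'z, 'm) module_scheme"
 assumes B: "vspace B" and A: "vspace A" and s: "!!x. x :. A ==> s x \<in> S"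
  and lin: "linear_map A B (%x. b (s x))" and b: "!!s. s \<in> S ==> b s :. B" and r: "r \<in> lin_rels A s"
 shows "formal_value B b r = \<zero>[B]"
 using r unfolding lin_rels_def
proof (elim UnE CollectE exE conjE)
 have d: "(delta (s x) :: _ \<Rightarrow>\<^sub>0 'k) \<in> supported S" if "x :. A" for x
  by (rule delta_supported[OF s[OF that]])
 have c: "b (s x) :. B" if "x :. A" for x using that by (intro b s)
 have diff: "formal_value B b (x - y) = formal_value B b x \<ominus>\<^bsub>B\<^esub> formal_value B b y"
  if "x \<in> supported S" "y \<in> supported S" for x y
  by (rule formal_value_diff[OF B that b])
 have single: "formal_value B b (delta (s x)) = b (s x)" if "x :. A" for x
  by (rule formal_value_delta[of B b, OF B c[OF that]])
 have scale: "formal_value B b (fscale c x) = c .[B] formal_value B b x"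
  if "x \<in> supported S" for c x
  by (rule formal_value_fscale[OF B that b])
 {
  fix x y assume r: "r = delta (s (x +[A] y)) - delta (s x) - delta (s y)"
   and xy: "x :. A" "y :. A"
  have xy': "x +[A] y :. A" using A xy by simp
  have "formal_value B b r = b (s (x +[A] y)) \<ominus>\<^bsub>B\<^esub> b (s x) \<ominus>\<^bsub>B\<^esub> b (s y)"
   unfolding r diff[OF free.subspace_diff[OF supported_subspace d[OF xy'] d[OF xy(1)]] d[OF xy(2)]]
    diff[OF d[OF xy'] d[OF xy(1)]] single[OF xy'] single[OF xy(1)] single[OF xy(2)] ..
  also have "... = \<zero>[B]"
   using c B xy lin_add[OF lin xy] vs_eq_diff[OF B c[OF xy(2)] c[OF xy'] c[OF xy(1)]]
   by (simp add: vs_add_ac)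
  finally show ?thesis .
 next
  fix k x assume r: "r = delta (s (k .[A] x)) - fscale k (delta (s x))" and x: "x :. A"
  have x': "k .[A] x :. A" using A x by simp
  have "formal_value B b r = b (s (k .[A] x)) \<ominus>\<^bsub>B\<^esub> k .[B] b (s x)"
   unfolding r diff[OF d[OF x'] free.subspace_scale[OF supported_subspace d[OF x]]]
    scale[OF d[OF x]] single[OF x'] single[OF x] ..
  also have "... = \<zero>[B]" using c[OF x] B lin_smult[OF lin x] by simp
  finally show ?thesis .
 }
qed

lemma tensor_rels_supported:
 assumes E: "bal_maps E M N" and M: "vspace M" and N: "vspace N"
 shows "tensor_rels E M N \<subseteq> supported (carrier M \<times> carrier N)"
proof -
 have "delta (f m, n) - delta (m, g n) \<in> supported (carrier M \<times> carrier N)"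
  if "(f, g) \<in> E" "m :. M" "n :. N" for f g m n
  using that E by (intro free.subspace_diff[OF supported_subspace] delta_supported) (auto simp: bal_maps_def)
 then have "{delta (f m, n) - delta (m, g n) | f g m n. (f, g) \<in> E \<and> m :. M \<and> n :. N}
   \<subseteq> supported (carrier M \<times> carrier N)" by blast
 moreover have "lin_rels M (%m. (m, n)) \<subseteq> supported (carrier M \<times> carrier N)" if "n :. N" for n
  using that by (intro lin_rels_supported[OF M]) simp
 moreover have "lin_rels N (%n. (m, n)) \<subseteq> supported (carrier M \<times> carrier N)" if "m :. M" for m
  using that by (intro lin_rels_supported[OF N]) simp
 ultimately show ?thesis unfolding tensor_rels_def by blast
qed

lemma vspace_tensor_over [simp]: "vspace (tensor_over E M N)"
 by (simp add: tensor_over_def)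

context
 fixes E :: "('m, 'n) balancing" and M :: "('k::field, 'm, 'p) module_scheme" and N :: "('k, 'n, 'q) module_scheme"
begin

lemma ten_closed [simp]:
 "m :. M ==> n :. N ==> ten_over E M N m n :. (tensor_over E M N)"
 by (auto simp: ten_over_def tensor_over_def free_quot_simps)

lemma ten_left: assumes n: "n :. N" shows "linear_map M (tensor_over E M N) (%m. ten_over E M N m n)"
proof (rule linear_mapI)
 have rel: "r \<in> free.span (tensor_rels E M N)" if "r \<in> lin_rels M (%m. (m, n))" for r
  using that n unfolding tensor_rels_def by (intro free.span_base) blast
 fix x y c assume x: "x :. M"
 show "ten_over E M N x n :. (tensor_over E M N)" using x n by simp
 have "delta (c .[M] x, n) - fscale c (delta (x, n)) \<in> free.span (tensor_rels E M N)"
  by (rule rel) (use x in \<open>auto simp: lin_rels_def\<close>)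
 then show "ten_over E M N (c .[M] x) n = c .[tensor_over E M N] ten_over E M N x n"
  by (simp add: ten_over_def tensor_over_def free_quot_simps fclass_eq_iff)
 assume y: "y :. M"
 have "delta (x +[M] y, n) - delta (x, n) - delta (y, n) \<in> free.span (tensor_rels E M N)"
  by (rule rel) (use x y in \<open>auto simp: lin_rels_def\<close>)
 then show "ten_over E M N (x +[M] y) n = ten_over E M N x n +[tensor_over E M N] ten_over E M N y n"
  by (simp add: ten_over_def tensor_over_def free_quot_simps fclass_eq_iff diff_diff_eq)
qed

lemma ten_right: assumes m: "m :. M" shows "linear_map N (tensor_over E M N) (%n. ten_over E M N m n)"
proof (rule linear_mapI)
 have rel: "r \<in> free.span (tensor_rels E M N)" if "r \<in> lin_rels N (%n. (m, n))" for r
  using that m unfolding tensor_rels_def by (intro free.span_base) blast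
 fix x y c assume x: "x :. N"
 show "ten_over E M N m x :. (tensor_over E M N)" using x m by simp
 have "delta (m, c .[N] x) - fscale c (delta (m, x)) \<in> free.span (tensor_rels E M N)"
  by (rule rel) (use x in \<open>auto simp: lin_rels_def\<close>)
 then show "ten_over E M N m (c .[N] x) = c .[tensor_over E M N] ten_over E M N m x"
  by (simp add: ten_over_def tensor_over_def free_quot_simps fclass_eq_iff)
 assume y: "y :. N"
 have "delta (m, x +[N] y) - delta (m, x) - delta (m, y) \<in> free.span (tensor_rels E M N)"
  by (rule rel) (use x y in \<open>auto simp: lin_rels_def\<close>)
 then show "ten_over E M N m (x +[N] y) = ten_over E M N m x +[tensor_over E M N] ten_over E M N m y"
  by (simp add: ten_over_def tensor_over_def free_quot_simps fclass_eq_iff diff_diff_eq)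
qed

lemma ten_bilin: "bilin M N (tensor_over E M N) (ten_over E M N)"
 by (intro bilinI ten_left ten_right)

lemma ten_balanced: "balanced E M N (ten_over E M N)"
 unfolding balanced_def
proof (intro ballI, clarify)
 fix f g m n assume "(f, g) \<in> E" "m :. M" "n :. N"
 then have "delta (f m, n) - delta (m, g n) \<in> free.span (tensor_rels E M N)"
  by (intro free.span_base) (auto simp: tensor_rels_def)
 then show "ten_over E M N (f m) n = ten_over E M N m (g n)"
  by (simp add: ten_over_def fclass_eq_iff)
qed

lemma tensor_induct [consumes 3, case_names ten add]:
 assumes "t :. (tensor_over E M N)" and M: "vspace M" and N: "vspace N"
  and ten: "!!m n. m :. M ==> n :. N ==> P (ten_over E M N m n)"
  and add: "!!s t. s :. (tensor_over E M N) ==> t :. (tensor_over E M N) ==> P s ==> P t ==>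
   P (s +[tensor_over E M N] t)"
 shows "P t"
proof (rule free_quot_induct[OF assms(1)[unfolded tensor_over_def]])
 have "ten_over E M N \<zero>[M] \<zero>[N] = \<zero>[tensor_over E M N]"
  using lin_zero[OF M _ ten_left] N by simp
 then show "P (fclass (tensor_rels E M N) 0)"
  using ten[of "\<zero>[M]" "\<zero>[N]"] M N by (simp add: tensor_over_def free_quot_simps)
next
 fix c s t assume 2: "s \<in> carrier M \<times> carrier N" "t :. (free_quot (carrier M \<times> carrier N) (tensor_rels E M N))" "P t"
 obtain m n where s: "s = (m, n)" "m :. M" "n :. N" using 2 by auto
 have "c .[tensor_over E M N] ten_over E M N m n = ten_over E M N (c .[M] m) n"
  using s by (simp add: lin_smult[OF ten_left])
 then show "P (c .[free_quot (carrier M \<times> carrier N) (tensor_rels E M N)] fclass (tensor_rels E M N) (delta s)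
   +[free_quot (carrier M \<times> carrier N) (tensor_rels E M N)] t)"
  using add[of "ten_over E M N (c .[M] m) n" t] 2 s ten[of "c .[M] m" n] M ten_closed[of "c .[M] m" n]
  by (auto simp: ten_over_def tensor_over_def)
qed

lemma tensor_ext:
 fixes B :: "('k, 'z, 'r) module_scheme"
 assumes M: "vspace M" "vspace N" and lin: "linear_map (tensor_over E M N) B f" "linear_map (tensor_over E M N) B g"
  and eq: "!!m n. m :. M ==> n :. N ==> f (ten_over E M N m n) = g (ten_over E M N m n)"
  and t: "t :. (tensor_over E M N)"
 shows "f t = g t"
 using t M by (induction rule: tensor_induct) (auto simp: eq lin_add[OF lin(1)] lin_add[OF lin(2)])

context
 assumes M: "vspace M" and N: "vspace N" and E: "bal_maps E M N"
begin

lemma tensor_supp: "t :. (tensor_over E M N) ==> supp_in (carrier M \<times> carrier N) t"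
 using supp_in_free_quot tensor_rels_supported[OF E M N] unfolding tensor_over_def by blast

context
 fixes B :: "('k, 'z, 'r) module_scheme" and b :: "'m => 'n => 'z"
 assumes B: "vspace B" and b: "bilin M N B b" "balanced E M N b"
begin

text \<open>A bilinear balanced map kills the relations of the tensor product.\<close>

lemma tensor_rels_kernel:
 assumes r: "r \<in> tensor_rels E M N"
 shows "formal_value B (case_prod b) r = \<zero>[B]"
proof -
 have c: "case_prod b s :. B" if "s \<in> carrier M \<times> carrier N" for s
  using that b(1) by (auto intro: bilin_closed)
 from r consider n where "n :. N" "r \<in> lin_rels M (%m. (m, n))"
  | m where "m :. M" "r \<in> lin_rels N (%n. (m, n))"
  | f g m n where "r = delta (f m, n) - delta (m, g n)" "(f, g) \<in> E" "m :. M" "n :. N"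
  unfolding tensor_rels_def by blast
 then show ?thesis
 proof cases
  case 1
  then show ?thesis using M B c bilin_left[OF b(1)]
   by (intro lin_rels_kernel[where S="carrier M \<times> carrier N" and A=M and s="%m. (m, n)"]) auto
 next
  case 2
  then show ?thesis using N B c bilin_right[OF b(1)]
   by (intro lin_rels_kernel[where S="carrier M \<times> carrier N" and A=N and s="%n. (m, n)"]) auto
 next
  case 3
  have cl: "f m :. M" "g n :. N" using 3 E by (auto simp: bal_maps_def)
  have eq: "b (f m) n = b m (g n)" using b(2) 3 by (auto simp: balanced_def)
  have cb: "b m (g n) :. B" using 3 cl b(1) by (auto intro: bilin_closed)
  have "formal_value B (case_prod b) r = b (f m) n \<ominus>\<^bsub>B\<^esub> b m (g n)"
   unfolding 3 using cl 3(3,4) B c cb eq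
   by (subst formal_value_diff[where S="carrier M \<times> carrier N"]) (auto simp: formal_value_delta)
  then show ?thesis using cb B eq by simp
 qed
qed

lemma lift_ten: "m :. M ==> n :. N ==>
  lift2 B (%x y. b x y) (ten_over E M N m n) = b m n"
proof -
 assume m: "m :. M" and n: "n :. N"
 have "lift2 B (%x y. b x y) (ten_over E M N m n) = formal_value B (case_prod b) (delta (m, n))"
  unfolding ten_over_def formal_value_def using b(1) m n
  by (intro tl_fclass[OF B tensor_rels_supported[OF E M N] _ tensor_rels_kernel[unfolded formal_value_def]])
   (auto intro: bilin_closed)
 also have "... = b m n" using formal_value_delta[of B "case_prod b" "(m, n)"] B bilin_closed[OF b(1) m n] by simp
 finally show ?thesis .
qed

lemma lift_linear: "linear_map (tensor_over E M N) B (lift2 B (%x y. b x y))"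
 unfolding tensor_over_def using b(1)
 by (intro tl_linear_free_quot[OF B tensor_rels_supported[OF E M N] _ tensor_rels_kernel[unfolded formal_value_def]])
  (auto intro: bilin_closed)

end

end

end

subsection \<open>Threefold tensor products\<close>

definition trilin :: "('k::field, 'a, 'm) module_scheme => ('k, 'c, 'p) module_scheme => ('a => 'a => 'a => 'c) => bool" where
 "trilin K B b \<longleftrightarrow> (\<forall>x\<in>carrier K. \<forall>y\<in>carrier K.
  linear_map K B (%z. b z x y) \<and> linear_map K B (%z. b x z y) \<and> linear_map K B (%z. b x y z))"

definition balanced3 ::
 "('a, 'a) balancing => ('a, 'a) balancing => ('k::field, 'a, 'm) module_scheme => ('a => 'a => 'a => 'c) => bool" where
 "balanced3 E F K b \<longleftrightarrow>
  (\<forall>(f, g)\<in>E. \<forall>x\<in>carrier K. \<forall>y\<in>carrier K. \<forall>z\<in>carrier K. b (f x) y z = b x (g y) z) \<and>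
  (\<forall>(f, g)\<in>F. \<forall>x\<in>carrier K. \<forall>y\<in>carrier K. \<forall>z\<in>carrier K. b x (f y) z = b x y (g z))"

lemma vspace_tensor3 [simp]: "vspace (tensor3 E F K)"
 by (simp add: tensor3_def)

context
 fixes E F :: "('a, 'a) balancing" and K :: "('k::field, 'a, 'p) module_scheme"
begin

lemma ten3_closed [simp]:
 "x :. K ==> y :. K ==> z :. K ==> ten3 E F K x y z :. (tensor3 E F K)"
 by (auto simp: ten3_def tensor3_def free_quot_simps)

lemma ten3_linear:
 assumes "!!r. r \<in> lin_rels K s ==> r \<in> tensor3_rels E F K" and "!!x. x :. K ==> s x \<in> carrier K \<times> carrier K \<times> carrier K"
 shows "linear_map K (tensor3 E F K) (%x. fclass (tensor3_rels E F K) (delta (s x)))"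
proof (rule linear_mapI)
 have rel: "r \<in> free.span (tensor3_rels E F K)" if "r \<in> lin_rels K s" for r
  using that by (intro free.span_base assms(1))
 fix x y c assume x: "x :. K"
 show "fclass (tensor3_rels E F K) (delta (s x)) :. (tensor3 E F K)"
  using assms(2)[OF x] by (auto simp: tensor3_def free_quot_simps)
 have "delta (s (c .[K] x)) - fscale c (delta (s x)) \<in> free.span (tensor3_rels E F K)"
  by (rule rel) (use x in \<open>auto simp: lin_rels_def\<close>)
 then show "fclass (tensor3_rels E F K) (delta (s (c .[K] x))) = c .[tensor3 E F K] fclass (tensor3_rels E F K) (delta (s x))"
  by (simp add: tensor3_def free_quot_simps fclass_eq_iff)
 assume y: "y :. K"
 have "delta (s (x +[K] y)) - delta (s x) - delta (s y) \<in> free.span (tensor3_rels E F K)"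
  by (rule rel) (use x y in \<open>auto simp: lin_rels_def\<close>)
 then show "fclass (tensor3_rels E F K) (delta (s (x +[K] y))) =
   fclass (tensor3_rels E F K) (delta (s x)) +[tensor3 E F K] fclass (tensor3_rels E F K) (delta (s y))"
  by (simp add: tensor3_def free_quot_simps fclass_eq_iff diff_diff_eq)
qed

lemma tensor3_relsI:
 assumes "y :. K" "z :. K"
 shows "r \<in> lin_rels K (%x. (x, y, z)) ==> r \<in> tensor3_rels E F K"
  and "r \<in> lin_rels K (%x. (y, x, z)) ==> r \<in> tensor3_rels E F K"
  and "r \<in> lin_rels K (%x. (y, z, x)) ==> r \<in> tensor3_rels E F K"
 unfolding tensor3_rels_def Un_iff UN_iff using assms by blast+

lemma tensor3_rels_balI:
 assumes "x :. K" "y :. K" "z :. K"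
 shows "(f, g) \<in> E ==> delta (f x, y, z) - delta (x, g y, z) \<in> tensor3_rels E F K"
  and "(f, g) \<in> F ==> delta (x, f y, z) - delta (x, y, g z) \<in> tensor3_rels E F K"
proof -
 show "delta (f x, y, z) - delta (x, g y, z) \<in> tensor3_rels E F K" if "(f, g) \<in> E"
  unfolding tensor3_rels_def by (rule UnI1, rule UnI2, rule CollectI, rule exI[of _ f], rule exI[of _ g], rule exI[of _ x], rule exI[of _ y], rule exI[of _ z], simp add: that assms)
 show "delta (x, f y, z) - delta (x, y, g z) \<in> tensor3_rels E F K" if "(f, g) \<in> F"
  unfolding tensor3_rels_def by (rule UnI2, rule CollectI, rule exI[of _ f], rule exI[of _ g], rule exI[of _ x], rule exI[of _ y], rule exI[of _ z], simp add: that assms)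
qed

lemma ten3_trilin: "trilin K (tensor3 E F K) (ten3 E F K)"
 unfolding trilin_def ten3_def
 by (intro ballI conjI ten3_linear) (erule (2) tensor3_relsI, simp)+

lemma ten3_balanced: "balanced3 E F K (ten3 E F K)"
proof -
 have "ten3 E F K (f x) y z = ten3 E F K x (g y) z"
  if "(f, g) \<in> E" "x :. K" "y :. K" "z :. K" for f g x y z
 proof -
  have "delta (f x, y, z) - delta (x, g y, z) \<in> free.span (tensor3_rels E F K)"
   using that by (intro free.span_base tensor3_rels_balI)
  then show ?thesis by (simp add: ten3_def fclass_eq_iff)
 qed
 moreover have "ten3 E F K x (f y) z = ten3 E F K x y (g z)"
  if "(f, g) \<in> F" "x :. K" "y :. K" "z :. K" for f g x y z
 proof -
  have "delta (x, f y, z) - delta (x, y, g z) \<in> free.span (tensor3_rels E F K)"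
   using that by (intro free.span_base tensor3_rels_balI)
  then show ?thesis by (simp add: ten3_def fclass_eq_iff)
 qed
 ultimately show ?thesis by (auto simp: balanced3_def)
qed

end

section \<open>Tensor products over the ground field\<close>

text \<open>Sums over a representative of \<open>t\<close>, written as sums over two variables.\<close>

context
 fixes V :: "('k::field, 'a, 'm) module_scheme" and W :: "('k, 'b, 'n) module_scheme"
  and E :: "('a, 'b) balancing" and t :: "('k, 'a \<times> 'b) formal"
 assumes V: "vspace V" and W: "vspace W" and E: "bal_maps E V W" and t: "t :. (tensor_over E V W)"
begin

lemma tl2_closed:
 fixes B :: "('k, 'z, 'r) module_scheme"
 assumes "vspace B" "!!x y. x :. V ==> y :. W ==> b x y :. B"
 shows "lift2 B (%x y. b x y) t :. B"
 using assms by (intro tl_closed[OF _ tensor_supp[OF V W E t]]) auto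

lemma tl2_cong:
 fixes B :: "('k, 'z, 'r) module_scheme"
 assumes "vspace B" "!!x y. x :. V ==> y :. W ==> b x y = b' x y"
  "!!x y. x :. V ==> y :. W ==> b' x y :. B"
 shows "lift2 B (%x y. b x y) t = lift2 B (%x y. b' x y) t"
 using assms by (intro tl_cong[OF _ tensor_supp[OF V W E t]]) auto

lemma tl2_linear:
 fixes B :: "('k, 'z, 'r) module_scheme" and C :: "('k, 'y, 's) module_scheme"
 assumes "linear_map B C f" "vspace B" "vspace C"
  "!!x y. x :. V ==> y :. W ==> b x y :. B"
 shows "f (lift2 B (%x y. b x y) t) = lift2 C (%x y. f (b x y)) t"
 using tl_linear[OF assms(2) tensor_supp[OF V W E t] assms(1,3), of "case_prod b"] assms(4)
 by (auto simp: case_prod_unfold)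

lemma tl2_add:
 fixes B :: "('k, 'z, 'r) module_scheme"
 assumes "vspace B" "!!x y. x :. V ==> y :. W ==> b x y :. B"
  "!!x y. x :. V ==> y :. W ==> b' x y :. B"
 shows "lift2 B (%x y. b x y +[B] b' x y) t =
  lift2 B (%x y. b x y) t +[B] lift2 B (%x y. b' x y) t"
 using tl_add[OF assms(1) tensor_supp[OF V W E t], of "case_prod b" "case_prod b'"] assms(2,3)
 by (auto simp: case_prod_unfold)

lemma tl2_finsum:
 fixes B :: "('k, 'z, 'r) module_scheme"
 assumes "vspace B" "finite A" "!!i x y. i \<in> A ==> x :. V ==> y :. W ==> b i x y :. B"
 shows "lift2 B (%x y. finsum B (%i. b i x y) A) t = finsum B (%i. lift2 B (%x y. b i x y) t) A"
 using tl_finsum[OF assms(1) tensor_supp[OF V W E t] assms(2), of "%i. case_prod (b i)"] assms(3)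
 by (auto simp: case_prod_unfold)

lemma tl2_swap:
 fixes B :: "('k, 'z, 'r) module_scheme" and V' :: "('k, 'c, 'm1) module_scheme" and W' :: "('k, 'd, 'n1) module_scheme"
  and E' :: "('c, 'd) balancing"
 assumes "vspace B" "vspace V'" "vspace W'" "bal_maps E' V' W'" "s :. (tensor_over E' V' W')"
  "!!x y x' y'. x :. V ==> y :. W ==> x' :. V' ==> y' :. W' ==> b x y x' y' :. B"
 shows "lift2 B (%x y. lift2 B (%x' y'. b x y x' y') s) t =
  lift2 B (%x' y'. lift2 B (%x y. b x y x' y') t) s"
 using tl_swap[OF assms(1) tensor_supp[OF V W E t] tensor_supp[OF assms(2-5)],
   of "%(x, y) (x', y'). b x y x' y'"] assms(6)
 by (auto simp: case_prod_unfold)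

lemma tl2_fun_linear:
 fixes B :: "('k, 'z, 'r) module_scheme" and Q :: "('k, 'y, 's) module_scheme" and b :: "'y => 'a => 'b => 'z"
 assumes B: "vspace B" and Q: "vspace Q"
  and lin: "!!x y. x :. V ==> y :. W ==> linear_map Q B (%u. b u x y)"
 shows "linear_map Q B (%u. lift2 B (%x y. b u x y) t)"
proof (rule linear_mapI)
 show "lift2 B (%x y. b u x y) t :. B" if "u :. Q" for u
  using that B lin_closed[OF lin] by (intro tl2_closed) auto
 show "lift2 B (%x y. b (u +[Q] v) x y) t =
   lift2 B (%x y. b u x y) t +[B] lift2 B (%x y. b v x y) t"
  if uv: "u :. Q" "v :. Q" for u v
 proof -
  have cl: "b w x y :. B" if "x :. V" "y :. W" "w :. Q" for w x y
   by (rule lin_closed[OF lin[OF that(1,2)] that(3)])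
  have "lift2 B (%x y. b (u +[Q] v) x y) t = lift2 B (%x y. b u x y +[B] b v x y) t"
   using uv B cl by (intro tl2_cong) (auto simp: lin_add[OF lin])
  also have "... = lift2 B (%x y. b u x y) t +[B] lift2 B (%x y. b v x y) t"
   using cl B uv by (intro tl2_add) auto
  finally show ?thesis .
 qed
 show "lift2 B (%x y. b (c .[Q] u) x y) t = c .[B] lift2 B (%x y. b u x y) t"
  if u: "u :. Q" for c u
 proof -
  have cl: "b u x y :. B" if "x :. V" "y :. W" for x y
   by (rule lin_closed[OF lin[OF that] u])
  have "lift2 B (%x y. b (c .[Q] u) x y) t = lift2 B (%x y. c .[B] b u x y) t"
   using u B cl by (intro tl2_cong) (auto simp: lin_smult[OF lin])
  also have "... = c .[B] lift2 B (%x y. b u x y) t"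
   using cl B by (intro tl2_linear[OF lin_fun_smult[OF B B lin_id], symmetric]) auto
  finally show ?thesis .
 qed
qed

end

lemma tl2_zero:
 fixes B :: "('k::field, 'z, 'r) module_scheme"
 shows "vspace B ==> lift2 B (%x y. \<zero>[B]) t = \<zero>[B]"
 by (simp add: tensor_lift_rep case_prod_unfold)

lemma tensor_id:
 assumes "vspace V" "vspace W" "bal_maps E V W" "t :. (tensor_over E V W)"
 shows "lift2 (tensor_over E V W) (%x y. ten_over E V W x y) t = t"
proof (rule tensor_ext[OF assms(1,2) _ lin_id _ assms(4)])
 show "linear_map (tensor_over E V W) (tensor_over E V W)
   (lift2 (tensor_over E V W) (%x y. ten_over E V W x y))"
  by (rule lift_linear[OF assms(1-3) vspace_tensor_over ten_bilin ten_balanced])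
 show "lift2 (tensor_over E V W) (%x y. ten_over E V W x y) (ten_over E V W m n) = ten_over E V W m n"
  if "m :. V" "n :. W" for m n
  using that by (rule lift_ten[OF assms(1-3) vspace_tensor_over ten_bilin ten_balanced])
qed

definition flip :: "('k::field, 'a, 'm) module_scheme => ('k, 'b, 'n) module_scheme =>
  ('k, 'a \<times> 'b) formal => ('k, 'b \<times> 'a) formal" where
 "flip V W t = lift2 (tensor W V) (%x y. ten W V y x) t"

context
 fixes V :: "('k::field, 'a, 'm) module_scheme" and W :: "('k, 'b, 'n) module_scheme"
 assumes V: "vspace V" and W: "vspace W"
begin

lemma ten_flip_bilin: "bilin V W (tensor W V) (%x y. ten W V y x)"
 by (intro bilinI ten_left ten_right)

lemma flip_linear: "linear_map (tensor V W) (tensor W V) (flip V W)"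
 unfolding flip_def by (rule lift_linear[OF V W _ _ ten_flip_bilin]) auto

lemma flip_ten: "x :. V ==> y :. W ==> flip V W (ten V W x y) = ten W V y x"
 unfolding flip_def by (rule lift_ten[OF V W _ _ ten_flip_bilin]) auto

end

text \<open>Induction on the number of terms of \<open>t\<close>: if some functional does not vanish on the first
 factor of the last term, then the hypothesis expresses the second factor of the last term by the
 others, and \<open>t\<close> can be written with one term less. So no bases are needed.\<close>

lemma finsum_ten_zero:
 fixes V :: "('k::field, 'a, 'm) module_scheme" and W :: "('k, 'b, 'n) module_scheme" and n :: nat
 assumes V: "vspace V" and W: "vspace W"
  and p: "!!D. D \<in> S ==> linear_map V scalars (p D)"
  and sep: "!!v. v :. V ==> (!!D. D \<in> S ==> p D v = 0) ==> v = \<zero>[V]"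
  and "!!i. i < n ==> v i :. V" "!!i. i < n ==> w i :. W"
  and "!!D. D \<in> S ==> finsum W (%i. p D (v i) .[W] w i) {..<n} = \<zero>[W]"
 shows "finsum (tensor V W) (%i. ten V W (v i) (w i)) {..<n} = \<zero>[tensor V W]"
 using assms(5-)
proof (induction n arbitrary: v)
 case 0
 show ?case by simp
next
 case (Suc n)
 have v: "v i :. V" and w: "w i :. W" if "i \<le> n" for i
  using Suc.prems(1,2) that by auto
 have last: "finsum (tensor V W) (%i. ten V W (u i) (w i)) {..<Suc n} =
   ten V W (u n) (w n) +[tensor V W] finsum (tensor V W) (%i. ten V W (u i) (w i)) {..<n}"
  if "!!i. i \<le> n ==> u i :. V" for u
  unfolding lessThan_Suc using that w by (intro vs_finsum_insert) auto
 have lastW: "finsum W (%i. c i .[W] w i) {..<Suc n} = c n .[W] w n +[W] finsum W (%i. c i .[W] w i) {..<n}" for c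
  unfolding lessThan_Suc using w W by (intro vs_finsum_insert) auto
 have sum_closed: "finsum W (%i. c i .[W] w i) {..<n} :. W" for c
  using w W by (intro vs_finsum_closed vs_closed) auto
 have rel: "p D (v n) .[W] w n +[W] finsum W (%i. p D (v i) .[W] w i) {..<n} = \<zero>[W]"
  if "D \<in> S" for D
  using Suc.prems(3)[OF that] lastW[of "%i. p D (v i)"] by simp
 show ?case
 proof (cases "\<exists>D\<in>S. p D (v n) \<noteq> 0")
  case False
  then have vn: "v n = \<zero>[V]" by (intro sep v) auto
  have "finsum W (%i. p D (v i) .[W] w i) {..<n} = \<zero>[W]" if "D \<in> S" for D
   using rel[OF that] False that w[of n] W sum_closed by simp
  then have "finsum (tensor V W) (%i. ten V W (v i) (w i)) {..<n} = \<zero>[tensor V W]"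
   using v w by (intro Suc.IH) auto
  moreover have "ten V W (v n) (w n) = \<zero>[tensor V W]"
   unfolding vn by (rule lin_zero[OF V _ ten_left]) (use w in auto)
  ultimately show ?thesis using v by (simp add: last)
 next
  case True
  then obtain D0 where D0: "D0 \<in> S" "p D0 (v n) \<noteq> 0" by blast
  define a where "a i = - p D0 (v i) / p D0 (v n)" for i
  have "(1 / p D0 (v n)) .[W] (p D0 (v n) .[W] w n) =
    (1 / p D0 (v n)) .[W] (\<ominus>\<^bsub>W\<^esub> finsum W (%i. p D0 (v i) .[W] w i) {..<n})"
  proof -
   have "p D0 (v n) .[W] w n = \<zero>[W] \<ominus>\<^bsub>W\<^esub> finsum W (%i. p D0 (v i) .[W] w i) {..<n}"
    using rel[OF D0(1)] w W sum_closed by (subst vs_eq_diff) auto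
   then show ?thesis using w W sum_closed by (simp add: a_minus_def)
  qed
  also have "... = finsum W (%i. (- 1 / p D0 (v n)) .[W] (p D0 (v i) .[W] w i)) {..<n}"
   using w W sum_closed by (subst vs_finsum_smult) (auto simp: vs_minus_eq_smult)
  also have "... = finsum W (%i. a i .[W] w i) {..<n}"
   using w W by (intro vs_finsum_cong) (auto simp: a_def)
  finally have wn: "w n = finsum W (%i. a i .[W] w i) {..<n}"
   using w W D0(2) by simp
  define v' where "v' i = v i +[V] a i .[V] v n" for i
  have v': "v' i :. V" if "i < n" for i using v V that by (simp add: v'_def)
  have split: "finsum B (%i. b (v' i) (w i)) {..<n} = b (v n) (w n) +[B] finsum B (%i. b (v i) (w i)) {..<n}"
   if B: "vspace B" and b: "bilin V W B b" for B :: "('k, 'z, 'mm) module_scheme" and b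
  proof -
   have c: "b x (w i) :. B" if "i \<le> n" "x :. V" for i x
    using that w b by (auto intro: bilin_closed)
   have "b (v' i) (w i) = b (v i) (w i) +[B] b (v n) (a i .[W] w i)" if "i < n" for i
    using that v w V B c by (simp add: v'_def lin_add[OF bilin_left[OF b w]] lin_smult[OF bilin_left[OF b w]]
      lin_smult[OF bilin_right[OF b v]])
   then have "finsum B (%i. b (v' i) (w i)) {..<n} =
     finsum B (%i. b (v i) (w i) +[B] b (v n) (a i .[W] w i)) {..<n}"
    using v w W B c b by (intro vs_finsum_cong) (auto intro!: vs_closed intro: bilin_closed)
   also have "... = finsum B (%i. b (v i) (w i)) {..<n} +[B] finsum B (%i. b (v n) (a i .[W] w i)) {..<n}"
    using v w W B c b by (intro vs_finsum_add) (auto intro: bilin_closed)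
   also have "finsum B (%i. b (v n) (a i .[W] w i)) {..<n} = b (v n) (w n)"
    unfolding wn using v w W B b by (intro lin_finsum[symmetric] bilin_right) auto
   also have "finsum B (%i. b (v i) (w i)) {..<n} +[B] b (v n) (w n) =
     b (v n) (w n) +[B] finsum B (%i. b (v i) (w i)) {..<n}"
    using v B c by (intro vs_add_ac(2)) (auto intro!: vs_finsum_closed)
   finally show ?thesis .
  qed
  have "finsum (tensor V W) (%i. ten V W (v' i) (w i)) {..<n} = \<zero>[tensor V W]"
  proof (rule Suc.IH)
   fix D assume D: "D \<in> S"
   have "bilin V W W (%x y. p D x .[W] y)"
    using V W p[OF D] by (intro bilinI lin_fun_scalar lin_fun_smult lin_id)
   from split[OF W this] show "finsum W (%i. p D (v' i) .[W] w i) {..<n} = \<zero>[W]"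
    using rel[OF D] by simp
  qed (use v' w in auto)
  then show ?thesis
   using split[OF vspace_tensor_over ten_bilin, of "{}"] v by (simp add: last)
 qed
qed

lemma tensor_finsum:
 fixes V :: "('k::field, 'a, 'm) module_scheme" and W :: "('k, 'b, 'n) module_scheme"
 assumes V: "vspace V" and W: "vspace W" and t: "t :. (tensor V W)"
 obtains n and v :: "nat => 'a" and w :: "nat => 'b" where
  "!!i. i < n ==> v i :. V" "!!i. i < n ==> w i :. W"
  "t = finsum (tensor V W) (%i. ten V W (v i) (w i)) {..<n}"
proof -
 define P where "P t \<longleftrightarrow> (\<exists>n v w. (\<forall>i<n. v i :. V) \<and> (\<forall>i<n. w i :. W) \<and>
  t = finsum (tensor V W) (%i. ten V W (v i) (w i)) {..<n::nat})" for t
 have "P t"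
  using t V W
 proof (induction rule: tensor_induct)
  case (ten x y)
  then show ?case
   unfolding P_def by (intro exI[of _ 1] exI[of _ "%_. x"] exI[of _ "%_. y"])
    (simp add: lessThan_Suc vs_finsum_insert)
 next
  case (add s t)
  obtain n v w where s: "!!i. i < n ==> v i :. V" "!!i. i < n ==> w i :. W"
   "s = finsum (tensor V W) (%i. ten V W (v i) (w i)) {..<n::nat}" using add(3) unfolding P_def by auto
  obtain m v' w' where t: "!!i. i < m ==> v' i :. V" "!!i. i < m ==> w' i :. W"
   "t = finsum (tensor V W) (%i. ten V W (v' i) (w' i)) {..<m::nat}" using add(4) unfolding P_def by auto
  define x where "x i = (if i < n then v i else v' (i - n))" for i
  define y where "y i = (if i < n then w i else w' (i - n))" for i
  have xy: "x i :. V" "y i :. W" if "i < n + m" for i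
   using s t that by (auto simp: x_def y_def)
  interpret T: abelian_monoid "tensor V W" by simp
  have un: "{..<n + m} = {..<n} \<union> {n..<n + m}" by auto
  have "finsum (tensor V W) (%i. ten V W (x i) (y i)) {..<n + m} =
   finsum (tensor V W) (%i. ten V W (x i) (y i)) {..<n} +[tensor V W]
   finsum (tensor V W) (%i. ten V W (x i) (y i)) {n..<n + m}"
   unfolding un using xy by (intro T.finsum_Un_disjoint) auto
  also have "finsum (tensor V W) (%i. ten V W (x i) (y i)) {..<n} = s"
   unfolding s(3) using s by (intro vs_finsum_cong) (auto simp: x_def y_def)
  also have "{n..<n + m} = (%i. i + n) ` {..<m}" by (simp add: lessThan_atLeast0 add.commute)
  also have "finsum (tensor V W) (%i. ten V W (x i) (y i)) ((%i. i + n) ` {..<m}) =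
    finsum (tensor V W) (%i. ten V W (x (i + n)) (y (i + n))) {..<m}"
   using xy by (intro T.add.finprod_reindex) (auto simp: inj_on_def)
  also have "... = t"
   unfolding t(3) using t by (intro vs_finsum_cong) (auto simp: x_def y_def)
  finally show ?case
   unfolding P_def using xy by (intro exI[of _ "n + m"] exI[of _ x] exI[of _ y]) simp
 qed
 then obtain n v w where "\<forall>i<n. v i :. V" "\<forall>i<n. w i :. W"
  "t = finsum (tensor V W) (%i. ten V W (v i) (w i)) {..<n::nat}" unfolding P_def by (elim exE conjE)
 then show ?thesis by (intro that[of n v w]) simp_all
qed

text \<open>Functionals that separate the points of \<open>V\<close> detect the elements of \<open>V \<otimes> W\<close>.\<close>

lemma tensor_separate_left:
 fixes V :: "('k::field, 'a, 'm) module_scheme" and W :: "('k, 'b, 'n) module_scheme"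
 assumes V: "vspace V" and W: "vspace W"
  and p: "!!D. D \<in> S ==> linear_map V scalars (p D)"
  and sep: "!!v. v :. V ==> (!!D. D \<in> S ==> p D v = 0) ==> v = \<zero>[V]"
  and t: "t :. (tensor V W)" and s: "s :. (tensor V W)"
  and eq: "!!D. D \<in> S ==> lift2 W (%x y. p D x .[W] y) t = lift2 W (%x y. p D x .[W] y) s"
 shows "t = s"
proof -
 have bil: "bilin V W W (%x y. p D x .[W] y)" if "D \<in> S" for D
  using V W p[OF that] by (intro bilinI lin_fun_scalar lin_fun_smult lin_id)
 have lin: "linear_map (tensor V W) W (lift2 W (%x y. p D x .[W] y))" if "D \<in> S" for D
  by (rule lift_linear[OF V W _ W bil[OF that]]) auto
 have d: "t \<ominus>\<^bsub>tensor V W\<^esub> s :. (tensor V W)" using s t by simp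
 obtain n v w where vw: "!!i. i < n ==> v i :. V" "!!i. i < n ==> w i :. W"
  "t \<ominus>\<^bsub>tensor V W\<^esub> s = finsum (tensor V W) (%i. ten V W (v i) (w i)) {..<n::nat}"
  using tensor_finsum[OF V W d] by blast
 have "t \<ominus>\<^bsub>tensor V W\<^esub> s = \<zero>[tensor V W]"
  unfolding vw(3)
 proof (rule finsum_ten_zero[OF V W p sep vw(1,2)])
  fix D assume D: "D \<in> S"
  have "\<zero>[W] = lift2 W (%x y. p D x .[W] y) (t \<ominus>\<^bsub>tensor V W\<^esub> s)"
   using eq[OF D] s t W lin_closed[OF lin[OF D]] by (simp add: lin_diff[OF _ W lin[OF D]])
  also have "... = finsum W (%i. p D (v i) .[W] w i) {..<n}"
   unfolding vw(3) using vw(1,2) W p[OF D]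
   by (subst lin_finsum[OF _ W lin[OF D]])
    (auto intro!: vs_finsum_cong simp: lift_ten[OF V W _ W bil[OF D]])
  finally show "finsum W (%i. p D (v i) .[W] w i) {..<n} = \<zero>[W]" by simp
 qed auto
 then show ?thesis using s t by (simp add: vs_diff_eq_zero)
qed

lemma tensor_separate:
 fixes V :: "('k::field, 'a, 'm) module_scheme" and W :: "('k, 'b, 'n) module_scheme"
 assumes V: "vspace V" and W: "vspace W"
  and p: "!!D. D \<in> S ==> linear_map V scalars (p D)"
  and sep: "!!v. v :. V ==> (!!D. D \<in> S ==> p D v = 0) ==> v = \<zero>[V]"
  and q: "!!D. D \<in> T ==> linear_map W scalars (q D)"
  and sepq: "!!v. v :. W ==> (!!D. D \<in> T ==> q D v = 0) ==> v = \<zero>[W]"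
  and t: "t :. (tensor V W)" and s: "s :. (tensor V W)"
  and eq: "!!D E. D \<in> S ==> E \<in> T ==>
   lift2 scalars (%x y. p D x * q E y) t = lift2 scalars (%x y. p D x * q E y) s"
 shows "t = s"
proof (rule tensor_separate_left[OF V W p sep t s])
 fix D assume D: "D \<in> S"
 let ?L = "lift2 W (%x y. p D x .[W] y)"
 have cl: "?L r :. W" if "r :. (tensor V W)" for r
  using that W by (intro tl2_closed[OF V W]) auto
 have "q E (?L t \<ominus>\<^bsub>W\<^esub> ?L s) = 0" if E: "E \<in> T" for E
 proof -
  have "q E (?L r) = lift2 scalars (%x y. p D x * q E y) r" if "r :. (tensor V W)" for r
  proof -
   have "q E (?L r) = lift2 scalars (%x y. q E (p D x .[W] y)) r"
    using that W by (intro tl2_linear[OF V W _ _ q[OF E]]) auto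
   also have "... = lift2 scalars (%x y. p D x * q E y) r"
    using that W by (intro tl2_cong[OF V W]) (auto simp: lin_smult[OF q[OF E]])
   finally show ?thesis .
  qed
  then show ?thesis using s t cl W eq[OF D E]
   by (simp add: a_minus_def vs_minus_eq_smult lin_add[OF q[OF E]] lin_smult[OF q[OF E]])
 qed
 then have "?L t \<ominus>\<^bsub>W\<^esub> ?L s = \<zero>[W]" using cl s t W by (intro sepq) auto
 then show "?L t = ?L s" using cl s t W by (simp add: vs_diff_eq_zero)
qed

section \<open>Algebras\<close>

lemma k_algebraI:
 fixes A :: "('k::field, 'a, 'm) module_scheme"
 assumes "vspace A" "\<one>[A] :. A"
  and "!!x y. x :. A ==> y :. A ==> x *[A] y :. A"
  and "!!x. x :. A ==> \<one>[A] *[A] x = x" "!!x. x :. A ==> x *[A] \<one>[A] = x"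
  and "!!x y z. x :. A ==> y :. A ==> z :. A ==> (x *[A] y) *[A] z = x *[A] (y *[A] z)"
  and "!!a. a :. A ==> linear_map A A (%x. a *[A] x)" "!!a. a :. A ==> linear_map A A (%x. x *[A] a)"
 shows "k_algebra A"
 unfolding k_algebra_def
proof (intro conjI allI ballI)
 show "ring A"
  using assms by (intro ringI monoidI) (auto simp: linear_map_def)
qed (use assms in \<open>auto simp: linear_map_def\<close>)

lemma vspace_cong:
 fixes A :: "('k::field, 'a, 'm) module_scheme" and B :: "('k, 'a, 'n) module_scheme"
 assumes A: "vspace A" and [simp]: "carrier B = carrier A" "add B = add A" "zero B = zero A"
  "module.smult B = module.smult A"
 shows "vspace B"
proof (rule vspaceI)
 have inv: "\<exists>y\<in>carrier A. y +[A] x = \<zero>[A]" if "x :. A" for x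
  using that A by (intro bexI[of _ "\<ominus>\<^bsub>A\<^esub> x"]) (auto simp: abelian_group.l_neg[OF vs_abelian_group])
 show "abelian_group B"
  by (rule abelian_groupI) (use A inv in \<open>auto simp: vs_add_ac\<close>)
qed (use A in \<open>auto simp: vs_smult_add\<close>)

lemma k_algebra_cong:
 fixes A :: "('k::field, 'a, 'm) module_scheme" and B :: "('k, 'a, 'n) module_scheme"
 assumes A: "k_algebra A" and eq: "carrier B = carrier A" "add B = add A" "zero B = zero A"
  "module.smult B = module.smult A" "monoid.mult B = monoid.mult A" "one B = one A"
 shows "k_algebra B"
proof (rule k_algebraI)
 show "vspace B" using vspace_cong[OF k_algebra_vspace[OF A] eq(1-4)] .
qed (use A in \<open>auto simp: eq alg_assoc linear_map_def alg_distr alg_smult\<close>)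

definition op :: "('k, 'a, 'm) module_scheme => ('k, 'a, 'm) module_scheme" where
 "op A = A\<lparr>monoid.mult := (%x y. y *[A] x)\<rparr>"

lemma op_simps [simp]:
 "carrier (op A) = carrier A" "x +[op A] y = x +[A] y" "add (op A) = add A" "\<zero>[op A] = \<zero>[A]" "\<one>[op A] = \<one>[A]"
 "c .[op A] x = c .[A] x" "module.smult (op A) = module.smult A" "x *[op A] y = y *[A] x"
 by (simp_all add: op_def)

lemma finsum_op [simp]: "finsum (op A) = finsum A"
 by (simp add: finsum_def finprod_def fun_eq_iff)

lemma vspace_op [simp]: "vspace A ==> vspace (op A)"
 by (erule vspace_cong) simp_all

lemma k_algebra_op: "k_algebra A ==> k_algebra (op A)"
 by (rule k_algebraI) (auto simp: alg_assoc linear_map_def alg_distr alg_smult)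

lemma linear_map_op [simp]:
 "linear_map (op A) B f = linear_map A B f" "linear_map A (op B) f = linear_map A B f"
 by (simp_all add: linear_map_def)

lemma alg_hom_op: "alg_hom (op A) (op B) f = alg_hom A B f" "alg_hom (op A) B f = alg_antihom A B f"
  "alg_hom A (op B) f = alg_antihom A B f" "alg_antihom (op A) B f = alg_hom A B f" "alg_antihom A (op B) f = alg_hom A B f"
 by (auto simp: alg_hom_def alg_antihom_def)

lemma alg_hom_linear: "alg_hom A B f ==> linear_map A B f" and alg_antihom_linear: "alg_antihom A B f ==> linear_map A B f"
 by (auto simp: alg_hom_def alg_antihom_def)

lemma alg_hom_comp: "alg_hom B C f ==> alg_hom A B h ==> alg_hom A C (%x. f (h x))"
 and alg_hom_comp_anti: "alg_antihom B C f ==> alg_hom A B h ==> alg_antihom A C (%x. f (h x))"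
 and alg_antihom_comp: "alg_hom B C f ==> alg_antihom A B h ==> alg_antihom A C (%x. f (h x))"
 and alg_antihom_comp_anti: "alg_antihom B C f ==> alg_antihom A B h ==> alg_hom A C (%x. f (h x))"
 by (simp_all add: alg_hom_def alg_antihom_def linear_map_def Pi_iff)

lemma k_algebra_scalars [simp]: "k_algebra scalars"
 by (rule k_algebraI) (auto simp: linear_map_def algebra_simps)

subsection \<open>The tensor product of two algebras\<close>

context
 fixes A :: "('k::field, 'a, 'm) module_scheme" and B :: "('k, 'b, 'n) module_scheme"
 assumes A: "k_algebra A" and B: "k_algebra B"
begin

lemma tensor_alg_simps [simp]:
 "carrier (tensor_alg A B) = carrier (tensor A B)" "add (tensor_alg A B) = add (tensor A B)"
 "zero (tensor_alg A B) = zero (tensor A B)" "module.smult (tensor_alg A B) = module.smult (tensor A B)"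
 "\<one>[tensor_alg A B] = ten A B \<one>[A] \<one>[B]"
 by (simp_all add: tensor_alg_def)

lemma vspace_tensor_alg: "vspace (tensor_alg A B)"
 by (rule vspace_cong[of "tensor A B"]) simp_all

lemma tensor_alg_inner:
 assumes "a :. A" "b :. B"
 shows "bilin A B (tensor A B) (%a' b'. ten A B (a *[A] a') (b *[B] b'))"
 using assms A B by (intro bilinI lin_comp[OF ten_right] lin_comp[OF ten_left] lin_mult_left) auto

lemma tensor_alg_mult:
 "s *[tensor_alg A B] t = tensor_lift (tensor A B) (%(a, b).
   lift2 (tensor A B) (%a' b'. ten A B (a *[A] a') (b *[B] b')) t) s"
 by (simp add: tensor_alg_def)

lemma tensor_alg_outer:
 assumes "t :. (tensor A B)"
 shows "bilin A B (tensor A B) (%a b. lift2 (tensor A B) (%a' b'. ten A B (a *[A] a') (b *[B] b')) t)"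
 using assms A B
 by (intro bilinI tl2_fun_linear[OF k_algebra_vspace[OF A] k_algebra_vspace[OF B]]
   lin_comp[OF ten_right] lin_comp[OF ten_left] lin_mult_right) auto

lemma tensor_alg_linear:
 "t :. (tensor A B) ==> linear_map (tensor A B) (tensor A B) (%s. s *[tensor_alg A B] t)"
 "s :. (tensor A B) ==> linear_map (tensor A B) (tensor A B) (%t. s *[tensor_alg A B] t)"
proof -
 show "linear_map (tensor A B) (tensor A B) (%s. s *[tensor_alg A B] t)" if "t :. (tensor A B)"
  unfolding tensor_alg_mult using A B that by (intro lift_linear tensor_alg_outer) auto
 show "linear_map (tensor A B) (tensor A B) (%t. s *[tensor_alg A B] t)" if s: "s :. (tensor A B)"
  unfolding tensor_alg_mult using A B
  by (intro tl2_fun_linear[OF k_algebra_vspace[OF A] k_algebra_vspace[OF B] _ s] lift_linear tensor_alg_inner) auto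
qed

lemma tensor_alg_ten:
 assumes "a :. A" "b :. B" "a' :. A" "b' :. B"
 shows "ten A B a b *[tensor_alg A B] ten A B a' b' = ten A B (a *[A] a') (b *[B] b')"
 unfolding tensor_alg_mult using A B assms
 by (subst lift_ten[OF _ _ _ _ tensor_alg_outer]) (simp_all add: lift_ten[OF _ _ _ _ tensor_alg_inner])

lemma k_algebra_tensor_alg: "k_algebra (tensor_alg A B)"
proof (rule k_algebraI)
 note [simp] = A B k_algebra_vspace[OF A] k_algebra_vspace[OF B]
 note lin = tensor_alg_linear and T = vspace_tensor_over[of "{}" A B]
 show "vspace (tensor_alg A B)" by (rule vspace_tensor_alg)
 show "linear_map (tensor_alg A B) (tensor_alg A B) (%x. a *[tensor_alg A B] x)"
  "linear_map (tensor_alg A B) (tensor_alg A B) (%x. x *[tensor_alg A B] a)"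
  if "a :. (tensor_alg A B)" for a
  using lin[of a] that by (simp_all add: linear_map_def)
 show closed: "x *[tensor_alg A B] y :. (tensor_alg A B)"
  if "x :. (tensor_alg A B)" "y :. (tensor_alg A B)" for x y
  using lin_closed[OF lin(1)[of y], of x] that by simp
 show "\<one>[tensor_alg A B] :. (tensor_alg A B)" by simp
 show "\<one>[tensor_alg A B] *[tensor_alg A B] x = x" if "x :. (tensor_alg A B)" for x
  by (rule tensor_ext[where M=A and N=B and E="{}" and B="tensor A B" and f="%x. \<one>[tensor_alg A B] *[tensor_alg A B] x" and g="%x. x"])
   (use that in \<open>simp_all add: lin lin_id tensor_alg_ten\<close>)
 show "x *[tensor_alg A B] \<one>[tensor_alg A B] = x" if "x :. (tensor_alg A B)" for x
  by (rule tensor_ext[where M=A and N=B and E="{}" and B="tensor A B" and f="%x. x *[tensor_alg A B] \<one>[tensor_alg A B]" and g="%x. x"])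
   (use that in \<open>simp_all add: lin lin_id tensor_alg_ten\<close>)
 fix x y z assume xyz: "x :. (tensor_alg A B)" "y :. (tensor_alg A B)" "z :. (tensor_alg A B)"
 let ?m = "monoid.mult (tensor_alg A B)"
 have c: "?m s t :. (tensor A B)" if "s :. (tensor A B)" "t :. (tensor A B)" for s t
  using closed that by simp
 have 1: "?m (?m (ten A B a b) (ten A B a' b')) w = ?m (ten A B a b) (?m (ten A B a' b') w)"
  if "a :. A" "b :. B" "a' :. A" "b' :. B" "w :. (tensor A B)" for a b a' b' w
  by (rule tensor_ext[where M=A and N=B and E="{}" and B="tensor A B" and f="%w. ?m (?m (ten A B a b) (ten A B a' b')) w" and g="%w. ?m (ten A B a b) (?m (ten A B a' b') w)"])
   (use that in \<open>auto simp: tensor_alg_ten alg_assoc intro!: lin lin_comp[OF lin(2)] c\<close>)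
 have 2: "?m (?m (ten A B a b) v) w = ?m (ten A B a b) (?m v w)"
  if "a :. A" "b :. B" "v :. (tensor A B)" "w :. (tensor A B)" for a b v w
  by (rule tensor_ext[where M=A and N=B and E="{}" and B="tensor A B" and f="%v. ?m (?m (ten A B a b) v) w" and g="%v. ?m (ten A B a b) (?m v w)"])
   (use that in \<open>auto simp: 1 intro!: lin lin_comp[OF lin(1)] lin_comp[OF lin(2)] c\<close>)
 show "?m (?m x y) z = ?m x (?m y z)"
  by (rule tensor_ext[where M=A and N=B and E="{}" and B="tensor A B" and f="%x. ?m (?m x y) z" and g="%x. ?m x (?m y z)"])
   (use xyz in \<open>auto simp: 2 intro!: lin lin_comp[OF lin(1)] c\<close>)
qed

end

section \<open>Universal enveloping algebras\<close>

abbreviation free_ring :: "('g word \<Rightarrow>\<^sub>0 'k::field) ring" where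
 "free_ring \<equiv> ring_of_type_algebra"

lemma free_ring_simps [simp]:
 "carrier (free_ring :: ('g word \<Rightarrow>\<^sub>0 'k::field) ring) = UNIV" "x +[free_ring] y = x + (y :: 'g word \<Rightarrow>\<^sub>0 'k)"
 "x *[free_ring] y = x * (y :: 'g word \<Rightarrow>\<^sub>0 'k)" "\<one>[free_ring] = (1 :: 'g word \<Rightarrow>\<^sub>0 'k)" "\<zero>[free_ring] = (0 :: 'g word \<Rightarrow>\<^sub>0 'k)"
 by (simp_all add: ring_of_type_algebra_def)

lemma free_ring_is_ring: "ring (free_ring :: ('g word \<Rightarrow>\<^sub>0 'k::field) ring)"
proof -
 have "\<exists>y. x + y = 0" for x :: "'g word \<Rightarrow>\<^sub>0 'k" by (rule exI[of _ "- x"]) simp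
 then show ?thesis
  unfolding ring_of_type_algebra_def using add.right_inverse
  by unfold_locales (auto simp: algebra_simps Units_def)
qed

lemma free_ring_minus [simp]: "x \<ominus>\<^bsub>free_ring\<^esub> y = x - (y :: 'g word \<Rightarrow>\<^sub>0 'k::field)"
proof -
 interpret ring "free_ring :: ('g word \<Rightarrow>\<^sub>0 'k) ring" by (rule free_ring_is_ring)
 have "\<ominus>\<^bsub>free_ring\<^esub> y = - y" by (rule minus_equality) simp_all
 then show ?thesis by (simp add: a_minus_def)
qed

context
 fixes g :: "('k::field, 'g::ab_group_add) based_lie"
begin

lemma env_ideal_ideal: "ideal (env_ideal g) free_ring"
 unfolding env_ideal_def by (rule ring.genideal_ideal[OF free_ring_is_ring]) simp

lemma env_algebra_simps [simp]:
 "\<one>[env_algebra g] = env_class g 1"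
 "\<zero>[env_algebra g] = env_class g 0"
 "env_class g a +[env_algebra g] env_class g b = env_class g (a + b)"
 "env_class g a *[env_algebra g] env_class g b = env_class g (a * b)"
 "c .[env_algebra g] env_class g a = env_class g (free_const c * a)"
 and carrier_env_algebra: "carrier (env_algebra g) = range (env_class g)"
proof -
 interpret ideal "env_ideal g" free_ring by (rule env_ideal_ideal)
 show "env_class g a +[env_algebra g] env_class g b = env_class g (a + b)"
  using a_rcos_sum[of a b]
  by (simp add: env_algebra_def Let_def env_class_def ring.defs module.defs FactRing_def)
 show "env_class g a *[env_algebra g] env_class g b = env_class g (a * b)"
  "c .[env_algebra g] env_class g a = env_class g (free_const c * a)"
  using rcoset_mult_add[of a b] rcoset_mult_add[of "free_const c" a]
  by (simp_all add: env_algebra_def Let_def env_class_def ring.defs module.defs FactRing_def)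
 show "\<zero>[env_algebra g] = env_class g 0"
  using a_coset_add_zero[of "env_ideal g"]
  by (simp add: env_algebra_def Let_def env_class_def ring.defs module.defs FactRing_def)
qed (auto simp: env_algebra_def Let_def env_class_def ring.defs module.defs FactRing_def A_RCOSETS_def RCOSETS_def a_r_coset_def)

lemma env_class_eq_iff: "env_class g a = env_class g b \<longleftrightarrow> a - b \<in> env_ideal g"
proof -
 interpret ideal "env_ideal g" free_ring by (rule env_ideal_ideal)
 show ?thesis
  using quotient_eq_iff_same_a_r_cos[OF env_ideal_ideal, of a b] by (simp add: env_class_def)
qed

lemma free_const_simps:
 "free_const (c + d) = (free_const c + free_const d :: 'g word \<Rightarrow>\<^sub>0 'k)"
 "free_const (c * d) = (free_const c * free_const d :: 'g word \<Rightarrow>\<^sub>0 'k)"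
 "free_const 1 = (1 :: 'g word \<Rightarrow>\<^sub>0 'k)"
 by (simp_all add: free_const_def single_add mult_single)

lemma free_const_commute: "free_const c * a = a * (free_const c :: 'g word \<Rightarrow>\<^sub>0 'k)"
proof (induction a rule: update_induct)
 case const then show ?case by simp
next
 case (update f w d)
 have "Poly_Mapping.update w d f = Poly_Mapping.single w d + f"
  using update by (intro poly_mapping_eqI) (auto simp: lookup_update lookup_add lookup_single when_def in_keys_iff)
 then show ?case
  using update by (simp add: distrib_left distrib_right free_const_def mult_single mult.commute)
qed

lemma k_algebra_env_algebra: "k_algebra (env_algebra g)"
proof (rule k_algebraI)
 show "vspace (env_algebra g)"
 proof (rule vspaceI)
  show "abelian_group (env_algebra g)"
  proof (rule abelian_groupI)
   fix x assume "x :. (env_algebra g)"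
   then obtain a where "x = env_class g a" by (auto simp: carrier_env_algebra)
   then show "\<exists>y\<in>carrier (env_algebra g). y +[env_algebra g] x = \<zero>[env_algebra g]"
    by (intro bexI[of _ "env_class g (- a)"]) (simp_all add: carrier_env_algebra)
  qed (auto simp: carrier_env_algebra ac_simps)
 qed (auto simp only: carrier_env_algebra env_algebra_simps free_const_simps distrib_left distrib_right mult_1 mult.assoc)
 have "linear_map (env_algebra g) (env_algebra g) (%x. env_class g a *[env_algebra g] x)" for a
 proof (rule linear_mapI)
  fix c x assume "x :. (env_algebra g)"
  then obtain b where x: "x = env_class g b" by (auto simp: carrier_env_algebra)
  have "a * (free_const c * b) = free_const c * (a * b)"
   using free_const_commute[of c a] by (metis mult.assoc)
  then show "env_class g a *[env_algebra g] (c .[env_algebra g] x) = c .[env_algebra g] (env_class g a *[env_algebra g] x)"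
   by (simp add: x)
 qed (auto simp only: carrier_env_algebra env_algebra_simps distrib_left)
 then show "!!a. a :. (env_algebra g) ==> linear_map (env_algebra g) (env_algebra g) (%x. a *[env_algebra g] x)"
  by (auto simp only: carrier_env_algebra)
 have "linear_map (env_algebra g) (env_algebra g) (%x. x *[env_algebra g] env_class g a)" for a
  by (rule linear_mapI) (auto simp only: carrier_env_algebra env_algebra_simps distrib_right mult.assoc)
 then show "!!a. a :. (env_algebra g) ==> linear_map (env_algebra g) (env_algebra g) (%x. x *[env_algebra g] a)"
  by (auto simp only: carrier_env_algebra)
qed (auto simp only: carrier_env_algebra env_algebra_simps mult.assoc mult_1 mult_1_right)

lemma env_incl_closed [simp]: "env_incl g x :. (env_algebra g)"
 by (simp add: env_incl_def carrier_env_algebra)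

lemma env_ideal_gens:
 "free_gen (x + y) - free_gen x - free_gen y \<in> env_ideal g"
 "free_gen (lie_scale g c x) - free_const c * free_gen x \<in> env_ideal g"
 "free_gen x * free_gen y - free_gen y * free_gen x - free_gen (lie_bracket g x y) \<in> env_ideal g"
proof -
 have "S \<subseteq> Idl\<^bsub>free_ring\<^esub> S" for S :: "('g word \<Rightarrow>\<^sub>0 'k) set"
  by (rule ring.genideal_self[OF free_ring_is_ring]) simp
 from this[of "range (%(x, y). free_gen (x + y) - free_gen x - free_gen y) \<union>
   range (%(c, x). free_gen (lie_scale g c x) - free_const c * free_gen x) \<union>
   range (%(x, y). free_gen x * free_gen y - free_gen y * free_gen x - free_gen (lie_bracket g x y))"]
 show "free_gen (x + y) - free_gen x - free_gen y \<in> env_ideal g"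
  "free_gen (lie_scale g c x) - free_const c * free_gen x \<in> env_ideal g"
  "free_gen x * free_gen y - free_gen y * free_gen x - free_gen (lie_bracket g x y) \<in> env_ideal g"
  unfolding env_ideal_def by (force simp del: base_field_simps)+
qed

lemma env_incl_add: "env_incl g (x + y) = env_incl g x +[env_algebra g] env_incl g y"
 and env_incl_scale: "env_incl g (lie_scale g c x) = c .[env_algebra g] env_incl g x"
 and env_incl_bracket: "env_incl g x *[env_algebra g] env_incl g y =
  env_incl g y *[env_algebra g] env_incl g x +[env_algebra g] env_incl g (lie_bracket g x y)"
 using env_ideal_gens(1,3)[of x y] env_ideal_gens(2)[of c x]
 by (simp_all add: env_incl_def env_class_eq_iff diff_diff_eq)

lemma env_algebra_induct [consumes 1, case_names one incl add smult mult]: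
 assumes u: "u :. (env_algebra g)"
  and one: "P \<one>[env_algebra g]" and incl: "!!x. P (env_incl g x)"
  and add: "!!u v. u :. (env_algebra g) ==> v :. (env_algebra g) ==> P u ==> P v ==> P (u +[env_algebra g] v)"
  and smult: "!!c u. u :. (env_algebra g) ==> P u ==> P (c .[env_algebra g] u)"
  and mult: "!!u v. u :. (env_algebra g) ==> v :. (env_algebra g) ==> P u ==> P v ==> P (u *[env_algebra g] v)"
 shows "P u"
proof -
 have word: "P (env_class g (Poly_Mapping.single (Word xs) 1))" for xs
 proof (induction xs)
  case Nil
  then show ?case using one by (simp flip: zero_word_def)
 next
  case (Cons x xs)
  have "Poly_Mapping.single (Word (x # xs)) 1 = free_gen x * Poly_Mapping.single (Word xs) (1::'k)"
   by (simp add: free_gen_def mult_single plus_word_def)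
  then show ?case
   using mult[OF _ _ incl[of x] Cons] by (simp add: env_incl_def carrier_env_algebra)
 qed
 have "P (env_class g a)" for a
 proof (induction a rule: update_induct)
  case const
  have "P (0 .[env_algebra g] \<one>[env_algebra g])" by (rule smult) (auto simp: one carrier_env_algebra simp del: env_algebra_simps, simp add: carrier_env_algebra)
  then show ?case by (simp add: free_const_def)
 next
  case (update f w d)
  have *: "Poly_Mapping.update w d f = free_const d * Poly_Mapping.single w 1 + f"
   using update by (intro poly_mapping_eqI)
    (auto simp: lookup_update lookup_add lookup_single when_def in_keys_iff free_const_def mult_single)
  have "P (d .[env_algebra g] env_class g (Poly_Mapping.single w 1))"
   using word[of "letters w"] by (intro smult) (auto simp: carrier_env_algebra)
  from add[OF _ _ this update(3)] show ?case
   unfolding * by (auto simp: carrier_env_algebra)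
 qed
 then show ?thesis using u by (auto simp: carrier_env_algebra)
qed

end

subsection \<open>The universal property\<close>

lemma formal_value_add:
 fixes B :: "('k::field, 'z, 'm) module_scheme"
 assumes B: "vspace B" and b: "!!s. b s :. B"
 shows "formal_value B b (x + y) = formal_value B b x +[B] formal_value B b y"
proof -
 have cl: "formal_value B b z :. B" for z
  unfolding formal_value_def using B b by (intro vs_finsum_closed) auto
 have "formal_value B b ((x + y) - y) = formal_value B b (x + y) \<ominus>\<^bsub>B\<^esub> formal_value B b y"
  by (rule formal_value_diff[where S=UNIV]) (use B b in auto)
 then have "formal_value B b x = formal_value B b (x + y) \<ominus>\<^bsub>B\<^esub> formal_value B b y" by simp
 then show ?thesis using vs_eq_diff[OF B cl cl cl, of x "x + y" y] by simp
qed

lemma formal_value_single: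
 fixes B :: "('k::field, 'z, 'm) module_scheme"
 assumes B: "vspace B" and b: "!!s. b s :. B"
 shows "formal_value B b (Poly_Mapping.single s c) = c .[B] b s"
proof -
 have "Poly_Mapping.single s c = fscale c (delta s)"
  by (rule poly_mapping_eqI) (simp add: lookup_single when_def)
 then show ?thesis
  using formal_value_fscale[OF B, of "delta s" UNIV b c] formal_value_delta[of B b s, OF B b] b by simp
qed

lemma poly_mapping_single_induct [case_names zero single]:
 fixes x :: "'s \<Rightarrow>\<^sub>0 'k::field"
 assumes "P 0" "!!w c x. P x ==> P (Poly_Mapping.single w c + x)"
 shows "P x"
proof (induction x rule: update_induct)
 case const then show ?case by (rule assms(1))
next
 case (update f w d)
 have "Poly_Mapping.update w d f = Poly_Mapping.single w d + f"
  using update by (intro poly_mapping_eqI) (auto simp: lookup_update lookup_add lookup_single when_def in_keys_iff)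
 then show ?case using assms(2)[OF update(3)] by simp
qed

definition word_value :: "('k::field, 'a, 'm) module_scheme => ('g => 'a) => 'g word => 'a" where
 "word_value A f w = foldr (%x u. f x *[A] u) (letters w) \<one>[A]"

context
 fixes A :: "('k::field, 'a, 'm) module_scheme" and f :: "'g => 'a"
 assumes A: "k_algebra A" and f: "!!x. f x :. A"
begin

lemma word_value_closed: "word_value A f w :. A"
proof -
 have "foldr (%x u. f x *[A] u) xs \<one>[A] :. A" for xs
  by (induction xs) (use A f in auto)
 then show ?thesis by (simp add: word_value_def)
qed

lemma word_value_add: "word_value A f (v + w) = word_value A f v *[A] word_value A f w"
proof -
 have cl: "foldr (%x u. f x *[A] u) xs \<one>[A] :. A" for xs
  by (induction xs) (use A f in auto)
 have "foldr (%x u. f x *[A] u) (xs @ ys) \<one>[A] =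
   foldr (%x u. f x *[A] u) xs \<one>[A] *[A] foldr (%x u. f x *[A] u) ys \<one>[A]" for xs ys
 proof (induction xs)
  case Nil then show ?case using A cl by simp
 next
  case (Cons a xs)
  then show ?case using A f cl by (simp add: alg_assoc del: foldr_append)
 qed
 then show ?thesis by (simp add: word_value_def plus_word_def)
qed

abbreviation "free_value \<equiv> formal_value A (word_value A f)"

lemma free_value_closed: "free_value x :. A"
 unfolding formal_value_def using A word_value_closed by (intro vs_finsum_closed) auto

lemma free_value_add: "free_value (x + y) = free_value x +[A] free_value y"
 using A word_value_closed by (intro formal_value_add) auto

lemma free_value_single: "free_value (Poly_Mapping.single w c) = c .[A] word_value A f w"
 using A word_value_closed by (intro formal_value_single) auto

lemma free_value_zero: "free_value 0 = \<zero>[A]"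
 using A by (simp add: formal_value_def)

lemma free_value_mult: "free_value (x * y) = free_value x *[A] free_value y"
proof (induction x rule: poly_mapping_single_induct)
 case zero
 then show ?case using A free_value_closed by (simp add: free_value_zero)
next
 case (single w c x)
 have "free_value (Poly_Mapping.single w c * y) = free_value (Poly_Mapping.single w c) *[A] free_value y"
 proof (induction y rule: poly_mapping_single_induct)
  case zero
  then show ?case using A free_value_closed by (simp add: free_value_zero)
 next
  case (single v d y)
  then show ?case using A free_value_closed word_value_closed
   by (simp add: distrib_left free_value_add alg_distr mult_single free_value_single word_value_add alg_smult mult.commute)
 qed
 then show ?case using A free_value_closed single by (simp add: distrib_right free_value_add alg_distr)
qed

lemma free_value_one: "free_value 1 = \<one>[A]"
proof -
 have "free_value (Poly_Mapping.single 0 1) = \<one>[A]"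
  unfolding free_value_single using A by (simp add: word_value_def zero_word_def)
 then show ?thesis by simp
qed

lemma free_value_gen: "free_value (free_gen x) = f x"
 unfolding free_gen_def free_value_single using A f by (simp add: word_value_def)

lemma free_value_const: "free_value (free_const c) = c .[A] \<one>[A]"
 unfolding free_const_def free_value_single using A by (simp add: word_value_def zero_word_def)

lemma free_value_diff: "free_value (x - y) = free_value x \<ominus>\<^bsub>A\<^esub> free_value y"
 using A word_value_closed by (intro formal_value_diff[where S=UNIV]) auto

end

text \<open>The kernel of the evaluation of noncommutative polynomials contains the defining relations.\<close>

lemma env_universal:
 fixes g :: "('k::field, 'g::ab_group_add) based_lie" and A :: "('k, 'a, 'm) module_scheme" and f :: "'g => 'a"
 assumes A: "k_algebra A" and f: "!!x. f x :. A"
  and add: "!!x y. f (x + y) = f x +[A] f y" and scale: "!!c x. f (lie_scale g c x) = c .[A] f x"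
  and br: "!!x y. f x *[A] f y = f y *[A] f x +[A] f (lie_bracket g x y)"
 obtains F where "alg_hom (env_algebra g) A F" "!!x. F (env_incl g x) = f x"
proof -
 let ?F = "formal_value A (word_value A f)"
 interpret A: ring A by (rule k_algebra_ring[OF A])
 interpret R: ring "free_ring :: ('g word \<Rightarrow>\<^sub>0 'k) ring" by (rule free_ring_is_ring)
 note F = free_value_closed[where f=f, OF A f] free_value_add[where f=f, OF A f] free_value_mult[where f=f, OF A f]
  free_value_one[where f=f, OF A f] free_value_gen[where f=f, OF A f] free_value_const[where f=f, OF A f]
  free_value_diff[where f=f, OF A f]
 have hom: "ring_hom_ring (free_ring :: ('g word \<Rightarrow>\<^sub>0 'k) ring) A ?F"
  by (rule ring_hom_ringI2) (auto simp: R.ring_axioms A.ring_axioms ring_hom_def F)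
 then have ideal: "ideal (a_kernel free_ring A ?F) free_ring" by (rule ring_hom_ring.kernel_is_ideal)
 have "env_ideal g \<subseteq> a_kernel free_ring A ?F"
  unfolding env_ideal_def
 proof (rule R.genideal_minimal[OF ideal])
  have "f x *[A] f y \<ominus>\<^bsub>A\<^esub> f y *[A] f x \<ominus>\<^bsub>A\<^esub> f (lie_bracket g x y) = \<zero>[A]" for x y
   using f[of x] f[of y] f[of "lie_bracket g x y"] by (simp add: br[of x y]) algebra
  moreover have "f (x + y) \<ominus>\<^bsub>A\<^esub> f x \<ominus>\<^bsub>A\<^esub> f y = \<zero>[A]" for x y
   using f[of x] f[of y] by (simp add: add) algebra
  ultimately show "range (%(x, y). free_gen (x + y) - free_gen x - free_gen y) \<union>
   range (%(c, x). free_gen (lie_scale g c x) - free_const c * free_gen x) \<union>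
   range (%(x, y). free_gen x * free_gen y - free_gen y * free_gen x - free_gen (lie_bracket g x y))
   \<subseteq> a_kernel free_ring A ?F"
   using A f by (auto simp: a_kernel_def' F scale alg_smult)
 qed
 then have ker: "?F a = ?F b" if "env_class g a = env_class g b" for a b
 proof -
  have "?F (a - b) = \<zero>[A]"
   using \<open>env_ideal g \<subseteq> _\<close> that by (auto simp: env_class_eq_iff a_kernel_def')
  then show ?thesis
   unfolding F(7) by (subst (asm) vs_diff_eq_zero[OF k_algebra_vspace[OF A] F(1) F(1)])
 qed
 define G where "G u = ?F (SOME a. env_class g a = u)" for u
 have G: "G (env_class g a) = ?F a" for a
  unfolding G_def by (rule ker) (rule someI_ex, blast)
 have "alg_hom (env_algebra g) A G"
  unfolding alg_hom_def
  by (intro conjI linear_mapI ballI) (use A F in \<open>auto simp: carrier_env_algebra G alg_smult simp del: F(5,6)\<close>)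
 moreover have "G (env_incl g x) = f x" for x by (simp add: env_incl_def G F)
 ultimately show thesis by (rule that)
qed

subsection \<open>Bases\<close>

definition coef :: "('k::field, 'g::ab_group_add) based_lie => 'g => nat => 'k" where
 "coef g x i = Modules.module.representation (lie_scale g) (lie_basis g ` idx g) x (lie_basis g i)"

context
 fixes g :: "('k::field, 'g::ab_group_add) based_lie"
 assumes g: "based_lie_algebra g"
begin

interpretation lie_algebra "lie_scale g" "lie_bracket g"
 using g by (simp add: based_lie_algebra_def)

lemma basis_facts: "inj_on (lie_basis g) (idx g)" "independent (lie_basis g ` idx g)" "span (lie_basis g ` idx g) = UNIV"
 using g by (auto simp: based_lie_algebra_def)

lemma coef_add: "coef g (x + y) i = coef g x i + coef g y i"
 and coef_scale: "coef g (lie_scale g c x) i = c * coef g x i"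
 unfolding coef_def
 by (simp_all only: representation_add[OF basis_facts(2)] representation_scale[OF basis_facts(2)] basis_facts(3) UNIV_I)

lemma coef_basis: "i \<in> idx g ==> j \<in> idx g ==> coef g (lie_basis g i) j = (if i = j then 1 else 0)"
 unfolding coef_def
 by (simp only: representation_basis[OF basis_facts(2) imageI] inj_on_eq_iff[OF basis_facts(1)] eq_commute[of j i])

lemma coef_expand: "x = (\<Sum>i\<in>idx g. lie_scale g (coef g x i) (lie_basis g i))"
proof -
 have "x = (\<Sum>b\<in>lie_basis g ` idx g. lie_scale g (representation (lie_basis g ` idx g) x b) b)"
  by (rule sum_representation_eq[symmetric]) (use basis_facts in auto)
 also have "... = (\<Sum>i\<in>idx g. lie_scale g (coef g x i) (lie_basis g i))"
  unfolding coef_def using basis_facts(1) by (simp add: sum.reindex)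
 finally show ?thesis .
qed

lemma struct_const_coef: "struct_const g i j k = coef g (lie_bracket g (lie_basis g i) (lie_basis g j)) k"
 by (simp add: struct_const_def coef_def)

lemma lie_basis_induct:
 assumes "P 0" "!!x y. P x ==> P y ==> P (x + y)" "!!c x. P x ==> P (lie_scale g c x)" "!!i. i \<in> idx g ==> P (lie_basis g i)"
 shows "P x"
proof -
 have "x \<in> span (lie_basis g ` idx g)" by (simp only: basis_facts(3) UNIV_I)
 then show ?thesis
  by (induction rule: span_induct_alt) (use assms in auto)
qed

lemma bracket_antisym: "lie_bracket g y x = - lie_bracket g x y"
proof -
 have "lie_bracket g x y + lie_bracket g y x = lie_bracket g (x + y) (x + y)"
  by (subst bracket_add_left) (simp add: bracket_add_right bracket_self)
 also have "... = 0" by (rule bracket_self)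
 finally have "lie_bracket g x y + lie_bracket g y x = 0" .
 then show ?thesis by (simp add: eq_neg_iff_add_eq_0 add.commute)
qed

lemma based_lie_algebra_opp: "based_lie_algebra (opp g)"
proof -
 have "lie_algebra (lie_scale g) (%x y. lie_bracket g y x)"
 proof unfold_locales
  fix x y z
  show "lie_bracket g (lie_bracket g z y) x + lie_bracket g (lie_bracket g x z) y + lie_bracket g (lie_bracket g y x) z = 0"
  proof -
   have neg: "lie_bracket g u (- w) = - lie_bracket g u w" for u w
    using bracket_scale_right[of u "- 1" w] by simp
   have "lie_bracket g (lie_bracket g c b) a = lie_bracket g a (lie_bracket g b c)" for a b c
    by (subst bracket_antisym) (simp add: bracket_antisym[of b c] neg)
   then show ?thesis using jacobi[of x y z] by simp
  qed
 qed (simp_all add: bracket_add_left bracket_add_right bracket_scale_left bracket_scale_right bracket_self)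
 then show ?thesis using g by (simp add: based_lie_algebra_def opp_def)
qed

end

lemmas lie_basis_induct_cases = lie_basis_induct [consumes 1, case_names zero add scale basis]

lemma opp_simps [simp]: "lie_scale (opp g) = lie_scale g" "lie_dim (opp g) = lie_dim g" "lie_basis (opp g) = lie_basis g"
 "lie_bracket (opp g) x y = lie_bracket g y x" "opp (opp g) = g"
 by (simp_all add: opp_def)

lemma struct_const_antisym:
 assumes "based_lie_algebra g"
 shows "struct_const g j i k = - struct_const g i j k"
proof -
 interpret lie_algebra "lie_scale g" "lie_bracket g" using assms by (simp add: based_lie_algebra_def)
 show ?thesis
  using bracket_antisym[OF assms, of "lie_basis g j" "lie_basis g i"] coef_scale[OF assms, of "- 1"]
  by (simp add: struct_const_coef[OF assms])
qed

lemma struct_const_opp: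
 assumes "based_lie_algebra g"
 shows "struct_const (opp g) i j k = - struct_const g i j k"
 using struct_const_antisym[OF assms, of j i k] by (simp add: struct_const_def)

subsection \<open>The Hopf algebra structure\<close>

lemma env_simps [simp]:
 "carrier (env g) = carrier (env_algebra g)" "add (env g) = add (env_algebra g)" "zero (env g) = zero (env_algebra g)"
 "module.smult (env g) = module.smult (env_algebra g)" "monoid.mult (env g) = monoid.mult (env_algebra g)"
 "one (env g) = one (env_algebra g)"
 by (simp_all add: env_def Let_def module.defs hopf.defs)

declare env_algebra_simps(1,2) [simp del]

lemma tensor_env: "tensor (env g) (env g) = tensor (env_algebra g) (env_algebra g)"
  "ten (env g) (env g) = ten (env_algebra g) (env_algebra g)"
  "tensor_alg (env g) (env g) = tensor_alg (env_algebra g) (env_algebra g)"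
proof -
 have r: "tensor_rels {} (env g) (env g) = tensor_rels {} (env_algebra g) (env_algebra g)"
  by (simp add: tensor_rels_def lin_rels_def)
 show 1: "tensor (env g) (env g) = tensor (env_algebra g) (env_algebra g)"
  "ten (env g) (env g) = ten (env_algebra g) (env_algebra g)"
  by (simp_all add: tensor_over_def ten_over_def fun_eq_iff r)
 show "tensor_alg (env g) (env g) = tensor_alg (env_algebra g) (env_algebra g)"
  by (simp add: tensor_alg_def 1)
qed

lemma alg_hom_env:
 "alg_hom (env g) B F = alg_hom (env_algebra g) B F" "alg_hom A (env g) F' = alg_hom A (env_algebra g) F'"
 "alg_antihom (env g) B G = alg_antihom (env_algebra g) B G" "alg_antihom A (env g) G' = alg_antihom A (env_algebra g) G'"
 by (simp_all add: alg_hom_def alg_antihom_def linear_map_def)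

lemma k_algebra_env [simp]: "k_algebra (env g)"
 by (rule k_algebra_cong[OF k_algebra_env_algebra]) simp_all

lemma env_comult_exists:
 fixes g :: "('k::field, 'g::ab_group_add) based_lie"
 shows "\<exists>F. alg_hom (env_algebra g) (tensor_alg (env_algebra g) (env_algebra g)) F \<and>
  (\<forall>x\<in>UNIV. F (env_incl g x) = ten (env_algebra g) (env_algebra g) (env_incl g x) \<one>[env_algebra g]
   +[tensor (env_algebra g) (env_algebra g)] ten (env_algebra g) (env_algebra g) \<one>[env_algebra g] (env_incl g x))"
proof -
 let ?U = "env_algebra g"
 let ?T = "tensor_alg ?U ?U"
 note U = k_algebra_env_algebra[of g]
 note T = k_algebra_tensor_alg[OF U U]
 note [simp] = U T k_algebra_vspace[OF U] k_algebra_vspace[OF T] tensor_alg_simps[OF U U]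
 interpret T: ring ?T by (rule k_algebra_ring[OF T])
 define p where "p x = ten ?U ?U (env_incl g x) \<one>[?U]" for x
 define q where "q x = ten ?U ?U \<one>[?U] (env_incl g x)" for x
 have cl: "p x :. ?T" "q x :. ?T" for x by (simp_all add: p_def q_def)
 have pq: "p (x + y) = p x +[?T] p y" "q (x + y) = q x +[?T] q y"
   "p (lie_scale g c x) = c .[?T] p x" "q (lie_scale g c x) = c .[?T] q x"
   "p x *[?T] p y = p y *[?T] p x +[?T] p (lie_bracket g x y)"
   "q x *[?T] q y = q y *[?T] q x +[?T] q (lie_bracket g x y)"
   "p x *[?T] q y = q y *[?T] p x" for x y c
  by (simp_all add: p_def q_def env_incl_add env_incl_scale tensor_alg_ten[OF U U] env_incl_bracket[of g x y]
    lin_add[OF ten_left] lin_smult[OF ten_left] lin_add[OF ten_right] lin_smult[OF ten_right])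
 obtain F where "alg_hom ?U ?T F" "!!x. F (env_incl g x) = p x +[?T] q x"
 proof (rule env_universal[OF T, of "%x. p x +[?T] q x"])
  show "p x +[?T] q x :. ?T" for x using cl by (intro T.a_closed)
  show "p (x + y) +[?T] q (x + y) = p x +[?T] q x +[?T] (p y +[?T] q y)" for x y
   unfolding pq using cl[of x] cl[of y] by (simp only: T.a_ac T.a_closed)
  show "p (lie_scale g c x) +[?T] q (lie_scale g c x) = c .[?T] (p x +[?T] q x)" for c x
   unfolding pq using cl[of x] by (simp only: vs_smult_add[OF k_algebra_vspace[OF T]])
  show "(p x +[?T] q x) *[?T] (p y +[?T] q y) =
    (p y +[?T] q y) *[?T] (p x +[?T] q x) +[?T] (p (lie_bracket g x y) +[?T] q (lie_bracket g x y))" for x y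
   using cl[of x] cl[of y] cl[of "lie_bracket g x y"]
   by (simp only: T.l_distr T.r_distr T.a_closed T.m_closed pq(5,6)[of x y] pq(7) T.a_ac)
 qed blast
 then show ?thesis
  unfolding p_def q_def tensor_alg_simps(2)[OF U U] by (intro exI[of _ F]) simp
qed

lemma env_counit_exists:
 "\<exists>F. alg_hom (env_algebra g) scalars F \<and> (\<forall>x\<in>UNIV. F (env_incl g x) = 0)"
 by (rule env_universal[of scalars "%_. 0" g]) auto

lemma env_antipode_exists:
 "\<exists>F. alg_antihom (env_algebra g) (env_algebra g) F \<and> (\<forall>x\<in>UNIV. F (env_incl g x) = \<ominus>\<^bsub>env_algebra g\<^esub> env_incl g x)"
proof -
 let ?U = "env_algebra g"
 note U = k_algebra_env_algebra[of g]
 note [simp] = U k_algebra_vspace[OF U]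
 interpret U: ring ?U by (rule k_algebra_ring[OF U])
 obtain F where F: "alg_hom ?U (op ?U) F" "!!x. F (env_incl g x) = \<ominus>\<^bsub>?U\<^esub> env_incl g x"
 proof (rule env_universal[OF k_algebra_op[OF U], of "%x. \<ominus>\<^bsub>?U\<^esub> env_incl g x"])
  show "\<ominus>\<^bsub>?U\<^esub> env_incl g x *[op ?U] \<ominus>\<^bsub>?U\<^esub> env_incl g y =
    \<ominus>\<^bsub>?U\<^esub> env_incl g y *[op ?U] \<ominus>\<^bsub>?U\<^esub> env_incl g x +[op ?U] \<ominus>\<^bsub>?U\<^esub> env_incl g (lie_bracket g x y)" for x y
   using env_incl_closed[of g x] env_incl_closed[of g y] env_incl_closed[of g "lie_bracket g x y"]
   by (simp add: U.l_minus U.r_minus env_incl_bracket[of g x y] U.a_assoc U.r_neg)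
 qed (simp_all add: env_incl_add env_incl_scale U.minus_add vs_minus_eq_smult vs_smult_add)
 then show ?thesis by (auto simp: alg_hom_op)
qed


context
 fixes g :: "('k::field, 'g::ab_group_add) based_lie"
begin

lemma env_structure:
 "comult (env g) = hom_ext (env_algebra g) (tensor_alg (env_algebra g) (env_algebra g)) UNIV (env_incl g)
  (%x. ten (env_algebra g) (env_algebra g) (env_incl g x) \<one>[env_algebra g]
   +[tensor (env_algebra g) (env_algebra g)] ten (env_algebra g) (env_algebra g) \<one>[env_algebra g] (env_incl g x))"
 "counit (env g) = hom_ext (env_algebra g) scalars UNIV (env_incl g) (%x. 0)"
 "antipode (env g) = antihom_ext (env_algebra g) (env_algebra g) UNIV (env_incl g) (%x. \<ominus>\<^bsub>env_algebra g\<^esub> env_incl g x)"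
 by (simp_all add: env_def Let_def module.defs hopf.defs)

lemma comult_hom: "alg_hom (env g) (tensor_alg (env g) (env g)) (comult (env g))"
 and comult_incl: "comult (env g) (env_incl g x) = ten (env g) (env g) (env_incl g x) \<one>[env g] +[tensor (env g) (env g)] ten (env g) (env g) \<one>[env g] (env_incl g x)"
 using someI_ex[OF env_comult_exists[of g]] unfolding env_structure hom_ext_def tensor_env alg_hom_env env_simps
 by blast+

lemma counit_hom: "alg_hom (env g) scalars (counit (env g))"
 and counit_incl: "counit (env g) (env_incl g x) = 0"
 using someI_ex[OF env_counit_exists[of g]] unfolding env_structure hom_ext_def alg_hom_env
 by blast+

lemma env_minus: "\<ominus>\<^bsub>env g\<^esub> x = \<ominus>\<^bsub>env_algebra g\<^esub> x"
 by (simp add: a_inv_def m_inv_def)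

lemma antipode_antihom: "alg_antihom (env g) (env g) (antipode (env g))"
 and antipode_incl: "antipode (env g) (env_incl g x) = \<ominus>\<^bsub>env g\<^esub> env_incl g x"
 using someI_ex[OF env_antipode_exists[of g]] unfolding env_structure antihom_ext_def alg_hom_env env_minus
 by blast+

end

text \<open>From here on the enveloping algebra is only used through \<open>env\<close> and its generators.\<close>

declare env_simps [simp del]
declare subset_antisym [rule del]

lemma env_one_closed [simp]: "\<one>[env g] :. (env g)"
 by (rule alg_closed(2)) simp

lemma env_incl_env [simp]: "env_incl g x :. (env g)"
 by (simp add: env_simps)

lemma env_gen_closed [simp]: "env_gen g j :. (env g)"
 by (simp add: env_gen_def)

lemma env_vspace [simp]: "vspace (env g)" by simp

lemma env_incl_bracket_env:
 "env_incl g x *[env g] env_incl g y = env_incl g y *[env g] env_incl g x +[env g] env_incl g (lie_bracket g x y)"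
 unfolding env_simps by (rule env_incl_bracket)

lemma env_incl_linear:
 "env_incl g (x + y) = env_incl g x +[env g] env_incl g y" "env_incl g (lie_scale g c x) = c .[env g] env_incl g x"
 unfolding env_simps by (rule env_incl_add env_incl_scale)+

lemma env_induct [consumes 2, case_names one gen add smult mult]:
 assumes g: "based_lie_algebra g" and u: "u :. (env g)"
  and one: "P \<one>[env g]" and gen: "!!j. j \<in> idx g ==> P (env_gen g j)"
  and add: "!!u v. u :. (env g) ==> v :. (env g) ==> P u ==> P v ==> P (u +[env g] v)"
  and smult: "!!c u. u :. (env g) ==> P u ==> P (c .[env g] u)"
  and mult: "!!u v. u :. (env g) ==> v :. (env g) ==> P u ==> P v ==> P (u *[env g] v)"
 shows "P u"
proof -
 interpret lie_algebra "lie_scale g" "lie_bracket g" using g by (simp add: based_lie_algebra_def)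
 have zero: "P \<zero>[env g]" using smult[OF _ one, of 0] by simp
 have "env_incl g 0 = \<zero>[env g]" using env_incl_linear(2)[of g 0 0] by simp
 then have incl: "P (env_incl g x)" for x
  by (induction x rule: lie_basis_induct[OF g])
   (use zero add smult gen in \<open>auto simp: env_incl_linear env_gen_def\<close>)
 show ?thesis
  using u[unfolded env_simps]
  by (induction rule: env_algebra_induct) (use one incl add smult mult in \<open>simp_all add: env_simps\<close>)
qed

lemma env_induct_left [consumes 2, case_names one gen add smult]:
 assumes g: "based_lie_algebra g" and u: "u :. (env g)"
  and one: "P \<one>[env g]"
  and gen: "!!j u. j \<in> idx g ==> u :. (env g) ==> P u ==> P (env_gen g j *[env g] u)"
  and add: "!!u v. u :. (env g) ==> v :. (env g) ==> P u ==> P v ==> P (u +[env g] v)"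
  and smult: "!!c u. u :. (env g) ==> P u ==> P (c .[env g] u)"
 shows "P u"
proof -
 have "\<forall>v\<in>carrier (env g). P v \<longrightarrow> P (u *[env g] v)"
  using g u
  by (induction rule: env_induct) (simp_all add: gen alg_distr alg_smult alg_assoc add smult)
 then have "P (u *[env g] \<one>[env g])" using one env_one_closed by blast
 then show ?thesis using u by simp
qed

lemma env_induct_right [consumes 2, case_names one gen add smult]:
 assumes g: "based_lie_algebra g" and u: "u :. (env g)"
  and one: "P \<one>[env g]"
  and gen: "!!j u. j \<in> idx g ==> u :. (env g) ==> P u ==> P (u *[env g] env_gen g j)"
  and add: "!!u v. u :. (env g) ==> v :. (env g) ==> P u ==> P v ==> P (u +[env g] v)"
  and smult: "!!c u. u :. (env g) ==> P u ==> P (c .[env g] u)"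
 shows "P u"
proof -
 have "\<forall>v\<in>carrier (env g). P v \<longrightarrow> P (v *[env g] u)"
  using g u
  by (induction rule: env_induct) (simp_all add: gen alg_distr alg_smult alg_assoc[symmetric] add smult)
 then have "P (\<one>[env g] *[env g] u)" using one env_one_closed by blast
 then show ?thesis using u by simp
qed

lemma alg_hom_add: "alg_hom A B f ==> x :. A ==> y :. A ==> f (x +[A] y) = f x +[B] f y"
 and alg_hom_smult: "alg_hom A B f ==> x :. A ==> f (c .[A] x) = c .[B] f x"
 and alg_hom_mult: "alg_hom A B f ==> x :. A ==> y :. A ==> f (x *[A] y) = f x *[B] f y"
 and alg_hom_one: "alg_hom A B f ==> f \<one>[A] = \<one>[B]"
 and alg_hom_closed: "alg_hom A B f ==> x :. A ==> f x :. B"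
 by (auto simp: alg_hom_def linear_map_def)

lemma alg_antihom_add: "alg_antihom A B f ==> x :. A ==> y :. A ==> f (x +[A] y) = f x +[B] f y"
 and alg_antihom_smult: "alg_antihom A B f ==> x :. A ==> f (c .[A] x) = c .[B] f x"
 and alg_antihom_mult: "alg_antihom A B f ==> x :. A ==> y :. A ==> f (x *[A] y) = f y *[B] f x"
 and alg_antihom_one: "alg_antihom A B f ==> f \<one>[A] = \<one>[B]"
 and alg_antihom_closed: "alg_antihom A B f ==> x :. A ==> f x :. B"
 by (auto simp: alg_antihom_def linear_map_def)

lemma env_hom_unique:
 assumes "based_lie_algebra g" "alg_hom (env g) A F" "alg_hom (env g) A G"
  and "!!j. j \<in> idx g ==> F (env_gen g j) = G (env_gen g j)" and "u :. (env g)"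
 shows "F u = G u"
 using assms(1,5)
 by (induction rule: env_induct)
  (use assms(4) in \<open>simp_all add: alg_hom_add[OF assms(2)] alg_hom_add[OF assms(3)] alg_hom_smult[OF assms(2)] alg_hom_smult[OF assms(3)]
   alg_hom_mult[OF assms(2)] alg_hom_mult[OF assms(3)] alg_hom_one[OF assms(2)] alg_hom_one[OF assms(3)]\<close>)

lemma env_antihom_unique:
 assumes "based_lie_algebra g" "alg_antihom (env g) A F" "alg_antihom (env g) A G"
  and "!!j. j \<in> idx g ==> F (env_gen g j) = G (env_gen g j)" and "u :. (env g)"
 shows "F u = G u"
 using env_hom_unique[of g "op A" F G u] assms by (simp add: alg_hom_op)

lemma antihom_ext_env:
 assumes "alg_antihom (env g) A F" "!!j. j \<in> idx g ==> F (env_gen g j) = f j"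
 shows "alg_antihom (env g) A (antihom_ext (env g) A (idx g) (env_gen g) f)"
  and "j \<in> idx g ==> antihom_ext (env g) A (idx g) (env_gen g) f (env_gen g j) = f j"
proof -
 have "\<exists>F. alg_antihom (env g) A F \<and> (\<forall>j\<in>idx g. F (env_gen g j) = f j)" using assms by blast
 from someI_ex[OF this] show "alg_antihom (env g) A (antihom_ext (env g) A (idx g) (env_gen g) f)"
  and "j \<in> idx g ==> antihom_ext (env g) A (idx g) (env_gen g) f (env_gen g j) = f j"
  unfolding antihom_ext_def by blast+
qed

text \<open>A homomorphism out of the enveloping algebra may be prescribed on the basis.\<close>

lemma env_universal_basis:
 fixes g :: "('k::field, 'g::ab_group_add) based_lie" and A :: "('k, 'a, 'm) module_scheme"
 assumes g: "based_lie_algebra g" and A: "k_algebra A" and a: "!!i. i \<in> idx g ==> a i :. A"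
  and br: "!!i j. i \<in> idx g ==> j \<in> idx g ==>
   a i *[A] a j = a j *[A] a i +[A] finsum A (%k. struct_const g i j k .[A] a k) (idx g)"
 obtains F where "alg_hom (env g) A F" "!!i. i \<in> idx g ==> F (env_gen g i) = a i"
proof -
 interpret lie_algebra "lie_scale g" "lie_bracket g" using g by (simp add: based_lie_algebra_def)
 interpret A: ring A by (rule k_algebra_ring[OF A])
 note [simp] = A k_algebra_vspace[OF A]
 define f where "f x = finsum A (%k. coef g x k .[A] a k) (idx g)" for x
 have f: "f x :. A" for x unfolding f_def using a by (intro vs_finsum_closed vs_closed) auto
 have add: "f (x + y) = f x +[A] f y" for x y
 proof -
  have "f (x + y) = finsum A (%k. coef g x k .[A] a k +[A] coef g y k .[A] a k) (idx g)"
   unfolding f_def using a by (intro vs_finsum_cong) (auto simp: coef_add[OF g] vs_smult_add)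
  also have "... = f x +[A] f y" unfolding f_def using a by (intro vs_finsum_add) auto
  finally show ?thesis .
 qed
 have scale: "f (lie_scale g c x) = c .[A] f x" for c x
 proof -
  have "f (lie_scale g c x) = finsum A (%k. c .[A] (coef g x k .[A] a k)) (idx g)"
   unfolding f_def using a by (intro vs_finsum_cong) (auto simp: coef_scale[OF g])
  also have "... = c .[A] f x" unfolding f_def using a by (intro vs_finsum_smult) auto
  finally show ?thesis .
 qed
 have zero: "f 0 = \<zero>[A]" using scale[of 0 0] f by simp
 have f_basis: "f (lie_basis g i) = a i" if "i \<in> idx g" for i
 proof -
  have "f (lie_basis g i) = finsum A (%k. (if i = k then 1 else 0) .[A] a k) (idx g)"
   unfolding f_def using that a by (intro vs_finsum_cong) (auto simp: coef_basis[OF g])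
  also have "... = finsum A (%k. (if i = k then 1 else 0) .[A] a i) (idx g)"
   using a that by (intro vs_finsum_cong) auto
  also have "... = a i" using that a by (intro vs_finsum_delta) auto
  finally show ?thesis .
 qed
 have b0: "lie_bracket g 0 y = 0" "lie_bracket g y 0 = 0" for y
  using bracket_scale_left[of 0 0 y] bracket_scale_right[of y 0 0] by simp_all
 have br1: "f (lie_basis g i) *[A] f y = f y *[A] f (lie_basis g i) +[A] f (lie_bracket g (lie_basis g i) y)"
  if i: "i \<in> idx g" for i y
  using g
 proof (induction y rule: lie_basis_induct_cases)
  case (basis j)
  have "f (lie_bracket g (lie_basis g i) (lie_basis g j)) = finsum A (%k. struct_const g i j k .[A] a k) (idx g)"
   by (simp add: f_def struct_const_coef[OF g])
  then show ?case using br[OF i basis] by (simp only: f_basis[OF i] f_basis[OF basis])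
 qed (use f in \<open>simp_all add: zero b0 add scale bracket_add_right bracket_scale_right alg_distr alg_smult vs_smult_add A.a_ac\<close>)
 have br2: "f x *[A] f y = f y *[A] f x +[A] f (lie_bracket g x y)" for x y
  by (induction x rule: lie_basis_induct[OF g])
   (use f in \<open>simp_all add: br1 zero b0 add scale bracket_add_left bracket_scale_left alg_distr alg_smult vs_smult_add A.a_ac\<close>)
 from env_universal[OF A f add scale br2] obtain F where "alg_hom (env_algebra g) A F" "!!x. F (env_incl g x) = f x"
  by blast
 then show thesis
  by (intro that[of F]) (auto simp: alg_hom_env env_gen_def f_basis)
qed

subsection \<open>Comultiplication, counit and antipode on products\<close>

lemma comult_closed [simp]: "u :. (env g) ==> comult (env g) u :. (tensor (env g) (env g))"
 using alg_hom_closed[OF comult_hom[of g]] by (simp add: tensor_alg_simps)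

lemmas env_tl_cong = tl2_cong[OF env_vspace env_vspace bal_maps_empty comult_closed]
 and env_tl_closed = tl2_closed[OF env_vspace env_vspace bal_maps_empty comult_closed]
 and env_tl_linear = tl2_linear[OF env_vspace env_vspace bal_maps_empty comult_closed]
 and env_tl_add = tl2_add[OF env_vspace env_vspace bal_maps_empty comult_closed]
 and env_tl_swap = tl2_swap[OF env_vspace env_vspace bal_maps_empty comult_closed _ env_vspace env_vspace bal_maps_empty comult_closed]
 and env_tl_fun_linear = tl2_fun_linear[OF env_vspace env_vspace bal_maps_empty comult_closed]

context
 fixes g :: "('k::field, 'g::ab_group_add) based_lie"
 assumes g: "based_lie_algebra g"
begin

interpretation U: ring "env g" by (rule k_algebra_ring) simp

lemma comult_linear: "linear_map (env g) (tensor (env g) (env g)) (comult (env g))"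
 using alg_hom_linear[OF comult_hom[of g]] by (simp add: linear_map_def tensor_alg_simps)

lemma counit_simps:
 "counit (env g) \<one>[env g] = 1" "counit (env g) (env_gen g j) = 0"
 "u :. (env g) ==> v :. (env g) ==> counit (env g) (u *[env g] v) = counit (env g) u * counit (env g) v"
 using alg_hom_one[OF counit_hom[of g]] alg_hom_mult[OF counit_hom[of g]] by (simp_all add: counit_incl env_gen_def)

lemma counit_linear: "linear_map (env g) scalars (counit (env g))" by (rule alg_hom_linear[OF counit_hom])

lemma antipode_simps:
 "antipode (env g) \<one>[env g] = \<one>[env g]" "antipode (env g) (env_gen g j) = \<ominus>\<^bsub>env g\<^esub> env_gen g j"
 "u :. (env g) ==> v :. (env g) ==> antipode (env g) (u *[env g] v) = antipode (env g) v *[env g] antipode (env g) u"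
 "u :. (env g) ==> antipode (env g) u :. (env g)"
 using alg_antihom_one[OF antipode_antihom[of g]] alg_antihom_mult[OF antipode_antihom[of g]]
  alg_antihom_closed[OF antipode_antihom[of g]] by (simp_all add: antipode_incl env_gen_def)

lemma antipode_linear: "linear_map (env g) (env g) (antipode (env g))" by (rule alg_antihom_linear[OF antipode_antihom])

context
 fixes B :: "('k, 'z, 'm) module_scheme" and b
 assumes B: "vspace B" and b: "bilin (env g) (env g) B b"
begin

lemma lift_comult_linear: "linear_map (tensor (env g) (env g)) B (lift2 B (%x y. b x y))"
 by (rule lift_linear) (use B b in auto)

lemma lift_comult_one: "lift2 B (%x y. b x y) (comult (env g) \<one>[env g]) = b \<one>[env g] \<one>[env g]"
 using alg_hom_one[OF comult_hom[of g]] b B by (simp add: tensor_alg_simps lift_ten)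

lemma lift_comult_gen:
 "lift2 B (%x y. b x y) (comult (env g) (env_gen g j)) = b (env_gen g j) \<one>[env g] +[B] b \<one>[env g] (env_gen g j)"
 unfolding env_gen_def comult_incl using B b
 by (subst lin_add[OF lift_comult_linear]) (simp_all add: lift_ten)

lemma lift_comult_mult:
 assumes u: "u :. (env g)" and v: "v :. (env g)"
 shows "lift2 B (%x y. b x y) (comult (env g) (u *[env g] v)) =
  lift2 B (%x y. lift2 B (%x' y'. b (x *[env g] x') (y *[env g] y')) (comult (env g) v)) (comult (env g) u)"
proof -
 have "comult (env g) (u *[env g] v) = tensor_lift (tensor (env g) (env g)) (%(x, y).
   lift2 (tensor (env g) (env g)) (%x' y'. ten (env g) (env g) (x *[env g] x') (y *[env g] y')) (comult (env g) v)) (comult (env g) u)"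
  using alg_hom_mult[OF comult_hom[of g] u v] by (simp add: tensor_alg_mult)
 then have "lift2 B (%x y. b x y) (comult (env g) (u *[env g] v)) =
   lift2 B (%x y. b x y) (tensor_lift (tensor (env g) (env g)) (%(x, y).
   lift2 (tensor (env g) (env g)) (%x' y'. ten (env g) (env g) (x *[env g] x') (y *[env g] y')) (comult (env g) v)) (comult (env g) u))"
  by (rule arg_cong)
 also have "... = lift2 B (%x y. lift2 B (%x y. b x y)
   (lift2 (tensor (env g) (env g)) (%x' y'. ten (env g) (env g) (x *[env g] x') (y *[env g] y')) (comult (env g) v))) (comult (env g) u)"
  using u v B by (intro env_tl_linear[OF _ lift_comult_linear] env_tl_closed) auto
 also have "... = lift2 B (%x y. lift2 B (%x' y'. b (x *[env g] x') (y *[env g] y')) (comult (env g) v)) (comult (env g) u)"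
 proof (intro env_tl_cong env_tl_closed B)
  fix x y assume xy: "x :. (env g)" "y :. (env g)"
  have "lift2 B (%x y. b x y) (lift2 (tensor (env g) (env g)) (%x' y'. ten (env g) (env g) (x *[env g] x') (y *[env g] y')) (comult (env g) v))
   = lift2 B (%x' y'. lift2 B (%x y. b x y) (ten (env g) (env g) (x *[env g] x') (y *[env g] y'))) (comult (env g) v)"
   using xy v B by (intro env_tl_linear[OF _ lift_comult_linear]) auto
  also have "... = lift2 B (%x' y'. b (x *[env g] x') (y *[env g] y')) (comult (env g) v)"
   using xy v B b by (intro env_tl_cong) (auto simp: lift_ten intro: bilin_closed)
  finally show "lift2 B (%x y. b x y) (lift2 (tensor (env g) (env g)) (%x' y'. ten (env g) (env g) (x *[env g] x') (y *[env g] y')) (comult (env g) v))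
   = lift2 B (%x' y'. b (x *[env g] x') (y *[env g] y')) (comult (env g) v)" .
 qed (use u v b in \<open>auto intro: bilin_closed\<close>)
 finally show ?thesis .
qed

end

text \<open>Products with a generator on either side, which drive all inductions on the enveloping algebra.\<close>

lemma bilin_mult:
 assumes B: "vspace B" and b: "bilin (env g) (env g) B b" and "u :. (env g)" "v :. (env g)"
 shows "bilin (env g) (env g) B (%x y. b (u *[env g] x) (v *[env g] y))" "bilin (env g) (env g) B (%x y. b (x *[env g] u) (y *[env g] v))"
 using assms by (auto intro!: bilinI lin_comp[OF bilin_right[OF b]] lin_comp[OF bilin_left[OF b]] lin_mult_left lin_mult_right)

lemma lift_comult_gen_mult:
 fixes B :: "('k, 'z, 'm) module_scheme"
 assumes B: "vspace B" and b: "bilin (env g) (env g) B b" and u: "u :. (env g)"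
 shows "lift2 B (%x y. b x y) (comult (env g) (env_gen g j *[env g] u)) =
   lift2 B (%x y. b (env_gen g j *[env g] x) y +[B] b x (env_gen g j *[env g] y)) (comult (env g) u)"
  and "lift2 B (%x y. b x y) (comult (env g) (u *[env g] env_gen g j)) =
   lift2 B (%x y. b (x *[env g] env_gen g j) y +[B] b x (y *[env g] env_gen g j)) (comult (env g) u)"
proof -
 have cl: "b x y :. B" if "x :. (env g)" "y :. (env g)" for x y using that b by (rule bilin_closed[rotated])
 have "lift2 B (%x y. b x y) (comult (env g) (env_gen g j *[env g] u)) =
  lift2 B (%x' y'. lift2 B (%x y. b (x *[env g] x') (y *[env g] y')) (comult (env g) (env_gen g j))) (comult (env g) u)"
  unfolding lift_comult_mult[OF B b env_gen_closed u] using B u cl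
  by (intro env_tl_swap) auto
 also have "... = lift2 B (%x y. b (env_gen g j *[env g] x) y +[B] b x (env_gen g j *[env g] y)) (comult (env g) u)"
  using u B cl by (intro env_tl_cong) (auto simp: lift_comult_gen[OF B bilin_mult(2)[OF B b]])
 finally show "lift2 B (%x y. b x y) (comult (env g) (env_gen g j *[env g] u)) =
   lift2 B (%x y. b (env_gen g j *[env g] x) y +[B] b x (env_gen g j *[env g] y)) (comult (env g) u)" .
 show "lift2 B (%x y. b x y) (comult (env g) (u *[env g] env_gen g j)) =
   lift2 B (%x y. b (x *[env g] env_gen g j) y +[B] b x (y *[env g] env_gen g j)) (comult (env g) u)"
  unfolding lift_comult_mult[OF B b u env_gen_closed] using u B cl
  by (intro env_tl_cong) (auto simp: lift_comult_gen[OF B bilin_mult(1)[OF B b]])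
qed

text \<open>The comultiplication of a generator is symmetric, and the flip is multiplicative.\<close>

lemma comult_cocommutative:
 fixes B :: "('k, 'z, 'm) module_scheme"
 assumes B: "vspace B" and b: "bilin (env g) (env g) B b" and u: "u :. (env g)"
 shows "lift2 B (%x y. b y x) (comult (env g) u) = lift2 B (%x y. b x y) (comult (env g) u)"
proof -
 have flip: "bilin (env g) (env g) B (%x y. c y x)" if "bilin (env g) (env g) B c" for c using that by (auto simp: bilin_def)
 have cl: "c x y :. B" if "bilin (env g) (env g) B c" "x :. (env g)" "y :. (env g)" for c x y using that by (rule bilin_closed)
 have l: "linear_map (env g) B (%u. lift2 B (%x y. c x y) (comult (env g) u))" if "bilin (env g) (env g) B c" for c
  by (rule lin_comp[OF lift_comult_linear[OF B that] comult_linear])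
 have "\<forall>c. bilin (env g) (env g) B c \<longrightarrow> lift2 B (%x y. c y x) (comult (env g) u) = lift2 B (%x y. c x y) (comult (env g) u)"
  using g u
 proof (induction rule: env_induct_left)
  case one
  then show ?case by (auto simp: lift_comult_one[OF B] lift_comult_one[OF B flip])
 next
  case (gen j u)
  show ?case
  proof (intro allI impI)
   fix c assume c: "bilin (env g) (env g) B c"
   let ?c1 = "%x y. c (env_gen g j *[env g] x) y" and ?c2 = "%x y. c x (env_gen g j *[env g] y)"
   have c12: "bilin (env g) (env g) B (%x y. ?c1 x y +[B] ?c2 x y)"
    using c B by (intro bilinI lin_fun_add lin_comp[OF bilin_left[OF c]] lin_comp[OF bilin_right[OF c]] bilin_left[OF c] bilin_right[OF c]
      lin_mult_left) auto
   have "lift2 B (%x y. c y x) (comult (env g) (env_gen g j *[env g] u)) =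
     lift2 B (%x y. ?c2 y x +[B] ?c1 y x) (comult (env g) u)"
    by (rule lift_comult_gen_mult(1)[OF B flip[OF c] gen(2)])
   also have "... = lift2 B (%x y. ?c1 y x +[B] ?c2 y x) (comult (env g) u)"
    using gen B cl[OF c] by (intro env_tl_cong) (auto simp: vs_add_ac)
   also have "... = lift2 B (%x y. ?c1 x y +[B] ?c2 x y) (comult (env g) u)"
    using gen(3) c12 by blast
   also have "... = lift2 B (%x y. c x y) (comult (env g) (env_gen g j *[env g] u))"
    by (rule lift_comult_gen_mult(1)[OF B c gen(2), symmetric])
   finally show "lift2 B (%x y. c y x) (comult (env g) (env_gen g j *[env g] u)) =
    lift2 B (%x y. c x y) (comult (env g) (env_gen g j *[env g] u))" .
  qed
 qed (auto simp: lin_add[OF l] lin_add[OF l[OF flip]] lin_smult[OF l] lin_smult[OF l[OF flip]])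
 then show ?thesis using b by blast
qed

lemma counit_comult:
 assumes u: "u :. (env g)"
 shows "lift2 (env g) (%x y. counit (env g) x .[env g] y) (comult (env g) u) = u"
proof -
 have b: "bilin (env g) (env g) (env g) (%x y. counit (env g) x .[env g] y)"
  by (intro bilinI lin_fun_scalar counit_linear lin_fun_smult lin_id) auto
 have l: "linear_map (env g) (env g) (%u. lift2 (env g) (%x y. counit (env g) x .[env g] y) (comult (env g) u))"
  by (rule lin_comp[OF lift_comult_linear[OF _ b] comult_linear]) simp
 show ?thesis
  using g u
 proof (induction rule: env_induct_left)
  case one
  then show ?case by (simp add: lift_comult_one[OF _ b] counit_simps)
 next
  case (gen j u)
  have "lift2 (env g) (%x y. counit (env g) x .[env g] y) (comult (env g) (env_gen g j *[env g] u)) =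
   lift2 (env g) (%x y. env_gen g j *[env g] (counit (env g) x .[env g] y)) (comult (env g) u)"
   unfolding lift_comult_gen_mult(1)[OF env_vspace b gen(2)] using gen
   by (intro env_tl_cong) (auto simp: counit_simps alg_smult)
  also have "... = env_gen g j *[env g] u"
   using env_tl_linear[OF gen(2) lin_mult_left[OF k_algebra_env env_gen_closed] env_vspace env_vspace,
     of "%x y. counit (env g) x .[env g] y" g j] gen(3) by simp
  finally show ?case .
 qed (simp_all add: lin_add[OF l] lin_smult[OF l])
qed

lemma antipode_comult:
 assumes u: "u :. (env g)"
 shows "lift2 (env g) (%x y. antipode (env g) x *[env g] y) (comult (env g) u) = counit (env g) u .[env g] \<one>[env g]" (is ?L)
  and "lift2 (env g) (%x y. x *[env g] antipode (env g) y) (comult (env g) u) = counit (env g) u .[env g] \<one>[env g]" (is ?R)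
proof -
 have b: "bilin (env g) (env g) (env g) (%x y. antipode (env g) x *[env g] y)"
  by (intro bilinI lin_fun_mult_left lin_fun_mult_right antipode_linear lin_id) (auto simp: antipode_simps)
 have b': "bilin (env g) (env g) (env g) (%x y. x *[env g] antipode (env g) y)"
  by (intro bilinI lin_fun_mult_left lin_fun_mult_right antipode_linear lin_id) (auto simp: antipode_simps)
 have l: "linear_map (env g) (env g) (%u. lift2 (env g) (%x y. c x y) (comult (env g) u))" if "bilin (env g) (env g) (env g) c" for c
  by (rule lin_comp[OF lift_comult_linear[OF _ that] comult_linear]) simp
 note c = counit_simps lin_add[OF counit_linear] lin_smult[OF counit_linear] vs_smult_add
 have zero: "lift2 (env g) (%x y. \<zero>[env g]) t = \<zero>[env g]" for t by (rule tl2_zero) simp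
 show ?L
  using g u
 proof (induction rule: env_induct_left)
  case one
  then show ?case by (simp add: lift_comult_one[OF _ b] counit_simps antipode_simps)
 next
  case (gen j u)
  have "lift2 (env g) (%x y. antipode (env g) x *[env g] y) (comult (env g) (env_gen g j *[env g] u)) =
   lift2 (env g) (%x y. \<zero>[env g]) (comult (env g) u)"
   unfolding lift_comult_gen_mult(1)[OF env_vspace b gen(2)] using gen
   by (intro env_tl_cong)
    (auto simp: antipode_simps U.l_minus U.r_minus U.m_assoc U.l_neg)
  then show ?case using gen by (simp add: zero counit_simps)
 qed (simp_all add: lin_add[OF l[OF b]] lin_smult[OF l[OF b]] c)
 show ?R
  using g u
 proof (induction rule: env_induct_right)
  case one
  then show ?case by (simp add: lift_comult_one[OF _ b'] counit_simps antipode_simps)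
 next
  case (gen j u)
  have "lift2 (env g) (%x y. x *[env g] antipode (env g) y) (comult (env g) (u *[env g] env_gen g j)) =
   lift2 (env g) (%x y. \<zero>[env g]) (comult (env g) u)"
   unfolding lift_comult_gen_mult(2)[OF env_vspace b' gen(2)] using gen
   by (intro env_tl_cong)
    (auto simp: antipode_simps U.l_minus U.r_minus U.m_assoc U.r_neg)
  then show ?case using gen by (simp add: zero counit_simps)
 qed (simp_all add: lin_add[OF l[OF b']] lin_smult[OF l[OF b']] c)
qed

lemma antipode_antipode:
 assumes u: "u :. (env g)"
 shows "antipode (env g) (antipode (env g) u) = u"
proof (rule env_hom_unique[OF g _ _ _ u])
 show "alg_hom (env g) (env g) (%u. antipode (env g) (antipode (env g) u))"
  by (rule alg_antihom_comp_anti[OF antipode_antihom antipode_antihom])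
 show "alg_hom (env g) (env g) (%u. u)" by (auto simp: alg_hom_def lin_id)
qed (simp add: antipode_simps lin_minus[OF env_vspace env_vspace antipode_linear] U.minus_minus)

end

declare One_nat_def [simp del] atLeastAtMost_iff [simp del]

text \<open>By cocommutativity the order of the factors need not be reversed.\<close>

lemma lift_comult_antipode:
 assumes g: "based_lie_algebra g" and B: "vspace B" and b: "bilin (env g) (env g) B b" and u: "u :. (env g)"
 shows "lift2 B (%x y. b x y) (comult (env g) (antipode (env g) u)) =
  lift2 B (%x y. b (antipode (env g) x) (antipode (env g) y)) (comult (env g) u)"
proof -
 interpret U: ring "env g" by (rule k_algebra_ring) simp
 let ?S = "antipode (env g)"
 note [simp] = g
 note S = antipode_simps antipode_linear
 have Sb: "bilin (env g) (env g) B (%x y. c (?S x) (?S y))" if "bilin (env g) (env g) B c" for c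
  by (intro bilinI lin_comp[OF bilin_left[OF that]] lin_comp[OF bilin_right[OF that]] S) simp_all
 have cl: "c x y :. B" if "bilin (env g) (env g) B c" "x :. (env g)" "y :. (env g)" for c x y
  using that by (rule bilin_closed)
 have l: "linear_map (env g) B (%u. lift2 B (%x y. c x y) (comult (env g) u))" if "bilin (env g) (env g) B c" for c
  by (rule lin_comp[OF lift_comult_linear[OF g B that] comult_linear[OF g]])
 have l': "linear_map (env g) B (%u. lift2 B (%x y. c x y) (comult (env g) (?S u)))" if "bilin (env g) (env g) B c" for c
  by (rule lin_comp[OF l[OF that] antipode_linear[OF g]])
 have "\<forall>c. bilin (env g) (env g) B c \<longrightarrow> lift2 B (%x y. c x y) (comult (env g) (?S u)) =
  lift2 B (%x y. c (?S x) (?S y)) (comult (env g) u)"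
  using g u
 proof (induction rule: env_induct_left)
  case one
  then show ?case by (auto simp: S lift_comult_one[OF g B] lift_comult_one[OF g B Sb])
 next
  case (gen j u)
  show ?case
  proof (intro allI impI)
   fix c assume c: "bilin (env g) (env g) B c"
   let ?X = "env_gen g j"
   let ?d = "%x y. c (\<ominus>\<^bsub>env g\<^esub> (x *[env g] ?X)) y +[B] c x (\<ominus>\<^bsub>env g\<^esub> (y *[env g] ?X))"
   have m: "linear_map (env g) (env g) (%x. \<ominus>\<^bsub>env g\<^esub> (x *[env g] ?X))"
    by (intro lin_fun_minus lin_mult_right) simp_all
   have d: "bilin (env g) (env g) B ?d"
    using B by (intro bilinI lin_fun_add lin_comp[OF bilin_left[OF c]] lin_comp[OF bilin_right[OF c]] bilin_left[OF c]
      bilin_right[OF c] m lin_closed[OF m]) simp_all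
   have "lift2 B (%x y. c x y) (comult (env g) (?S (?X *[env g] u))) =
     \<ominus>\<^bsub>B\<^esub> lift2 B (%x y. c x y) (comult (env g) (?S u *[env g] ?X))"
    using gen(2) by (simp add: S U.r_minus lin_minus[OF env_vspace B l[OF c]])
   also have "... = \<ominus>\<^bsub>B\<^esub> lift2 B (%x y. c (x *[env g] ?X) y +[B] c x (y *[env g] ?X)) (comult (env g) (?S u))"
    using gen(2) by (subst lift_comult_gen_mult(2)[OF g B c]) (simp_all add: S)
   also have "... = lift2 B (%x y. \<ominus>\<^bsub>B\<^esub> (c (x *[env g] ?X) y +[B] c x (y *[env g] ?X))) (comult (env g) (?S u))"
    using gen(2) B cl[OF c] by (intro env_tl_linear lin_fun_minus lin_id) (simp_all add: S)
   also have "... = lift2 B (%x y. ?d x y) (comult (env g) (?S u))"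
    using gen(2) B cl[OF c]
    by (intro env_tl_cong) (simp_all add: S lin_minus[OF env_vspace B bilin_left[OF c]] lin_minus[OF env_vspace B bilin_right[OF c]]
      vs_minus_eq_smult[OF B] vs_smult_add)
   also have "... = lift2 B (%x y. ?d (?S x) (?S y)) (comult (env g) u)"
    using gen(3) d by blast
   also have "... = lift2 B (%x y. c (?S (?X *[env g] x)) (?S y) +[B] c (?S x) (?S (?X *[env g] y))) (comult (env g) u)"
    using gen(2) B cl[OF c] by (intro env_tl_cong) (simp_all add: S U.r_minus)
   also have "... = lift2 B (%x y. c (?S x) (?S y)) (comult (env g) (?X *[env g] u))"
    by (rule lift_comult_gen_mult(1)[OF g B Sb[OF c] gen(2), symmetric])
   finally show "lift2 B (%x y. c x y) (comult (env g) (?S (?X *[env g] u))) =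
    lift2 B (%x y. c (?S x) (?S y)) (comult (env g) (?X *[env g] u))" .
  qed
 qed (auto simp: lin_add[OF l'] lin_add[OF l[OF Sb]] lin_smult[OF l'] lin_smult[OF l[OF Sb]])
 then show ?thesis using b by blast
qed

text \<open>Sums with values in the ground field may be rearranged without any side condition.\<close>

lemma scalar_lift_sum:
 "tensor_lift scalars b t = (\<Sum>s\<in>Poly_Mapping.keys (rep t). Poly_Mapping.lookup (rep t) s * b s)"
 by (simp add: tensor_lift_rep)

lemma scalar_lift_mult:
 "c * lift2 scalars (%x y. b x y) t = lift2 scalars (%x y. c * b x y) t"
 "lift2 scalars (%x y. b x y) t * c = lift2 scalars (%x y. b x y * c) t"
 unfolding scalar_lift_sum by (auto simp: sum_distrib_left sum_distrib_right case_prod_unfold mult_ac)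

lemma scalar_lift_swap:
 "lift2 scalars (%x y. lift2 scalars (%x' y'. b x y x' y') s) t =
  lift2 scalars (%x' y'. lift2 scalars (%x y. b x y x' y') t) s"
 unfolding scalar_lift_sum sum_distrib_left case_prod_unfold
 by (subst sum.swap) (simp add: mult_ac)

lemma scalar_lift_add:
 "lift2 scalars (%x y. b x y + b' x y) t =
  lift2 scalars (%x y. b x y) t + lift2 scalars (%x y. b' x y) t"
 unfolding scalar_lift_sum by (simp add: sum.distrib distrib_left case_prod_unfold)

section \<open>Enveloping algebras paired with Hopf algebras\<close>

text \<open>The enveloping algebra separates the elements of \<open>H\<close>, so identities in \<open>H\<close> are proved by
  evaluation, and the Hopf algebra axioms of \<open>H\<close> are consequences. The elements \<open>u i j\<close> are
  characterised by their values, as the matrix coefficients of the adjoint representation.\<close>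

locale dual_pair =
 fixes g :: "('k::field, 'g::ab_group_add) based_lie" and H :: "('k, 'h) hopf"
  and p :: "('k, 'g) env => 'h => 'k" and u :: "nat => nat => 'h"
 assumes g: "based_lie_algebra g"
  and H_alg [simp]: "k_algebra H"
  and H_comult [simp]: "f :. H ==> comult H f :. (tensor H H)"
  and H_antipode [simp]: "f :. H ==> antipode H f :. H"
  and p_left: "f :. H ==> linear_map (env g) scalars (%D. p D f)"
  and p_right: "D :. (env g) ==> linear_map H scalars (p D)"
  and p_mult: "D :. (env g) ==> E :. (env g) ==> f :. H ==>
   p (D *[env g] E) f = lift2 scalars (%x y. p D x * p E y) (comult H f)"
  and p_H_mult: "D :. (env g) ==> f :. H ==> h :. H ==>
   p D (f *[H] h) = lift2 scalars (%x y. p x f * p y h) (comult (env g) D)"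
  and p_one: "f :. H ==> p \<one>[env g] f = counit H f"
  and p_H_one: "D :. (env g) ==> p D \<one>[H] = counit (env g) D"
  and p_antipode: "D :. (env g) ==> f :. H ==> p D (antipode H f) = p (antipode (env g) D) f"
  and nondegenerate: "f :. H ==> (!!D. D :. (env g) ==> p D f = 0) ==> f = \<zero>[H]"
  and u_closed [simp]: "i \<in> idx g ==> j \<in> idx g ==> u i j :. H"
  and p_u_mult: "i \<in> idx g ==> j \<in> idx g ==> D :. (env g) ==> E :. (env g) ==>
   p (D *[env g] E) (u i j) = (\<Sum>k\<in>idx g. p D (u i k) * p E (u k j))"
  and p_u_one: "i \<in> idx g ==> j \<in> idx g ==> p \<one>[env g] (u i j) = (if i = j then 1 else 0)"
  and p_u_gen: "i \<in> idx g ==> j \<in> idx g ==> k \<in> idx g ==> p (env_gen g k) (u i j) = struct_const g k j i"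
begin

abbreviation U where "U \<equiv> env g"
abbreviation S where "S \<equiv> antipode H"
abbreviation Xg where "Xg \<equiv> env_gen g"
abbreviation I where "I \<equiv> idx g"
abbreviation HH where "HH \<equiv> tensor H H"

declare g [simp]

sublocale U: ring U by (rule k_algebra_ring) simp
sublocale H: ring H by (rule k_algebra_ring) simp

lemma H_vspace [simp]: "vspace H" by simp

lemmas H_tl_cong = tl2_cong[OF H_vspace H_vspace bal_maps_empty H_comult]
 and H_tl_closed = tl2_closed[OF H_vspace H_vspace bal_maps_empty H_comult]
 and H_tl_linear = tl2_linear[OF H_vspace H_vspace bal_maps_empty H_comult]
 and H_tl_add = tl2_add[OF H_vspace H_vspace bal_maps_empty H_comult]
 and H_tl_finsum = tl2_finsum[OF H_vspace H_vspace bal_maps_empty H_comult]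
 and H_tl_swap = tl2_swap[OF H_vspace H_vspace bal_maps_empty H_comult _ H_vspace H_vspace bal_maps_empty H_comult]
 and H_tl_fun_linear = tl2_fun_linear[OF H_vspace H_vspace bal_maps_empty H_comult]

lemma H_eqI:
 assumes "f :. H" "h :. H" "!!D. D :. U ==> p D f = p D h"
 shows "f = h"
proof -
 have "f \<ominus>\<^bsub>H\<^esub> h = \<zero>[H]"
  using assms by (intro nondegenerate) (simp_all add: lin_diff[OF H_vspace vspace_scalars p_right] vs_minus_eq_smult a_minus_def
   lin_add[OF p_right] lin_smult[OF p_right])
 then show ?thesis using assms by (simp add: vs_diff_eq_zero)
qed

definition pp :: "('k, 'g) env => ('k, 'g) env => ('k, 'h \<times> 'h) formal => 'k" where
 "pp D E t = lift2 scalars (%x y. p D x * p E y) t"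

lemma bilin_scalars:
 assumes "linear_map V scalars a" "linear_map W scalars b"
 shows "bilin V W scalars (%x y. a x * b y)"
 using assms by (auto simp: bilin_def linear_map_def algebra_simps)

lemma bilin_p: "D :. U ==> E :. U ==> bilin H H scalars (%x y. p D x * p E y)"
 by (intro bilin_scalars p_right)

lemma pp_linear: "D :. U ==> E :. U ==> linear_map HH scalars (pp D E)"
 unfolding pp_def by (intro lift_linear bilin_p) simp_all

lemma pp_ten: "D :. U ==> E :. U ==> x :. H ==> y :. H ==> pp D E (ten H H x y) = p D x * p E y"
 unfolding pp_def by (rule lift_ten[OF _ _ _ _ bilin_p]) simp_all

lemma pp_comult: "D :. U ==> E :. U ==> f :. H ==> pp D E (comult H f) = p (D *[U] E) f"
 by (simp add: pp_def p_mult)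

lemma HH_eqI:
 assumes "s :. HH" "t :. HH" "!!D E. D :. U ==> E :. U ==> pp D E s = pp D E t"
 shows "s = t"
 by (rule tensor_separate[of H H "carrier U" p "carrier U" p])
  (use assms in \<open>simp_all add: pp_def[symmetric] p_right nondegenerate\<close>)

text \<open>Evaluation of a sum over a comultiplication.\<close>

lemma p_lift:
 assumes "D :. U" "f :. H" "!!x y. x :. H ==> y :. H ==> b x y :. H"
 shows "p D (lift2 H (%x y. b x y) (comult H f)) = lift2 scalars (%x y. p D (b x y)) (comult H f)"
 using assms by (intro H_tl_linear p_right) simp_all

lemma pp_lift:
 assumes "D :. U" "E :. U" "f :. H" "!!x y. x :. H ==> y :. H ==> a x y :. H"
  "!!x y. x :. H ==> y :. H ==> b x y :. H"
 shows "pp D E (lift2 HH (%x y. ten H H (a x y) (b x y)) (comult H f)) =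
  lift2 scalars (%x y. p D (a x y) * p E (b x y)) (comult H f)"
proof -
 have "pp D E (lift2 HH (%x y. ten H H (a x y) (b x y)) (comult H f)) =
   lift2 scalars (%x y. pp D E (ten H H (a x y) (b x y))) (comult H f)"
  using assms by (intro H_tl_linear pp_linear) simp_all
 also have "... = lift2 scalars (%x y. p D (a x y) * p E (b x y)) (comult H f)"
  using assms by (intro H_tl_cong) (simp_all add: pp_ten)
 finally show ?thesis .
qed

lemma H_comult_linear: "linear_map H HH (comult H)"
 by (intro linear_mapI HH_eqI)
  (simp_all add: lin_add[OF pp_linear] lin_smult[OF pp_linear] pp_comult lin_add[OF p_right] lin_smult[OF p_right])

text \<open>A consequence of the cocommutativity of the enveloping algebra.\<close>

lemma H_commute: "f :. H ==> h :. H ==> f *[H] h = h *[H] f"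
 by (rule H_eqI) (simp_all add: p_H_mult, subst comult_cocommutative[OF g, symmetric],
   auto intro!: bilin_scalars p_left simp: mult.commute)

lemma H_counit_linear: "linear_map H scalars (counit H)"
 using p_right[of "\<one>[U]"] by (simp add: linear_map_def p_one)

lemma H_counit_one: "counit H \<one>[H] = 1"
 using p_H_one[of "\<one>[U]"] by (simp add: p_one counit_simps)

lemma H_counit_mult: "f :. H ==> h :. H ==> counit H (f *[H] h) = counit H f * counit H h"
 using p_H_mult[of "\<one>[U]" f h] by (simp add: p_one lift_comult_one bilin_scalars p_left)

lemma H_comult_one: "comult H \<one>[H] = ten H H \<one>[H] \<one>[H]"
 by (rule HH_eqI) (simp_all add: pp_comult pp_ten p_H_one counit_simps)

lemma S_linear: "linear_map H H S"
 by (intro linear_mapI H_eqI) (simp_all add: p_antipode antipode_simps lin_add[OF p_right] lin_smult[OF p_right])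

lemma S_one: "S \<one>[H] = \<one>[H]"
proof (rule H_eqI)
 fix D assume D: "D :. U"
 have "counit U (antipode U D) = counit U D"
  by (rule env_antihom_unique[OF g _ _ _ D, of scalars])
   (simp_all add: alg_antihom_comp[OF counit_hom antipode_antihom] antipode_simps counit_simps
    lin_smult[OF counit_linear] lin_comp[OF counit_linear antipode_linear] alg_antihom_def counit_linear vs_minus_eq_smult)
 then show "p D (S \<one>[H]) = p D \<one>[H]" using D by (simp add: p_antipode p_H_one antipode_simps)
qed simp_all

lemma S_mult: "f :. H ==> h :. H ==> S (f *[H] h) = S f *[H] S h"
proof (rule H_eqI)
 fix D assume f: "f :. H" and h: "h :. H" and D: "D :. U"
 have "p D (S (f *[H] h)) = lift2 scalars (%x y. p (antipode U x) f * p (antipode U y) h) (comult U D)"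
  using D f h by (simp add: p_antipode p_H_mult antipode_simps lift_comult_antipode[OF g] bilin_scalars p_left)
 also have "... = p D (S f *[H] S h)"
  using D f h by (auto simp: p_H_mult p_antipode intro!: env_tl_cong)
 finally show "p D (S (f *[H] h)) = p D (S f *[H] S h)" .
qed simp_all

subsection \<open>Translations\<close>

text \<open>Transposes of the right and left multiplication by the \<open>j\<close>-th generator.\<close>

definition rt :: "nat => 'h => 'h" where
 "rt j f = lift2 H (%x y. p (Xg j) y .[H] x) (comult H f)"

definition lt :: "nat => 'h => 'h" where
 "lt j f = lift2 H (%x y. p (Xg j) x .[H] y) (comult H f)"

lemma rt_closed [simp]: "f :. H ==> rt j f :. H"
 and lt_closed [simp]: "f :. H ==> lt j f :. H"
 unfolding rt_def lt_def by (intro H_tl_closed; simp)+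

lemma p_rt: "D :. U ==> f :. H ==> p D (rt j f) = p (D *[U] Xg j) f"
 unfolding rt_def by (subst p_lift) (auto simp: p_mult lin_smult[OF p_right] mult.commute intro!: H_tl_cong)

lemma p_lt: "D :. U ==> f :. H ==> p D (lt j f) = p (Xg j *[U] D) f"
 unfolding lt_def by (subst p_lift) (auto simp: p_mult lin_smult[OF p_right] intro!: H_tl_cong)

lemma rt_linear: "linear_map H H (rt j)" and lt_linear: "linear_map H H (lt j)"
 by (intro linear_mapI H_eqI; simp add: p_rt p_lt lin_add[OF p_right] lin_smult[OF p_right])+

text \<open>Both sides have the value \<open>\<langle>D X\<^sub>j E, f\<rangle>\<close> on \<open>D \<otimes> E\<close>. This is the source of the Takeuchi conditions.\<close>

lemma comult_rt_lt:
 "f :. H ==> lift2 HH (%x y. ten H H (rt j x) y) (comult H f) =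
  lift2 HH (%x y. ten H H x (lt j y)) (comult H f)"
proof (rule HH_eqI)
 fix D E assume f: "f :. H" and D: "D :. U" and E: "E :. U"
 have "pp D E (lift2 HH (%x y. ten H H (rt j x) y) (comult H f)) = pp (D *[U] Xg j) E (comult H f)"
  using f D E by (subst pp_lift) (auto simp: p_rt pp_def intro!: H_tl_cong)
 also have "... = pp D (Xg j *[U] E) (comult H f)" using f D E by (simp add: pp_comult U.m_assoc)
 also have "... = pp D E (lift2 HH (%x y. ten H H x (lt j y)) (comult H f))"
  using f D E by (subst pp_lift) (auto simp: p_lt pp_def intro!: H_tl_cong)
 finally show "pp D E (lift2 HH (%x y. ten H H (rt j x) y) (comult H f)) =
  pp D E (lift2 HH (%x y. ten H H x (lt j y)) (comult H f))" .
qed (auto intro!: H_tl_closed)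

lemma comult_lt:
 "f :. H ==> comult H (lt j f) = lift2 HH (%x y. ten H H (lt j x) y) (comult H f)"
proof (rule HH_eqI)
 fix D E assume f: "f :. H" and D: "D :. U" and E: "E :. U"
 have "pp D E (lift2 HH (%x y. ten H H (lt j x) y) (comult H f)) = pp (Xg j *[U] D) E (comult H f)"
  using f D E by (subst pp_lift) (auto simp: p_lt pp_def intro!: H_tl_cong)
 then show "pp D E (comult H (lt j f)) = pp D E (lift2 HH (%x y. ten H H (lt j x) y) (comult H f))"
  using f D E by (simp add: pp_comult p_lt U.m_assoc)
qed (auto intro!: H_tl_closed)

lemma comult_rt:
 "f :. H ==> comult H (rt j f) = lift2 HH (%x y. ten H H x (rt j y)) (comult H f)"
proof (rule HH_eqI)
 fix D E assume f: "f :. H" and D: "D :. U" and E: "E :. U"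
 have "pp D E (lift2 HH (%x y. ten H H x (rt j y)) (comult H f)) = pp D (E *[U] Xg j) (comult H f)"
  using f D E by (subst pp_lift) (auto simp: p_rt pp_def intro!: H_tl_cong)
 then show "pp D E (comult H (rt j f)) = pp D E (lift2 HH (%x y. ten H H x (rt j y)) (comult H f))"
  using f D E by (simp add: pp_comult p_rt U.m_assoc)
qed (auto intro!: H_tl_closed)

lemma counit_rt_lt: "f :. H ==> counit H (rt j f) = p (Xg j) f" "f :. H ==> counit H (lt j f) = p (Xg j) f"
 using p_rt[of "\<one>[U]" f j] p_lt[of "\<one>[U]" f j] by (simp_all add: p_one)

lemma S_rt: "f :. H ==> S (rt j f) = \<ominus>\<^bsub>H\<^esub> lt j (S f)"
 by (rule H_eqI) (simp_all add: p_antipode p_rt p_lt antipode_simps U.r_minus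
   lin_minus[OF H_vspace vspace_scalars p_right] lin_minus[OF env_vspace vspace_scalars p_left]
   lin_smult[OF p_left] lin_smult[OF p_right] vs_minus_eq_smult alg_smult)

lemma lt_mult:
 assumes f: "f :. H" and h: "h :. H"
 shows "lt j (f *[H] h) = lt j f *[H] h +[H] f *[H] lt j h"
proof (rule H_eqI)
 fix D assume D: "D :. U"
 have "p D (lt j (f *[H] h)) = lift2 scalars (%x y. p (Xg j *[U] x) f * p y h + p x f * p (Xg j *[U] y) h) (comult U D)"
  using f h D lift_comult_gen_mult(1)[OF g vspace_scalars bilin_scalars[OF p_left[OF f] p_left[OF h]] D, of j]
  by (simp add: p_lt p_H_mult)
 also have "... = p D (lt j f *[H] h +[H] f *[H] lt j h)"
  using f h D by (auto simp: lin_add[OF p_right] p_H_mult p_lt simp flip: scalar_lift_add intro!: env_tl_cong)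
 finally show "p D (lt j (f *[H] h)) = p D (lt j f *[H] h +[H] f *[H] lt j h)" .
qed (use f h in simp_all)

subsection \<open>The Hopf algebra axioms\<close>

lemma H_counit:
 assumes "f :. H"
 shows "lift2 H (%x y. counit H x .[H] y) (comult H f) = f"
  and "lift2 H (%x y. counit H y .[H] x) (comult H f) = f"
proof -
 show "lift2 H (%x y. counit H x .[H] y) (comult H f) = f"
 proof (rule H_eqI)
  fix D assume D: "D :. U"
  have "p D (lift2 H (%x y. counit H x .[H] y) (comult H f)) = pp \<one>[U] D (comult H f)"
   using D assms by (subst p_lift) (auto simp: pp_def p_one lin_smult[OF p_right] intro!: H_tl_cong)
  then show "p D (lift2 H (%x y. counit H x .[H] y) (comult H f)) = p D f"
   using D assms by (simp add: pp_comult)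
 qed (use assms in \<open>auto intro!: H_tl_closed\<close>)
 show "lift2 H (%x y. counit H y .[H] x) (comult H f) = f"
 proof (rule H_eqI)
  fix D assume D: "D :. U"
  have "p D (lift2 H (%x y. counit H y .[H] x) (comult H f)) = pp D \<one>[U] (comult H f)"
   using D assms by (subst p_lift) (auto simp: pp_def p_one lin_smult[OF p_right] mult.commute intro!: H_tl_cong)
  then show "p D (lift2 H (%x y. counit H y .[H] x) (comult H f)) = p D f"
   using D assms by (simp add: pp_comult)
 qed (use assms in \<open>auto intro!: H_tl_closed\<close>)
qed

lemma H_antipode_axiom:
 assumes f: "f :. H"
 shows "lift2 H (%x y. S x *[H] y) (comult H f) = counit H f .[H] \<one>[H]"
  and "lift2 H (%x y. x *[H] S y) (comult H f) = counit H f .[H] \<one>[H]"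
proof -
 have *: "p D (counit H f .[H] \<one>[H]) = p (counit U D .[U] \<one>[U]) f" if "D :. U" for D
  using that f by (simp add: lin_smult[OF p_right] lin_smult[OF p_left] p_one p_H_one)
 show "lift2 H (%x y. S x *[H] y) (comult H f) = counit H f .[H] \<one>[H]"
 proof (rule H_eqI)
  fix D assume D: "D :. U"
  have "p D (lift2 H (%x y. S x *[H] y) (comult H f)) =
    lift2 scalars (%x y. tensor_lift scalars (%(D1, D2). p (antipode U D1) x * p D2 y) (comult U D)) (comult H f)"
   using D f by (subst p_lift) (auto simp: p_H_mult p_antipode intro!: H_tl_cong env_tl_cong)
  also have "... = tensor_lift scalars (%(D1, D2). p (antipode U D1 *[U] D2) f) (comult U D)"
   using D f by (subst scalar_lift_swap) (auto simp: p_mult antipode_simps intro!: env_tl_cong)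
  also have "... = p (tensor_lift U (%(D1, D2). antipode U D1 *[U] D2) (comult U D)) f"
   using D f by (intro env_tl_linear[OF _ p_left, symmetric]) (auto simp: antipode_simps)
  finally show "p D (lift2 H (%x y. S x *[H] y) (comult H f)) = p D (counit H f .[H] \<one>[H])"
   using D by (simp add: antipode_comult[OF g] *)
 qed (use f in \<open>auto intro!: H_tl_closed\<close>)
 show "lift2 H (%x y. x *[H] S y) (comult H f) = counit H f .[H] \<one>[H]"
 proof (rule H_eqI)
  fix D assume D: "D :. U"
  have "p D (lift2 H (%x y. x *[H] S y) (comult H f)) =
    lift2 scalars (%x y. tensor_lift scalars (%(D1, D2). p D1 x * p (antipode U D2) y) (comult U D)) (comult H f)"
   using D f by (subst p_lift) (auto simp: p_H_mult p_antipode intro!: H_tl_cong env_tl_cong)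
  also have "... = tensor_lift scalars (%(D1, D2). p (D1 *[U] antipode U D2) f) (comult U D)"
   using D f by (subst scalar_lift_swap) (auto simp: p_mult antipode_simps intro!: env_tl_cong)
  also have "... = p (tensor_lift U (%(D1, D2). D1 *[U] antipode U D2) (comult U D)) f"
   using D f by (intro env_tl_linear[OF _ p_left, symmetric]) (auto simp: antipode_simps)
  finally show "p D (lift2 H (%x y. x *[H] S y) (comult H f)) = p D (counit H f .[H] \<one>[H])"
   using D by (simp add: antipode_comult[OF g] *)
 qed (use f in \<open>auto intro!: H_tl_closed\<close>)
qed

lemma H_comult_mult:
 assumes f: "f :. H" and h: "h :. H"
 shows "comult H (f *[H] h) = tensor_lift HH (%(x, y).
  lift2 HH (%x' y'. ten H H (x *[H] x') (y *[H] y')) (comult H h)) (comult H f)"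
proof (rule HH_eqI)
 fix D E assume D: "D :. U" and E: "E :. U"
 have "pp D E (lift2 HH (%x y. lift2 HH (%x' y'. ten H H (x *[H] x') (y *[H] y')) (comult H h)) (comult H f)) =
  lift2 scalars (%x y. pp D E (lift2 HH (%x' y'. ten H H (x *[H] x') (y *[H] y')) (comult H h))) (comult H f)"
  using D E f h by (intro H_tl_linear pp_linear H_tl_closed) simp_all
 also have "... = lift2 scalars (%x y. tensor_lift scalars (%(x', y').
   lift2 scalars (%a b. p a x * p b x') (comult U D) * lift2 scalars (%a' b'. p a' y * p b' y') (comult U E))
   (comult H h)) (comult H f)"
  using D E f h by (intro H_tl_cong) (auto simp: pp_lift p_H_mult intro!: H_tl_cong)
 also have "... = lift2 scalars (%a b. tensor_lift scalars (%(a', b').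
   lift2 scalars (%x y. lift2 scalars (%x' y'. p a x * p b x' * (p a' y * p b' y')) (comult H h)) (comult H f))
   (comult U E)) (comult U D)"
  by (simp only: scalar_lift_mult scalar_lift_swap[where t="comult H h" and s="comult U E"]
    scalar_lift_swap[where t="comult H h" and s="comult U D"] scalar_lift_swap[where t="comult H f" and s="comult U E"]
    scalar_lift_swap[where t="comult H f" and s="comult U D"] scalar_lift_swap[where t="comult U E" and s="comult U D"])
 also have "... = lift2 scalars (%a b. tensor_lift scalars (%(a', b').
   lift2 scalars (%x y. p a x * p a' y) (comult H f) * lift2 scalars (%x' y'. p b x' * p b' y') (comult H h))
   (comult U E)) (comult U D)"
  by (simp only: scalar_lift_mult scalar_lift_swap[where t="comult H h" and s="comult H f"] mult_ac)
 also have "... = lift2 scalars (%a b. lift2 scalars (%a' b'. p (a *[U] a') f * p (b *[U] b') h)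
   (comult U E)) (comult U D)"
  using D E f h by (intro env_tl_cong) (simp_all add: p_mult)
 also have "... = p (D *[U] E) (f *[H] h)"
  using D E f h by (simp add: p_H_mult lift_comult_mult[OF g vspace_scalars bilin_scalars[OF p_left[OF f] p_left[OF h]] D E])
 finally show "pp D E (comult H (f *[H] h)) = pp D E (tensor_lift HH (%(x, y).
  lift2 HH (%x' y'. ten H H (x *[H] x') (y *[H] y')) (comult H h)) (comult H f))"
  using D E f h by (simp add: pp_comult)
qed (use f h in \<open>auto intro!: H_tl_closed\<close>)

end

context
 fixes g :: "('k::field, 'g::ab_group_add) based_lie"
 assumes g: "based_lie_algebra g"
begin

interpretation lie_algebra "lie_scale g" "lie_bracket g"
 using g by (simp add: based_lie_algebra_def)

lemma coef_sum: "coef g (sum f A) m = (\<Sum>i\<in>A. coef g (f i) m)"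
proof (induction A rule: infinite_finite_induct)
 case (infinite A)
 then show ?case using coef_scale[OF g, of 0 0 m] by simp
next
 case empty
 then show ?case using coef_scale[OF g, of 0 0 m] by simp
qed (simp add: coef_add[OF g])

lemma bracket_sum: "lie_bracket g x (sum f A) = (\<Sum>i\<in>A. lie_bracket g x (f i))"
proof (induction A rule: infinite_finite_induct)
 case (infinite A)
 then show ?case using bracket_scale_right[of x 0 0] by simp
next
 case empty
 then show ?case using bracket_scale_right[of x 0 0] by simp
qed (simp add: bracket_add_right)

lemma coef_bracket:
 "coef g (lie_bracket g (lie_basis g i) y) m = (\<Sum>l\<in>idx g. coef g y l * struct_const g i l m)"
proof -
 have "coef g (lie_bracket g (lie_basis g i) y) m =
   coef g (lie_bracket g (lie_basis g i) (\<Sum>l\<in>idx g. lie_scale g (coef g y l) (lie_basis g l))) m"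
  using coef_expand[OF g, of y] by simp
 then show ?thesis
  by (simp add: bracket_sum coef_sum bracket_scale_right coef_scale[OF g] struct_const_coef[OF g])
qed

text \<open>The trace of the adjoint representation vanishes on brackets, because by the Jacobi identity
 the bracket acts by a commutator of matrices.\<close>

lemma trace_ad_bracket:
 "(\<Sum>l\<in>idx g. (\<Sum>i\<in>idx g. struct_const g i l i) * struct_const g k j l) = 0"
proof -
 let ?C = "struct_const g"
 have C: "coef g (lie_bracket g (lie_basis g i) (lie_bracket g (lie_basis g k) (lie_basis g j))) m =
   (\<Sum>l\<in>idx g. ?C k j l * ?C i l m)" for i k j m
  by (subst coef_bracket) (simp add: struct_const_coef[OF g])
 have jac: "(\<Sum>l\<in>idx g. ?C k j l * ?C i l m) + (\<Sum>l\<in>idx g. ?C j i l * ?C k l m) + (\<Sum>l\<in>idx g. ?C i k l * ?C j l m) = 0" for i m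
  using arg_cong[OF jacobi[of "lie_basis g i" "lie_basis g k" "lie_basis g j"], of "%x. coef g x m"] coef_scale[OF g, of 0 0 m]
  by (simp add: coef_add[OF g] C)
 have "(\<Sum>i\<in>idx g. \<Sum>l\<in>idx g. ?C j i l * ?C k l i) = (\<Sum>i\<in>idx g. \<Sum>l\<in>idx g. ?C k i l * ?C j l i)"
  by (subst sum.swap) (simp add: mult.commute)
 also have "... = - (\<Sum>i\<in>idx g. \<Sum>l\<in>idx g. ?C i k l * ?C j l i)"
  by (simp add: struct_const_antisym[OF g, of k] sum_negf)
 finally have "(\<Sum>i\<in>idx g. \<Sum>l\<in>idx g. ?C k j l * ?C i l i) =
   (\<Sum>i\<in>idx g. (\<Sum>l\<in>idx g. ?C k j l * ?C i l i) + (\<Sum>l\<in>idx g. ?C j i l * ?C k l i) + (\<Sum>l\<in>idx g. ?C i k l * ?C j l i))"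
  by (simp add: sum.distrib)
 also have "... = 0" by (simp add: jac)
 finally show ?thesis
  by (subst (asm) sum.swap) (simp only: sum_distrib_right mult.commute[of "struct_const g k j _"])
qed

lemma env_gen_bracket:
 "env_gen g k *[env g] env_gen g i = env_gen g i *[env g] env_gen g k +[env g] finsum (env g) (%l. struct_const g k i l .[env g] env_gen g l) (idx g)"
proof -
 interpret lie_algebra "lie_scale g" "lie_bracket g" using g by (simp add: based_lie_algebra_def)
 let ?b = "lie_bracket g (lie_basis g k) (lie_basis g i)"
 have e0: "env_incl g 0 = \<zero>[env g]" using env_incl_linear(2)[of g 0 0] by simp
 have es: "env_incl g (\<Sum>l\<in>A. lie_scale g (c l) (lie_basis g l)) = finsum (env g) (%l. c l .[env g] env_gen g l) A" if "finite A" for A c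
  using that by (induction A rule: finite_induct) (simp_all add: e0 env_incl_linear vs_finsum_insert flip: env_gen_def)
 have "env_incl g ?b = finsum (env g) (%l. struct_const g k i l .[env g] env_gen g l) (idx g)"
  using es[of "idx g" "coef g ?b"] coef_expand[OF g, of ?b] by (simp add: struct_const_coef[OF g])
 then show ?thesis unfolding env_gen_def using env_incl_bracket_env[of g "lie_basis g k" "lie_basis g i"] by simp
qed


end

context dual_pair
begin

subsection \<open>Coassociativity\<close>

text \<open>Both sides have the value \<open>\<langle>D E F, f\<rangle>\<close> on \<open>D \<otimes> E \<otimes> F\<close>.\<close>

lemma H_coassoc:
 fixes B :: "('k, 'z, 'm) module_scheme"
 assumes B: "vspace B" and b: "trilin H B b" and f: "f :. H"
 shows "lift2 B (%x y. lift2 B (%x1 x2. b x1 x2 y) (comult H x)) (comult H f) =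
  lift2 B (%x y. lift2 B (%y1 y2. b x y1 y2) (comult H y)) (comult H f)"
proof -
 let ?T = "tensor HH H"
 note [simp] = B
 have HHv: "vspace HH" by simp
 have bcl: "b x y z :. B" if "x :. H" "y :. H" "z :. H" for x y z
  using b that by (auto simp: trilin_def intro: lin_closed)
 define s1 where "s1 = lift2 ?T (%x y. ten HH H (comult H x) y) (comult H f)"
 define s2 where "s2 = lift2 ?T (%x y. lift2 ?T (%y1 y2. ten HH H (ten H H x y1) y2) (comult H y)) (comult H f)"
 have cl: "s1 :. ?T" "s2 :. ?T"
  unfolding s1_def s2_def using f by (auto intro!: H_tl_closed)
 have "s1 = s2"
 proof (rule tensor_separate[OF HHv H_vspace _ _ _ _ cl, where S="carrier U \<times> carrier U" and p="%(D, E). pp D E" and T="carrier U" and q=p])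
  show "DE \<in> carrier U \<times> carrier U ==> linear_map HH scalars (case DE of (D, E) => pp D E)" for DE
   by (auto simp: pp_linear)
  show "v = \<zero>[HH]" if "v :. HH" "!!DE. DE \<in> carrier U \<times> carrier U ==> (case DE of (D, E) => pp D E) v = 0" for v
   using that(1) that(2)[of "(_, _)"] by (intro HH_eqI) (auto simp: lin_zero[OF HHv vspace_scalars pp_linear])
  show "v = \<zero>[H]" if "v :. H" "!!D. D :. U ==> p D v = 0" for v
   using that by (rule nondegenerate)
  fix DE F assume DE: "DE \<in> carrier U \<times> carrier U" and F: "F :. U"
  obtain D E where DE': "DE = (D, E)" "D :. U" "E :. U" using DE by auto
  have bil: "bilin HH H scalars (%s y. pp D E s * p F y)"
   using DE' F by (intro bilin_scalars pp_linear p_right)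
  have lin: "linear_map ?T scalars (lift2 scalars (%s y. pp D E s * p F y))"
   by (rule lift_linear[OF HHv H_vspace _ _ bil]) simp_all
  have ten: "lift2 scalars (%s y. pp D E s * p F y) (ten HH H s y) = pp D E s * p F y"
   if "s :. HH" "y :. H" for s y
   using that by (intro lift_ten[OF HHv H_vspace _ _ bil]) simp_all
  have "lift2 scalars (%s y. pp D E s * p F y) s1 = lift2 scalars (%x y. pp D E (comult H x) * p F y) (comult H f)"
   unfolding s1_def using f by (subst H_tl_linear[OF _ lin]) (auto simp: ten intro!: H_tl_cong)
  also have "... = p (D *[U] E *[U] F) f"
   using f DE' F by (auto simp: p_mult[of "D *[U] E"] pp_comult intro!: H_tl_cong)
  also have "... = lift2 scalars (%x y. p D x * p (E *[U] F) y) (comult H f)"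
   using f DE' F by (simp add: U.m_assoc p_mult[of D])
  also have "... = lift2 scalars (%x y. lift2 scalars (%s y. pp D E s * p F y)
    (lift2 ?T (%y1 y2. ten HH H (ten H H x y1) y2) (comult H y))) (comult H f)"
  proof (rule H_tl_cong)
   fix x y assume xy: "x :. H" "y :. H"
   have "lift2 scalars (%s y. pp D E s * p F y) (lift2 ?T (%y1 y2. ten HH H (ten H H x y1) y2) (comult H y)) =
     lift2 scalars (%y1 y2. p D x * (p E y1 * p F y2)) (comult H y)"
    using xy DE' F by (subst H_tl_linear[OF _ lin]) (auto simp: ten pp_ten mult.assoc intro!: H_tl_cong)
   then show "p D x * p (E *[U] F) y = lift2 scalars (%s y. pp D E s * p F y)
     (lift2 ?T (%y1 y2. ten HH H (ten H H x y1) y2) (comult H y))"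
    using xy DE' F by (simp add: p_mult scalar_lift_mult)
  qed (use f in auto)
  also have "... = lift2 scalars (%s y. pp D E s * p F y) s2"
   unfolding s2_def using f by (subst H_tl_linear[OF _ lin]) (auto intro!: H_tl_closed)
  finally show "lift2 scalars (%x y. (case DE of (D, E) => pp D E) x * p F y) s1 =
    lift2 scalars (%x y. (case DE of (D, E) => pp D E) x * p F y) s2"
   by (simp add: DE')
 qed (auto intro: p_right)
 define L where "L = lift2 B (%s z. lift2 B (%x y. b x y z) s)"
 have bil1: "bilin H H B (%x y. b x y z)" if "z :. H" for z
  using b that by (auto simp: trilin_def bilin_def)
 have bil2: "bilin HH H B (%s z. lift2 B (%x y. b x y z) s)"
 proof (rule bilinI)
  show "linear_map H B (%z. lift2 B (%x y. b x y z) s)" if "s :. HH" for s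
   using that b by (intro tl2_fun_linear[OF H_vspace H_vspace bal_maps_empty that]) (auto simp: trilin_def)
  show "linear_map HH B (%s. lift2 B (%x y. b x y z) s)" if "z :. H" for z
   using that by (intro lift_linear bil1) simp_all
 qed
 have L: "linear_map ?T B L" unfolding L_def by (rule lift_linear[OF HHv H_vspace _ _ bil2]) simp_all
 have Lten: "L (ten HH H s z) = lift2 B (%x y. b x y z) s" if "s :. HH" "z :. H" for s z
  unfolding L_def using that by (intro lift_ten[OF HHv H_vspace _ _ bil2]) simp_all
 have Lten2: "L (ten HH H (ten H H x y) z) = b x y z" if "x :. H" "y :. H" "z :. H" for x y z
  using that by (simp add: Lten lift_ten[OF _ _ _ _ bil1])
 have "L s1 = lift2 B (%x y. lift2 B (%x1 x2. b x1 x2 y) (comult H x)) (comult H f)"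
  unfolding s1_def using f bcl by (subst H_tl_linear[OF _ L]) (auto simp: Lten intro!: H_tl_cong H_tl_closed)
 moreover have "L s2 = lift2 B (%x y. lift2 B (%y1 y2. b x y1 y2) (comult H y)) (comult H f)"
 proof -
  have "L s2 = lift2 B (%x y. L (lift2 ?T (%y1 y2. ten HH H (ten H H x y1) y2) (comult H y))) (comult H f)"
   unfolding s2_def using f by (subst H_tl_linear[OF _ L]) (auto intro!: H_tl_closed)
  also have "... = lift2 B (%x y. lift2 B (%y1 y2. b x y1 y2) (comult H y)) (comult H f)"
  proof (rule H_tl_cong)
   show "L (lift2 ?T (%y1 y2. ten HH H (ten H H x y1) y2) (comult H y)) =
     lift2 B (%y1 y2. b x y1 y2) (comult H y)" if "x :. H" "y :. H" for x y
    using that bcl by (subst H_tl_linear[OF _ L]) (auto simp: Lten2 intro!: H_tl_cong)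
  qed (use f bcl in \<open>auto intro!: H_tl_closed\<close>)
  finally show ?thesis .
 qed
 ultimately show ?thesis using \<open>s1 = s2\<close> by simp
qed

subsection \<open>The adjoint matrix coefficients\<close>

definition v :: "nat => nat => 'h" where "v i j = S (u i j)"

definition tr :: "nat => 'k" where "tr j = (\<Sum>i\<in>I. struct_const g i j i)"

lemma finite_I [simp]: "finite I" by simp

lemma v_closed [simp]: "i \<in> I ==> j \<in> I ==> v i j :. H"
 by (simp add: v_def)

lemma p_finsum:
 "D :. U ==> (!!i. i \<in> A ==> f i :. H) ==> p D (finsum H f A) = (\<Sum>i\<in>A. p D (f i))"
 by (subst lin_finsum[OF H_vspace vspace_scalars p_right]) simp_all

lemma pp_finsum:
 "D :. U ==> E :. U ==> (!!i. i \<in> A ==> f i :. HH) ==> pp D E (finsum HH f A) = (\<Sum>i\<in>A. pp D E (f i))"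
 by (subst lin_finsum[OF vspace_tensor_over vspace_scalars pp_linear]) simp_all

lemma comult_u: "i \<in> I ==> j \<in> I ==> comult H (u i j) = finsum HH (%k. ten H H (u i k) (u k j)) I"
 by (rule HH_eqI) (simp_all add: pp_comult p_u_mult pp_finsum pp_ten)

lemma comult_v: "i \<in> I ==> j \<in> I ==> comult H (v i j) = finsum HH (%k. ten H H (v k j) (v i k)) I"
 by (rule HH_eqI) (simp_all add: pp_comult p_u_mult pp_finsum pp_ten v_def p_antipode antipode_simps mult.commute)

lemma counit_u: "i \<in> I ==> j \<in> I ==> counit H (u i j) = (if i = j then 1 else 0)"
 by (simp add: p_u_one flip: p_one)

lemma counit_v: "i \<in> I ==> j \<in> I ==> counit H (v i j) = (if i = j then 1 else 0)"
 by (simp add: v_def p_antipode antipode_simps p_u_one flip: p_one)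

lemma lift_finsum_ten:
 fixes B :: "('k, 'z, 'm) module_scheme"
 assumes B: "vspace B" and b: "bilin H H B b" and a: "!!k. k \<in> A ==> a k :. H" "!!k. k \<in> A ==> c k :. H"
 shows "lift2 B (%x y. b x y) (finsum HH (%k. ten H H (a k) (c k)) A) = finsum B (%k. b (a k) (c k)) A"
proof -
 have "lift2 B (%x y. b x y) (finsum HH (%k. ten H H (a k) (c k)) A) =
   finsum B (%k. lift2 B (%x y. b x y) (ten H H (a k) (c k))) A"
  using a B b by (intro lin_finsum lift_linear) simp_all
 also have "... = finsum B (%k. b (a k) (c k)) A"
  using a B b by (intro vs_finsum_cong) (auto simp: lift_ten intro: bilin_closed)
 finally show ?thesis .
qed

lemma vu_uv:
 assumes "i \<in> I" "j \<in> I"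
 shows "finsum H (%k. v i k *[H] u k j) I = (if i = j then 1 else 0) .[H] \<one>[H]"
  and "finsum H (%k. u i k *[H] v k j) I = (if i = j then 1 else 0) .[H] \<one>[H]"
proof -
 have b: "bilin H H H (%x y. S x *[H] y)" "bilin H H H (%x y. x *[H] S y)"
  by (intro bilinI lin_fun_mult_left lin_fun_mult_right S_linear lin_id; simp)+
 show "finsum H (%k. v i k *[H] u k j) I = (if i = j then 1 else 0) .[H] \<one>[H]"
  using H_antipode_axiom(1)[of "u i j"] assms lift_finsum_ten[OF H_vspace b(1), of I "%k. u i k" "%k. u k j"]
  by (simp add: comult_u counit_u v_def)
 show "finsum H (%k. u i k *[H] v k j) I = (if i = j then 1 else 0) .[H] \<one>[H]"
  using H_antipode_axiom(2)[of "u i j"] assms lift_finsum_ten[OF H_vspace b(2), of I "%k. u i k" "%k. u k j"]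
  by (simp add: comult_u counit_u v_def)
qed

lemma lt_u: "i \<in> I ==> j \<in> I ==> k \<in> I ==> lt k (u i j) = finsum H (%l. struct_const g k l i .[H] u l j) I"
 by (rule H_eqI) (simp_all add: p_lt p_u_mult p_u_gen p_finsum lin_smult[OF p_right])

text \<open>On \<open>D\<close> the left side is the trace form at \<open>ad(D) X\<^sub>j\<close>. It vanishes on brackets, so only the counit of
  \<open>D\<close> survives.\<close>

lemma tr_u: "j \<in> I ==> finsum H (%l. tr l .[H] u l j) I = tr j .[H] \<one>[H]"
proof (rule H_eqI)
 fix D assume D: "D :. U" and j: "j \<in> I"
 note lin = p_left[OF u_closed]
 have "(\<Sum>l\<in>I. tr l * p D (u l j)) = tr j * counit U D"
  using g D
 proof (induction rule: env_induct_left)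
  case one
  have "(\<Sum>l\<in>I. tr l * p \<one>[U] (u l j)) = (\<Sum>l\<in>I. if l = j then tr l else 0)"
   using j by (intro sum.cong) (auto simp: p_u_one)
  then show ?case using j by (simp add: counit_simps)
 next
  case (gen k D)
  have "(\<Sum>l\<in>I. tr l * p (Xg k *[U] D) (u l j)) = (\<Sum>l\<in>I. \<Sum>m\<in>I. tr l * (struct_const g k m l * p D (u m j)))"
   using gen j by (intro sum.cong) (simp_all add: p_u_mult p_u_gen sum_distrib_left)
  also have "... = (\<Sum>m\<in>I. (\<Sum>l\<in>I. tr l * struct_const g k m l) * p D (u m j))"
   by (subst sum.swap) (simp add: sum_distrib_right mult.assoc)
  also have "... = 0" by (simp add: tr_def trace_ad_bracket[OF g])
  finally show ?case using gen by (simp add: counit_simps)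
 next
  case (add D E)
  then show ?case using j by (simp add: lin_add[OF lin] lin_add[OF counit_linear] distrib_left sum.distrib)
 next
  case (smult c D)
  have "(\<Sum>l\<in>I. tr l * p (c .[U] D) (u l j)) = c * (\<Sum>l\<in>I. tr l * p D (u l j))"
   unfolding sum_distrib_left using j smult(1) by (intro sum.cong) (simp_all add: lin_smult[OF lin])
  also have "... = tr j * counit U (c .[U] D)"
   unfolding smult(2) using smult(1) by (simp add: lin_smult[OF counit_linear])
  finally show ?case .
 qed
 then show "p D (finsum H (%l. tr l .[H] u l j) I) = p D (tr j .[H] \<one>[H])"
  using D j by (simp add: p_finsum lin_smult[OF p_right] p_H_one)
qed simp_all

subsection \<open>The action of functionals on the enveloping algebra\<close>

abbreviation act :: "('k, 'g) env => 'h => ('k, 'g) env" where "act \<equiv> hopf_action U p"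

lemma act_bilin_inner: "f :. H ==> bilin U U U (%x y. p x f .[U] y)"
 by (intro bilinI lin_fun_scalar lin_fun_smult p_left lin_id) simp_all

lemma act_closed [simp]: "D :. U ==> f :. H ==> act D f :. U"
 unfolding hopf_action_def by (intro env_tl_closed) simp_all

lemma act_linear: "f :. H ==> linear_map U U (%D. act D f)"
 unfolding hopf_action_def by (intro lin_comp[OF lift_comult_linear comult_linear] act_bilin_inner) simp_all

lemma act_linear_right: "D :. U ==> linear_map H U (act D)"
 unfolding hopf_action_def by (intro env_tl_fun_linear lin_fun_scalar p_right) simp_all

lemma act_one: "f :. H ==> act \<one>[U] f = counit H f .[U] \<one>[U]"
 unfolding hopf_action_def by (subst lift_comult_one) (simp_all add: act_bilin_inner p_one)

lemma act_H_one: "D :. U ==> act D \<one>[H] = D"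
proof -
 assume D: "D :. U"
 have "act D \<one>[H] = lift2 U (%x y. counit U x .[U] y) (comult U D)"
  unfolding hopf_action_def using D by (intro env_tl_cong) (simp_all add: p_H_one)
 then show ?thesis using D by (simp add: counit_comult)
qed

lemma act_gen_left:
 "D :. U ==> f :. H ==> act (Xg j *[U] D) f = Xg j *[U] act D f +[U] act D (lt j f)"
proof -
 assume D: "D :. U" and f: "f :. H"
 have "act (Xg j *[U] D) f = lift2 U (%x y. p (Xg j *[U] x) f .[U] y +[U] p x f .[U] (Xg j *[U] y)) (comult U D)"
  unfolding hopf_action_def by (rule lift_comult_gen_mult(1)[OF g env_vspace act_bilin_inner[OF f] D])
 also have "... = lift2 U (%x y. p (Xg j *[U] x) f .[U] y) (comult U D) +[U]
   lift2 U (%x y. p x f .[U] (Xg j *[U] y)) (comult U D)"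
  using D by (intro env_tl_add) simp_all
 also have "lift2 U (%x y. p (Xg j *[U] x) f .[U] y) (comult U D) = act D (lt j f)"
  unfolding hopf_action_def using D f by (intro env_tl_cong) (simp_all add: p_lt)
 also have "lift2 U (%x y. p x f .[U] (Xg j *[U] y)) (comult U D) = Xg j *[U] act D f"
  unfolding hopf_action_def using D f
  by (subst env_tl_linear[OF _ lin_mult_left]) (auto simp: alg_smult intro!: env_tl_cong)
 finally show ?thesis using D f by (simp add: U.a_comm)
qed

lemma act_gen_right:
 "D :. U ==> f :. H ==> act (D *[U] Xg j) f = act D f *[U] Xg j +[U] act D (rt j f)"
proof -
 assume D: "D :. U" and f: "f :. H"
 have "act (D *[U] Xg j) f = lift2 U (%x y. p (x *[U] Xg j) f .[U] y +[U] p x f .[U] (y *[U] Xg j)) (comult U D)"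
  unfolding hopf_action_def by (rule lift_comult_gen_mult(2)[OF g env_vspace act_bilin_inner[OF f] D])
 also have "... = lift2 U (%x y. p (x *[U] Xg j) f .[U] y) (comult U D) +[U]
   lift2 U (%x y. p x f .[U] (y *[U] Xg j)) (comult U D)"
  using D by (intro env_tl_add) simp_all
 also have "lift2 U (%x y. p (x *[U] Xg j) f .[U] y) (comult U D) = act D (rt j f)"
  unfolding hopf_action_def using D f by (intro env_tl_cong) (simp_all add: p_rt)
 also have "lift2 U (%x y. p x f .[U] (y *[U] Xg j)) (comult U D) = act D f *[U] Xg j"
  unfolding hopf_action_def using D f
  by (subst env_tl_linear[OF _ lin_mult_right]) (auto simp: alg_smult intro!: env_tl_cong)
 finally show ?thesis using D f by (simp add: U.a_comm)
qed

lemma act_act: "D :. U ==> f :. H ==> h :. H ==> act (act D f) h = act D (f *[H] h)"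
proof -
 assume "D :. U" "f :. H" "h :. H"
 moreover have "\<forall>f\<in>carrier H. \<forall>h\<in>carrier H. act (act D f) h = act D (f *[H] h)"
  using g \<open>D :. U\<close>
 proof (induction rule: env_induct_left)
  case one
  then show ?case by (simp add: act_one lin_smult[OF act_linear] H_counit_mult)
 next
  case (gen j D)
  show ?case
  proof (intro ballI)
   fix f h assume f: "f :. H" and h: "h :. H"
   have "act (act (Xg j *[U] D) f) h = Xg j *[U] act (act D f) h +[U] act (act D f) (lt j h) +[U] act (act D (lt j f)) h"
    using f h gen(2) by (simp add: act_gen_left lin_add[OF act_linear])
   also have "... = act (Xg j *[U] D) (f *[H] h)"
    using f h gen(2,3) by (simp add: act_gen_left lt_mult lin_add[OF act_linear_right] U.a_ac)
   finally show "act (act (Xg j *[U] D) f) h = act (Xg j *[U] D) (f *[H] h)" .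
  qed
 qed (simp_all add: lin_add[OF act_linear] lin_smult[OF act_linear])
 ultimately show ?thesis by blast
qed

lemma act_mult:
 assumes D: "D :. U" and E: "E :. U" and f: "f :. H"
 shows "act (D *[U] E) f = lift2 U (%x y. act D x *[U] act E y) (comult H f)"
proof -
 have b: "bilin H H U (%x y. act D x *[U] act E y)" if "D :. U" "E :. U" for D E
  using that by (intro bilinI lin_fun_mult_left lin_fun_mult_right act_linear_right) simp_all
 have "\<forall>f\<in>carrier H. act (D *[U] E) f = lift2 U (%x y. act D x *[U] act E y) (comult H f)"
  using g E
 proof (induction rule: env_induct_right)
  case one
  show ?case
  proof
   fix f assume f: "f :. H"
   have "lift2 U (%x y. act D x *[U] act \<one>[U] y) (comult H f) = lift2 U (%x y. act D (counit H y .[H] x)) (comult H f)"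
    using D f by (intro H_tl_cong) (simp_all add: act_one lin_smult[OF act_linear_right] alg_smult)
   also have "... = act D f"
    using D f by (subst H_tl_linear[OF _ act_linear_right, symmetric]) (simp_all add: H_counit)
   finally show "act (D *[U] \<one>[U]) f = lift2 U (%x y. act D x *[U] act \<one>[U] y) (comult H f)"
    using D by simp
  qed
 next
  case (gen j E)
  show ?case
  proof
   fix f assume f: "f :. H"
   have rt: "lift2 U (%x y. act D x *[U] act E y) (comult H (rt j f)) =
     lift2 U (%x y. act D x *[U] act E (rt j y)) (comult H f)"
    unfolding comult_rt[OF f] using f D gen(2) b
    by (subst H_tl_linear[OF _ lift_linear]) (auto simp: lift_ten intro!: H_tl_cong)
   have "lift2 U (%x y. act D x *[U] act (E *[U] Xg j) y) (comult H f) =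
     lift2 U (%x y. (act D x *[U] act E y) *[U] Xg j +[U] act D x *[U] act E (rt j y)) (comult H f)"
    using f D gen(2) by (intro H_tl_cong) (simp_all add: act_gen_right U.r_distr U.m_assoc)
   also have "... = lift2 U (%x y. (act D x *[U] act E y) *[U] Xg j) (comult H f) +[U]
     lift2 U (%x y. act D x *[U] act E (rt j y)) (comult H f)"
    using f D gen(2) by (intro H_tl_add) simp_all
   also have "lift2 U (%x y. (act D x *[U] act E y) *[U] Xg j) (comult H f) =
     lift2 U (%x y. act D x *[U] act E y) (comult H f) *[U] Xg j"
    using f D gen(2) by (intro H_tl_linear[OF _ lin_mult_right, symmetric]) simp_all
   finally show "act (D *[U] (E *[U] Xg j)) f = lift2 U (%x y. act D x *[U] act (E *[U] Xg j) y) (comult H f)"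
    using f D gen(2,3) by (simp add: U.m_assoc[symmetric] act_gen_right rt)
  qed
 next
  case (add E F)
  have "lift2 U (%x y. act D x *[U] act (E +[U] F) y) (comult H f) =
    lift2 U (%x y. act D x *[U] act E y +[U] act D x *[U] act F y) (comult H f)" if "f :. H" for f
   using that D add(1,2) by (intro H_tl_cong) (simp_all add: lin_add[OF act_linear] U.r_distr)
  then show ?case using D add by (simp add: H_tl_add U.r_distr lin_add[OF act_linear])
 next
  case (smult c E)
  have l: "linear_map U U (%E. lift2 U (%x y. act D x *[U] act E y) (comult H f))" if "f :. H" for f
   using that D by (intro H_tl_fun_linear lin_fun_mult_left act_linear) simp_all
  show ?case using D smult by (simp add: lin_smult[OF l] alg_smult lin_smult[OF act_linear])
 qed
 then show ?thesis using f by blast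
qed

lemmas gen_bracket = env_gen_bracket[OF g]

text \<open>The adjoint matrix coefficients measure how a generator moves past \<open>D\<close>; induction on \<open>D\<close> from
  the left reduces this to the bracket of two generators.\<close>

lemma mult_gen_right:
 assumes D: "D :. U" and j: "j \<in> I"
 shows "D *[U] Xg j = finsum U (%i. Xg i *[U] act D (u i j)) I"
 using g D
proof (induction rule: env_induct_left)
 case one
 have "finsum U (%i. Xg i *[U] act \<one>[U] (u i j)) I = finsum U (%i. (if i = j then 1 else 0) .[U] Xg j) I"
  using j by (intro vs_finsum_cong) (auto simp: act_one counit_u alg_smult)
 then show ?case using j by (simp add: vs_finsum_delta)
next
 case (gen k D)
 have sw: "finsum U (%i. finsum U (%l. struct_const g k i l .[U] (Xg l *[U] act D (u i j))) I) I =
   finsum U (%i. Xg i *[U] act D (lt k (u i j))) I"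
 proof -
  have "Xg i *[U] act D (lt k (u i j)) = finsum U (%l. struct_const g k l i .[U] (Xg i *[U] act D (u l j))) I" if "i \<in> I" for i
  proof -
   have "Xg i *[U] act D (lt k (u i j)) = finsum U (%l. Xg i *[U] act D (struct_const g k l i .[H] u l j)) I"
    unfolding lt_u[OF that j gen(1)] using gen(2) j
    by (intro lin_finsum[OF H_vspace env_vspace lin_fun_mult_left[OF k_algebra_env _ act_linear_right]]) simp_all
   also have "... = finsum U (%l. struct_const g k l i .[U] (Xg i *[U] act D (u l j))) I"
    using that gen(2) j by (intro vs_finsum_cong) (simp_all add: lin_smult[OF act_linear_right] alg_smult)
   finally show ?thesis .
  qed
  then have "finsum U (%i. Xg i *[U] act D (lt k (u i j))) I =
    finsum U (%i. finsum U (%l. struct_const g k l i .[U] (Xg i *[U] act D (u l j))) I) I"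
   using gen(2) j by (intro vs_finsum_cong) simp_all
  then show ?thesis
   using gen(2) j by (simp only:) (intro vs_finsum_swap; simp)
 qed
 have "Xg k *[U] D *[U] Xg j = Xg k *[U] finsum U (%i. Xg i *[U] act D (u i j)) I"
  using gen by (simp add: U.m_assoc)
 also have "... = finsum U (%i. Xg k *[U] (Xg i *[U] act D (u i j))) I"
  using gen(2) j by (intro lin_finsum lin_mult_left) simp_all
 also have "... = finsum U (%i. Xg i *[U] (Xg k *[U] act D (u i j)) +[U]
   finsum U (%l. struct_const g k i l .[U] (Xg l *[U] act D (u i j))) I) I"
 proof (rule vs_finsum_cong)
  fix i assume i: "i \<in> I"
  have "Xg k *[U] (Xg i *[U] act D (u i j)) = (Xg k *[U] Xg i) *[U] act D (u i j)"
   using gen(2) i j by (simp add: U.m_assoc)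
  also have "... = Xg i *[U] (Xg k *[U] act D (u i j)) +[U]
    finsum U (%l. struct_const g k i l .[U] Xg l) I *[U] act D (u i j)"
   unfolding gen_bracket[of k i] using gen(2) i j by (simp add: U.m_assoc U.l_distr)
  also have "finsum U (%l. struct_const g k i l .[U] Xg l) I *[U] act D (u i j) =
    finsum U (%l. (struct_const g k i l .[U] Xg l) *[U] act D (u i j)) I"
   using gen(2) i j by (intro lin_finsum lin_mult_right) simp_all
  also have "... = finsum U (%l. struct_const g k i l .[U] (Xg l *[U] act D (u i j))) I"
   using gen(2) i j by (intro vs_finsum_cong) (simp_all add: alg_smult)
  finally show "Xg k *[U] (Xg i *[U] act D (u i j)) = Xg i *[U] (Xg k *[U] act D (u i j)) +[U]
   finsum U (%l. struct_const g k i l .[U] (Xg l *[U] act D (u i j))) I" .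
 qed (use gen(2) j in simp_all)
 also have "... = finsum U (%i. Xg i *[U] (Xg k *[U] act D (u i j))) I +[U]
   finsum U (%i. Xg i *[U] act D (lt k (u i j))) I"
  unfolding sw[symmetric] using gen(2) j by (intro vs_finsum_add) simp_all
 also have "... = finsum U (%i. Xg i *[U] (Xg k *[U] act D (u i j)) +[U] Xg i *[U] act D (lt k (u i j))) I"
  using gen(2) j by (intro vs_finsum_add[symmetric]) simp_all
 also have "... = finsum U (%i. Xg i *[U] act (Xg k *[U] D) (u i j)) I"
  using gen(2) j by (intro vs_finsum_cong) (simp_all add: act_gen_left U.r_distr)
 finally show ?case .
next
 case (add D E)
 have "finsum U (%i. Xg i *[U] act (D +[U] E) (u i j)) I =
   finsum U (%i. Xg i *[U] act D (u i j) +[U] Xg i *[U] act E (u i j)) I"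
  using add j by (intro vs_finsum_cong) (simp_all add: lin_add[OF act_linear] U.r_distr)
 then show ?case using add j by (simp add: vs_finsum_add U.l_distr)
next
 case (smult c D)
 have "finsum U (%i. Xg i *[U] act (c .[U] D) (u i j)) I =
   finsum U (%i. c .[U] (Xg i *[U] act D (u i j))) I"
  using smult j by (intro vs_finsum_cong) (simp_all add: lin_smult[OF act_linear] alg_smult)
 then show ?case using smult j by (simp add: vs_finsum_smult alg_smult)
qed

lemma mult_gen_left:
 assumes D: "D :. U" and j: "j \<in> I"
 shows "Xg j *[U] D = finsum U (%i. act D (v i j) *[U] Xg i) I"
proof -
 have "finsum U (%i. act D (v i j) *[U] Xg i) I = finsum U (%i. finsum U (%k. Xg k *[U] act D (u k i *[H] v i j)) I) I"
  using D j by (intro vs_finsum_cong) (auto simp: mult_gen_right act_act H_commute intro!: vs_finsum_cong)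
 also have "... = finsum U (%k. finsum U (%i. Xg k *[U] act D (u k i *[H] v i j)) I) I"
  using D j by (intro vs_finsum_swap) simp_all
 also have "... = finsum U (%k. (if k = j then 1 else 0) .[U] (Xg j *[U] D)) I"
 proof (rule vs_finsum_cong)
  fix k assume k: "k \<in> I"
  have "finsum U (%i. Xg k *[U] act D (u k i *[H] v i j)) I = Xg k *[U] act D (finsum H (%i. u k i *[H] v i j) I)"
   using D j k by (intro lin_finsum[symmetric] lin_fun_mult_left act_linear_right) simp_all
  then show "finsum U (%i. Xg k *[U] act D (u k i *[H] v i j)) I = (if k = j then 1 else 0) .[U] (Xg j *[U] D)"
   using D j k by (simp add: vu_uv lin_smult[OF act_linear_right] act_H_one alg_smult)
 qed (use D j in simp_all)
 also have "... = Xg j *[U] D" using D j by (simp add: vs_finsum_delta)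
 finally show ?thesis by simp
qed

end

context dual_pair
begin

section \<open>The smash product as an algebra of operators\<close>

abbreviation HU where "HU \<equiv> tensor H U"

definition K :: "('k, ('k, 'h \<times> ('k, 'g) env) formal) module" where
 "K = smash_right H U act"

lemma K_simps [simp]:
 "carrier K = carrier HU" "add K = add HU" "zero K = zero HU" "module.smult K = module.smult HU"
 "\<one>[K] = ten H U \<one>[H] \<one>[U]"
 by (simp_all add: K_def smash_right_def)

lemma K_vspace [simp]: "vspace K"
 by (rule vspace_cong[of HU]) simp_all

lemma K_lin [simp]: "linear_map K B f = linear_map HU B f" "linear_map B' K f' = linear_map B' HU f'"
 by (simp_all add: linear_map_def)

lemma K_finsum: "finsum K f A = finsum HU f A"
 by (simp add: finsum_def finprod_def)

definition sm :: "'h => ('k, 'g) env => 'h => ('k, 'g) env => ('k, 'h \<times> ('k, 'g) env) formal" where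
 "sm h a h' a' = lift2 HU (%h1 h2. ten H U (h *[H] h1) (act a h2 *[U] a')) (comult H h')"

lemma K_mult: "s *[K] t = lift2 HU (%h a. lift2 HU (%h' a'. sm h a h' a') t) s"
 by (simp add: K_def smash_right_def sm_def)

lemma sm_bilin_inner:
 assumes "h :. H" "a :. U" "a' :. U"
 shows "bilin H H HU (%h1 h2. ten H U (h *[H] h1) (act a h2 *[U] a'))"
 using assms by (intro bilinI lin_comp[OF ten_right] lin_comp[OF ten_left] lin_mult_left lin_fun_mult_right act_linear_right) simp_all

lemma sm_closed [simp]:
 "h :. H ==> a :. U ==> h' :. H ==> a' :. U ==> sm h a h' a' :. HU"
 unfolding sm_def by (intro H_tl_closed) simp_all

lemma sm_bilin_right: "h :. H ==> a :. U ==> bilin H U HU (%h' a'. sm h a h' a')"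
 unfolding sm_def
 by (intro bilinI H_tl_fun_linear lin_comp[OF ten_right] lin_mult_left
   lin_comp[OF lift_linear[OF H_vspace H_vspace _ _ sm_bilin_inner] H_comult_linear]) simp_all

lemma sm_bilin_left: "h' :. H ==> a' :. U ==> bilin H U HU (%h a. sm h a h' a')"
 unfolding sm_def
 by (intro bilinI H_tl_fun_linear lin_comp[OF ten_right] lin_comp[OF ten_left] lin_fun_mult_right lin_mult_right act_linear lin_id) simp_all

lemma sm_outer:
 assumes "t :. HU"
 shows "bilin H U HU (%h a. lift2 HU (%h' a'. sm h a h' a') t)"
 using assms
 by (intro bilinI tl2_fun_linear[OF H_vspace env_vspace bal_maps_empty assms] bilin_left[OF sm_bilin_left] bilin_right[OF sm_bilin_left]) simp_all

lemma K_mult_ten: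
 assumes "h :. H" "a :. U" "h' :. H" "a' :. U"
 shows "ten H U h a *[K] ten H U h' a' = sm h a h' a'"
 unfolding K_mult using assms
 by (simp add: lift_ten[OF H_vspace env_vspace _ _ sm_outer] lift_ten[OF H_vspace env_vspace _ _ sm_bilin_right])

lemma K_mult_linear:
 "t :. HU ==> linear_map HU HU (%s. s *[K] t)"
 "s :. HU ==> linear_map HU HU (%t. s *[K] t)"
proof -
 show "t :. HU ==> linear_map HU HU (%s. s *[K] t)"
  unfolding K_mult by (intro lift_linear sm_outer) simp_all
 show "linear_map HU HU (%t. s *[K] t)" if "s :. HU"
  unfolding K_mult
  by (intro tl2_fun_linear[OF H_vspace env_vspace bal_maps_empty that] lift_linear sm_bilin_right) simp_all
qed

lemma K_mult_closed: "s :. HU ==> t :. HU ==> s *[K] t :. HU"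
 by (rule lin_closed[OF K_mult_linear(1)])

text \<open>The element \<open>h # a\<close> acts on the enveloping algebra by the operator that first applies the
 functional \<open>h\<close> and then multiplies by \<open>a\<close> from the right.\<close>

definition T :: "('k, 'h \<times> ('k, 'g) env) formal => ('k, 'g) env => ('k, 'g) env" where
 "T t D = lift2 U (%h a. act D h *[U] a) t"

lemma T_bilin: "D :. U ==> bilin H U U (%h a. act D h *[U] a)"
 by (intro bilinI lin_mult_left lin_fun_mult_right act_linear_right) simp_all

lemma T_linear: "D :. U ==> linear_map HU U (%t. T t D)"
 unfolding T_def by (intro lift_linear T_bilin) simp_all

lemma T_ten: "D :. U ==> h :. H ==> a :. U ==> T (ten H U h a) D = act D h *[U] a"
 unfolding T_def by (simp add: lift_ten[OF H_vspace env_vspace _ _ T_bilin])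

lemma T_linear_right: "t :. HU ==> linear_map U U (T t)"
 unfolding T_def by (intro tl2_fun_linear[OF H_vspace env_vspace bal_maps_empty] lin_fun_mult_right act_linear) simp_all

lemma T_closed [simp]: "t :. HU ==> D :. U ==> T t D :. U"
 by (rule lin_closed[OF T_linear])

lemma T_mult:
 assumes s: "s :. HU" and t: "t :. HU" and D: "D :. U"
 shows "T (s *[K] t) D = T t (T s D)"
proof -
 have ten: "T (ten H U h a *[K] ten H U h' a') D = T (ten H U h' a') (T (ten H U h a) D)"
  if "h :. H" "a :. U" "h' :. H" "a' :. U" for h a h' a'
 proof -
  have "T (sm h a h' a') D = lift2 U (%h1 h2. T (ten H U (h *[H] h1) (act a h2 *[U] a')) D) (comult H h')"
   unfolding sm_def using that D by (intro H_tl_linear[OF _ T_linear]) simp_all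
  also have "... = lift2 U (%h1 h2. (act (act D h) h1 *[U] act a h2) *[U] a') (comult H h')"
   using that D by (intro H_tl_cong) (simp_all add: T_ten act_act U.m_assoc)
  also have "... = lift2 U (%h1 h2. act (act D h) h1 *[U] act a h2) (comult H h') *[U] a'"
   using that D by (intro H_tl_linear[OF _ lin_mult_right, symmetric]) simp_all
  also have "... = act (act D h *[U] a) h' *[U] a'"
   using that D by (simp add: act_mult)
  finally show ?thesis using that D by (simp add: K_mult_ten T_ten)
 qed
 have 1: "T (ten H U h a *[K] t) D = T t (T (ten H U h a) D)" if "h :. H" "a :. U" for h a
  by (rule tensor_ext[where M=H and N=U and E="{}" and B=U and f="%t. T (ten H U h a *[K] t) D" and g="%t. T t (T (ten H U h a) D)"])
   (use that t D ten in \<open>auto intro!: T_linear lin_comp[OF T_linear] K_mult_linear\<close>)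
 show ?thesis
  by (rule tensor_ext[where M=H and N=U and E="{}" and B=U and f="%s. T (s *[K] t) D" and g="%s. T t (T s D)"])
   (use s t D 1 in \<open>simp_all add: lin_comp[OF T_linear_right[OF t] T_linear[OF D]] lin_comp[OF T_linear[OF D] K_mult_linear(1)[OF t]]\<close>)
qed

text \<open>The operators are faithful. If the operator of \<open>t = \<Sum> h # a\<close> is zero, then so is the one
 of \<open>\<Sum> lt j h # a\<close>, because both differ by the left multiplication by \<open>X\<^sub>j\<close>; evaluating
 at the unit shows by induction on \<open>D\<close> that \<open>\<Sum> \<langle>D, h\<rangle> a = 0\<close>.\<close>

lemma T_inject:
 assumes s: "s :. HU" and t: "t :. HU" and eq: "!!D. D :. U ==> T s D = T t D"
 shows "s = t"
proof -
 define shl where "shl j = lift2 HU (%h a. ten H U (lt j h) a)" for j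
 define ev where "ev D = lift2 U (%h a. p D h .[U] a)" for D
 have b1: "bilin H U HU (%h a. ten H U (lt j h) a)" for j
  by (intro bilinI lin_comp[OF ten_left] ten_right lt_linear) simp_all
 have b2: "bilin H U U (%h a. p D h .[U] a)" if "D :. U" for D
  using that by (intro bilinI lin_fun_scalar lin_fun_smult p_right lin_id) simp_all
 have shl: "linear_map HU HU (shl j)" for j unfolding shl_def by (intro lift_linear b1) simp_all
 have ev: "linear_map HU U (ev D)" if "D :. U" for D unfolding ev_def using that by (intro lift_linear b2) simp_all
 have shl_ten: "shl j (ten H U h a) = ten H U (lt j h) a" if "h :. H" "a :. U" for j h a
  unfolding shl_def using that by (simp add: lift_ten[OF _ _ _ _ b1])
 have ev_ten: "ev D (ten H U h a) = p D h .[U] a" if "D :. U" "h :. H" "a :. U" for D h a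
  unfolding ev_def using that by (simp add: lift_ten[OF _ _ _ _ b2])
 have Tgen: "T r (Xg j *[U] D) = Xg j *[U] T r D +[U] T (shl j r) D" if "r :. HU" "D :. U" for r j D
  by (rule tensor_ext[where M=H and N=U and E="{}" and B=U and f="%r. T r (Xg j *[U] D)" and g="%r. Xg j *[U] T r D +[U] T (shl j r) D"])
   (use that in \<open>auto intro!: T_linear lin_fun_add lin_fun_mult_left lin_comp[OF T_linear] shl
    simp: T_ten shl_ten act_gen_left U.l_distr U.m_assoc\<close>)
 have evgen: "ev (Xg j *[U] D) r = ev D (shl j r)" if "r :. HU" "D :. U" for r j D
  by (rule tensor_ext[where M=H and N=U and E="{}" and B=U and f="ev (Xg j *[U] D)" and g="%r. ev D (shl j r)"])
   (use that in \<open>auto intro!: ev lin_comp[OF ev] shl simp: ev_ten shl_ten p_lt\<close>)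
 have evone: "ev \<one>[U] r = T r \<one>[U]" if "r :. HU" for r
  by (rule tensor_ext[where M=H and N=U and E="{}" and B=U and f="ev \<one>[U]" and g="%r. T r \<one>[U]"])
   (use that in \<open>auto intro!: ev T_linear simp: ev_ten T_ten p_one act_one alg_smult\<close>)
 have evlin: "linear_map U U (%D. ev D r)" if "r :. HU" for r
  unfolding ev_def by (intro tl2_fun_linear[OF H_vspace env_vspace bal_maps_empty that] lin_fun_scalar p_left) simp_all
 have zero: "ev D r = \<zero>[U]" if "r :. HU" "!!D. D :. U ==> T r D = \<zero>[U]" "D :. U" for D r
 proof -
  have "\<forall>r\<in>carrier HU. (\<forall>D\<in>carrier U. T r D = \<zero>[U]) \<longrightarrow> ev D r = \<zero>[U]"
   using g that(3)
  proof (induction rule: env_induct_left)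
   case one
   then show ?case by (simp add: evone)
  next
   case (gen j D)
   show ?case
   proof (intro ballI impI)
    fix r assume r: "r :. HU" "\<forall>D\<in>carrier U. T r D = \<zero>[U]"
    have "T (shl j r) E = \<zero>[U]" if "E :. U" for E
     using Tgen[OF r(1) that, of j] r that lin_closed[OF shl r(1)] by simp
    then show "ev (Xg j *[U] D) r = \<zero>[U]"
     using gen(2,3) r(1) lin_closed[OF shl r(1)] by (simp add: evgen)
   qed
  qed (simp_all add: lin_add[OF evlin] lin_smult[OF evlin])
  then show ?thesis using that by blast
 qed
 show ?thesis
 proof (rule tensor_separate_left[OF H_vspace env_vspace p_right nondegenerate s t])
  fix D assume D: "D :. U"
  have r: "s \<ominus>\<^bsub>HU\<^esub> t :. HU" using s t by simp
  have "T (s \<ominus>\<^bsub>HU\<^esub> t) E = \<zero>[U]" if "E :. U" for E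
   using that s t eq by (simp add: lin_diff[OF vspace_tensor_over env_vspace T_linear])
  from zero[OF r this D] have "ev D s \<ominus>\<^bsub>U\<^esub> ev D t = \<zero>[U]"
   using D s t by (simp add: lin_diff[OF vspace_tensor_over env_vspace ev])
  then have "ev D s = ev D t"
   using D s t lin_closed[OF ev] by (simp add: vs_diff_eq_zero)
  then show "lift2 U (%x y. p D x .[U] y) s = lift2 U (%x y. p D x .[U] y) t"
   by (simp add: ev_def)
 qed
qed

lemma T_one: "D :. U ==> T \<one>[K] D = D"
 by (simp add: T_ten act_H_one)

lemma K_algebra [simp]: "k_algebra K"
proof (rule k_algebraI)
 show "\<one>[K] *[K] x = x" "x *[K] \<one>[K] = x" if "x :. K" for x
 proof -
  have one: "\<one>[K] :. HU" by simp
  show "\<one>[K] *[K] x = x" "x *[K] \<one>[K] = x"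
   using that one by (auto intro!: T_inject K_mult_closed simp: T_mult T_one simp del: K_simps(5))
 qed
 show "(x *[K] y) *[K] z = x *[K] (y *[K] z)" if "x :. K" "y :. K" "z :. K" for x y z
  using that by (auto intro!: T_inject K_mult_closed simp: T_mult K_mult_closed)
qed (simp_all add: K_mult_closed K_mult_linear)

sublocale K: ring K by (rule k_algebra_ring) simp

lemma ten_K [simp]: "h :. H ==> a :. U ==> ten H U h a :. K"
 by simp

lemma K_eqI: "s :. K ==> t :. K ==> (!!D. D :. U ==> T s D = T t D) ==> s = t"
 using T_inject by simp

lemma K_one: "\<one>[K] = ten H U \<one>[H] \<one>[U]" by simp

declare K_simps [simp del] K_lin [simp del]

subsection \<open>The three subalgebras\<close>

definition iH :: "'h => ('k, 'h \<times> ('k, 'g) env) formal" where "iH h = ten H U h \<one>[U]"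
definition iX :: "('k, 'g) env => ('k, 'h \<times> ('k, 'g) env) formal" where "iX a = ten H U \<one>[H] a"
definition lm :: "('k, 'g) env => ('k, 'h \<times> ('k, 'g) env) formal" where
 "lm a = (THE k. k :. K \<and> (\<forall>D\<in>carrier U. T k D = a *[U] D))"

lemma iH_closed [simp]: "h :. H ==> iH h :. K"
 and iX_closed [simp]: "a :. U ==> iX a :. K"
 by (simp_all add: iH_def iX_def)

lemma T_iH: "D :. U ==> h :. H ==> T (iH h) D = act D h"
 and T_iX: "D :. U ==> a :. U ==> T (iX a) D = D *[U] a"
 by (simp_all add: iH_def iX_def T_ten act_H_one)

lemma iH_linear: "linear_map H K iH" and iX_linear: "linear_map U K iX"
 unfolding iH_def iX_def K_lin by (simp_all add: ten_left ten_right)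

lemma T_K_mult: "s :. K ==> t :. K ==> D :. U ==> T (s *[K] t) D = T t (T s D)"
 by (simp add: T_mult K_simps)

lemma T_K_add: "s :. K ==> t :. K ==> D :. U ==> T (s +[K] t) D = T s D +[U] T t D"
 by (simp add: lin_add[OF T_linear] K_simps)

lemma T_K_smult: "s :. K ==> D :. U ==> T (c .[K] s) D = c .[U] T s D"
 by (simp add: lin_smult[OF T_linear] K_simps)

lemma T_K_finsum: "D :. U ==> (!!i. i \<in> A ==> f i :. K) ==> T (finsum K f A) D = finsum U (%i. T (f i) D) A"
 unfolding K_finsum by (intro lin_finsum T_linear) (simp_all add: K_simps)

lemma T_K_closed [simp]: "s :. K ==> D :. U ==> T s D :. U"
 by (simp add: K_simps)

lemma iH_hom: "alg_hom H K iH"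
 unfolding alg_hom_def
proof (intro conjI ballI iH_linear)
 show "iH (f *[H] h) = iH f *[K] iH h" if "f :. H" "h :. H" for f h
  using that by (intro K_eqI K.m_closed) (simp_all add: T_K_mult T_iH act_act)
qed (simp add: iH_def K_one)

lemma iX_hom: "alg_hom U K iX"
 unfolding alg_hom_def
proof (intro conjI ballI iX_linear)
 show "iX (a *[U] b) = iX a *[K] iX b" if "a :. U" "b :. U" for a b
  using that by (intro K_eqI K.m_closed) (simp_all add: T_K_mult T_iX U.m_assoc)
qed (simp add: iX_def K_one)

lemma ten_eq_mult: "h :. H ==> a :. U ==> ten H U h a = iH h *[K] iX a"
proof (rule K_eqI)
 show "T (ten H U h a) D = T (iH h *[K] iX a) D" if "h :. H" "a :. U" "D :. U" for D
  using that by (simp add: T_K_mult T_iH T_iX T_ten)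
qed simp_all

text \<open>Left multiplications by elements of the enveloping algebra are among the operators.\<close>

lemma lm_gen_value:
 assumes "j \<in> I" "D :. U"
 shows "T (finsum K (%i. ten H U (v i j) (Xg i)) I) D = Xg j *[U] D"
proof -
 have "T (finsum K (%i. ten H U (v i j) (Xg i)) I) D = finsum U (%i. T (ten H U (v i j) (Xg i)) D) I"
  using assms by (intro T_K_finsum) simp_all
 also have "... = finsum U (%i. act D (v i j) *[U] Xg i) I"
  using assms by (intro vs_finsum_cong) (simp_all add: T_ten)
 finally show ?thesis using assms by (simp add: mult_gen_left)
qed

lemma lm_exists:
 assumes "a :. U"
 shows "\<exists>k\<in>carrier K. \<forall>D\<in>carrier U. T k D = a *[U] D"
 using g assms
proof (induction rule: env_induct_left)
 case one
 show ?case by (intro bexI[of _ "\<one>[K]"] ballI) (simp_all add: T_one )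
next
 case (gen j a)
 then obtain k where k: "k :. K" "\<forall>D\<in>carrier U. T k D = a *[U] D" by blast
 have c: "finsum K (%i. ten H U (v i j) (Xg i)) I :. K"
  using gen(1) by (intro vs_finsum_closed K_vspace) simp
 show ?case
 proof (intro bexI ballI)
  show "T (k *[K] finsum K (%i. ten H U (v i j) (Xg i)) I) D = Xg j *[U] a *[U] D" if "D :. U" for D
   using that k c gen(1,2) by (simp add: T_K_mult lm_gen_value U.m_assoc)
  show "k *[K] finsum K (%i. ten H U (v i j) (Xg i)) I :. K" using k c by simp
 qed
next
 case (add a b)
 then obtain k l where "k :. K" "\<forall>D\<in>carrier U. T k D = a *[U] D" "l :. K" "\<forall>D\<in>carrier U. T l D = b *[U] D" by blast
 then show ?case
  using add(1,2) by (intro bexI[of _ "k +[K] l"] ballI) (simp_all add: T_K_add U.l_distr)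
next
 case (smult c a)
 then obtain k where "k :. K" "\<forall>D\<in>carrier U. T k D = a *[U] D" by blast
 then show ?case
  using smult(1) by (intro bexI[of _ "c .[K] k"] ballI) (simp_all add: T_K_smult alg_smult)
qed

lemma lm_closed [simp]: "a :. U ==> lm a :. K"
 and T_lm: "a :. U ==> D :. U ==> T (lm a) D = a *[U] D"
proof -
 have "lm a :. K \<and> (\<forall>D\<in>carrier U. T (lm a) D = a *[U] D)" if a: "a :. U"
 proof -
  have "\<exists>!k. k :. K \<and> (\<forall>D\<in>carrier U. T k D = a *[U] D)"
   using lm_exists[OF a] by (metis K_eqI)
  from theI'[OF this] show ?thesis unfolding lm_def .
 qed
 then show "a :. U ==> lm a :. K" "a :. U ==> D :. U ==> T (lm a) D = a *[U] D"
  by blast+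
qed

lemma lm_antihom: "alg_antihom U K lm"
 unfolding alg_antihom_def
proof (intro conjI ballI linear_mapI)
 show "lm (a *[U] b) = lm b *[K] lm a" if "a :. U" "b :. U" for a b
  using that by (intro K_eqI K.m_closed) (simp_all add: T_K_mult T_lm U.m_assoc)
 show "lm (a +[U] b) = lm a +[K] lm b" if "a :. U" "b :. U" for a b
  using that by (intro K_eqI K.a_closed) (simp_all add: T_K_add T_lm U.l_distr)
 show "lm (c .[U] a) = c .[K] lm a" if "a :. U" for c a
  using that by (intro K_eqI vs_closed) (simp_all add: T_K_smult T_lm alg_smult)
 show "lm \<one>[U] = \<one>[K]"
  by (intro K_eqI) (simp_all add: T_lm T_one)
qed simp

lemma lm_linear: "linear_map U K lm" by (rule alg_antihom_linear[OF lm_antihom])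

lemma lm_gen: "j \<in> I ==> lm (Xg j) = finsum K (%i. iH (v i j) *[K] iX (Xg i)) I"
proof -
 assume j: "j \<in> I"
 have "lm (Xg j) = finsum K (%i. ten H U (v i j) (Xg i)) I"
  using j by (intro K_eqI vs_finsum_closed K_vspace) (simp_all add: T_lm lm_gen_value)
 also have "... = finsum K (%i. iH (v i j) *[K] iX (Xg i)) I"
  using j by (intro vs_finsum_cong) (simp_all add: ten_eq_mult)
 finally show ?thesis .
qed

lemma iX_lm_commute: "a :. U ==> b :. U ==> iX a *[K] lm b = lm b *[K] iX a"
 by (rule K_eqI; (rule K.m_closed)?) (simp_all add: T_K_mult T_lm T_iX U.m_assoc)

lemma iX_iH: "f :. H ==> iX (Xg j) *[K] iH f = iH f *[K] iX (Xg j) +[K] iH (rt j f)"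
 by (rule K_eqI) (simp_all add: T_K_mult T_K_add T_iH T_iX act_gen_right)

lemma lm_iH: "f :. H ==> lm (Xg j) *[K] iH f = iH f *[K] lm (Xg j) +[K] iH (lt j f)"
 by (rule K_eqI) (simp_all add: T_K_mult T_K_add T_iH T_lm act_gen_left)

text \<open>The expansion \<open>mult_gen_right\<close> of right multiplications, seen as an identity of operators.\<close>

lemma iX_gen: "j \<in> I ==> iX (Xg j) = finsum K (%i. iH (u i j) *[K] lm (Xg i)) I"
proof (rule K_eqI)
 fix D assume D: "D :. U" and j: "j \<in> I"
 have "T (finsum K (%i. iH (u i j) *[K] lm (Xg i)) I) D = finsum U (%i. T (iH (u i j) *[K] lm (Xg i)) D) I"
  using D j by (intro T_K_finsum) simp_all
 also have "... = finsum U (%i. Xg i *[U] act D (u i j)) I"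
  using D j by (intro vs_finsum_cong) (simp_all add: T_K_mult T_iH T_lm)
 finally show "T (iX (Xg j)) D = T (finsum K (%i. iH (u i j) *[K] lm (Xg i)) I) D"
  using D j by (simp add: mult_gen_right T_iX)
qed simp_all

lemma tr_sum: "k \<in> I ==> finsum H (%i. lt i (u i k)) I = tr k .[H] \<one>[H]"
proof -
 assume k: "k \<in> I"
 have "finsum H (%i. lt i (u i k)) I = finsum H (%i. finsum H (%l. struct_const g i l i .[H] u l k) I) I"
  using k by (intro vs_finsum_cong) (simp_all add: lt_u)
 also have "... = finsum H (%l. finsum H (%i. struct_const g i l i .[H] u l k) I) I"
  using k by (intro vs_finsum_swap) simp_all
 also have "... = finsum H (%l. tr l .[H] u l k) I"
  using k by (intro vs_finsum_cong) (simp_all add: vs_finsum_smult_left tr_def)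
 finally show ?thesis using k by (simp add: tr_u)
qed

text \<open>Commuting \<open>Y\<^sub>i\<close> past \<open>u i j\<close> costs a structure constant each time; they add up to a trace.\<close>

lemma iX_shift_gen:
 assumes j: "j \<in> I"
 shows "finsum K (%i. lm (Xg i) *[K] iH (u i j)) I = iX (Xg j) +[K] tr j .[K] \<one>[K]"
proof -
 have "finsum K (%i. lm (Xg i) *[K] iH (u i j)) I = finsum K (%i. iH (u i j) *[K] lm (Xg i) +[K] iH (lt i (u i j))) I"
  using j by (intro vs_finsum_cong) (simp_all add: lm_iH)
 also have "... = iX (Xg j) +[K] finsum K (%i. iH (lt i (u i j))) I"
  using j unfolding iX_gen[OF j] by (intro vs_finsum_add) (simp_all)
 also have "finsum K (%i. iH (lt i (u i j))) I = iH (finsum H (%i. lt i (u i j)) I)"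
  using j by (intro lin_finsum[symmetric] iH_linear) simp_all
 also have "... = tr j .[K] \<one>[K]"
  using j by (simp add: tr_sum lin_smult[OF iH_linear] alg_hom_one[OF iH_hom])
 finally show ?thesis .
qed

end

context dual_pair
begin

lemmas iH_simps = alg_hom_add[OF iH_hom] alg_hom_smult[OF iH_hom] alg_hom_mult[OF iH_hom] alg_hom_one[OF iH_hom]
 and iX_simps = alg_hom_add[OF iX_hom] alg_hom_smult[OF iX_hom] alg_hom_mult[OF iX_hom] alg_hom_one[OF iX_hom]
 and lm_simps = alg_antihom_add[OF lm_antihom] alg_antihom_smult[OF lm_antihom] alg_antihom_mult[OF lm_antihom] alg_antihom_one[OF lm_antihom]

lemma iH_commute: "f :. H ==> h :. H ==> iH f *[K] iH h = iH h *[K] iH f"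
 by (simp add: H_commute flip: iH_simps(3))

lemma K_ext:
 fixes B :: "('k, 'z, 'm) module_scheme"
 assumes "linear_map K B f" "linear_map K B f'" "t :. K"
  and "!!h a. h :. H ==> a :. U ==> f (iH h *[K] iX a) = f' (iH h *[K] iX a)"
 shows "f t = f' t"
 by (rule tensor_ext[where M=H and N=U and E="{}" and B=B and f=f and g=f'])
  (use assms in \<open>simp_all add: K_lin K_simps(1) ten_eq_mult\<close>)

section \<open>The twist by the trace of the adjoint representation\<close>

definition shift :: "'k => ('k, 'g) env => ('k, 'g) env" where
 "shift c = (SOME F. alg_hom U U F \<and> (\<forall>j\<in>I. F (Xg j) = Xg j +[U] (c * tr j) .[U] \<one>[U]))"

text \<open>The trace vanishes on brackets, so the shifted generators satisfy the same relations.\<close>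

lemma shift_exists: "\<exists>F. alg_hom U U F \<and> (\<forall>j\<in>I. F (Xg j) = Xg j +[U] (c * tr j) .[U] \<one>[U])"
proof (rule env_universal_basis[OF g k_algebra_env[of g], of "%j. Xg j +[U] (c * tr j) .[U] \<one>[U]"])
 fix i j assume ij: "i \<in> I" "j \<in> I"
 define b where "b = finsum U (%l. struct_const g i j l .[U] Xg l) I"
 have b: "b :. U" unfolding b_def by (intro vs_finsum_closed) simp_all
 have "(\<Sum>l\<in>I. struct_const g i j l * (c * tr l)) = c * (\<Sum>l\<in>I. tr l * struct_const g i j l)"
  by (simp add: sum_distrib_left mult_ac)
 also have "... = 0" by (simp add: tr_def trace_ad_bracket[OF g])
 finally have zero: "(\<Sum>l\<in>I. struct_const g i j l * (c * tr l)) = 0" .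
 have "finsum U (%l. struct_const g i j l .[U] (Xg l +[U] (c * tr l) .[U] \<one>[U])) I =
   finsum U (%l. struct_const g i j l .[U] Xg l +[U] (struct_const g i j l * (c * tr l)) .[U] \<one>[U]) I"
  by (intro vs_finsum_cong) (simp_all add: vs_smult_add)
 also have "... = b +[U] finsum U (%l. (struct_const g i j l * (c * tr l)) .[U] \<one>[U]) I"
  unfolding b_def by (intro vs_finsum_add) simp_all
 also have "... = b" using b by (simp add: vs_finsum_smult_left zero)
 finally have sum: "finsum U (%l. struct_const g i j l .[U] (Xg l +[U] (c * tr l) .[U] \<one>[U])) I = b" .
 show "(Xg i +[U] (c * tr i) .[U] \<one>[U]) *[U] (Xg j +[U] (c * tr j) .[U] \<one>[U]) =
   (Xg j +[U] (c * tr j) .[U] \<one>[U]) *[U] (Xg i +[U] (c * tr i) .[U] \<one>[U]) +[U]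
   finsum U (%l. struct_const g i j l .[U] (Xg l +[U] (c * tr l) .[U] \<one>[U])) I"
  unfolding sum using b gen_bracket[of i j, folded b_def]
  by (simp add: U.l_distr U.r_distr alg_smult vs_smult_add(1) mult.commute) (simp add: U.a_ac)
qed (simp, blast)

lemma shift_hom: "alg_hom U U (shift c)"
 and shift_gen: "j \<in> I ==> shift c (Xg j) = Xg j +[U] (c * tr j) .[U] \<one>[U]"
 unfolding shift_def using someI_ex[OF shift_exists[of c]] by blast+

lemmas shift_simps = alg_hom_add[OF shift_hom] alg_hom_smult[OF shift_hom] alg_hom_mult[OF shift_hom] alg_hom_one[OF shift_hom]

lemma shift_closed [simp]: "a :. U ==> shift c a :. U"
 by (rule alg_hom_closed[OF shift_hom])

lemma S_S: "f :. H ==> S (S f) = f"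
 by (rule H_eqI) (simp_all add: p_antipode antipode_simps antipode_antipode)

section \<open>The antipode\<close>

abbreviation sh where "sh \<equiv> shift (- 1)"

definition ta :: "('k, 'h \<times> ('k, 'g) env) formal => ('k, 'h \<times> ('k, 'g) env) formal" where
 "ta t = lift2 K (%h a. lm (sh a) *[K] iH (S h)) t"

lemma ta_bilin: "bilin H U K (%h a. lm (sh a) *[K] iH (S h))"
 by (intro bilinI lin_fun_mult_left lin_fun_mult_right lin_comp[OF iH_linear S_linear]
   lin_comp[OF lm_linear alg_hom_linear[OF shift_hom]]) simp_all

lemma ta_linear: "linear_map K K ta"
 unfolding ta_def K_lin(1) by (intro lift_linear ta_bilin) simp_all

lemma ta_mult_ten: "h :. H ==> a :. U ==> ta (ten H U h a) = lm (sh a) *[K] iH (S h)"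
 unfolding ta_def by (simp add: lift_ten[OF _ _ _ _ ta_bilin])

lemma ta_mult: "h :. H ==> a :. U ==> ta (iH h *[K] iX a) = lm (sh a) *[K] iH (S h)"
 by (simp add: ta_mult_ten flip: ten_eq_mult)

lemma lift_comult_rt:
 fixes B :: "('k, 'z, 'm) module_scheme"
 assumes "vspace B" "bilin H H B b" "f :. H"
 shows "lift2 B (%x y. b x y) (comult H (rt j f)) = lift2 B (%x y. b x (rt j y)) (comult H f)"
 unfolding comult_rt[OF assms(3)] using assms
 by (subst H_tl_linear[OF _ lift_linear]) (auto simp: lift_ten bilin_closed[OF assms(2)] intro!: H_tl_cong)

lemma lift_comult_lt:
 fixes B :: "('k, 'z, 'm) module_scheme"
 assumes "vspace B" "bilin H H B b" "f :. H"
 shows "lift2 B (%x y. b x y) (comult H (lt j f)) = lift2 B (%x y. b (lt j x) y) (comult H f)"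
 unfolding comult_lt[OF assms(3)] using assms
 by (subst H_tl_linear[OF _ lift_linear]) (auto simp: lift_ten bilin_closed[OF assms(2)] intro!: H_tl_cong)

lemma lift_rt_lt:
 fixes B :: "('k, 'z, 'm) module_scheme"
 assumes B: "vspace B" and b: "bilin H H B b" and f: "f :. H"
 shows "lift2 B (%x y. b (rt j x) y) (comult H f) = lift2 B (%x y. b x (lt j y)) (comult H f)"
proof -
 note lin = lift_linear[OF H_vspace H_vspace bal_maps_empty B b balanced_empty]
 have bcl: "b x y :. B" if "x :. H" "y :. H" for x y using that by (rule bilin_closed[OF b])
 have "lift2 B (%x y. b (rt j x) y) (comult H f) =
   lift2 B (%x y. b x y) (lift2 HH (%x y. ten H H (rt j x) y) (comult H f))"
  using B b f by (subst H_tl_linear[OF _ lin]) (auto simp: lift_ten bcl intro!: H_tl_cong)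
 also have "... = lift2 B (%x y. b x y) (lift2 HH (%x y. ten H H x (lt j y)) (comult H f))"
  using f by (simp add: comult_rt_lt)
 also have "... = lift2 B (%x y. b x (lt j y)) (comult H f)"
  using B b f by (subst H_tl_linear[OF _ lin]) (auto simp: lift_ten bcl intro!: H_tl_cong)
 finally show ?thesis .
qed

text \<open>This is antimultiplicativity of the antipode on \<open>X\<close> and \<open>f\<close>; for a generator \<open>X\<close> it is the rule
  for moving \<open>\<lambda>(X)\<close> past \<open>S(f)\<close>, as \<open>S\<close> exchanges the two translations up to sign.\<close>

lemma ta_commute:
 assumes f: "f :. H" and a: "a :. U"
 shows "lift2 K (%x y. lm (sh (act a y)) *[K] iH (S x)) (comult H f) = iH (S f) *[K] lm (sh a)"
proof -
 have b: "bilin H H K (%x y. lm (sh (act a y)) *[K] iH (S x))" if "a :. U" for a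
  using that by (intro bilinI lin_fun_mult_left lin_fun_mult_right lin_comp[OF iH_linear S_linear]
   lin_comp[OF lm_linear lin_comp[OF alg_hom_linear[OF shift_hom] act_linear_right]]) simp_all
 have "\<forall>f\<in>carrier H. lift2 K (%x y. lm (sh (act a y)) *[K] iH (S x)) (comult H f) = iH (S f) *[K] lm (sh a)"
  using g a
 proof (induction rule: env_induct_right)
  case one
  show ?case
  proof
   fix f assume f: "f :. H"
   have "lift2 K (%x y. lm (sh (act \<one>[U] y)) *[K] iH (S x)) (comult H f) =
     lift2 K (%x y. iH (S (counit H y .[H] x))) (comult H f)"
    using f by (intro H_tl_cong) (simp_all add: act_one shift_simps lm_simps iH_simps lin_smult[OF S_linear] alg_smult)
   also have "... = iH (S f)"
    using f by (subst H_tl_linear[OF _ lin_comp[OF iH_linear S_linear], symmetric]) (simp_all add: H_counit)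
   finally show "lift2 K (%x y. lm (sh (act \<one>[U] y)) *[K] iH (S x)) (comult H f) = iH (S f) *[K] lm (sh \<one>[U])"
    using f by (simp add: shift_simps lm_simps)
  qed
 next
  case (gen j D)
  show ?case
  proof
   fix f assume f: "f :. H"
   let ?Y = "lm (sh (Xg j))"
   have Y: "?Y = lm (Xg j) +[K] (- tr j) .[K] \<one>[K]" using gen(1) by (simp add: shift_gen lm_simps)
   have comm: "?Y *[K] iH (S f) +[K] iH (S (rt j f)) = iH (S f) *[K] ?Y"
   proof -
    have l: "iH (S (rt j f)) = \<ominus>\<^bsub>K\<^esub> iH (lt j (S f))"
     using f by (simp add: S_rt lin_minus[OF H_vspace K_vspace iH_linear])
    have cancel: "(a +[K] b) +[K] \<ominus>\<^bsub>K\<^esub> a = b" if "a :. K" "b :. K" for a b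
     using that by (simp add: K.a_comm[of a b] K.a_assoc K.r_neg)
    show ?thesis
     unfolding l using f by (simp add: Y K.l_distr K.r_distr lm_iH alg_smult K.a_assoc K.r_neg K.a_ac)
      (simp add: cancel flip: K.a_assoc)
   qed
   have "lift2 K (%x y. lm (sh (act (D *[U] Xg j) y)) *[K] iH (S x)) (comult H f) =
     lift2 K (%x y. ?Y *[K] (lm (sh (act D y)) *[K] iH (S x)) +[K] lm (sh (act D (rt j y))) *[K] iH (S x)) (comult H f)"
    using f gen(1,2) by (intro H_tl_cong) (simp_all add: act_gen_right shift_simps lm_simps K.l_distr K.m_assoc)
   also have "... = lift2 K (%x y. ?Y *[K] (lm (sh (act D y)) *[K] iH (S x))) (comult H f) +[K]
     lift2 K (%x y. lm (sh (act D (rt j y))) *[K] iH (S x)) (comult H f)"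
    using f gen(1,2) by (intro H_tl_add) simp_all
   also have "lift2 K (%x y. ?Y *[K] (lm (sh (act D y)) *[K] iH (S x))) (comult H f) = ?Y *[K] (iH (S f) *[K] lm (sh D))"
    using f gen by (subst H_tl_linear[OF _ lin_mult_left, symmetric]) simp_all
   also have "lift2 K (%x y. lm (sh (act D (rt j y))) *[K] iH (S x)) (comult H f) = iH (S (rt j f)) *[K] lm (sh D)"
    using f gen by (subst lift_comult_rt[OF K_vspace b, symmetric]) simp_all
   also have "?Y *[K] (iH (S f) *[K] lm (sh D)) +[K] iH (S (rt j f)) *[K] lm (sh D) = iH (S f) *[K] ?Y *[K] lm (sh D)"
    using f gen(1,2) by (simp add: comm[symmetric] K.l_distr K.m_assoc)
   also have "... = iH (S f) *[K] lm (sh (D *[U] Xg j))"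
    using f gen(1,2) by (simp add: shift_simps lm_simps K.m_assoc)
   finally show "lift2 K (%x y. lm (sh (act (D *[U] Xg j) y)) *[K] iH (S x)) (comult H f) = iH (S f) *[K] lm (sh (D *[U] Xg j))" .
  qed
 next
  case (add D E)
  have l: "linear_map U K (%D. lift2 K (%x y. lm (sh (act D y)) *[K] iH (S x)) (comult H f))" if "f :. H" for f
   using that by (intro H_tl_fun_linear lin_fun_mult_right lin_comp[OF lm_linear lin_comp[OF alg_hom_linear[OF shift_hom] act_linear]]) simp_all
  show ?case using add by (simp add: lin_add[OF l] shift_simps lm_simps K.r_distr)
 next
  case (smult c D)
  have l: "linear_map U K (%D. lift2 K (%x y. lm (sh (act D y)) *[K] iH (S x)) (comult H f))" if "f :. H" for f
   using that by (intro H_tl_fun_linear lin_fun_mult_right lin_comp[OF lm_linear lin_comp[OF alg_hom_linear[OF shift_hom] act_linear]]) simp_all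
  show ?case using smult by (simp add: lin_smult[OF l] shift_simps lm_simps alg_smult)
 qed
 then show ?thesis using f by blast
qed

lemma ta_antihom: "alg_antihom K K ta"
 unfolding alg_antihom_def
proof (intro conjI ballI ta_linear)
 have one: "ta (iH h *[K] iX \<one>[U]) = iH (S h)" if "h :. H" for h
  using that by (simp add: ta_mult shift_simps lm_simps)
 then show "ta \<one>[K] = \<one>[K]"
  using one[of "\<one>[H]"] by (simp add: iX_simps iH_simps S_one)
 have ten: "ta (ten H U h a *[K] ten H U h' a') = ta (ten H U h' a') *[K] ta (ten H U h a)"
  if "h :. H" "a :. U" "h' :. H" "a' :. U" for h a h' a'
 proof -
  let ?l = "lm (sh a')" and ?r = "iH (S h)"
  have "ta (sm h a h' a') = lift2 K (%x y. ta (ten H U (h *[H] x) (act a y *[U] a'))) (comult H h')"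
   unfolding sm_def using that by (intro H_tl_linear[OF _ ta_linear[unfolded K_lin(1)]]) (simp_all add: K_simps)
  also have "... = lift2 K (%x y. ?l *[K] (lm (sh (act a y)) *[K] iH (S x)) *[K] ?r) (comult H h')"
   using that by (intro H_tl_cong) (simp_all add: ta_mult_ten shift_simps lm_simps S_mult iH_commute iH_simps K.m_assoc)
  also have "... = ?l *[K] lift2 K (%x y. lm (sh (act a y)) *[K] iH (S x)) (comult H h') *[K] ?r"
   using that by (intro H_tl_linear[OF _ lin_fun_mult_right[OF K_algebra _ lin_mult_left], symmetric]) simp_all
  finally show ?thesis using that by (simp add: K_mult_ten ta_mult_ten ta_commute K.m_assoc)
 qed
 fix x y assume x: "x :. K" and y: "y :. K"
 have 1: "ta (ten H U h a *[K] y) = ta y *[K] ta (ten H U h a)" if "h :. H" "a :. U" for h a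
  by (rule K_ext[of K "%y. ta (ten H U h a *[K] y)" "%y. ta y *[K] ta (ten H U h a)"])
   (use that y ten in \<open>simp_all add: lin_comp[OF ta_linear lin_mult_left] lin_fun_mult_right ta_linear lin_closed[OF ta_linear] ten_eq_mult[symmetric]\<close>)
 show "ta (x *[K] y) = ta y *[K] ta x"
  by (rule K_ext[of K "%x. ta (x *[K] y)" "%x. ta y *[K] ta x"])
   (use x y 1 in \<open>simp_all add: lin_comp[OF ta_linear lin_mult_right] lin_fun_mult_left ta_linear lin_closed[OF ta_linear] ten_eq_mult[symmetric]\<close>)
qed

lemma ta_iH: "f :. H ==> ta (iH f) = iH (S f)"
 using ta_mult[of f "\<one>[U]"] by (simp add: iX_simps shift_simps lm_simps)

text \<open>The shift in the definition of the antipode cancels the trace that arises from reordering.\<close>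

lemma ta_lm_gen: "j \<in> I ==> ta (lm (Xg j)) = iX (Xg j)"
proof -
 assume j: "j \<in> I"
 have "ta (lm (Xg j)) = finsum K (%i. ta (iH (v i j) *[K] iX (Xg i))) I"
  unfolding lm_gen[OF j] using j by (intro lin_finsum ta_linear) simp_all
 also have "... = finsum K (%i. lm (Xg i) *[K] iH (u i j) +[K] iH ((- 1) .[H] (tr i .[H] u i j))) I"
  using j by (intro vs_finsum_cong) (simp_all add: ta_mult shift_gen lm_simps v_def S_S K.l_distr alg_smult iH_simps)
 also have "... = finsum K (%i. lm (Xg i) *[K] iH (u i j)) I +[K] finsum K (%i. iH ((- 1) .[H] (tr i .[H] u i j))) I"
  using j by (intro vs_finsum_add) simp_all
 also have "finsum K (%i. iH ((- 1) .[H] (tr i .[H] u i j))) I = iH ((- 1) .[H] finsum H (%i. tr i .[H] u i j) I)"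
  using j by (intro lin_finsum[symmetric] lin_comp[OF iH_linear lin_fun_smult[OF _ _ lin_id]]) simp_all
 also have "... = (- tr j) .[K] \<one>[K]" using j by (simp add: tr_u iH_simps)
 also have "finsum K (%i. lm (Xg i) *[K] iH (u i j)) I +[K] (- tr j) .[K] \<one>[K] =
   iX (Xg j) +[K] (tr j + - tr j) .[K] \<one>[K]"
  using j by (subst vs_smult_add(2)) (simp_all add: iX_shift_gen K.a_assoc)
 finally show ?thesis by simp
qed

lemma ta_lm: "a :. U ==> ta (lm a) = iX a"
 by (rule env_hom_unique[OF g alg_antihom_comp_anti[OF ta_antihom lm_antihom] iX_hom])
  (simp_all add: ta_lm_gen)

section \<open>The opposite factorisation\<close>

definition JU :: "('k, ('k, 'g) env \<times> 'h) formal => ('k, 'h \<times> ('k, 'g) env) formal" where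
 "JU t = lift2 K (%a f. lm a *[K] iH f) t"

lemma JU_bilin: "bilin U H K (%a f. lm a *[K] iH f)"
 by (intro bilinI lin_fun_mult_left lin_fun_mult_right iH_linear lm_linear) simp_all

lemma JU_linear: "linear_map (tensor U H) K JU"
 unfolding JU_def by (intro lift_linear JU_bilin) simp_all

lemma JU_ten: "a :. U ==> f :. H ==> JU (ten U H a f) = lm a *[K] iH f"
 unfolding JU_def by (simp add: lift_ten[OF _ _ _ _ JU_bilin])

text \<open>The antipode turns \<open>\<lambda>(a) f\<close> into \<open>S(f) # a\<close>, from which \<open>a \<otimes> f\<close> can be read off.\<close>

lemma JU_inj: "inj_on JU (carrier (tensor U H))"
proof -
 define R where "R t = lift2 (tensor U H) (%h a. ten U H a (S h)) t" for t
 have b: "bilin H U (tensor U H) (%h a. ten U H a (S h))"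
  by (intro bilinI lin_comp[OF ten_right S_linear] ten_left) simp_all
 have R: "linear_map K (tensor U H) R" unfolding R_def K_lin by (intro lift_linear b) simp_all
 have R_ten: "R (iH h *[K] iX a) = ten U H a (S h)" if "h :. H" "a :. U" for h a
  unfolding R_def using that by (simp add: lift_ten[OF _ _ _ _ b] flip: ten_eq_mult)
 have "R (ta (JU t)) = t" if "t :. (tensor U H)" for t
  by (rule tensor_ext[where M=U and N=H and E="{}" and B="tensor U H" and f="%t. R (ta (JU t))" and g="%t. t"])
   (use that in \<open>simp_all add: lin_comp[OF R lin_comp[OF ta_linear JU_linear]] lin_id JU_ten alg_antihom_mult[OF ta_antihom] ta_iH ta_lm R_ten S_S\<close>)
 then show ?thesis by (rule inj_on_inverseI)
qed

lemma iH_lm: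
 assumes f: "f :. H" and a: "a :. U"
 shows "iH f *[K] lm a = lift2 K (%x y. lm (act a (S x)) *[K] iH y) (comult H f)"
 using g a
proof (induction rule: env_induct_left)
 case one
 have "lift2 K (%x y. lm (act \<one>[U] (S x)) *[K] iH y) (comult H f) = lift2 K (%x y. iH (counit H x .[H] y)) (comult H f)"
 proof -
  have "counit H (S x) = counit H x" if "x :. H" for x
   using p_antipode[of "\<one>[U]" x] that by (simp add: antipode_simps p_one)
  then show ?thesis using f by (intro H_tl_cong) (simp_all add: act_one lm_simps iH_simps alg_smult)
 qed
 also have "... = iH f" using f by (subst H_tl_linear[OF _ iH_linear, symmetric]) (simp_all add: H_counit)
 finally show ?case using f by (simp add: lm_simps)
next
 case (gen j a)
 let ?Y = "lm (Xg j)"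
 have b: "bilin H H K (%x y. lm (act a (S x)) *[K] iH y)"
  using gen(2) by (intro bilinI lin_fun_mult_left lin_fun_mult_right iH_linear lin_comp[OF lm_linear lin_comp[OF act_linear_right S_linear]]) simp_all
 have "lift2 K (%x y. lm (act (Xg j *[U] a) (S x)) *[K] iH y) (comult H f) =
   lift2 K (%x y. ((lm (act a (S x)) *[K] iH y) *[K] ?Y +[K] lm (act a (S x)) *[K] iH (lt j y)) +[K]
    (- 1) .[K] (lm (act a (S (rt j x))) *[K] iH y)) (comult H f)"
 proof (intro H_tl_cong)
  fix x y assume xy: "x :. H" "y :. H"
  have lt: "lt j (S x) = (- 1) .[H] S (rt j x)" using xy by (simp add: S_rt vs_minus_eq_smult)
  show "lm (act (Xg j *[U] a) (S x)) *[K] iH y = ((lm (act a (S x)) *[K] iH y) *[K] ?Y +[K] lm (act a (S x)) *[K] iH (lt j y)) +[K]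
    (- 1) .[K] (lm (act a (S (rt j x))) *[K] iH y)"
   using xy gen(2) by (simp add: act_gen_left lt lin_smult[OF act_linear_right] lm_simps K.l_distr K.m_assoc lm_iH K.r_distr alg_smult)
 qed (use f gen(2) in simp_all)
 also have "... = lift2 K (%x y. (lm (act a (S x)) *[K] iH y) *[K] ?Y) (comult H f) +[K]
   lift2 K (%x y. lm (act a (S x)) *[K] iH (lt j y)) (comult H f) +[K]
   lift2 K (%x y. (- 1) .[K] (lm (act a (S (rt j x))) *[K] iH y)) (comult H f)"
  using f gen(2) by (subst H_tl_add, simp_all, subst H_tl_add, simp_all)
 also have "lift2 K (%x y. (- 1) .[K] (lm (act a (S (rt j x))) *[K] iH y)) (comult H f) =
   (- 1) .[K] lift2 K (%x y. lm (act a (S x)) *[K] iH (lt j y)) (comult H f)"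
  unfolding lift_rt_lt[OF K_vspace b f, symmetric] using f gen(2)
  by (intro H_tl_linear[OF _ lin_fun_smult[OF _ _ lin_id], symmetric]) simp_all
 also have "lift2 K (%x y. (lm (act a (S x)) *[K] iH y) *[K] ?Y) (comult H f) = iH f *[K] lm a *[K] ?Y"
  unfolding gen(3) using f gen(2) by (intro H_tl_linear[OF _ lin_mult_right, symmetric]) simp_all
 finally have *: "lift2 K (%x y. lm (act (Xg j *[U] a) (S x)) *[K] iH y) (comult H f) =
   iH f *[K] lm a *[K] ?Y +[K] lift2 K (%x y. lm (act a (S x)) *[K] iH (lt j y)) (comult H f) +[K]
   (- 1) .[K] lift2 K (%x y. lm (act a (S x)) *[K] iH (lt j y)) (comult H f)" .
 have c: "lift2 K (%x y. lm (act a (S x)) *[K] iH (lt j y)) (comult H f) :. K"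
  using f gen(2) by (intro H_tl_closed) simp_all
 show ?case
  unfolding * using f gen(2) c by (simp add: lm_simps K.a_assoc K.r_neg K.m_assoc flip: vs_minus_eq_smult)
next
 case (add a b)
 have l: "linear_map U K (%a. lift2 K (%x y. lm (act a (S x)) *[K] iH y) (comult H f))"
  using f by (intro H_tl_fun_linear lin_fun_mult_right lin_comp[OF lm_linear act_linear]) simp_all
 show ?case using f add by (simp add: lin_add[OF l] lm_simps K.r_distr)
next
 case (smult c a)
 have l: "linear_map U K (%a. lift2 K (%x y. lm (act a (S x)) *[K] iH y) (comult H f))"
  using f by (intro H_tl_fun_linear lin_fun_mult_right lin_comp[OF lm_linear act_linear]) simp_all
 show ?case using f smult by (simp add: lin_smult[OF l] lm_simps alg_smult)
qed

text \<open>The image contains \<open>f \<lambda>(a)\<close>, hence is stable under right multiplication by \<open>\<lambda>(b)\<close>. An induction on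
  \<open>a\<close> that writes generators \<open>X\<^sub>j\<close> through \<open>\<lambda>(X\<^sub>i)\<close> then gives \<open>f # a\<close>.\<close>

lemma JU_image: "JU ` carrier (tensor U H) = carrier K"
proof (rule subset_antisym)
 let ?Im = "JU ` carrier (tensor U H)"
 show "?Im \<subseteq> carrier K" using lin_closed[OF JU_linear] by blast
 have add: "x +[K] y \<in> ?Im" if xy: "x \<in> ?Im" "y \<in> ?Im" for x y
 proof -
  from xy obtain s t where "x = JU s" "s :. (tensor U H)" "y = JU t" "t :. (tensor U H)" by blast
  then show ?thesis by (intro image_eqI[of _ _ "s +[tensor U H] t"]) (simp_all add: lin_add[OF JU_linear])
 qed
 have smult: "c .[K] x \<in> ?Im" if x: "x \<in> ?Im" for c x
 proof -
  from x obtain s where "x = JU s" "s :. (tensor U H)" by blast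
  then show ?thesis by (intro image_eqI[of _ _ "c .[tensor U H] s"]) (simp_all add: lin_smult[OF JU_linear])
 qed
 have pure: "lm a *[K] iH f \<in> ?Im" if "a :. U" "f :. H" for a f
  using that by (intro image_eqI[of _ _ "ten U H a f"]) (simp_all add: JU_ten)
 have fin: "finsum K x A \<in> ?Im" if "finite A" "!!i. i \<in> A ==> x i \<in> ?Im" for A :: "nat set" and x
  using that
 proof (induction A rule: finite_induct)
  case empty
  have "\<zero>[K] \<in> ?Im" using smult[OF pure[of "\<one>[U]" "\<one>[H]"], of 0] by simp
  then show ?case by simp
 next
  case (insert i A)
  then show ?case using \<open>?Im \<subseteq> carrier K\<close> by (subst vs_finsum_insert) (auto intro: add)
 qed
 have HL: "iH f *[K] lm a \<in> ?Im" if f: "f :. H" and a: "a :. U" for f a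
 proof (intro image_eqI)
  show "lift2 (tensor U H) (%x y. ten U H (act a (S x)) y) (comult H f) :. (tensor U H)"
   using f a by (intro H_tl_closed) simp_all
  show "iH f *[K] lm a = JU (lift2 (tensor U H) (%x y. ten U H (act a (S x)) y) (comult H f))"
   using f a by (subst H_tl_linear[OF _ JU_linear]) (auto simp: iH_lm JU_ten intro!: H_tl_cong)
 qed
 have mult_lm: "x *[K] lm b \<in> ?Im" if x: "x \<in> ?Im" and b: "b :. U" for x b
 proof -
  from x obtain t where t: "x = JU t" "t :. (tensor U H)" by blast
  have "JU t *[K] lm b \<in> ?Im"
   using t(2) env_vspace H_vspace
  proof (induction rule: tensor_induct)
   case (ten a f)
   have "iH f *[K] lm b \<in> ?Im" using HL ten b by blast
   then obtain s where s: "iH f *[K] lm b = JU s" "s :. (tensor U H)" by blast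
   have "lm a *[K] JU s \<in> ?Im"
    using s(2) env_vspace H_vspace
   proof (induction rule: tensor_induct)
    case (ten c h)
    then show ?case using \<open>a :. U\<close> pure[of "c *[U] a" h] by (simp add: JU_ten lm_simps K.m_assoc)
   next
    case (add s t)
    then show ?case using \<open>a :. U\<close> lin_closed[OF JU_linear]
     by (auto simp: lin_add[OF JU_linear] K.r_distr intro: \<open>!!x y. x \<in> ?Im ==> y \<in> ?Im ==> x +[K] y \<in> ?Im\<close>)
   qed
   then show ?case using ten b s(1) by (simp add: JU_ten K.m_assoc)
  next
   case (add s t)
   then show ?case using b lin_closed[OF JU_linear]
    by (auto simp: lin_add[OF JU_linear] K.l_distr intro: \<open>!!x y. x \<in> ?Im ==> y \<in> ?Im ==> x +[K] y \<in> ?Im\<close>)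
  qed
  then show ?thesis by (simp add: t)
 qed
 have HX: "\<forall>f\<in>carrier H. iH f *[K] iX a \<in> ?Im" if "a :. U" for a
  using g that
 proof (induction rule: env_induct_left)
  case one
  show ?case using pure[of "\<one>[U]"] by (auto simp: iX_simps lm_simps)
 next
  case (gen j a)
  show ?case
  proof
   fix f assume f: "f :. H"
   have "iH f *[K] iX (Xg j *[U] a) = iH f *[K] finsum K (%i. iH (u i j) *[K] lm (Xg i)) I *[K] iX a"
    using f gen(1,2) by (simp add: iX_simps iX_gen K.m_assoc)
   also have "... = finsum K (%i. iH f *[K] (iH (u i j) *[K] lm (Xg i)) *[K] iX a) I"
    using f gen(1,2) by (intro lin_finsum lin_fun_mult_right[OF K_algebra _ lin_mult_left]) simp_all
   also have "... = finsum K (%i. (iH (f *[H] u i j) *[K] iX a) *[K] lm (Xg i)) I"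
    using f gen(1,2) by (intro vs_finsum_cong) (simp_all add: iH_simps K.m_assoc iX_lm_commute)
   also have "... \<in> ?Im" using f gen by (intro fin mult_lm) simp_all
   finally show "iH f *[K] iX (Xg j *[U] a) \<in> ?Im" .
  qed
 qed (auto simp: iX_simps K.r_distr alg_smult intro!: add smult)
 show "carrier K \<subseteq> ?Im"
 proof
  fix k assume "k :. K"
  then have "k :. HU" by (simp add: K_simps)
  then show "k \<in> ?Im"
   using H_vspace env_vspace
  proof (induction rule: tensor_induct)
   case (ten h a)
   then show ?case using HX by (simp add: ten_eq_mult)
  next
   case (add s t)
   then show ?case using \<open>!!x y. x \<in> ?Im ==> y \<in> ?Im ==> x +[K] y \<in> ?Im\<close>[of s t] by (simp add: K_simps)
  qed
 qed
qed

end

section \<open>Bialgebroids generated by a Hopf algebra and a base algebra\<close>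

text \<open>Source \<open>al\<close>, target \<open>be\<close> and a Hopf algebra inside \<open>A\<close>. The sign \<open>sg\<close> is \<open>- 1\<close> for the left
  structure and \<open>1\<close> for the right one, whose products are taken in the opposite algebra.\<close>

locale bialgebroid_base = dual_pair g H p u
 for g :: "('k::field, 'g::ab_group_add) based_lie" and H :: "('k, 'h) hopf"
  and p :: "('k, 'g) env => 'h => 'k" and u :: "nat => nat => 'h" +
 fixes A :: "('k, 'a) module" and gl :: "('k, 'g) based_lie" and io :: "'h => 'a"
  and al be :: "('k, 'g) env => 'a" and sg :: 'k
 assumes gl [simp]: "based_lie_algebra gl" and idx_gl: "lie_dim gl = lie_dim g"
  and A_alg [simp]: "k_algebra A"
  and io_hom: "alg_hom H A io" and al_hom: "alg_hom (env gl) A al" and be_anti: "alg_antihom (env gl) A be"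
  and al_be: "l :. (env gl) ==> l' :. (env gl) ==> al l *[A] be l' = be l' *[A] al l"
  and io_al: "f :. H ==> j \<in> idx g ==>
   io f *[A] al (env_gen gl j) = al (env_gen gl j) *[A] io f +[A] sg .[A] io (lt j f)"
  and io_be: "f :. H ==> j \<in> idx g ==>
   io f *[A] be (env_gen gl j) = be (env_gen gl j) *[A] io f +[A] sg .[A] io (rt j f)"
begin

abbreviation L where "L \<equiv> env gl"
abbreviation E where "E \<equiv> left_balancing A L al be"
abbreviation AA where "AA \<equiv> tensor_over E A A"
abbreviation tn where "tn \<equiv> ten_over E A A"
abbreviation yy where "yy \<equiv> env_gen gl"

sublocale A: ring A by (rule k_algebra_ring) simp
sublocale L: ring L by (rule k_algebra_ring) simp

lemma A_vspace [simp]: "vspace A" by simp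

lemmas io_simps = alg_hom_add[OF io_hom] alg_hom_smult[OF io_hom] alg_hom_mult[OF io_hom] alg_hom_one[OF io_hom]
 and al_simps = alg_hom_add[OF al_hom] alg_hom_smult[OF al_hom] alg_hom_mult[OF al_hom] alg_hom_one[OF al_hom]
 and be_simps = alg_antihom_add[OF be_anti] alg_antihom_smult[OF be_anti] alg_antihom_mult[OF be_anti] alg_antihom_one[OF be_anti]

lemmas io_linear = alg_hom_linear[OF io_hom] and al_linear = alg_hom_linear[OF al_hom] and be_linear = alg_antihom_linear[OF be_anti]

lemma frame_closed [simp]:
 "f :. H ==> io f :. A" "l :. L ==> al l :. A" "l :. L ==> be l :. A"
 by (rule lin_closed[OF io_linear] lin_closed[OF al_linear] lin_closed[OF be_linear]; assumption)+

subsection \<open>The balanced square\<close>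

lemma bal_E [simp]: "bal_maps E A A" by (auto simp: bal_maps_def left_balancing_def)

lemma balanced_EI:
 "(!!l x y. l :. L ==> x :. A ==> y :. A ==> b (be l *[A] x) y = b x (al l *[A] y)) ==> balanced E A A b"
 by (auto simp: balanced_def left_balancing_def)

lemma balanced_ED: "balanced E A A b ==> l :. L ==> x :. A ==> y :. A ==>
  b (be l *[A] x) y = b x (al l *[A] y)"
 unfolding balanced_def left_balancing_def by fastforce

lemma tn_balanced: "l :. L ==> x :. A ==> y :. A ==> tn (be l *[A] x) y = tn x (al l *[A] y)"
 using ten_balanced[of E A A] unfolding balanced_def left_balancing_def by fastforce

lemma tn_bilin: "linear_map A A f ==> linear_map A A h ==> bilin A A AA (%x y. tn (f x) (h y))"
 by (intro bilinI lin_comp[OF ten_right] lin_comp[OF ten_left]) (simp_all add: lin_closed)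

lemmas AA_linear = lift_linear[OF A_vspace A_vspace bal_E]
 and AA_ten = lift_ten[OF A_vspace A_vspace bal_E]
 and AA_tl_cong = tl2_cong[OF A_vspace A_vspace bal_E]
 and AA_tl_closed = tl2_closed[OF A_vspace A_vspace bal_E]
 and AA_tl_linear = tl2_linear[OF A_vspace A_vspace bal_E]
 and AA_tl_fun_linear = tl2_fun_linear[OF A_vspace A_vspace bal_E]
 and AA_ext = tensor_ext[OF A_vspace A_vspace, where E = E]

definition mL :: "('k, 'g) env => ('k, 'a \<times> 'a) formal => ('k, 'a \<times> 'a) formal" where
 "mL l s = lift2 AA (%x y. tn (al l *[A] x) y) s"

definition mB :: "('k, 'g) env => ('k, 'a \<times> 'a) formal => ('k, 'a \<times> 'a) formal" where
 "mB l s = lift2 AA (%x y. tn x (be l *[A] y)) s"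

lemma mL_bilin: "l :. L ==> bilin A A AA (%x y. tn (al l *[A] x) y)"
 by (intro tn_bilin lin_mult_left lin_id) simp_all

lemma mL_balanced: "l :. L ==> balanced E A A (%x y. tn (al l *[A] x) y)"
proof (intro balanced_EI)
 fix l' x y assume *: "l :. L" "l' :. L" "x :. A" "y :. A"
 have "al l *[A] (be l' *[A] x) = be l' *[A] (al l *[A] x)"
  using * by (simp add: al_be flip: A.m_assoc)
 then show "tn (al l *[A] (be l' *[A] x)) y = tn (al l *[A] x) (al l' *[A] y)"
  using * by (simp add: tn_balanced)
qed

lemma mL_linear: "l :. L ==> linear_map AA AA (mL l)"
 unfolding mL_def by (intro AA_linear mL_bilin mL_balanced) simp_all

lemma mL_ten: "l :. L ==> x :. A ==> z :. A ==> mL l (tn x z) = tn (al l *[A] x) z"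
 unfolding mL_def by (simp add: AA_ten[OF _ mL_bilin mL_balanced])

lemma mB_bilin: "l :. L ==> bilin A A AA (%x y. tn x (be l *[A] y))"
 by (intro tn_bilin lin_mult_left lin_id) simp_all

lemma mB_balanced: "l :. L ==> balanced E A A (%x y. tn x (be l *[A] y))"
 by (intro balanced_EI) (simp add: tn_balanced, simp add: al_be flip: A.m_assoc)

lemma mB_linear: "l :. L ==> linear_map AA AA (mB l)"
 unfolding mB_def by (intro AA_linear mB_bilin mB_balanced) simp_all

lemma mB_ten: "l :. L ==> x :. A ==> z :. A ==> mB l (tn x z) = tn x (be l *[A] z)"
 unfolding mB_def by (simp add: AA_ten[OF _ mB_bilin mB_balanced])

lemma mL_closed [simp]: "l :. L ==> s :. AA ==> mL l s :. AA"
 and mB_closed [simp]: "l :. L ==> s :. AA ==> mB l s :. AA"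
 by (rule lin_closed[OF mL_linear] lin_closed[OF mB_linear]; assumption)+

lemma mL_mL:
 assumes "l :. L" "l' :. L" "s :. AA"
 shows "mL l (mL l' s) = mL (l *[L] l') s"
 by (rule AA_ext[where B=AA and f="%s. mL l (mL l' s)" and g="mL (l *[L] l')"])
  (use assms in \<open>simp_all add: lin_comp[OF mL_linear mL_linear] mL_linear mL_ten al_simps A.m_assoc\<close>)

lemma mB_mB:
 assumes "l :. L" "l' :. L" "s :. AA"
 shows "mB l (mB l' s) = mB (l' *[L] l) s"
 by (rule AA_ext[where B=AA and f="%s. mB l (mB l' s)" and g="mB (l' *[L] l)"])
  (use assms in \<open>simp_all add: lin_comp[OF mB_linear mB_linear] mB_linear mB_ten be_simps A.m_assoc\<close>)

lemma mL_one: "s :. AA ==> mL \<one>[L] s = s"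
 by (rule AA_ext[where B=AA and f="mL \<one>[L]" and g="%s. s"]) (simp_all add: mL_linear lin_id mL_ten al_simps)

lemma mB_one: "s :. AA ==> mB \<one>[L] s = s"
 by (rule AA_ext[where B=AA and f="mB \<one>[L]" and g="%s. s"]) (simp_all add: mB_linear lin_id mB_ten be_simps)

lemma mL_lin: "s :. AA ==> linear_map L AA (%l. mL l s)"
 and mB_lin: "s :. AA ==> linear_map L AA (%l. mB l s)"
 unfolding mL_def mB_def
 by (intro AA_tl_fun_linear lin_comp[OF ten_left] lin_comp[OF ten_right] lin_fun_mult_right al_linear be_linear; simp)+

end

text \<open>Comultiplication and counit need only be compatible with generators of the base, and elements
  \<open>al l f\<close> must span; symmetric roles of \<open>al\<close> and \<open>be\<close> allow both kinds of bialgebroid.\<close>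

locale bialgebroid_frame = bialgebroid_base g H p u A gl io al be sg
 for g :: "('k::field, 'g::ab_group_add) based_lie" and H :: "('k, 'h) hopf"
  and p :: "('k, 'g) env => 'h => 'k" and u :: "nat => nat => 'h"
  and A :: "('k, 'a) module" and gl :: "('k, 'g) based_lie" and io :: "'h => 'a"
  and al be :: "('k, 'g) env => 'a" and sg :: 'k +
 fixes De :: "'a => ('k, 'a \<times> 'a) formal" and ep :: "'a => ('k, 'g) env"
 assumes span: "b :. A ==>
   (!!l f. l :. (env gl) ==> f :. H ==> P (al l *[A] io f)) ==>
   (!!b c. b :. A ==> c :. A ==> P b ==> P c ==> P (b +[A] c)) ==> P b"
  and De_linear: "linear_map A (tensor_over (left_balancing A (env gl) al be) A A) De"
  and De_al_gen: "j \<in> idx g ==> b :. A ==> De (al (env_gen gl j) *[A] b) =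
   tensor_lift (tensor_over (left_balancing A (env gl) al be) A A)
    (%(x, y). ten_over (left_balancing A (env gl) al be) A A (al (env_gen gl j) *[A] x) y) (De b)"
  and De_be_gen: "j \<in> idx g ==> b :. A ==> De (be (env_gen gl j) *[A] b) =
   tensor_lift (tensor_over (left_balancing A (env gl) al be) A A)
    (%(x, y). ten_over (left_balancing A (env gl) al be) A A x (be (env_gen gl j) *[A] y)) (De b)"
  and De_io: "f :. H ==> De (io f) =
   tensor_lift (tensor_over (left_balancing A (env gl) al be) A A)
    (%(x, y). ten_over (left_balancing A (env gl) al be) A A (io x) (io y)) (comult H f)"
  and ep_linear: "linear_map A (env gl) ep"
  and ep_al_gen: "j \<in> idx g ==> b :. A ==> ep (al (env_gen gl j) *[A] b) = env_gen gl j *[env gl] ep b"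
  and ep_be_gen: "j \<in> idx g ==> b :. A ==> ep (be (env_gen gl j) *[A] b) = ep b *[env gl] env_gen gl j"
  and ep_io: "f :. H ==> ep (io f) = counit H f .[env gl] \<one>[env gl]"
begin

lemma De_closed [simp]: "b :. A ==> De b :. AA"
 and ep_closed [simp]: "b :. A ==> ep b :. L"
 by (rule lin_closed[OF De_linear] lin_closed[OF ep_linear]; assumption)+

lemmas frame_induct [consumes 1, case_names mult add] = span

lemma mL_De: "l :. L ==> b :. A ==> De (al l *[A] b) = mL l (De b)"
proof -
 assume l: "l :. L" and b: "b :. A"
 have gen: "De (al (yy j) *[A] b) = mL (yy j) (De b)" if "j \<in> idx gl" "b :. A" for j b
  using De_al_gen that by (simp add: mL_def idx_gl)
 show ?thesis using gl l
  by (induction rule: env_induct_left)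
   (simp_all add: b al_simps A.m_assoc gen mL_mL mL_one A.l_distr alg_smult lin_add[OF De_linear] lin_smult[OF De_linear]
    lin_add[OF mL_lin] lin_smult[OF mL_lin])
qed

lemma mB_De: "l :. L ==> b :. A ==> De (be l *[A] b) = mB l (De b)"
proof -
 assume l: "l :. L" and b: "b :. A"
 have gen: "De (be (yy j) *[A] b) = mB (yy j) (De b)" if "j \<in> idx gl" "b :. A" for j b
  using De_be_gen that by (simp add: mB_def idx_gl)
 show ?thesis using gl l
  by (induction rule: env_induct_right)
   (simp_all add: b be_simps A.m_assoc gen mB_mB mB_one A.l_distr alg_smult lin_add[OF De_linear] lin_smult[OF De_linear]
    lin_add[OF mB_lin] lin_smult[OF mB_lin])
qed

lemma De_al: "l :. L ==> b :. A ==> De (al l *[A] b) = lift2 AA (%x y. tn (al l *[A] x) y) (De b)"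
 and De_be: "l :. L ==> b :. A ==> De (be l *[A] b) = lift2 AA (%x y. tn x (be l *[A] y)) (De b)"
 by (simp_all add: mL_De mB_De flip: mL_def mB_def)

lemma ep_al: "l :. L ==> b :. A ==> ep (al l *[A] b) = l *[L] ep b"
proof -
 assume l: "l :. L" and b: "b :. A"
 show ?thesis using gl l
  by (induction rule: env_induct_left)
   (simp_all add: b al_simps A.m_assoc ep_al_gen idx_gl L.m_assoc A.l_distr L.l_distr alg_smult lin_add[OF ep_linear] lin_smult[OF ep_linear])
qed

lemma ep_be: "l :. L ==> b :. A ==> ep (be l *[A] b) = ep b *[L] l"
proof -
 assume l: "l :. L" and b: "b :. A"
 show ?thesis using gl l
  by (induction rule: env_induct_right)
   (simp_all add: b be_simps A.m_assoc ep_be_gen idx_gl L.m_assoc A.l_distr L.r_distr alg_smult lin_add[OF ep_linear] lin_smult[OF ep_linear])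
qed

lemma lift_De_io:
 fixes B :: "('k, 'z, 'm) module_scheme"
 assumes B: "vspace B" and b: "bilin A A B b" "balanced E A A b" and f: "f :. H"
 shows "lift2 B (%x y. b x y) (De (io f)) = lift2 B (%x y. b (io x) (io y)) (comult H f)"
 unfolding De_io[OF f] using f B
 by (subst H_tl_linear[OF _ AA_linear[OF B b]]) (auto simp: AA_ten[OF B b] bilin_closed[OF b(1)] intro!: H_tl_cong)

lemma lift_De:
 fixes B :: "('k, 'z, 'm) module_scheme"
 assumes B: "vspace B" and b: "bilin A A B b" "balanced E A A b" and f: "f :. H" and l: "l :. L"
 shows "lift2 B (%x y. b x y) (De (al l *[A] io f)) =
  lift2 B (%x y. b (al l *[A] io x) (io y)) (comult H f)"
proof -
 have "lift2 B (%x y. b x y) (De (al l *[A] io f)) = lift2 B (%x y. b (al l *[A] x) y) (De (io f))"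
  unfolding De_al[OF l frame_closed(1)[OF f]] using f l B
  by (subst AA_tl_linear[OF _ AA_linear[OF B b]]) (auto simp: AA_ten[OF B b] bilin_closed[OF b(1)] intro!: AA_tl_cong)
 also have "... = lift2 B (%x y. b (al l *[A] io x) (io y)) (comult H f)"
 proof (intro lift_De_io B f bilinI balanced_EI)
  show "linear_map A B (%y. b (al l *[A] x) y)" if "x :. A" for x
   using that l by (intro bilin_right[OF b(1)]) simp
  show "linear_map A B (%x. b (al l *[A] x) y)" if "y :. A" for y
   using that l by (intro lin_comp[OF bilin_left[OF b(1)]] lin_mult_left) simp_all
  show "b (al l *[A] (be l' *[A] x)) y = b (al l *[A] x) (al l' *[A] y)"
   if "l' :. L" "x :. A" "y :. A" for l' x y
  proof -
   have "al l *[A] (be l' *[A] x) = be l' *[A] (al l *[A] x)"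
    using that l by (simp add: al_be flip: A.m_assoc)
   then show ?thesis using that l by (simp add: balanced_ED[OF b(2)])
  qed
 qed
 finally show ?thesis .
qed

subsection \<open>Componentwise multiplication from the right and the Takeuchi condition\<close>

definition mR :: "'a => 'a => ('k, 'a \<times> 'a) formal => ('k, 'a \<times> 'a) formal" where
 "mR c d s = lift2 AA (%x y. tn (x *[A] c) (y *[A] d)) s"

lemma mR_bilin: "c :. A ==> d :. A ==> bilin A A AA (%x y. tn (x *[A] c) (y *[A] d))"
 by (intro tn_bilin lin_mult_right) simp_all

lemma mR_balanced: "c :. A ==> d :. A ==> balanced E A A (%x y. tn (x *[A] c) (y *[A] d))"
 by (intro balanced_EI) (simp add: A.m_assoc tn_balanced)

lemma mR_linear: "c :. A ==> d :. A ==> linear_map AA AA (mR c d)"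
 unfolding mR_def by (intro AA_linear mR_bilin mR_balanced) simp_all

lemma mR_ten: "c :. A ==> d :. A ==> x :. A ==> z :. A ==> mR c d (tn x z) = tn (x *[A] c) (z *[A] d)"
 unfolding mR_def by (simp add: AA_ten[OF _ mR_bilin mR_balanced])

lemma mR_closed [simp]: "c :. A ==> d :. A ==> s :. AA ==> mR c d s :. AA"
 by (rule lin_closed[OF mR_linear])

lemma mR_mR:
 assumes "c :. A" "d :. A" "c' :. A" "d' :. A" "s :. AA"
 shows "mR c d (mR c' d' s) = mR (c' *[A] c) (d' *[A] d) s"
 by (rule AA_ext[where B=AA and f="%s. mR c d (mR c' d' s)" and g="mR (c' *[A] c) (d' *[A] d)"])
  (use assms in \<open>simp_all add: lin_comp[OF mR_linear mR_linear] mR_linear mR_ten A.m_assoc\<close>)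

lemma mR_mL:
 assumes "c :. A" "d :. A" "l :. L" "s :. AA"
 shows "mR c d (mL l s) = mL l (mR c d s)"
 by (rule AA_ext[where B=AA and f="%s. mR c d (mL l s)" and g="%s. mL l (mR c d s)"])
  (use assms in \<open>simp_all add: lin_comp[OF mR_linear mL_linear] lin_comp[OF mL_linear mR_linear] mR_ten mL_ten A.m_assoc\<close>)

lemma mR_lin1: "s :. AA ==> d :. A ==> linear_map A AA (%c. mR c d s)"
 and mR_lin2: "s :. AA ==> c :. A ==> linear_map A AA (%d. mR c d s)"
 unfolding mR_def by (intro AA_tl_fun_linear lin_comp[OF ten_left] lin_comp[OF ten_right] lin_mult_left; simp)+

definition takeuchi :: "('k, 'a \<times> 'a) formal => bool" where
 "takeuchi s \<longleftrightarrow> (\<forall>l\<in>carrier L. mR (be l) \<one>[A] s = mR \<one>[A] (al l) s)"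

text \<open>The elements \<open>l\<close> for which the condition holds form a subalgebra, because the two operations on
  the different tensor factors commute.\<close>

lemma takeuchi_generators:
 assumes s: "s :. AA" and gen: "!!j. j \<in> I ==> mR (be (yy j)) \<one>[A] s = mR \<one>[A] (al (yy j)) s"
 shows "takeuchi s"
 unfolding takeuchi_def
proof
 fix l assume "l :. L"
 with gl show "mR (be l) \<one>[A] s = mR \<one>[A] (al l) s"
 proof (induction rule: env_induct)
  case one
  show ?case by (simp add: al_simps be_simps)
 next
  case (gen j)
  then show ?case using assms(2) by (simp add: idx_gl)
 next
  case (add l l')
  then show ?case using s by (simp add: al_simps be_simps lin_add[OF mR_lin1] lin_add[OF mR_lin2])
 next
  case (smult c l)
  then show ?case using s by (simp add: al_simps be_simps lin_smult[OF mR_lin1] lin_smult[OF mR_lin2])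
 next
  case (mult l l')
  have "mR (be (l *[L] l')) \<one>[A] s = mR (be l) \<one>[A] (mR \<one>[A] (al l') s)"
   using mult s by (simp add: be_simps mR_mR flip: mult(4))
  also have "... = mR \<one>[A] (al l') (mR \<one>[A] (al l) s)"
   unfolding mult(3)[symmetric] using mult(1,2) s by (simp add: mR_mR)
  finally show ?case using mult(1,2) s by (simp add: al_simps mR_mR)
 qed
qed

text \<open>On generators both sides differ from \<open>\<Sum> f\<^sub>1 \<otimes> Y f\<^sub>2\<close> by corresponding translation terms.\<close>

lemma takeuchi_De: "b :. A ==> takeuchi (De b)"
proof (induction rule: frame_induct)
 case (mult l f)
 show ?case
 proof (rule takeuchi_generators)
  fix j assume j: "j \<in> I"
  let ?Y = "al (yy j)" and ?Z = "be (yy j)"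
  have b: "bilin H H AA (%x z. sg .[AA] tn (al l *[A] io x) (io z))"
   using mult by (intro bilinI lin_fun_smult lin_comp[OF ten_right] lin_comp[OF ten_left] io_linear lin_fun_mult_left) simp_all
  have "mR ?Z \<one>[A] (De (al l *[A] io f)) = lift2 AA (%x z. tn (al l *[A] io x *[A] ?Z) (io z *[A] \<one>[A])) (comult H f)"
   unfolding mR_def using mult j by (intro lift_De mR_bilin mR_balanced) simp_all
  also have "... = lift2 AA (%x z. tn (al l *[A] io x) (?Y *[A] io z) +[AA] sg .[AA] tn (al l *[A] io (rt j x)) (io z)) (comult H f)"
  proof (intro H_tl_cong)
   fix x z assume xz: "x :. H" "z :. H"
   have "al l *[A] io x *[A] ?Z = al l *[A] (?Z *[A] io x) +[A] sg .[A] (al l *[A] io (rt j x))"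
    using xz mult j by (simp add: A.m_assoc io_be A.r_distr alg_smult)
   also have "al l *[A] (?Z *[A] io x) = ?Z *[A] (al l *[A] io x)"
    using xz mult by (simp add: al_be flip: A.m_assoc)
   finally show "tn (al l *[A] io x *[A] ?Z) (io z *[A] \<one>[A]) =
     tn (al l *[A] io x) (?Y *[A] io z) +[AA] sg .[AA] tn (al l *[A] io (rt j x)) (io z)"
    using xz mult by (simp add: lin_add[OF ten_left] lin_smult[OF ten_left] tn_balanced)
  qed (use mult in simp_all)
  also have "... = lift2 AA (%x z. tn (al l *[A] io x) (?Y *[A] io z)) (comult H f) +[AA]
    lift2 AA (%x z. sg .[AA] tn (al l *[A] io (rt j x)) (io z)) (comult H f)"
   using mult by (intro H_tl_add) simp_all
  also have "lift2 AA (%x z. sg .[AA] tn (al l *[A] io (rt j x)) (io z)) (comult H f) =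
    lift2 AA (%x z. sg .[AA] tn (al l *[A] io x) (io (lt j z))) (comult H f)"
   using mult by (intro lift_rt_lt[OF _ b]) simp_all
  also have "lift2 AA (%x z. tn (al l *[A] io x) (?Y *[A] io z)) (comult H f) +[AA] ... =
    lift2 AA (%x z. tn (al l *[A] io x) (?Y *[A] io z) +[AA] sg .[AA] tn (al l *[A] io x) (io (lt j z))) (comult H f)"
   using mult by (intro H_tl_add[symmetric]) simp_all
  also have "... = lift2 AA (%x z. tn (al l *[A] io x *[A] \<one>[A]) (io z *[A] ?Y)) (comult H f)"
   using mult j by (intro H_tl_cong) (simp_all add: io_al lin_add[OF ten_right] lin_smult[OF ten_right])
  also have "... = mR \<one>[A] ?Y (De (al l *[A] io f))"
   unfolding mR_def using mult j by (intro lift_De[symmetric] mR_bilin mR_balanced) simp_all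
  finally show "mR ?Z \<one>[A] (De (al l *[A] io f)) = mR \<one>[A] ?Y (De (al l *[A] io f))" .
 qed (use mult in simp)
next
 case (add b c)
 then show ?case by (simp add: takeuchi_def lin_add[OF De_linear] lin_add[OF mR_linear])
qed

subsection \<open>Multiplicativity\<close>

definition tm :: "('k, 'a \<times> 'a) formal => ('k, 'a \<times> 'a) formal => ('k, 'a \<times> 'a) formal" where
 "tm s t = lift2 AA (%c d. mR c d s) t"

lemma tm_eq:
 assumes "s :. AA" "t :. AA"
 shows "takeuchi_mult E A s t = tm s t"
 unfolding takeuchi_mult_def tm_def mR_def using assms
 by (intro tl2_swap[OF A_vspace A_vspace bal_E _ _ A_vspace A_vspace bal_E]) simp_all

lemma tm_bilin: "s :. AA ==> bilin A A AA (%c d. mR c d s)"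
 by (intro bilinI mR_lin1 mR_lin2)

text \<open>Only for \<open>s\<close> in the Takeuchi product does the componentwise product not depend on the
  representative of the second factor.\<close>

lemma tm_balanced: "s :. AA ==> takeuchi s ==> balanced E A A (%c d. mR c d s)"
proof (intro balanced_EI)
 fix l c d assume *: "s :. AA" "takeuchi s" "l :. L" "c :. A" "d :. A"
 have "mR (be l *[A] c) d s = mR c d (mR (be l) \<one>[A] s)" using * by (simp add: mR_mR)
 also have "... = mR c d (mR \<one>[A] (al l) s)" using * by (simp add: takeuchi_def)
 finally show "mR (be l *[A] c) d s = mR c (al l *[A] d) s" using * by (simp add: mR_mR)
qed

lemma tm_linear: "s :. AA ==> takeuchi s ==> linear_map AA AA (tm s)"
 unfolding tm_def by (intro AA_linear tm_bilin tm_balanced) simp_all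

lemma tm_ten: "s :. AA ==> takeuchi s ==> c :. A ==> d :. A ==> tm s (tn c d) = mR c d s"
 unfolding tm_def by (simp add: AA_ten[OF _ tm_bilin tm_balanced])

lemma tm_linear_left: "t :. AA ==> linear_map AA AA (%s. tm s t)"
 unfolding tm_def by (intro AA_tl_fun_linear mR_linear) simp_all

lemma tm_mL: "s :. AA ==> t :. AA ==> l :. L ==> tm (mL l s) t = mL l (tm s t)"
 unfolding tm_def by (subst AA_tl_linear[OF _ mL_linear]) (auto simp: mR_mL intro!: AA_tl_cong)

lemma De_io_mult_aux:
 assumes f: "f :. H" and x: "x :. A" "z :. A"
 shows "mR x z (De (io f)) = lift2 AA (%c d. tn (io c *[A] x) (io d *[A] z)) (comult H f)"
 unfolding mR_def using assms by (intro lift_De_io mR_bilin mR_balanced) simp_all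

lemma tm_De_gen:
 assumes f: "f :. H" and j: "j \<in> I" and t: "t :. AA"
 shows "tm (De (io f)) (mL (yy j) t) = mL (yy j) (tm (De (io f)) t) +[AA] sg .[AA] tm (De (io (lt j f))) t"
proof (rule AA_ext[where B=AA and f="%t. tm (De (io f)) (mL (yy j) t)"
   and g="%t. mL (yy j) (tm (De (io f)) t) +[AA] sg .[AA] tm (De (io (lt j f))) t", OF _ _ _ t])
 have l: "linear_map AA AA (tm (De (io f)))" if "f :. H" for f
  using that by (intro tm_linear takeuchi_De) simp_all
 show "linear_map AA AA (%t. tm (De (io f)) (mL (yy j) t))"
  using f by (intro lin_comp[OF l mL_linear]) simp_all
 show "linear_map AA AA (%t. mL (yy j) (tm (De (io f)) t) +[AA] sg .[AA] tm (De (io (lt j f))) t)"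
  using f by (intro lin_fun_add lin_fun_smult lin_comp[OF mL_linear l] l) simp_all
 fix m n assume mn: "m :. A" "n :. A"
 have b: "bilin H H AA (%c d. tn (io c *[A] m) (io d *[A] n))"
  using mn by (intro bilinI lin_comp[OF ten_right] lin_comp[OF ten_left] io_linear lin_fun_mult_right) simp_all
 have "tm (De (io f)) (mL (yy j) (tn m n)) = mR (al (yy j) *[A] m) n (De (io f))"
  using f mn by (simp add: mL_ten tm_ten takeuchi_De)
 also have "... = lift2 AA (%c d. tn (al (yy j) *[A] (io c *[A] m)) (io d *[A] n) +[AA]
   sg .[AA] tn (io (lt j c) *[A] m) (io d *[A] n)) (comult H f)"
  using f mn j
  by (subst De_io_mult_aux, simp_all)
   (intro H_tl_cong, simp_all add: io_al A.l_distr alg_smult lin_add[OF ten_left] lin_smult[OF ten_left] flip: A.m_assoc)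
 also have "... = lift2 AA (%c d. tn (al (yy j) *[A] (io c *[A] m)) (io d *[A] n)) (comult H f) +[AA]
   lift2 AA (%c d. sg .[AA] tn (io (lt j c) *[A] m) (io d *[A] n)) (comult H f)"
  using f mn by (intro H_tl_add) simp_all
 also have "lift2 AA (%c d. tn (al (yy j) *[A] (io c *[A] m)) (io d *[A] n)) (comult H f) = mL (yy j) (mR m n (De (io f)))"
  using f mn by (subst De_io_mult_aux, simp_all, subst H_tl_linear[OF _ mL_linear])
   (auto simp: mL_ten intro!: H_tl_cong)
 also have "lift2 AA (%c d. sg .[AA] tn (io (lt j c) *[A] m) (io d *[A] n)) (comult H f) =
   sg .[AA] lift2 AA (%c d. tn (io (lt j c) *[A] m) (io d *[A] n)) (comult H f)"
  using f mn by (intro H_tl_linear[OF _ lin_fun_smult[OF _ _ lin_id], symmetric]) simp_all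
 also have "lift2 AA (%c d. tn (io (lt j c) *[A] m) (io d *[A] n)) (comult H f) = mR m n (De (io (lt j f)))"
  using f mn by (subst De_io_mult_aux) (simp_all add: lift_comult_lt[OF _ b])
 finally show "tm (De (io f)) (mL (yy j) (tn m n)) =
   mL (yy j) (tm (De (io f)) (tn m n)) +[AA] sg .[AA] tm (De (io (lt j f))) (tn m n)"
  using f mn by (simp add: tm_ten takeuchi_De)
qed

lemma De_io_mult:
 assumes f: "f :. H" and h: "h :. H"
 shows "De (io (f *[H] h)) = tm (De (io f)) (De (io h))"
proof -
 have b: "bilin H H AA (%x z. tn (io x) (io z))"
  by (intro bilinI lin_comp[OF ten_right] lin_comp[OF ten_left] io_linear) simp_all
 note lin = lift_linear[OF H_vspace H_vspace bal_maps_empty vspace_tensor_over b balanced_empty]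
 have i: "lift2 HH (%x' y'. ten H H (x *[H] x') (z *[H] y')) (comult H h) :. HH"
  if "x :. H" "z :. H" for x z
  using that h by (intro H_tl_closed) simp_all
 have "De (io (f *[H] h)) = lift2 AA (%x z. lift2 AA (%x' z'. tn (io (x *[H] x')) (io (z *[H] z'))) (comult H h)) (comult H f)"
  using f h i
  apply (simp only: De_io H.m_closed H_comult_mult)
  apply (subst H_tl_linear[OF _ lin])
  apply (simp_all)
  apply (intro H_tl_cong)
  apply simp_all
  apply (subst H_tl_linear[OF _ lin])
  apply (auto simp: lift_ten[OF _ _ _ _ b] intro!: H_tl_cong H_tl_closed)
  done
 also have "... = lift2 AA (%x' z'. lift2 AA (%x z. tn (io (x *[H] x')) (io (z *[H] z'))) (comult H f)) (comult H h)"
  using f h by (intro H_tl_swap) simp_all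
 also have "... = lift2 AA (%x' z'. mR (io x') (io z') (De (io f))) (comult H h)"
  using f h by (intro H_tl_cong) (auto simp: De_io_mult_aux io_simps intro!: H_tl_cong H_tl_closed)
 also have "... = tm (De (io f)) (De (io h))"
  unfolding tm_def using f h by (intro lift_De_io[symmetric] tm_bilin tm_balanced takeuchi_De) simp_all
 finally show ?thesis .
qed

text \<open>Induction on \<open>l\<close>: moving \<open>f\<close> past a generator gives a translation of \<open>f\<close>, and the product of
  the coproducts behaves in the same way by \<open>tm_De_gen\<close>.\<close>

lemma De_io_frame:
 assumes l: "l :. L" and h: "h :. H"
 shows "\<forall>f\<in>carrier H. De (io f *[A] (al l *[A] io h)) = tm (De (io f)) (De (al l *[A] io h))"
 using gl l
proof (induction rule: env_induct_left)
 case one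
 then show ?case using h by (simp add: al_simps De_io_mult flip: io_simps)
next
 case (gen j l)
 show ?case
 proof
  fix f assume f: "f :. H"
  let ?b = "al l *[A] io h"
  have j: "j \<in> I" using gen by (simp add: idx_gl)
  have b: "?b :. A" using gen h by simp
  have "io f *[A] (al (yy j *[L] l) *[A] io h) = (io f *[A] al (yy j)) *[A] ?b"
   using f h gen by (simp add: al_simps A.m_assoc)
  also have "... = al (yy j) *[A] (io f *[A] ?b) +[A] sg .[A] (io (lt j f) *[A] ?b)"
   using f b j by (simp add: io_al A.l_distr alg_smult A.m_assoc)
  finally have "De (io f *[A] (al (yy j *[L] l) *[A] io h)) =
    mL (yy j) (tm (De (io f)) (De ?b)) +[AA] sg .[AA] tm (De (io (lt j f))) (De ?b)"
   using f b gen(3) by (simp add: lin_add[OF De_linear] lin_smult[OF De_linear] mL_De)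
  also have "... = tm (De (io f)) (mL (yy j) (De ?b))"
   using f b j by (simp add: tm_De_gen)
  also have "mL (yy j) (De ?b) = De (al (yy j *[L] l) *[A] io h)"
   using b h gen(2) by (simp add: al_simps A.m_assoc flip: mL_De)
  finally show "De (io f *[A] (al (yy j *[L] l) *[A] io h)) = tm (De (io f)) (De (al (yy j *[L] l) *[A] io h))" .
 qed
next
 case (add l l')
 then show ?case using h
  by (simp add: al_simps A.l_distr A.r_distr lin_add[OF De_linear] lin_add[OF tm_linear] takeuchi_De)
next
 case (smult c l)
 then show ?case using h
  by (simp add: al_simps alg_smult lin_smult[OF De_linear] lin_smult[OF tm_linear] takeuchi_De)
qed

lemma De_mult: "b :. A ==> c :. A ==> De (b *[A] c) = tm (De b) (De c)"
proof (induction arbitrary: c rule: frame_induct)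
 case (mult l f)
 have "De (io f *[A] c) = tm (De (io f)) (De c)"
  using mult(3)
 proof (induction rule: frame_induct)
  case (mult l' h)
  then show ?case using De_io_frame mult(2) \<open>f :. H\<close> by blast
 next
  case (add b c)
  then show ?case using \<open>f :. H\<close>
   by (simp add: A.r_distr lin_add[OF De_linear] lin_add[OF tm_linear] takeuchi_De)
 qed
 then show ?case using mult by (simp add: A.m_assoc mL_De tm_mL)
next
 case (add b b')
 then show ?case by (simp add: A.l_distr lin_add[OF De_linear] lin_add[OF tm_linear_left])
qed

lemma De_one: "De \<one>[A] = tn \<one>[A] \<one>[A]"
proof -
 have b: "bilin H H AA (%x z. tn (io x) (io z))"
  by (intro bilinI lin_comp[OF ten_right] lin_comp[OF ten_left] io_linear) simp_all
 have "De \<one>[A] = De (io \<one>[H])" by (simp add: io_simps)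
 also have "... = tn (io \<one>[H]) (io \<one>[H])" by (simp only: De_io H.one_closed H_comult_one) (simp add: lift_ten[OF _ _ _ _ b])
 finally show ?thesis by (simp add: io_simps)
qed

lemma De_al_one: "l :. L ==> De (al l) = tn (al l) \<one>[A]"
 using mL_De[of l "\<one>[A]"] by (simp add: De_one mL_ten)

lemma De_mult_al: "b :. A ==> l :. L ==> De (b *[A] al l) = mR (al l) \<one>[A] (De b)"
 by (simp add: De_mult De_al_one tm_ten takeuchi_De)

lemma De_be_one: "l :. L ==> De (be l) = tn \<one>[A] (be l)"
 using mB_De[of l "\<one>[A]"] by (simp add: De_one mB_ten)

lemma De_mult_be: "b :. A ==> l :. L ==> De (b *[A] be l) = mR \<one>[A] (be l) (De b)"
 by (simp add: De_mult De_be_one tm_ten takeuchi_De)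

subsection \<open>Counit and coassociativity\<close>

lemma counit_left:
 assumes b: "b :. A"
 shows "lift2 A (%x z. al (ep x) *[A] z) (De b) = b"
proof -
 have bl: "bilin A A A (%x z. al (ep x) *[A] z)"
  by (intro bilinI lin_mult_left lin_fun_mult_right lin_comp[OF al_linear ep_linear]) simp_all
 have ba: "balanced E A A (%x z. al (ep x) *[A] z)"
  by (intro balanced_EI) (simp add: ep_be al_simps A.m_assoc)
 note lin = AA_linear[OF A_vspace bl ba]
 show ?thesis using b
 proof (induction rule: frame_induct)
  case (mult l f)
  have "lift2 A (%x z. al (ep x) *[A] z) (De (al l *[A] io f)) =
    lift2 A (%x z. al l *[A] io (counit H x .[H] z)) (comult H f)"
   using mult by (simp add: lift_De[OF _ bl ba])
    (auto simp: ep_al ep_io al_simps alg_smult io_simps intro!: H_tl_cong)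
  also have "... = al l *[A] io f"
   using mult by (subst H_tl_linear[OF _ lin_fun_mult_left[OF A_alg _ io_linear], symmetric]) (simp_all add: H_counit)
  finally show ?case .
 qed (simp add: lin_add[OF De_linear] lin_add[OF lin])
qed

lemma counit_right:
 assumes b: "b :. A"
 shows "lift2 A (%x z. be (ep z) *[A] x) (De b) = b"
proof -
 have bl: "bilin A A A (%x z. be (ep z) *[A] x)"
  by (intro bilinI lin_mult_left lin_fun_mult_right lin_comp[OF be_linear ep_linear]) simp_all
 have ba: "balanced E A A (%x z. be (ep z) *[A] x)"
  by (intro balanced_EI) (simp add: ep_al be_simps A.m_assoc)
 note lin = AA_linear[OF A_vspace bl ba]
 show ?thesis using b
 proof (induction rule: frame_induct)
  case (mult l f)
  have "lift2 A (%x z. be (ep z) *[A] x) (De (al l *[A] io f)) =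
    lift2 A (%x z. al l *[A] io (counit H z .[H] x)) (comult H f)"
   using mult by (simp add: lift_De[OF _ bl ba])
    (auto simp: ep_al ep_io be_simps alg_smult io_simps intro!: H_tl_cong)
  also have "... = al l *[A] io f"
   using mult by (subst H_tl_linear[OF _ lin_fun_mult_left[OF A_alg _ io_linear], symmetric]) (simp_all add: H_counit)
  finally show ?case .
 qed (simp add: lin_add[OF De_linear] lin_add[OF lin])
qed

lemma ep_one: "ep \<one>[A] = \<one>[L]"
 using ep_io[of "\<one>[H]"] by (simp add: io_simps H_counit_one)

lemma ep_al_io: "l :. L ==> f :. H ==> ep (al l *[A] io f) = counit H f .[L] l"
 by (simp add: ep_al ep_io alg_smult)

lemma ep_al_one: "l :. L ==> ep (al l) = l"
 and ep_be_one: "l :. L ==> ep (be l) = l"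
 using ep_al[of l "\<one>[A]"] ep_be[of l "\<one>[A]"] by (simp_all add: ep_one)

text \<open>For a generator, moving \<open>f\<close> past it contributes the counit of a left or of a right translation of
  \<open>f\<close>, and both are \<open>\<langle>X\<^sub>j, f\<rangle>\<close>.\<close>

lemma ep_mult_al_be:
 assumes l: "l :. L"
 shows "\<forall>b\<in>carrier A. ep (b *[A] al l) = ep (b *[A] be l)"
 using gl l
proof (induction rule: env_induct)
 case one
 show ?case by (simp add: al_simps be_simps)
next
 case (gen j)
 then have j: "j \<in> I" by (simp add: idx_gl)
 show ?case
 proof
  fix b assume "b :. A"
  then show "ep (b *[A] al (yy j)) = ep (b *[A] be (yy j))"
  proof (induction rule: frame_induct)
   case (mult l f)
   then show ?case using j
    by (simp add: A.m_assoc io_al io_be ep_al ep_be lin_add[OF ep_linear] lin_smult[OF ep_linear] ep_io counit_rt_lt alg_smult)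
  qed (simp add: A.l_distr lin_add[OF ep_linear])
 qed
next
 case (mult l l')
 show ?case
 proof
  fix b assume b: "b :. A"
  have "ep (b *[A] al (l *[L] l')) = ep ((b *[A] al l) *[A] al l')"
   using mult b by (simp add: al_simps A.m_assoc)
  also have "... = ep ((b *[A] be l') *[A] al l)"
   using mult b bspec[OF mult(4), of "b *[A] al l"] by (simp add: A.m_assoc al_be)
  also have "... = ep (b *[A] be (l *[L] l'))"
   using mult b bspec[OF mult(3), of "b *[A] be l'"] by (simp add: be_simps A.m_assoc)
  finally show "ep (b *[A] al (l *[L] l')) = ep (b *[A] be (l *[L] l'))" .
 qed
qed (simp_all add: al_simps be_simps A.r_distr alg_smult lin_add[OF ep_linear] lin_smult[OF ep_linear])

lemma ep_mult_io: "b :. A ==> h :. H ==> ep (b *[A] io h) = counit H h .[L] ep b"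
proof (induction rule: frame_induct)
 case (mult l f)
 then show ?case by (simp add: A.m_assoc ep_al_io H_counit_mult mult.commute flip: io_simps(3))
qed (simp add: A.l_distr lin_add[OF ep_linear] vs_smult_add)

lemma ep_mult: "c :. A ==> b :. A ==> ep (b *[A] al (ep c)) = ep (b *[A] c)"
proof (induction rule: frame_induct)
 case (mult l f)
 then show ?case
  by (simp add: ep_al_io ep_al_one al_simps alg_smult lin_smult[OF ep_linear] ep_mult_io flip: A.m_assoc)
qed (simp add: A.r_distr al_simps lin_add[OF ep_linear])

lemma coassociative:
 assumes b: "b :. A"
 shows "comult_id E E A De (De b) = id_comult E E A De (De b)"
proof -
 let ?T = "tensor3 E E A" and ?t = "ten3 E E A"
 note tri = ten3_trilin[of A E E, unfolded trilin_def]
 have bal1: "?t (be l *[A] x) z w = ?t x (al l *[A] z) w"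
  and bal2: "?t x (be l *[A] z) w = ?t x z (al l *[A] w)"
  if "l :. L" "x :. A" "z :. A" "w :. A" for l x z w
 proof -
  have E: "((%b. be l *[A] b), (%b. al l *[A] b)) \<in> E" using that by (auto simp: left_balancing_def)
  show "?t (be l *[A] x) z w = ?t x (al l *[A] z) w" "?t x (be l *[A] z) w = ?t x z (al l *[A] w)"
   using ten3_balanced[of E E A, unfolded balanced3_def] E that(2-4) by blast+
 qed
 have t1: "linear_map A ?T (%x. ?t x z w)" and t2: "linear_map A ?T (%x. ?t z x w)" and t3: "linear_map A ?T (%x. ?t z w x)"
  if "z :. A" "w :. A" for z w using tri that by auto
 define N where "N w s = lift2 ?T (%x1 x2. ?t x1 x2 w) s" for w s
 define N' where "N' w s = lift2 ?T (%x1 x2. ?t w x1 x2) s" for w s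
 have Nb: "bilin A A ?T (%x1 x2. ?t x1 x2 w)" "balanced E A A (%x1 x2. ?t x1 x2 w)"
  and N'b: "bilin A A ?T (%x1 x2. ?t w x1 x2)" "balanced E A A (%x1 x2. ?t w x1 x2)" if "w :. A" for w
  using that by (intro bilinI t1 t2 t3 balanced_EI; simp add: bal1 bal2)+
 have Nlin: "linear_map AA ?T (N w)" and N'lin: "linear_map AA ?T (N' w)" if "w :. A" for w
  unfolding N_def N'_def using that by (intro AA_linear Nb N'b; simp)+
 have Nw: "linear_map A ?T (%w. N w s)" and N'w: "linear_map A ?T (%w. N' w s)" if "s :. AA" for s
  unfolding N_def N'_def using that by (intro AA_tl_fun_linear t1 t2 t3; simp)+
 have b1: "bilin A A ?T (%x w. N w (De x))" by (intro bilinI lin_comp[OF Nlin De_linear] Nw) simp_all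
 have b2: "bilin A A ?T (%w x. N' w (De x))" by (intro bilinI lin_comp[OF N'lin De_linear] N'w) simp_all
 have Nmove: "N w (De (be l *[A] x)) = N (al l *[A] w) (De x)" if "l :. L" "x :. A" "w :. A" for l x w
  unfolding De_be[OF that(1,2)] using that
  by (subst AA_tl_linear[OF _ Nlin]) (auto simp: N_def AA_ten[OF _ Nb] bal2 intro!: AA_tl_cong)
 have N'move: "N' (be l *[A] w) (De x) = N' w (De (al l *[A] x))" if "l :. L" "x :. A" "w :. A" for l x w
  unfolding De_al[OF that(1,2)] using that
  by (subst AA_tl_linear[OF _ N'lin]) (auto simp: N'_def AA_ten[OF _ N'b] bal1 intro!: AA_tl_cong)
 have ba1: "balanced E A A (%x w. N w (De x))" by (intro balanced_EI Nmove)
 have ba2: "balanced E A A (%w x. N' w (De x))" by (intro balanced_EI N'move)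
 have eq1: "comult_id E E A De s = lift2 ?T (%x w. N w (De x)) s" for s by (simp add: comult_id_def N_def)
 have eq2: "id_comult E E A De s = lift2 ?T (%w x. N' w (De x)) s" for s by (simp add: id_comult_def N'_def)
 note lin1 = AA_linear[OF vspace_tensor3 b1 ba1] and lin2 = AA_linear[OF vspace_tensor3 b2 ba2]
 show ?thesis unfolding eq1 eq2 using b
 proof (induction rule: frame_induct)
  case (mult l f)
  have tr: "trilin H ?T (%x z w. ?t (al l *[A] io x) (io z) (io w))"
   unfolding trilin_def using mult(1)
   by (intro ballI conjI lin_comp[OF t1] lin_comp[OF t2] lin_comp[OF t3] io_linear lin_fun_mult_left) simp_all
  have "lift2 ?T (%x w. N w (De x)) (De (al l *[A] io f)) =
    lift2 ?T (%x w. N (io w) (De (al l *[A] io x))) (comult H f)"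
   using mult by (simp add: lift_De[OF _ b1 ba1])
  also have "... = lift2 ?T (%x w. lift2 ?T (%x1 x2. ?t (al l *[A] io x1) (io x2) (io w)) (comult H x)) (comult H f)"
   using mult by (intro H_tl_cong H_tl_closed) (simp_all add: N_def lift_De[OF _ Nb])
  also have "... = lift2 ?T (%w x. lift2 ?T (%x1 x2. ?t (al l *[A] io w) (io x1) (io x2)) (comult H x)) (comult H f)"
   using mult by (intro H_coassoc tr) simp_all
  also have "... = lift2 ?T (%w x. N' (al l *[A] io w) (De (io x))) (comult H f)"
   using mult by (intro H_tl_cong) (auto simp: N'_def lift_De[OF _ N'b] lift_De_io[OF _ N'b] intro!: H_tl_closed)
  also have "... = lift2 ?T (%w x. N' w (De x)) (De (al l *[A] io f))"
   using mult by (simp add: lift_De[OF _ b2 ba2])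
  finally show ?case .
 qed (simp add: lin_add[OF De_linear] lin_add[OF lin1] lin_add[OF lin2])
qed

theorem left_bialgebroid: "left_bialgebroid A L al be De ep"
 unfolding left_bialgebroid_def Let_def
proof (intro conjI ballI)
 show "De (al l *[A] be l' *[A] b) = lift2 AA (%x z. tn (al l *[A] x) (be l' *[A] z)) (De b)"
  if "l :. L" "l' :. L" "b :. A" for l l' b
  using that by (simp add: A.m_assoc mL_De De_be) (subst AA_tl_linear[OF _ mL_linear]; auto simp: mL_ten intro!: AA_tl_cong)
 show "ep (al l *[A] be l' *[A] b) = l *[L] ep b *[L] l'"
  if "l :. L" "l' :. L" "b :. A" for l l' b
  using that by (simp add: A.m_assoc ep_al ep_be L.m_assoc)
 show "lift2 AA (%x z. tn (x *[A] be l) z) (De b) = lift2 AA (%x z. tn x (z *[A] al l)) (De b)"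
  if "l :. L" "b :. A" for l b
 proof -
  have "lift2 AA (%x z. tn (x *[A] be l) z) (De b) = mR (be l) \<one>[A] (De b)"
   unfolding mR_def using that by (intro AA_tl_cong) simp_all
  also have "... = mR \<one>[A] (al l) (De b)" using that takeuchi_De by (simp add: takeuchi_def)
  also have "... = lift2 AA (%x z. tn x (z *[A] al l)) (De b)"
   unfolding mR_def using that by (intro AA_tl_cong) simp_all
  finally show ?thesis .
 qed
 show "ep (b *[A] c) = ep (b *[A] be (ep c))" if "b :. A" "c :. A" for b c
  using ep_mult_al_be[of "ep c"] that by (simp add: ep_mult)
qed (simp_all add: al_hom be_anti al_be De_linear ep_linear coassociative counit_left counit_right De_one
  De_mult tm_eq ep_one ep_mult)

end

section \<open>The opposite enveloping algebra\<close>

context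
 fixes g :: "('k::field, 'g::ab_group_add) based_lie"
 assumes g: "based_lie_algebra g"
begin

interpretation V: ring "env (opp g)" by (rule k_algebra_ring) simp

lemma phi_facts: "alg_antihom (env g) (env (opp g)) (phi g) \<and> (\<forall>j\<in>idx g. phi g (env_gen g j) = env_gen (opp g) j)"
proof -
 have "\<exists>F. alg_hom (env g) (op (env (opp g))) F \<and> (\<forall>j\<in>idx g. F (env_gen g j) = env_gen (opp g) j)"
 proof (rule env_universal_basis[OF g k_algebra_op[OF k_algebra_env[of "opp g"]], of "env_gen (opp g)"])
  fix i j assume "i \<in> idx g" "j \<in> idx g"
  have "struct_const (opp g) j i = struct_const g i j"
   using struct_const_opp[OF g, of j i] struct_const_antisym[OF g, of j i] by auto
  then show "env_gen (opp g) i *[op (env (opp g))] env_gen (opp g) j =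
   env_gen (opp g) j *[op (env (opp g))] env_gen (opp g) i +[op (env (opp g))]
   finsum (op (env (opp g))) (%k. struct_const g i j k .[op (env (opp g))] env_gen (opp g) k) (idx g)"
   using env_gen_bracket[OF based_lie_algebra_opp[OF g], of j i] by simp
 qed (simp, blast)
 then obtain F where "alg_antihom (env g) (env (opp g)) F" "\<forall>j\<in>idx g. F (env_gen g j) = env_gen (opp g) j"
  by (auto simp: alg_hom_op)
 then show ?thesis
  unfolding phi_def using antihom_ext_env[of g "env (opp g)" F "env_gen (opp g)"] by blast
qed

lemmas phi_antihom = conjunct1[OF phi_facts]

lemma phi_gen: "j \<in> idx g ==> phi g (env_gen g j) = env_gen (opp g) j" using phi_facts by blast

lemma phi_closed [simp]: "a :. (env g) ==> phi g a :. (env (opp g))"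
 by (rule alg_antihom_closed[OF phi_antihom])

end

lemma phi_phi:
 assumes g: "based_lie_algebra g" and a: "a :. (env g)"
 shows "phi (opp g) (phi g a) = a"
proof (rule env_hom_unique[OF g alg_antihom_comp_anti[OF phi_antihom[OF based_lie_algebra_opp[OF g]] phi_antihom[OF g]]])
 show "alg_hom (env g) (env (opp (opp g))) (%a. a)" by (simp add: alg_hom_def lin_id)
 show "phi (opp g) (phi g (env_gen g j)) = env_gen g j" if "j \<in> idx g" for j
  using that phi_gen[OF g, of j] phi_gen[OF based_lie_algebra_opp[OF g], of j] by simp
qed (rule a)

lemma psi_eq:
 assumes g: "based_lie_algebra g" and b: "b :. (env (opp g))"
 shows "psi g b = phi (opp g) b"
proof -
 have "inj_on (phi g) (carrier (env g))" by (rule inj_on_inverseI[of _ "phi (opp g)"]) (rule phi_phi[OF g])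
 moreover have "phi (opp g) b :. (env g)" using phi_closed[OF based_lie_algebra_opp[OF g] b] by simp
 moreover have "phi g (phi (opp g) b) = b" using phi_phi[OF based_lie_algebra_opp[OF g] b] by simp
 ultimately show ?thesis unfolding psi_def by (metis inv_into_f_f)
qed

lemma psi_antihom: "based_lie_algebra g ==> alg_antihom (env (opp g)) (env g) (psi g)"
 using phi_antihom[OF based_lie_algebra_opp, of g] by (auto simp: alg_antihom_def psi_eq linear_map_def Pi_iff)

lemma psi_closed [simp]: "based_lie_algebra g ==> b :. (env (opp g)) ==> psi g b :. (env g)"
 by (rule alg_antihom_closed[OF psi_antihom])

lemma psi_gen: "based_lie_algebra g ==> j \<in> idx g ==> psi g (env_gen (opp g) j) = env_gen g j"
 using phi_gen[OF based_lie_algebra_opp, of g j] by (simp add: psi_eq)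

lemma psi_phi: "based_lie_algebra g ==> a :. (env g) ==> psi g (phi g a) = a"
 by (simp add: psi_eq phi_phi)

lemma phi_psi: "based_lie_algebra g ==> b :. (env (opp g)) ==> phi g (psi g b) = b"
 using phi_phi[OF based_lie_algebra_opp, of g b] by (simp add: psi_eq)

section \<open>Scalar extension\<close>

lemma tensor_over_op: "tensor_over E (op M) (op N) = tensor_over E M N" "ten_over E (op M) (op N) = ten_over E M N"
 by (simp_all add: tensor_over_def ten_over_def tensor_rels_def lin_rels_def fun_eq_iff)

lemma tensor3_op: "tensor3 E F (op M) = tensor3 E F M" "ten3 E F (op M) = ten3 E F M"
 by (simp_all add: tensor3_def ten3_def tensor3_rels_def lin_rels_def fun_eq_iff)

lemma left_balancing_op: "left_balancing (op A) L b a = right_balancing A L a b"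
 by (simp add: left_balancing_def right_balancing_def)

context dual_pair
begin

abbreviation UR where "UR \<equiv> env (opp g)"

definition iY :: "('k, 'g) env => ('k, 'h \<times> ('k, 'g) env) formal" where "iY D = lm (psi g D)"

lemma g_opp [simp]: "based_lie_algebra (opp g)" by (rule based_lie_algebra_opp) simp

lemma iY_hom: "alg_hom UR K iY"
 unfolding iY_def by (rule alg_antihom_comp_anti[OF lm_antihom psi_antihom]) simp

lemma iY_closed [simp]: "D :. UR ==> iY D :. K" by (rule alg_hom_closed[OF iY_hom])

lemma iY_gen: "j \<in> I ==> iY (env_gen (opp g) j) = lm (Xg j)"
 by (simp add: iY_def psi_gen)

lemma iY_phi: "a :. U ==> iY (phi g a) = lm a"
 by (simp add: iY_def psi_phi)

lemmas iY_simps = alg_hom_add[OF iY_hom] alg_hom_smult[OF iY_hom] alg_hom_mult[OF iY_hom] alg_hom_one[OF iY_hom]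

lemma K_induct_left [consumes 1, case_names mult add]:
 assumes b: "b :. K"
  and mult: "!!D f. D :. UR ==> f :. H ==> P (iY D *[K] iH f)"
  and add: "!!b c. b :. K ==> c :. K ==> P b ==> P c ==> P (b +[K] c)"
 shows "P b"
proof -
 from b obtain t where t: "t :. (tensor U H)" "b = JU t" using JU_image by blast
 have "P (JU t)" using t(1) env_vspace H_vspace
 proof (induction rule: tensor_induct)
  case (ten a f)
  then show ?case using mult[of "phi g a" f] by (simp add: JU_ten iY_phi)
 next
  case (add s t)
  then show ?case using assms(3) by (simp add: lin_add[OF JU_linear] lin_closed[OF JU_linear])
 qed
 then show ?thesis by (simp add: t)
qed

lemma K_induct [consumes 1, case_names mult add]:
 assumes b: "b :. K"
  and mult: "!!D f. D :. U ==> f :. H ==> P (iH f *[K] iX D)"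
  and add: "!!b c. b :. K ==> c :. K ==> P b ==> P c ==> P (b +[K] c)"
 shows "P b"
proof -
 have "b :. HU" using b by (simp add: K_simps)
 then show ?thesis using H_vspace env_vspace
 proof (induction rule: tensor_induct)
  case (ten f a)
  then show ?case using mult by (simp add: ten_eq_mult)
 next
  case (add s t)
  then show ?case using assms(3)[of s t] by (simp add: K_simps)
 qed
qed

text \<open>Generators in \<open>\<lambda>(a)\<close> are moved to the right one at a time.\<close>

lemma K_induct_right [consumes 1, case_names mult add]:
 assumes b: "b :. K"
  and mult: "!!D f. D :. U ==> f :. H ==> P (iH f *[K] lm D)"
  and add: "!!b c. b :. K ==> c :. K ==> P b ==> P c ==> P (b +[K] c)"
 shows "P b"
proof -
 have "\<forall>D\<in>carrier U. \<forall>f\<in>carrier H. P (lm a *[K] iH f *[K] lm D)" if "a :. U" for a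
  using g that
 proof (induction rule: env_induct_left)
  case one
  then show ?case using mult by (simp add: lm_simps)
 next
  case (gen j a)
  show ?case
  proof (intro ballI)
   fix D f assume *: "D :. U" "f :. H"
   have "lm (Xg j *[U] a) *[K] iH f *[K] lm D = lm a *[K] (lm (Xg j) *[K] iH f) *[K] lm D"
    using * gen by (simp add: lm_simps K.m_assoc)
   also have "... = lm a *[K] iH f *[K] lm (D *[U] Xg j) +[K] lm a *[K] iH (lt j f) *[K] lm D"
    using * gen by (simp add: lm_iH lm_simps K.r_distr K.l_distr K.m_assoc)
   finally show "P (lm (Xg j *[U] a) *[K] iH f *[K] lm D)"
    using * gen add by simp
  qed
 next
  case (add a c)
  then show ?case using assms(3) by (simp add: lm_simps K.l_distr)
 next
  case (smult c a)
  show ?case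
  proof (intro ballI)
   fix D f assume *: "D :. U" "f :. H"
   then have "P (lm a *[K] iH (c .[H] f) *[K] lm D)" using smult(2) by simp
   then show "P (lm (c .[U] a) *[K] iH f *[K] lm D)" using * smult(1) by (simp add: lm_simps iH_simps alg_smult)
  qed
 qed
 then have one: "P (lm a *[K] iH f *[K] lm \<one>[U])" if "a :. U" "f :. H" for a f
  using that by blast
 have lmP: "P (lm a *[K] iH f)" if "a :. U" "f :. H" for a f
  using one[OF that] that by (simp add: lm_simps)
 show ?thesis
  using b by (induction rule: K_induct_left) (simp_all add: iY_def add lmP)
qed

lemma lift_comult_mult:
 fixes B :: "('k, 'z, 'm) module_scheme"
 assumes B: "vspace B" and b: "bilin H H B b" and f: "f :. H" and h: "h :. H"
 shows "lift2 B (%x z. b x z) (comult H (f *[H] h)) =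
  lift2 B (%x z. lift2 B (%x' z'. b (x *[H] x') (z *[H] z')) (comult H h)) (comult H f)"
proof -
 note lin = lift_linear[OF H_vspace H_vspace bal_maps_empty B b balanced_empty]
 have bcl: "b x z :. B" if "x :. H" "z :. H" for x z using that by (rule bilin_closed[OF b])
 have i: "lift2 HH (%x' y'. ten H H (x *[H] x') (z *[H] y')) (comult H h) :. HH"
  if "x :. H" "z :. H" for x z
  using that h by (intro H_tl_closed) simp_all
 have inner: "lift2 B (%x z. b x z) (lift2 HH (%x' y'. ten H H (x *[H] x') (z *[H] y')) (comult H h)) =
   lift2 B (%x' z'. b (x *[H] x') (z *[H] z')) (comult H h)" if "x :. H" "z :. H" for x z
  using that h B by (subst H_tl_linear[OF _ lin]) (auto simp: lift_ten[OF _ _ _ _ b] bcl intro!: H_tl_cong)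
 show ?thesis
  unfolding H_comult_mult[OF f h] using f h B i
  by (subst H_tl_linear[OF _ lin]) (auto simp: inner bcl intro!: H_tl_cong H_tl_closed)
qed

lemma
 fixes B :: "('k, 'z, 'm) module_scheme"
 assumes B: "vspace B" and b: "bilin H H B b" and f: "f :. H" and ij: "i \<in> I" "j \<in> I"
 shows lift_comult_u_mult: "lift2 B (%x z. b x z) (comult H (u i j *[H] f)) =
   finsum B (%k. lift2 B (%x z. b (u i k *[H] x) (u k j *[H] z)) (comult H f)) I"
  and lift_comult_v_mult: "lift2 B (%x z. b x z) (comult H (v i j *[H] f)) =
   finsum B (%k. lift2 B (%x z. b (v k j *[H] x) (v i k *[H] z)) (comult H f)) I"
proof -
 have b': "bilin H H B (%x z. lift2 B (%x' z'. b (x *[H] x') (z *[H] z')) (comult H f))"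
  using B f by (intro bilinI H_tl_fun_linear lin_comp[OF bilin_left[OF b]] lin_comp[OF bilin_right[OF b]] lin_mult_right) simp_all
 show "lift2 B (%x z. b x z) (comult H (u i j *[H] f)) =
   finsum B (%k. lift2 B (%x z. b (u i k *[H] x) (u k j *[H] z)) (comult H f)) I"
  using B f ij by (simp add: lift_comult_mult[OF B b] comult_u lift_finsum_ten[OF B b'])
 show "lift2 B (%x z. b x z) (comult H (v i j *[H] f)) =
   finsum B (%k. lift2 B (%x z. b (v k j *[H] x) (v i k *[H] z)) (comult H f)) I"
  using B f ij by (simp add: lift_comult_mult[OF B b] comult_v lift_finsum_ten[OF B b'])
qed

end

text \<open>The conditions of the two families of structure maps, relative to an arbitrary dual pair.\<close>

locale scalar_extension = dual_pair g H p u
 for g :: "('k::field, 'g::ab_group_add) based_lie" and H :: "('k, 'h) hopf"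
  and p :: "('k, 'g) env => 'h => 'k" and u :: "nat => nat => 'h" +
 fixes M :: "('k, ('k, 'g) env, ('k, 'g) env, ('k, 'h \<times> ('k, 'g) env) formal) algebroid_maps"
 assumes alphaL: "D :. UR ==> alphaL M D = iY D"
  and alphaR: "D :. U ==> alphaR M D = iX D"
  and betaL_anti: "alg_antihom UR K (betaL M)"
  and betaL_gen: "j \<in> I ==> betaL M (env_gen (opp g) j) = iX (Xg j) +[K] tr j .[K] \<one>[K]"
  and betaR_anti: "alg_antihom U K (betaR M)"
  and betaR_gen: "j \<in> I ==> betaR M (Xg j) = lm (Xg j)"
  and DeltaL_linear: "linear_map K (tensor_over (balL K UR M) K K) (DeltaL M)"
  and DeltaL: "D :. UR ==> h :. H ==> DeltaL M (iY D *[K] iH h) =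
    tensor_lift (tensor_over (balL K UR M) K K)
     (%(h1, h2). ten_over (balL K UR M) K K (iY D *[K] iH h1) (iH h2)) (comult H h)"
  and DeltaR_linear: "linear_map K (tensor_over (balR K U M) K K) (DeltaR M)"
  and DeltaR: "D :. U ==> h :. H ==> DeltaR M (iH h *[K] iX D) =
    tensor_lift (tensor_over (balR K U M) K K)
     (%(h1, h2). ten_over (balR K U M) K K (iH h1) (iH h2 *[K] iX D)) (comult H h)"
  and epsL_linear: "linear_map K UR (epsL M)"
  and epsL: "D :. UR ==> h :. H ==> epsL M (iY D *[K] iH h) = counit H h .[UR] D"
  and epsR_linear: "linear_map K U (epsR M)"
  and epsR: "D :. U ==> h :. H ==> epsR M (iH h *[K] iX D) = counit H h .[U] D"
  and tau_anti: "alg_antihom K K (tau M)"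
  and tau_gen: "j \<in> I ==> tau M (lm (Xg j)) = iX (Xg j)"
  and tau_H: "h :. H ==> tau M (iH h) = iH (S h)"
begin

abbreviation aL where "aL \<equiv> alphaL M"
abbreviation bL where "bL \<equiv> betaL M"
abbreviation aR where "aR \<equiv> alphaR M"
abbreviation bR where "bR \<equiv> betaR M"
abbreviation Yg where "Yg \<equiv> env_gen (opp g)"

lemma alphaL_hom: "alg_hom UR K aL"
 using iY_hom alg_hom_one[OF iY_hom] alg_hom_mult[OF iY_hom]
 by (auto simp: alg_hom_def linear_map_def alphaL Pi_iff)

lemma alphaR_hom: "alg_hom U K aR"
 using iX_hom alg_hom_one[OF iX_hom] alg_hom_mult[OF iX_hom]
 by (auto simp: alg_hom_def linear_map_def alphaR Pi_iff)

lemma betaR: "D :. U ==> bR D = lm D"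
 by (rule env_antihom_unique[OF g betaR_anti lm_antihom betaR_gen])

lemma betaL: "D :. UR ==> bL D = iX (shift 1 (psi g D))"
proof (rule env_antihom_unique[OF g_opp betaL_anti])
 show "alg_antihom UR K (%D. iX (shift 1 (psi g D)))"
  by (intro alg_antihom_comp[OF iX_hom] alg_antihom_comp[OF shift_hom] psi_antihom) simp
 show "bL (Yg j) = iX (shift 1 (psi g (Yg j)))" if "j \<in> idx (opp g)" for j
  using that by (simp add: betaL_gen psi_gen shift_gen iX_simps)
qed

lemma commute_L: "D :. UR ==> E :. UR ==> aL D *[K] bL E = bL E *[K] aL D"
 by (simp add: alphaL betaL iY_def iX_lm_commute)

lemma commute_R: "D :. U ==> E :. U ==> aR D *[K] bR E = bR E *[K] aR D"
 by (simp add: alphaR betaR iX_lm_commute)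

lemma iH_lm_gen: "f :. H ==> iH f *[K] lm (Xg j) = lm (Xg j) *[K] iH f +[K] (- 1) .[K] iH (lt j f)"
 and iH_iX_gen: "f :. H ==> iH f *[K] iX (Xg j) = iX (Xg j) *[K] iH f +[K] (- 1) .[K] iH (rt j f)"
 by (simp_all add: lm_iH iX_iH K.a_assoc K.r_neg flip: vs_minus_eq_smult)

sublocale lb: bialgebroid_base g H p u K "opp g" iH aL bL "- 1"
proof unfold_locales
 show "iH f *[K] aL (Yg j) = aL (Yg j) *[K] iH f +[K] (- 1) .[K] iH (lt j f)" if "f :. H" "j \<in> I" for f j
  using that by (simp add: alphaL iY_gen iH_lm_gen)
 show "iH f *[K] bL (Yg j) = bL (Yg j) *[K] iH f +[K] (- 1) .[K] iH (rt j f)" if "f :. H" "j \<in> I" for f j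
 proof -
  have "iH f *[K] bL (Yg j) = (iX (Xg j) *[K] iH f +[K] (- 1) .[K] iH (rt j f)) +[K] tr j .[K] iH f"
   using that by (simp add: betaL_gen K.r_distr iH_iX_gen alg_smult)
  also have "... = (iX (Xg j) *[K] iH f +[K] tr j .[K] iH f) +[K] (- 1) .[K] iH (rt j f)"
   using that by (simp add: K.a_ac)
  finally show ?thesis using that by (simp add: betaL_gen K.l_distr alg_smult)
 qed
qed (simp_all add: alphaL_hom betaL_anti iH_hom commute_L)

sublocale rb: bialgebroid_base g H p u "op K" g iH bR aR 1
proof unfold_locales
 show "iH f *[op K] bR (Xg j) = bR (Xg j) *[op K] iH f +[op K] 1 .[op K] iH (lt j f)" if "f :. H" "j \<in> I" for f j
  using that by (simp add: betaR lm_iH)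
 show "iH f *[op K] aR (Xg j) = aR (Xg j) *[op K] iH f +[op K] 1 .[op K] iH (rt j f)" if "f :. H" "j \<in> I" for f j
  using that by (simp add: alphaR iX_iH)
 show "alg_hom H (op K) iH"
  using alg_hom_linear[OF iH_hom] alg_hom_one[OF iH_hom] alg_hom_mult[OF iH_hom]
  by (auto simp: alg_hom_def iH_commute)
qed (simp_all add: alg_hom_op k_algebra_op alphaR_hom betaR_anti commute_R)

lemma right_square: "rb.AA = tensor_over (balR K U M) K K" "rb.tn = ten_over (balR K U M) K K"
 unfolding left_balancing_op tensor_over_op by simp_all

subsection \<open>The left bialgebroid\<close>

lemma betaL_sum: "j \<in> I ==> bL (Yg j) = finsum K (%i. iY (Yg i) *[K] iH (u i j)) I"
proof -
 assume j: "j \<in> I"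
 have "finsum K (%i. iY (Yg i) *[K] iH (u i j)) I = finsum K (%i. lm (Xg i) *[K] iH (u i j)) I"
  using j by (intro vs_finsum_cong) (simp_all add: iY_gen)
 then show ?thesis using j by (simp add: iX_shift_gen betaL_gen)
qed

lemma bL_closed [simp]: "D :. UR ==> bL D :. K" by (rule alg_antihom_closed[OF betaL_anti])

lemma betaL_expand:
 assumes j: "j \<in> I" and D: "D :. UR" and f: "f :. H"
 shows "bL (Yg j) *[K] (iY D *[K] iH f) = finsum K (%i. iY (D *[UR] Yg i) *[K] iH (u i j *[H] f)) I"
proof -
 have c: "bL (Yg j) *[K] iY D = iY D *[K] bL (Yg j)"
  using D commute_L[of D "Yg j"] by (simp add: alphaL)
 have "bL (Yg j) *[K] (iY D *[K] iH f) = bL (Yg j) *[K] iY D *[K] iH f"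
  using D f by (simp add: K.m_assoc)
 also have "... = iY D *[K] bL (Yg j) *[K] iH f" by (simp add: c)
 also have "... = finsum K (%i. iY D *[K] (iY (Yg i) *[K] iH (u i j)) *[K] iH f) I"
  unfolding betaL_sum[OF j] using D f j
  by (intro lin_finsum lin_fun_mult_right[OF K_algebra _ lin_mult_left]) simp_all
 also have "... = finsum K (%i. iY (D *[UR] Yg i) *[K] iH (u i j *[H] f)) I"
  using D f j by (intro vs_finsum_cong) (simp_all add: iY_simps iH_simps K.m_assoc)
 finally show ?thesis .
qed

lemma DL_bilin: "D :. UR ==> bilin H H lb.AA (%x z. lb.tn (iY D *[K] iH x) (iH z))"
 by (intro bilinI lin_comp[OF ten_right] lin_comp[OF ten_left] iH_linear lin_fun_mult_left) simp_all

text \<open>Expanding \<open>\<beta>\<^sub>L(Y\<^sub>j)\<close> and comultiplying the matrix coefficients gives a double sum in which the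
  balancing relation recollects \<open>\<beta>\<^sub>L\<close> on either side.\<close>

lemma DeltaL_betaL:
 assumes j: "j \<in> I" and D: "D :. UR" and f: "f :. H"
 shows "DeltaL M (bL (Yg j) *[K] (iY D *[K] iH f)) = lb.mB (Yg j) (DeltaL M (iY D *[K] iH f))"
proof -
 let ?t = "%i k x z. lb.tn (iY (D *[UR] Yg i) *[K] iH (u i k *[H] x)) (iH (u k j *[H] z))"
 have "DeltaL M (bL (Yg j) *[K] (iY D *[K] iH f)) = finsum lb.AA (%i. DeltaL M (iY (D *[UR] Yg i) *[K] iH (u i j *[H] f))) I"
  unfolding betaL_expand[OF assms] using D f j by (intro lin_finsum DeltaL_linear) simp_all
 also have "... = finsum lb.AA (%i. finsum lb.AA (%k. lift2 lb.AA (%x z. ?t i k x z) (comult H f)) I) I"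
  using D f j by (intro vs_finsum_cong) (auto simp: DeltaL lift_comult_u_mult[OF _ DL_bilin] intro!: vs_finsum_closed H_tl_closed)
 also have "... = finsum lb.AA (%k. finsum lb.AA (%i. lift2 lb.AA (%x z. ?t i k x z) (comult H f)) I) I"
  using D f j by (intro vs_finsum_swap) (auto intro!: H_tl_closed)
 also have "... = finsum lb.AA (%k. lift2 lb.AA (%x z. finsum lb.AA (%i. ?t i k x z) I) (comult H f)) I"
  using D f j by (intro vs_finsum_cong H_tl_finsum[symmetric]) (auto intro!: H_tl_closed vs_finsum_closed)
 also have "... = lift2 lb.AA (%x z. finsum lb.AA (%k. finsum lb.AA (%i. ?t i k x z) I) I) (comult H f)"
  using D f j by (intro H_tl_finsum[symmetric]) (auto intro!: vs_finsum_closed)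
 also have "... = lift2 lb.AA (%x z. lb.tn (iY D *[K] iH x) (bL (Yg j) *[K] iH z)) (comult H f)"
 proof (intro H_tl_cong)
  fix x z assume xz: "x :. H" "z :. H"
  have "lb.tn (iY D *[K] iH x) (bL (Yg j) *[K] iH z) =
    lb.tn (iY D *[K] iH x) (finsum K (%k. iY (Yg k) *[K] iH (u k j *[H] z)) I)"
   using betaL_expand[OF j _ xz(2), of "\<one>[UR]"] xz by (simp add: iY_simps)
  also have "... = finsum lb.AA (%k. lb.tn (iY D *[K] iH x) (iY (Yg k) *[K] iH (u k j *[H] z))) I"
   using D j xz by (intro lin_finsum ten_right) simp_all
  also have "... = finsum lb.AA (%k. finsum lb.AA (%i. ?t i k x z) I) I"
  proof (intro vs_finsum_cong)
   fix k assume k: "k \<in> I"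
   have "lb.tn (iY D *[K] iH x) (iY (Yg k) *[K] iH (u k j *[H] z)) = lb.tn (bL (Yg k) *[K] (iY D *[K] iH x)) (iH (u k j *[H] z))"
    using D j k xz by (simp add: lb.tn_balanced alphaL)
   also have "... = finsum lb.AA (%i. ?t i k x z) I"
    unfolding betaL_expand[OF k D xz(1)] using D j k xz by (intro lin_finsum ten_left) simp_all
   finally show "lb.tn (iY D *[K] iH x) (iY (Yg k) *[K] iH (u k j *[H] z)) = finsum lb.AA (%i. ?t i k x z) I" .
  qed (use D j xz in \<open>auto intro!: vs_finsum_closed\<close>)
  finally show "finsum lb.AA (%k. finsum lb.AA (%i. ?t i k x z) I) I = lb.tn (iY D *[K] iH x) (bL (Yg j) *[K] iH z)" ..
 qed (use D f j in simp_all)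
 also have "... = lb.mB (Yg j) (DeltaL M (iY D *[K] iH f))"
  using D f j by (simp add: DeltaL) (subst H_tl_linear[OF _ lb.mB_linear]; auto simp: lb.mB_ten intro!: H_tl_cong)
 finally show ?thesis .
qed

lemma epsL_betaL:
 assumes j: "j \<in> I" and D: "D :. UR" and f: "f :. H"
 shows "epsL M (bL (Yg j) *[K] (iY D *[K] iH f)) = counit H f .[UR] D *[UR] Yg j"
proof -
 have "epsL M (bL (Yg j) *[K] (iY D *[K] iH f)) = finsum UR (%i. epsL M (iY (D *[UR] Yg i) *[K] iH (u i j *[H] f))) I"
  unfolding betaL_expand[OF assms] using D f j by (intro lin_finsum epsL_linear) simp_all
 also have "... = finsum UR (%i. (if i = j then 1 else 0) .[UR] (counit H f .[UR] (D *[UR] Yg j))) I"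
  using D f j by (intro vs_finsum_cong) (simp_all add: epsL H_counit_mult counit_u)
 also have "... = counit H f .[UR] (D *[UR] Yg j)"
  using D f j by (intro vs_finsum_delta) simp_all
 finally show ?thesis using D f by (simp add: alg_smult)
qed

sublocale lb: bialgebroid_frame g H p u K "opp g" iH aL bL "- 1" "DeltaL M" "epsL M"
proof unfold_locales
 fix P :: "_ => bool" and b
 assume "b :. K" "!!l f. l :. UR ==> f :. H ==> P (aL l *[K] iH f)"
  "!!b c. b :. K ==> c :. K ==> P b ==> P c ==> P (b +[K] c)"
 then show "P b" by (induction rule: K_induct_left) (simp_all flip: alphaL)
next
 fix j b assume j: "j \<in> I" and b: "b :. K"
 have "DeltaL M (aL (Yg j) *[K] b) = lb.mL (Yg j) (DeltaL M b)" using b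
 proof (induction rule: K_induct_left)
  case (mult D f)
  have "DeltaL M (aL (Yg j) *[K] (iY D *[K] iH f)) = DeltaL M (iY (Yg j *[UR] D) *[K] iH f)"
   using mult by (simp add: alphaL iY_simps K.m_assoc)
  also have "... = lb.mL (Yg j) (DeltaL M (iY D *[K] iH f))"
   using mult by (simp add: DeltaL)
    (subst H_tl_linear[OF _ lb.mL_linear]; auto simp: lb.mL_ten alphaL iY_simps K.m_assoc intro!: H_tl_cong)
  finally show ?case .
 qed (simp add: K.r_distr lin_add[OF DeltaL_linear] lin_add[OF lb.mL_linear] lin_closed[OF DeltaL_linear])
 then show "DeltaL M (aL (Yg j) *[K] b) = lift2 lb.AA (%x z. lb.tn (aL (Yg j) *[K] x) z) (DeltaL M b)"
  by (simp add: lb.mL_def)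
 have "DeltaL M (bL (Yg j) *[K] b) = lb.mB (Yg j) (DeltaL M b)" using b
  by (induction rule: K_induct_left)
   (use j in \<open>simp_all add: DeltaL_betaL K.r_distr lin_add[OF DeltaL_linear] lin_add[OF lb.mB_linear] lin_closed[OF DeltaL_linear]\<close>)
 then show "DeltaL M (bL (Yg j) *[K] b) = lift2 lb.AA (%x z. lb.tn x (bL (Yg j) *[K] z)) (DeltaL M b)"
  by (simp add: lb.mB_def)
 show "epsL M (aL (Yg j) *[K] b) = Yg j *[UR] epsL M b" using b
 proof (induction rule: K_induct_left)
  case (mult D f)
  have "epsL M (aL (Yg j) *[K] (iY D *[K] iH f)) = epsL M (iY (Yg j *[UR] D) *[K] iH f)"
   using mult by (simp add: alphaL iY_simps K.m_assoc)
  then show ?case using mult by (simp add: epsL alg_smult)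
 qed (simp add: K.r_distr lb.L.r_distr lin_add[OF epsL_linear] lin_closed[OF epsL_linear])
 show "epsL M (bL (Yg j) *[K] b) = epsL M b *[UR] Yg j" using b
  by (induction rule: K_induct_left)
   (use j in \<open>simp_all add: epsL_betaL epsL K.r_distr lb.L.l_distr lin_add[OF epsL_linear] lin_closed[OF epsL_linear]\<close>)
next
 fix f assume f: "f :. H"
 show "DeltaL M (iH f) = lift2 lb.AA (%x z. lb.tn (iH x) (iH z)) (comult H f)"
 proof -
  have "DeltaL M (iY \<one>[UR] *[K] iH f) = lift2 lb.AA (%x z. lb.tn (iH x) (iH z)) (comult H f)"
   unfolding DeltaL[OF env_one_closed f] using f by (intro H_tl_cong) (simp_all add: iY_simps)
  then show ?thesis using f by (simp add: iY_simps)
 qed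
 show "epsL M (iH f) = counit H f .[UR] \<one>[UR]"
  using epsL[OF env_one_closed f] f by (simp add: iY_simps)
qed (simp_all add: DeltaL_linear epsL_linear)

end

lemma bilin_op [simp]: "bilin (op A) (op B) C b = bilin A B C b" by (simp add: bilin_def)

context scalar_extension
begin

subsection \<open>The right bialgebroid\<close>

lemma lm_expand:
 assumes j: "j \<in> I" and D: "D :. U" and f: "f :. H"
 shows "(iH f *[K] iX D) *[K] lm (Xg j) = finsum K (%i. iH (v i j *[H] f) *[K] iX (Xg i *[U] D)) I"
proof -
 have "(iH f *[K] iX D) *[K] lm (Xg j) = iH f *[K] lm (Xg j) *[K] iX D"
  using D f by (simp add: K.m_assoc iX_lm_commute)
 also have "... = finsum K (%i. iH f *[K] (iH (v i j) *[K] iX (Xg i)) *[K] iX D) I"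
  unfolding lm_gen[OF j] using D f j
  by (intro lin_finsum lin_fun_mult_right[OF K_algebra _ lin_mult_left]) simp_all
 also have "... = finsum K (%i. iH (v i j *[H] f) *[K] iX (Xg i *[U] D)) I"
  using D f j by (intro vs_finsum_cong) (simp_all add: iX_simps iH_simps K.m_assoc H_commute[of "v _ j" f])
 finally show ?thesis .
qed

lemma DR_linear: "linear_map K rb.AA (DeltaR M)"
 unfolding right_square by (rule DeltaR_linear)

lemma DR: "D :. U ==> h :. H ==>
  DeltaR M (iH h *[K] iX D) = lift2 rb.AA (%x z. rb.tn (iH x) (iH z *[K] iX D)) (comult H h)"
 unfolding right_square by (rule DeltaR)

lemma DR_bilin: "D :. U ==> bilin H H rb.AA (%x z. rb.tn (iH x) (iH z *[K] iX D))"
 by (intro bilinI lin_comp[OF ten_right[where M="op K" and N="op K"]] lin_comp[OF ten_left[where M="op K" and N="op K"]])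
  (simp_all add: iH_linear lin_fun_mult_right)

lemma abR_closed [simp]: "a :. U ==> aR a :. K" "a :. U ==> bR a :. K"
  "D :. UR ==> aL D :. K"
 by (simp_all add: alphaR alphaL betaR)

lemma rtn_closed [simp]: "x :. K ==> z :. K ==> rb.tn x z :. rb.AA"
 by (intro ten_closed) simp_all

lemma rtn_left: "z :. K ==> linear_map K rb.AA (%x. rb.tn x z)"
 and rtn_right: "x :. K ==> linear_map K rb.AA (%z. rb.tn x z)"
 using ten_left[where E="left_balancing (op K) U bR aR" and M="op K" and N="op K" and n=z]
  ten_right[where E="left_balancing (op K) U bR aR" and M="op K" and N="op K" and m=x]
 by simp_all

lemma rtn_balanced: "l :. U ==> x :. K ==> z :. K ==> rb.tn (x *[K] aR l) z = rb.tn x (z *[K] bR l)"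
 using rb.tn_balanced[of l x z] by simp

text \<open>As for \<open>\<beta>\<^sub>L\<close>, with the inverse matrix, whose comultiplication is reversed.\<close>

lemma DeltaR_betaR:
 assumes j: "j \<in> I" and D: "D :. U" and f: "f :. H"
 shows "DeltaR M ((iH f *[K] iX D) *[K] lm (Xg j)) = rb.mL (Xg j) (DeltaR M (iH f *[K] iX D))"
proof -
 let ?t = "%i k x z. rb.tn (iH (v k j *[H] x)) (iH (v i k *[H] z) *[K] iX (Xg i *[U] D))"
 have "DeltaR M ((iH f *[K] iX D) *[K] lm (Xg j)) = finsum rb.AA (%i. DeltaR M (iH (v i j *[H] f) *[K] iX (Xg i *[U] D))) I"
  unfolding lm_expand[OF assms] using D f j by (intro lin_finsum DR_linear) simp_all
 also have "... = finsum rb.AA (%i. finsum rb.AA (%k. lift2 rb.AA (%x z. ?t i k x z) (comult H f)) I) I"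
  using D f j by (intro vs_finsum_cong) (auto simp: DR lift_comult_v_mult[OF _ DR_bilin] intro!: vs_finsum_closed H_tl_closed)
 also have "... = finsum rb.AA (%k. finsum rb.AA (%i. lift2 rb.AA (%x z. ?t i k x z) (comult H f)) I) I"
  using D f j by (intro vs_finsum_swap) (auto intro!: H_tl_closed)
 also have "... = finsum rb.AA (%k. lift2 rb.AA (%x z. finsum rb.AA (%i. ?t i k x z) I) (comult H f)) I"
  using D f j by (intro vs_finsum_cong H_tl_finsum[symmetric]) (auto intro!: H_tl_closed vs_finsum_closed)
 also have "... = lift2 rb.AA (%x z. finsum rb.AA (%k. finsum rb.AA (%i. ?t i k x z) I) I) (comult H f)"
  using D f j by (intro H_tl_finsum[symmetric]) (auto intro!: vs_finsum_closed)
 also have "... = lift2 rb.AA (%x z. rb.tn (iH x *[K] lm (Xg j)) (iH z *[K] iX D)) (comult H f)"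
 proof (intro H_tl_cong)
  fix x z assume xz: "x :. H" "z :. H"
  have "rb.tn (iH x *[K] lm (Xg j)) (iH z *[K] iX D) =
    rb.tn (finsum K (%k. iH (v k j *[H] x) *[K] iX (Xg k)) I) (iH z *[K] iX D)"
   using lm_expand[OF j _ xz(1), of "\<one>[U]"] xz by (simp add: iX_simps)
  also have "... = finsum rb.AA (%k. rb.tn (iH (v k j *[H] x) *[K] iX (Xg k)) (iH z *[K] iX D)) I"
   using D j xz by (intro lin_finsum rtn_left) simp_all
  also have "... = finsum rb.AA (%k. finsum rb.AA (%i. ?t i k x z) I) I"
  proof (intro vs_finsum_cong)
   fix k assume k: "k \<in> I"
   have "rb.tn (iH (v k j *[H] x) *[K] iX (Xg k)) (iH z *[K] iX D) =
     rb.tn (iH (v k j *[H] x)) ((iH z *[K] iX D) *[K] lm (Xg k))"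
    using rtn_balanced[of "Xg k" "iH (v k j *[H] x)" "iH z *[K] iX D"] D j k xz by (simp add: alphaR betaR)
   also have "... = finsum rb.AA (%i. ?t i k x z) I"
    unfolding lm_expand[OF k D xz(2)] using D j k xz by (intro lin_finsum rtn_right) simp_all
   finally show "rb.tn (iH (v k j *[H] x) *[K] iX (Xg k)) (iH z *[K] iX D) = finsum rb.AA (%i. ?t i k x z) I" .
  qed (use D j xz in \<open>auto intro!: vs_finsum_closed\<close>)
  finally show "finsum rb.AA (%k. finsum rb.AA (%i. ?t i k x z) I) I = rb.tn (iH x *[K] lm (Xg j)) (iH z *[K] iX D)" ..
 qed (use D f j in simp_all)
 also have "... = rb.mL (Xg j) (DeltaR M (iH f *[K] iX D))"
  using D f j by (simp add: DR) (subst H_tl_linear[OF _ rb.mL_linear]; auto simp: rb.mL_ten betaR intro!: H_tl_cong)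
 finally show ?thesis .
qed

lemma epsR_betaR:
 assumes j: "j \<in> I" and D: "D :. U" and f: "f :. H"
 shows "epsR M ((iH f *[K] iX D) *[K] lm (Xg j)) = counit H f .[U] (Xg j *[U] D)"
proof -
 have "epsR M ((iH f *[K] iX D) *[K] lm (Xg j)) = finsum U (%i. epsR M (iH (v i j *[H] f) *[K] iX (Xg i *[U] D))) I"
  unfolding lm_expand[OF assms] using D f j by (intro lin_finsum epsR_linear) simp_all
 also have "... = finsum U (%i. (if i = j then 1 else 0) .[U] (counit H f .[U] (Xg j *[U] D))) I"
  using D f j by (intro vs_finsum_cong) (simp_all add: epsR H_counit_mult counit_v)
 also have "... = counit H f .[U] (Xg j *[U] D)"
  using D f j by (intro vs_finsum_delta) simp_all
 finally show ?thesis .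
qed

sublocale rb: bialgebroid_frame g H p u "op K" g iH bR aR 1 "DeltaR M" "epsR M"
proof unfold_locales
 fix P :: "_ => bool" and b
 assume "b :. (op K)" "!!l f. l :. U ==> f :. H ==> P (bR l *[op K] iH f)"
  "!!b c. b :. (op K) ==> c :. (op K) ==> P b ==> P c ==> P (b +[op K] c)"
 then have *: "b :. K" "!!l f. l :. U ==> f :. H ==> P (iH f *[K] lm l)"
  "!!b c. b :. K ==> c :. K ==> P b ==> P c ==> P (b +[K] c)" by (simp_all add: betaR)
 show "P b" using *(1) by (induction rule: K_induct_right) (simp_all add: *(2,3))
next
 fix j b assume j: "j \<in> I" and "b :. (op K)"
 then have b: "b :. K" by simp
 have "DeltaR M (b *[K] lm (Xg j)) = rb.mL (Xg j) (DeltaR M b)" using b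
  by (induction rule: K_induct)
   (use j lin_add[OF rb.mL_linear] in \<open>simp_all add: DeltaR_betaR K.l_distr lin_add[OF DR_linear] lin_closed[OF DR_linear]\<close>)
 then show "DeltaR M (bR (Xg j) *[op K] b) = lift2 rb.AA (%x z. rb.tn (bR (Xg j) *[op K] x) z) (DeltaR M b)"
  unfolding rb.mL_def by (simp add: betaR)
 have "DeltaR M (b *[K] aR (Xg j)) = rb.mB (Xg j) (DeltaR M b)" using b
 proof (induction rule: K_induct)
  case (mult D f)
  have "DeltaR M ((iH f *[K] iX D) *[K] aR (Xg j)) = DeltaR M (iH f *[K] iX (D *[U] Xg j))"
   using mult by (simp add: alphaR iX_simps K.m_assoc)
  also have "... = rb.mB (Xg j) (DeltaR M (iH f *[K] iX D))"
   using mult by (simp add: DR)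
    (subst H_tl_linear[OF _ rb.mB_linear]; auto simp: rb.mB_ten alphaR iX_simps K.m_assoc intro!: H_tl_cong)
  finally show ?case .
 qed (use lin_add[OF rb.mB_linear] in \<open>simp add: K.l_distr lin_add[OF DR_linear] lin_closed[OF DR_linear]\<close>)
 then show "DeltaR M (aR (Xg j) *[op K] b) = lift2 rb.AA (%x z. rb.tn x (aR (Xg j) *[op K] z)) (DeltaR M b)"
  unfolding rb.mB_def by simp
 have "epsR M (b *[K] lm (Xg j)) = Xg j *[U] epsR M b" using b
  by (induction rule: K_induct)
   (use j in \<open>simp_all add: epsR_betaR epsR alg_smult K.l_distr U.r_distr lin_add[OF epsR_linear] lin_closed[OF epsR_linear]\<close>)
 then show "epsR M (bR (Xg j) *[op K] b) = Xg j *[U] epsR M b" by (simp add: betaR)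
 have "epsR M (b *[K] iX (Xg j)) = epsR M b *[U] Xg j" using b
 proof (induction rule: K_induct)
  case (mult D f)
  have "epsR M ((iH f *[K] iX D) *[K] iX (Xg j)) = epsR M (iH f *[K] iX (D *[U] Xg j))"
   using mult by (simp add: iX_simps K.m_assoc)
  then show ?case using mult by (simp add: epsR alg_smult)
 qed (simp add: K.l_distr U.l_distr lin_add[OF epsR_linear] lin_closed[OF epsR_linear])
 then show "epsR M (aR (Xg j) *[op K] b) = epsR M b *[U] Xg j" by (simp add: alphaR)
next
 fix f assume f: "f :. H"
 show "DeltaR M (iH f) = lift2 rb.AA (%x z. rb.tn (iH x) (iH z)) (comult H f)"
 proof -
  have "DeltaR M (iH f *[K] iX \<one>[U]) = lift2 rb.AA (%x z. rb.tn (iH x) (iH z)) (comult H f)"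
   unfolding DR[OF env_one_closed f] using f by (intro H_tl_cong) (simp_all add: iX_simps)
  then show ?thesis using f by (simp add: iX_simps)
 qed
 show "epsR M (iH f) = counit H f .[U] \<one>[U]"
  using epsR[OF env_one_closed f] f by (simp add: iX_simps)
qed (simp_all add: DR_linear epsR_linear)

end

section \<open>From the left axioms over the opposite algebra to the right axioms\<close>

lemma tensor_lift_op: "tensor_lift (op A) b t = tensor_lift A b t" by (simp add: tensor_lift_def)

lemma comult_id_op: "comult_id E F (op A) De = comult_id E F A De" "id_comult E F (op A) De = id_comult E F A De"
 by (simp_all add: comult_id_def id_comult_def tensor3_op)

text \<open>The two sums over representatives are interchanged.\<close>

lemma takeuchi_mult_op:
 assumes A: "k_algebra A" and E: "bal_maps E A A" and s: "s :. (tensor_over E A A)" and t: "t :. (tensor_over E A A)"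
 shows "takeuchi_mult E (op A) s t = takeuchi_mult E A t s"
proof -
 have V: "vspace A" using A by simp
 show ?thesis unfolding takeuchi_mult_def tensor_over_op op_simps using A
  by (intro tl2_swap[OF V V E s _ V V E t]) simp_all
qed

lemma right_bialgebroid_op:
 assumes K: "k_algebra K" and L: "left_bialgebroid (op K) R b a De e"
 shows "right_bialgebroid K R a b De e"
proof -
 interpret K: ring K by (rule k_algebra_ring[OF K])
 let ?E = "right_balancing K R a b"
 note L' = L[unfolded left_bialgebroid_def Let_def left_balancing_op tensor_over_op op_simps tensor_lift_op alg_hom_op
   linear_map_op comult_id_op]
 from L' have ab: "alg_hom R K a" "alg_antihom R K b" and R: "k_algebra R" and De: "linear_map K (tensor_over ?E K K) De"
  and comm: "\<forall>l\<in>carrier R. \<forall>l'\<in>carrier R. a l' *[K] b l = b l *[K] a l'" by simp_all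
 have acl: "a r :. K" "b r :. K" if "r :. R" for r
  using that ab by (auto simp: alg_hom_closed alg_antihom_closed)
 have E: "bal_maps ?E K K" using acl by (auto simp: bal_maps_def right_balancing_def)
 have reorder: "x *[K] b r *[K] a r' = x *[K] (a r' *[K] b r)" if "r :. R" "r' :. R" "x :. K" for x r r'
  using that acl comm by (simp add: K.m_assoc)
 have mult: "De (x *[K] y) = takeuchi_mult ?E K (De x) (De y)" if "x :. K" "y :. K" for x y
  using L' that takeuchi_mult_op[OF K E, of "De y" "De x"] lin_closed[OF De] by simp
 show ?thesis
  unfolding right_bialgebroid_def Let_def
  using L' ab comm mult by (intro conjI ballI) (simp_all add: reorder K)
qed

context dual_pair
begin

lemma shift_shift: "a :. U ==> shift c (shift (- c) a) = a"
proof (rule env_hom_unique[OF g alg_hom_comp[OF shift_hom shift_hom]])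
 show "alg_hom U U (%a. a)" by (simp add: alg_hom_def lin_id)
 show "shift c (shift (- c) (Xg j)) = Xg j" if "j \<in> I" for j
 proof -
  have "shift c (shift (- c) (Xg j)) = Xg j +[U] ((c * tr j) .[U] \<one>[U] +[U] (- c * tr j) .[U] \<one>[U])"
   using that by (simp add: shift_gen shift_simps U.a_assoc)
  also have "(c * tr j) .[U] \<one>[U] +[U] (- c * tr j) .[U] \<one>[U] = \<zero>[U]"
   using vs_smult_add(2)[of U "\<one>[U]" "c * tr j" "- c * tr j"] by simp
  finally show ?thesis by simp
 qed
qed

end

context scalar_extension
begin

theorem right_bialgebroid: "right_bialgebroid K U aR bR (DeltaR M) (epsR M)"
 by (intro right_bialgebroid_op rb.left_bialgebroid) simp

section \<open>The Hopf algebroid axioms\<close>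

lemma aL_bR: "D :. UR ==> aL D = bR (psi g D)" by (simp add: alphaL betaR iY_def)
lemma bR_aL: "a :. U ==> bR a = aL (phi g a)" by (simp add: alphaL betaR iY_phi)
lemma bL_aR: "D :. UR ==> bL D = aR (shift 1 (psi g D))" by (simp add: betaL alphaR)
lemma aR_bL: "a :. U ==> aR a = bL (phi g (shift (- 1) a))"
 by (simp add: betaL alphaR psi_phi shift_shift)

lemma tau_lm: "a :. U ==> tau M (lm a) = iX a"
 by (rule env_hom_unique[OF g alg_antihom_comp_anti[OF tau_anti lm_antihom] iX_hom])
  (simp_all add: tau_gen)

lemma tau_eq: "b :. K ==> tau M b = ta b"
proof (induction rule: K_induct_left)
 case (mult D f)
 then show ?case
  by (simp add: alg_antihom_mult[OF tau_anti] alg_antihom_mult[OF ta_antihom] tau_H ta_iH iY_def tau_lm ta_lm)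
qed (simp add: alg_antihom_add[OF tau_anti] alg_antihom_add[OF ta_antihom])

lemma tau_betaL: "D :. UR ==> tau M (bL D) = aL D"
proof -
 assume D: "D :. UR"
 have "ta (iX (shift 1 (psi g D))) = lm (sh (shift 1 (psi g D)))"
  using ta_mult[of "\<one>[H]" "shift 1 (psi g D)"] D by (simp add: iH_simps S_one)
 then show ?thesis using D shift_shift[of "psi g D" "- 1"] by (simp add: tau_eq betaL alphaL iY_def)
qed

lemma tau_betaR: "a :. U ==> tau M (bR a) = aR a"
 by (simp add: betaR alphaR tau_lm)

lemma rb_linear:
 fixes B :: "('k, 'z, 'm) module_scheme"
 assumes "vspace B" "bilin K K B b"
  and "!!l x z. l :. U ==> x :. K ==> z :. K ==> b (x *[K] aR l) z = b x (z *[K] bR l)"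
 shows "linear_map rb.AA B (lift2 B (%x z. b x z))"
 using assms by (intro rb.AA_linear rb.balanced_EI) simp_all

lemma rb_ten:
 fixes B :: "('k, 'z, 'm) module_scheme"
 assumes "vspace B" "bilin K K B b"
  and "!!l x z. l :. U ==> x :. K ==> z :. K ==> b (x *[K] aR l) z = b x (z *[K] bR l)"
  and "x :. K" "z :. K"
 shows "lift2 B (%x z. b x z) (rb.tn x z) = b x z"
 using assms by (intro rb.AA_ten rb.balanced_EI) simp_all

lemma lift_DR_left:
 fixes B :: "('k, 'z, 'm) module_scheme"
 assumes B: "vspace B" "bilin K K B b"
  and bal: "!!l x z. l :. U ==> x :. K ==> z :. K ==> b (x *[K] aR l) z = b x (z *[K] bR l)"
  and D: "D :. UR" and f: "f :. H"
 shows "lift2 B (%x z. b x z) (DeltaR M (iY D *[K] iH f)) =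
  lift2 B (%x z. b (iY D *[K] iH x) (iH z)) (comult H f)"
proof -
 have iY: "iY D = bR (psi g D)" using D by (simp add: betaR iY_def)
 have Dcl: "psi g D :. U" using D by simp
 note bcl = bilin_closed[OF B(2)]
 have "DeltaR M (iY D *[K] iH f) = rb.mR (bR (psi g D)) \<one>[K] (DeltaR M (iH f))"
  using rb.De_mult_al[of "iH f" "psi g D"] f Dcl by (simp add: iY)
 also have "... = lift2 rb.AA (%x z. rb.tn (iY D *[K] iH x) (iH z)) (comult H f)"
  unfolding rb.De_io[OF f] using f Dcl
  by (subst H_tl_linear[OF _ rb.mR_linear]) (auto simp: rb.mR_ten iY intro!: H_tl_cong)
 also have "lift2 B (%x z. b x z) ... = lift2 B (%x z. b (iY D *[K] iH x) (iH z)) (comult H f)"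
  using f D B(1) by (subst H_tl_linear[OF _ rb_linear[OF B bal]]) (auto simp: rb_ten[OF B bal] bcl intro!: H_tl_cong)
 finally show ?thesis .
qed

lemma lift_DL_left:
 fixes B :: "('k, 'z, 'm) module_scheme"
 assumes "vspace B" "bilin K K B b" "balanced lb.E K K b" "D :. UR" "f :. H"
 shows "lift2 B (%x z. b x z) (DeltaL M (iY D *[K] iH f)) =
  lift2 B (%x z. b (iY D *[K] iH x) (iH z)) (comult H f)"
 using lb.lift_De[OF assms(1-3,5,4)] assms(4) by (simp add: alphaL)

lemma lift_DL_right:
 fixes B :: "('k, 'z, 'm) module_scheme"
 assumes B: "vspace B" "bilin K K B b" "balanced lb.E K K b" and D: "D :. U" and f: "f :. H"
 shows "lift2 B (%x z. b x z) (DeltaL M (iH f *[K] iX D)) =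
  lift2 B (%x z. b (iH x) (iH z *[K] iX D)) (comult H f)"
proof -
 define l where "l = phi g (shift (- 1) D)"
 have l: "l :. UR" and iX: "iX D = bL l" using D aR_bL[OF D] by (simp_all add: l_def alphaR)
 note bcl = bilin_closed[OF B(2)]
 have "DeltaL M (iH f *[K] iX D) = lb.mR \<one>[K] (bL l) (DeltaL M (iH f))"
  using lb.De_mult_be[of "iH f" l] f l by (simp add: iX)
 also have "... = lift2 lb.AA (%x z. lb.tn (iH x) (iH z *[K] iX D)) (comult H f)"
  unfolding lb.De_io[OF f] using f l
  by (subst H_tl_linear[OF _ lb.mR_linear]) (auto simp: lb.mR_ten iX intro!: H_tl_cong)
 also have "lift2 B (%x z. b x z) ... = lift2 B (%x z. b (iH x) (iH z *[K] iX D)) (comult H f)"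
  using f D B(1) by (subst H_tl_linear[OF _ lb.AA_linear[OF B]]) (auto simp: lb.AA_ten[OF B] bcl intro!: H_tl_cong)
 finally show ?thesis .
qed

lemma antipode_left:
 assumes b: "b :. K"
 shows "lift2 K (%x z. tau M x *[K] z) (DeltaL M b) = aR (epsR M b)"
proof -
 note tl = alg_antihom_linear[OF tau_anti]
 have tcl: "tau M x :. K" if "x :. K" for x using lin_closed[OF tl that] .
 have bl: "bilin K K K (%x z. tau M x *[K] z)"
  by (intro bilinI lin_mult_left lin_fun_mult_right tl) (simp_all add: tcl)
 have ba: "balanced lb.E K K (%x z. tau M x *[K] z)"
  by (intro lb.balanced_EI) (simp add: alg_antihom_mult[OF tau_anti] tau_betaL K.m_assoc tcl)
 note lin = lb.AA_linear[OF K_vspace bl ba]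
 show ?thesis using b
 proof (induction rule: K_induct)
  case (mult D f)
  have "lift2 K (%x z. tau M x *[K] z) (DeltaL M (iH f *[K] iX D)) =
    lift2 K (%x z. iH (S x *[H] z) *[K] iX D) (comult H f)"
   unfolding lift_DL_right[OF K_vspace bl ba mult] using mult
   by (intro H_tl_cong) (simp_all add: tau_H iH_simps K.m_assoc)
  also have "... = iH (lift2 H (%x z. S x *[H] z) (comult H f)) *[K] iX D"
   using mult by (intro H_tl_linear[OF _ lin_fun_mult_right[OF K_algebra _ iH_linear], symmetric]) simp_all
  also have "... = aR (epsR M (iH f *[K] iX D))"
   using mult by (simp add: H_antipode_axiom iH_simps alg_smult epsR alphaR iX_simps)
  finally show ?case .
 next
  case (add b c)
  then show ?case by (simp add: lin_add[OF lin] lin_add[OF DeltaL_linear] lin_closed[OF DeltaL_linear]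
     lin_add[OF epsR_linear] lin_closed[OF epsR_linear] alg_hom_add[OF alphaR_hom])
 qed
qed

lemma antipode_right:
 assumes b: "b :. K"
 shows "lift2 K (%x z. x *[K] tau M z) (DeltaR M b) = aL (epsL M b)"
proof -
 note tl = alg_antihom_linear[OF tau_anti]
 have tcl: "tau M x :. K" if "x :. K" for x using lin_closed[OF tl that] .
 have bl: "bilin K K K (%x z. x *[K] tau M z)"
  by (intro bilinI lin_mult_right lin_fun_mult_left tl) (simp_all add: tcl)
 have ba: "(x *[K] aR l) *[K] tau M z = x *[K] tau M (z *[K] bR l)"
  if "l :. U" "x :. K" "z :. K" for l x z
  using that by (simp add: alg_antihom_mult[OF tau_anti] tau_betaR K.m_assoc tcl)
 have lin: "linear_map rb.AA K (lift2 K (%x z. x *[K] tau M z))"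
  by (rule rb_linear[OF K_vspace bl]) (rule ba)
 show ?thesis using b
 proof (induction rule: K_induct_left)
  case (mult D f)
  have "lift2 K (%x z. x *[K] tau M z) (DeltaR M (iY D *[K] iH f)) =
    lift2 K (%x z. (iY D *[K] iH x) *[K] tau M (iH z)) (comult H f)"
   by (rule lift_DR_left[OF K_vspace bl]) (use mult ba in simp_all)
  also have "... = lift2 K (%x z. iY D *[K] iH (x *[H] S z)) (comult H f)"
   using mult
   by (intro H_tl_cong) (simp_all add: tau_H iH_simps K.m_assoc)
  also have "... = iY D *[K] iH (lift2 H (%x z. x *[H] S z) (comult H f))"
   using mult by (intro H_tl_linear[OF _ lin_fun_mult_left[OF K_algebra _ iH_linear], symmetric]) simp_all
  also have "... = aL (epsL M (iY D *[K] iH f))"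
   using mult by (simp add: H_antipode_axiom iH_simps alg_smult epsL alphaL iY_simps)
  finally show ?case .
 next
  case (add b c)
  then show ?case by (simp add: lin_add[OF lin] lin_add[OF DR_linear] lin_closed[OF DR_linear]
     lin_add[OF epsL_linear] lin_closed[OF epsL_linear] alg_hom_add[OF alphaL_hom])
 qed
qed

end

context scalar_extension
begin

subsection \<open>Mixed coassociativity\<close>

lemma ten3_facts:
 fixes E F :: "('x, 'x) balancing" and V :: "('k, 'x, 'm) module_scheme"
 assumes "z :. V" "w :. V"
 shows "linear_map V (tensor3 E F V) (%x. ten3 E F V x z w)" "linear_map V (tensor3 E F V) (%x. ten3 E F V z x w)"
  "linear_map V (tensor3 E F V) (%x. ten3 E F V z w x)"
 using ten3_trilin[of V E F] assms by (auto simp: trilin_def)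

lemma ten3_bal:
 fixes E F :: "('x, 'x) balancing" and V :: "('k, 'x, 'm) module_scheme"
 assumes "x :. V" "z :. V" "w :. V"
 shows "(a, b) \<in> E ==> ten3 E F V (a x) z w = ten3 E F V x (b z) w"
  "(a, b) \<in> F ==> ten3 E F V x (a z) w = ten3 E F V x z (b w)"
 using ten3_balanced[of E F V] assms unfolding balanced3_def by blast+

abbreviation EL where "EL \<equiv> balL K UR M"
abbreviation ER where "ER \<equiv> balR K U M"

lemma EL_mem: "l :. UR ==> ((%b. bL l *[K] b), (%b. aL l *[K] b)) \<in> EL"
 and ER_mem: "r :. U ==> ((%b. b *[K] aR r), (%b. b *[K] bR r)) \<in> ER"
 by (auto simp: left_balancing_def right_balancing_def)

lemma DR_closed [simp]: "b :. K ==> DeltaR M b :. rb.AA" by (rule lin_closed[OF DR_linear])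

lemma DR_left_mult: "l :. UR ==> x :. K ==> DeltaR M (aL l *[K] x) =
  lift2 rb.AA (%c d. rb.tn (aL l *[K] c) d) (DeltaR M x)"
 using rb.De_mult_al[of x "psi g l"] unfolding rb.mR_def
 by (simp add: aL_bR) (intro rb.AA_tl_cong; simp)

lemma DR_right_mult: "l :. UR ==> x :. K ==> DeltaR M (bL l *[K] x) =
  lift2 rb.AA (%c d. rb.tn c (bL l *[K] d)) (DeltaR M x)"
 using rb.De_mult_be[of x "shift 1 (psi g l)"] unfolding rb.mR_def
 by (simp add: bL_aR) (intro rb.AA_tl_cong; simp)

lemma DL_left_mult: "r :. U ==> x :. K ==> DeltaL M (x *[K] bR r) =
  lift2 lb.AA (%c d. lb.tn (c *[K] bR r) d) (DeltaL M x)"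
 using lb.De_mult_al[of x "phi g r"] unfolding lb.mR_def
 by (simp add: bR_aL) (intro lb.AA_tl_cong; simp)

lemma DL_right_mult: "r :. U ==> x :. K ==> DeltaL M (x *[K] aR r) =
  lift2 lb.AA (%c d. lb.tn c (d *[K] aR r)) (DeltaL M x)"
 using lb.De_mult_be[of x "phi g (shift (- 1) r)"] unfolding lb.mR_def
 by (simp add: aR_bL) (intro lb.AA_tl_cong; simp)

text \<open>Left multiplication by \<open>\<beta>\<^sub>L\<close> is one by \<open>\<alpha>\<^sub>R\<close> and so only touches the second factor of \<open>\<Delta>\<^sub>R\<close>; this makes
  both sides well defined, and on \<open>Y f\<close> they agree by coassociativity of \<open>H\<close>.\<close>

lemma mixed_RL:
 assumes b: "b :. K"
 shows "comult_id ER EL K (DeltaR M) (DeltaL M b) = id_comult ER EL K (DeltaL M) (DeltaR M b)"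
proof -
 let ?T = "tensor3 ER EL K" and ?t = "ten3 ER EL K"
 note t = ten3_facts[where V=K]
 have bal1: "?t (x *[K] aR l) z w = ?t x (z *[K] bR l) w" if "l :. U" "x :. K" "z :. K" "w :. K" for l x z w
  using ten3_bal(1)[OF that(2-4) ER_mem[OF that(1)], of EL] .
 have bal2: "?t x (bL l *[K] z) w = ?t x z (aL l *[K] w)" if "l :. UR" "x :. K" "z :. K" "w :. K" for l x z w
  using ten3_bal(2)[OF that(2-4) EL_mem[OF that(1)], of ER] .
 define N where "N w s = lift2 ?T (%x1 x2. ?t x1 x2 w) s" for w s
 define N' where "N' w s = lift2 ?T (%x1 x2. ?t w x1 x2) s" for w s
 have Nlin: "linear_map rb.AA ?T (N w)" and Nten: "!!x z. x :. K ==> z :. K ==> N w (rb.tn x z) = ?t x z w"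
  if w: "w :. K" for w
 proof -
  have b: "bilin K K ?T (%x z. ?t x z w)" using w by (intro bilinI t; simp)
  show "linear_map rb.AA ?T (N w)" unfolding N_def by (rule rb_linear[OF _ b]) (simp_all add: w bal1)
  show "N w (rb.tn x z) = ?t x z w" if "x :. K" "z :. K" for x z
   unfolding N_def by (rule rb_ten[OF _ b]) (simp_all add: w bal1 that)
 qed
 have N'b: "bilin K K ?T (%x z. ?t w x z)" "balanced lb.E K K (%x z. ?t w x z)" if "w :. K" for w
  using that by (intro bilinI t lb.balanced_EI; simp add: bal2)+
 have N'lin: "linear_map lb.AA ?T (N' w)" if "w :. K" for w
  unfolding N'_def using that by (intro lb.AA_linear N'b) simp_all
 have N'ten: "N' w (lb.tn x z) = ?t w x z" if "w :. K" "x :. K" "z :. K" for w x z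
  unfolding N'_def using that by (intro lb.AA_ten N'b) simp_all
 have Nw: "linear_map K ?T (%w. N w s)" if "s :. rb.AA" for s
  unfolding N_def using that by (intro rb.AA_tl_fun_linear t; simp)
 have N'w: "linear_map K ?T (%w. N' w s)" if "s :. lb.AA" for s
  unfolding N'_def using that by (intro lb.AA_tl_fun_linear t; simp)
 have b1: "bilin K K ?T (%x w. N w (DeltaR M x))" by (intro bilinI lin_comp[OF Nlin DR_linear] Nw) simp_all
 have b2: "bilin K K ?T (%w x. N' w (DeltaL M x))" by (intro bilinI lin_comp[OF N'lin DeltaL_linear] N'w) simp_all
 have move1: "N w (DeltaR M (bL l *[K] x)) = N (aL l *[K] w) (DeltaR M x)"
  if "l :. UR" "x :. K" "w :. K" for l x w
  unfolding DR_right_mult[OF that(1,2)] using that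
  by (subst rb.AA_tl_linear[OF _ Nlin]) (auto simp: N_def[of "aL l *[K] w"] Nten bal2 intro!: rb.AA_tl_cong)
 have move2: "N' (w *[K] aR l) (DeltaL M x) = N' w (DeltaL M (x *[K] bR l))"
  if "l :. U" "w :. K" "x :. K" for l x w
  unfolding DL_left_mult[OF that(1,3)] using that
  by (subst lb.AA_tl_linear[OF _ N'lin]) (auto simp: N'_def[of "w *[K] aR l"] N'ten bal1 intro!: lb.AA_tl_cong)
 have ba1: "balanced lb.E K K (%x w. N w (DeltaR M x))" by (intro lb.balanced_EI move1)
 have lin1: "linear_map lb.AA ?T (lift2 ?T (%x w. N w (DeltaR M x)))" by (intro lb.AA_linear b1 ba1) simp
 have lin2: "linear_map rb.AA ?T (lift2 ?T (%w x. N' w (DeltaL M x)))" by (rule rb_linear[OF _ b2]) (simp_all add: move2)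
 have eq1: "comult_id ER EL K (DeltaR M) s = lift2 ?T (%x w. N w (DeltaR M x)) s" for s by (simp add: comult_id_def N_def)
 have eq2: "id_comult ER EL K (DeltaL M) s = lift2 ?T (%w x. N' w (DeltaL M x)) s" for s by (simp add: id_comult_def N'_def)
 show ?thesis unfolding eq1 eq2 using b
 proof (induction rule: K_induct_left)
  case (mult D f)
  let ?y = "%x. iY D *[K] iH x"
  have tr: "trilin H ?T (%x z w. ?t (?y x) (iH z) (iH w))"
   unfolding trilin_def using mult(1)
   by (intro ballI conjI lin_comp[OF t(1)] lin_comp[OF t(2)] lin_comp[OF t(3)] iH_linear lin_fun_mult_left) simp_all
  have "lift2 ?T (%x w. N w (DeltaR M x)) (DeltaL M (iY D *[K] iH f)) =
    lift2 ?T (%x w. N (iH w) (DeltaR M (?y x))) (comult H f)"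
   by (rule lift_DL_left[OF _ b1 ba1]) (use mult in simp_all)
  also have "... = lift2 ?T (%x w. lift2 ?T (%x1 x2. ?t (?y x1) (iH x2) (iH w)) (comult H x)) (comult H f)"
  proof (intro H_tl_cong)
   fix x w assume xw: "x :. H" "w :. H"
   show "N (iH w) (DeltaR M (?y x)) = lift2 ?T (%x1 x2. ?t (?y x1) (iH x2) (iH w)) (comult H x)"
    unfolding N_def by (rule lift_DR_left) (use mult xw in \<open>auto intro!: bilinI t simp: bal1\<close>)
  qed (use mult in \<open>auto intro!: H_tl_closed\<close>)
  also have "... = lift2 ?T (%w x. lift2 ?T (%x1 x2. ?t (?y w) (iH x1) (iH x2)) (comult H x)) (comult H f)"
   using mult by (intro H_coassoc tr) simp_all
  also have "... = lift2 ?T (%w x. N' (?y w) (DeltaL M (iH x))) (comult H f)"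
  proof (intro H_tl_cong)
   fix w x assume xw: "w :. H" "x :. H"
   have "N' (?y w) (DeltaL M (iH x)) = lift2 ?T (%x1 x2. ?t (?y w) (iH x1) (iH x2)) (comult H x)"
    unfolding N'_def
    using lift_DL_left[OF _ N'b, of "iY D *[K] iH w" "\<one>[UR]" x] mult xw by (simp add: iY_simps) (intro H_tl_cong; simp)
   then show "lift2 ?T (%x1 x2. ?t (?y w) (iH x1) (iH x2)) (comult H x) = N' (?y w) (DeltaL M (iH x))" ..
  qed (use mult in \<open>auto intro!: lin_closed[OF N'lin] lin_closed[OF DeltaL_linear]\<close>)
  also have "... = lift2 ?T (%w x. N' w (DeltaL M x)) (DeltaR M (iY D *[K] iH f))"
   by (rule lift_DR_left[OF _ b2, symmetric]) (use mult move2 in simp_all)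
  finally show ?case .
 qed (simp add: lin_add[OF DR_linear] lin_add[OF DeltaL_linear] lin_add[OF lin1] lin_add[OF lin2] lin_closed[OF DeltaL_linear])
qed

lemma mixed_LR:
 assumes b: "b :. K"
 shows "comult_id EL ER K (DeltaL M) (DeltaR M b) = id_comult EL ER K (DeltaR M) (DeltaL M b)"
proof -
 let ?T = "tensor3 EL ER K" and ?t = "ten3 EL ER K"
 note t = ten3_facts[where V=K]
 have bal1: "?t (bL l *[K] x) z w = ?t x (aL l *[K] z) w" if "l :. UR" "x :. K" "z :. K" "w :. K" for l x z w
  using ten3_bal(1)[OF that(2-4) EL_mem[OF that(1)], of ER] .
 have bal2: "?t x (z *[K] aR l) w = ?t x z (w *[K] bR l)" if "l :. U" "x :. K" "z :. K" "w :. K" for l x z w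
  using ten3_bal(2)[OF that(2-4) ER_mem[OF that(1)], of EL] .
 define N where "N w s = lift2 ?T (%x1 x2. ?t x1 x2 w) s" for w s
 define N' where "N' w s = lift2 ?T (%x1 x2. ?t w x1 x2) s" for w s
 have N'lin: "linear_map rb.AA ?T (N' w)" and N'ten: "!!x z. x :. K ==> z :. K ==> N' w (rb.tn x z) = ?t w x z"
  if w: "w :. K" for w
 proof -
  have b: "bilin K K ?T (%x z. ?t w x z)" using w by (intro bilinI t; simp)
  show "linear_map rb.AA ?T (N' w)" unfolding N'_def by (rule rb_linear[OF _ b]) (simp_all add: w bal2)
  show "N' w (rb.tn x z) = ?t w x z" if "x :. K" "z :. K" for x z
   unfolding N'_def by (rule rb_ten[OF _ b]) (simp_all add: w bal2 that)
 qed
 have Nb: "bilin K K ?T (%x z. ?t x z w)" "balanced lb.E K K (%x z. ?t x z w)" if "w :. K" for w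
  using that by (intro bilinI t lb.balanced_EI; simp add: bal1)+
 have Nlin: "linear_map lb.AA ?T (N w)" if "w :. K" for w
  unfolding N_def using that by (intro lb.AA_linear Nb) simp_all
 have Nten: "N w (lb.tn x z) = ?t x z w" if "w :. K" "x :. K" "z :. K" for w x z
  unfolding N_def using that by (intro lb.AA_ten Nb) simp_all
 have Nw: "linear_map K ?T (%w. N w s)" if "s :. lb.AA" for s
  unfolding N_def using that by (intro lb.AA_tl_fun_linear t; simp)
 have N'w: "linear_map K ?T (%w. N' w s)" if "s :. rb.AA" for s
  unfolding N'_def using that by (intro rb.AA_tl_fun_linear t; simp)
 have b1: "bilin K K ?T (%x w. N w (DeltaL M x))" by (intro bilinI lin_comp[OF Nlin DeltaL_linear] Nw) simp_all
 have b2: "bilin K K ?T (%w x. N' w (DeltaR M x))" by (intro bilinI lin_comp[OF N'lin DR_linear] N'w) simp_all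
 have move1: "N w (DeltaL M (x *[K] aR l)) = N (w *[K] bR l) (DeltaL M x)"
  if "l :. U" "x :. K" "w :. K" for l x w
  unfolding DL_right_mult[OF that(1,2)] using that
  by (subst lb.AA_tl_linear[OF _ Nlin]) (auto simp: N_def[of "w *[K] bR l"] Nten bal2 intro!: lb.AA_tl_cong)
 have move2: "N' (bL l *[K] w) (DeltaR M x) = N' w (DeltaR M (aL l *[K] x))"
  if "l :. UR" "w :. K" "x :. K" for l x w
  unfolding DR_left_mult[OF that(1,3)] using that
  by (subst rb.AA_tl_linear[OF _ N'lin]) (auto simp: N'_def[of "bL l *[K] w"] N'ten bal1 intro!: rb.AA_tl_cong)
 have ba2: "balanced lb.E K K (%w x. N' w (DeltaR M x))" by (intro lb.balanced_EI move2)
 have lin2: "linear_map lb.AA ?T (lift2 ?T (%w x. N' w (DeltaR M x)))" by (intro lb.AA_linear b2 ba2) simp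
 have lin1: "linear_map rb.AA ?T (lift2 ?T (%x w. N w (DeltaL M x)))" by (rule rb_linear[OF _ b1]) (simp_all add: move1)
 have eq1: "comult_id EL ER K (DeltaL M) s = lift2 ?T (%x w. N w (DeltaL M x)) s" for s by (simp add: comult_id_def N_def)
 have eq2: "id_comult EL ER K (DeltaR M) s = lift2 ?T (%w x. N' w (DeltaR M x)) s" for s by (simp add: id_comult_def N'_def)
 show ?thesis unfolding eq1 eq2 using b
 proof (induction rule: K_induct_left)
  case (mult D f)
  let ?y = "%x. iY D *[K] iH x"
  have tr: "trilin H ?T (%x z w. ?t (?y x) (iH z) (iH w))"
   unfolding trilin_def using mult(1)
   by (intro ballI conjI lin_comp[OF t(1)] lin_comp[OF t(2)] lin_comp[OF t(3)] iH_linear lin_fun_mult_left) simp_all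
  have "lift2 ?T (%x w. N w (DeltaL M x)) (DeltaR M (iY D *[K] iH f)) =
    lift2 ?T (%x w. N (iH w) (DeltaL M (?y x))) (comult H f)"
   by (rule lift_DR_left[OF _ b1]) (use mult move1 in simp_all)
  also have "... = lift2 ?T (%x w. lift2 ?T (%x1 x2. ?t (?y x1) (iH x2) (iH w)) (comult H x)) (comult H f)"
  proof (intro H_tl_cong)
   fix x w assume xw: "x :. H" "w :. H"
   show "N (iH w) (DeltaL M (?y x)) = lift2 ?T (%x1 x2. ?t (?y x1) (iH x2) (iH w)) (comult H x)"
    unfolding N_def by (rule lift_DL_left[OF _ Nb]) (use mult xw in simp_all)
  qed (use mult in \<open>auto intro!: H_tl_closed\<close>)
  also have "... = lift2 ?T (%w x. lift2 ?T (%x1 x2. ?t (?y w) (iH x1) (iH x2)) (comult H x)) (comult H f)"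
   using mult by (intro H_coassoc tr) simp_all
  also have "... = lift2 ?T (%w x. N' (?y w) (DeltaR M (iH x))) (comult H f)"
  proof (intro H_tl_cong)
   fix w x assume xw: "w :. H" "x :. H"
   have "N' (?y w) (DeltaR M (iH x)) = lift2 ?T (%x1 x2. ?t (?y w) (iH x1) (iH x2)) (comult H x)"
   proof -
    have bw: "bilin K K ?T (?t (?y w))" using mult xw by (intro bilinI t; simp)
    have "lift2 ?T (%x1 x2. ?t (?y w) x1 x2) (DeltaR M (iY \<one>[UR] *[K] iH x)) =
      lift2 ?T (%x1 x2. ?t (?y w) (iY \<one>[UR] *[K] iH x1) (iH x2)) (comult H x)"
     by (rule lift_DR_left[OF _ bw]) (use mult xw bal2 in simp_all)
    also have "... = lift2 ?T (%x1 x2. ?t (?y w) (iH x1) (iH x2)) (comult H x)"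
     using mult xw by (intro H_tl_cong) (simp_all add: iY_simps)
    finally show ?thesis using xw by (simp add: N'_def iY_simps)
   qed
   then show "lift2 ?T (%x1 x2. ?t (?y w) (iH x1) (iH x2)) (comult H x) = N' (?y w) (DeltaR M (iH x))" ..
  qed (use mult in \<open>auto intro!: lin_closed[OF N'lin] lin_closed[OF DR_linear]\<close>)
  also have "... = lift2 ?T (%w x. N' w (DeltaR M x)) (DeltaL M (iY D *[K] iH f))"
   by (rule lift_DL_left[OF _ b2 ba2, symmetric]) (use mult in simp_all)
  finally show ?case .
 qed (simp add: lin_add[OF DR_linear] lin_add[OF DeltaL_linear] lin_add[OF lin1] lin_add[OF lin2] lin_closed[OF DeltaL_linear])
qed

theorem hopf_algebroid: "hopf_algebroid K UR U M"
 unfolding hopf_algebroid_def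
proof (intro conjI ballI)
 show "aL (epsL M (bR r)) = bR r" if "r :. U" for r
  using that by (simp add: bR_aL lb.ep_al_one)
 show "bL (epsL M (aR r)) = aR r" if "r :. U" for r
  using that by (simp add: aR_bL lb.ep_be_one)
 show "aR (epsR M (bL l)) = bL l" if "l :. UR" for l
  using that by (simp add: bL_aR rb.ep_be_one)
 show "bR (epsR M (aL l)) = aL l" if "l :. UR" for l
  using that by (simp add: aL_bR rb.ep_al_one)
qed (simp_all add: lb.left_bialgebroid right_bialgebroid tau_anti mixed_RL mixed_LR tau_betaL tau_betaR antipode_left antipode_right)

end

context dual_pair
begin

section \<open>Existence of the scalar extension\<close>

definition JUi where "JUi = inv_into (carrier (tensor U H)) JU"

lemma JUi_closed [simp]: "k :. K ==> JUi k :. (tensor U H)"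
 unfolding JUi_def using JU_image by (auto intro!: inv_into_into)

lemma JU_JUi: "k :. K ==> JU (JUi k) = k"
 unfolding JUi_def using JU_image by (intro f_inv_into_f) simp

lemma JUi_JU: "t :. (tensor U H) ==> JUi (JU t) = t"
 unfolding JUi_def by (intro inv_into_f_f JU_inj)

lemma JUi_linear: "linear_map K (tensor U H) JUi"
proof (rule linear_mapI)
 show "JUi (x +[K] y) = JUi x +[tensor U H] JUi y" if "x :. K" "y :. K" for x y
 proof -
  have "JUi (x +[K] y) = JUi (JU (JUi x +[tensor U H] JUi y))"
   using that by (simp add: lin_add[OF JU_linear] JU_JUi)
  then show ?thesis using that by (simp add: JUi_JU)
 qed
 show "JUi (c .[K] x) = c .[tensor U H] JUi x" if "x :. K" for c x
 proof -
  have "JUi (c .[K] x) = JUi (JU (c .[tensor U H] JUi x))"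
   using that by (simp add: lin_smult[OF JU_linear] JU_JUi)
  then show ?thesis using that by (simp add: JUi_JU)
 qed
qed simp

lemma JUi_iY: "D :. UR ==> f :. H ==> JUi (iY D *[K] iH f) = ten U H (psi g D) f"
 by (simp add: iY_def JUi_JU flip: JU_ten)

definition betaL0 where "betaL0 D = iX (shift 1 (psi g D))"
abbreviation EL0 where "EL0 \<equiv> left_balancing K UR iY betaL0"
abbreviation ER0 where "ER0 \<equiv> right_balancing K U iX lm"

text \<open>Left structure maps are defined through the factorisation \<open>Y f\<close>, right ones through \<open>f X\<close>.\<close>

definition extension_maps :: "('k, ('k, 'g) env, ('k, 'g) env, ('k, 'h \<times> ('k, 'g) env) formal) algebroid_maps" where
 "extension_maps = \<lparr>alphaL = iY, betaL = betaL0,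
  DeltaL = (%k. tensor_lift (tensor_over EL0 K K) (%(a, f).
    lift2 (tensor_over EL0 K K) (%x z. ten_over EL0 K K (lm a *[K] iH x) (iH z)) (comult H f)) (JUi k)),
  epsL = (%k. lift2 UR (%a f. counit H f .[UR] phi g a) (JUi k)),
  alphaR = iX, betaR = lm,
  DeltaR = (%k. tensor_lift (tensor_over ER0 K K) (%(f, a).
    lift2 (tensor_over ER0 K K) (%x z. ten_over ER0 K K (iH x) (iH z *[K] iX a)) (comult H f)) k),
  epsR = (%k. lift2 U (%f a. counit H f .[U] a) k),
  tau = ta\<rparr>"

lemma betaL0_anti: "alg_antihom UR K betaL0"
 unfolding betaL0_def by (intro alg_antihom_comp[OF iX_hom] alg_antihom_comp[OF shift_hom] psi_antihom) simp

lemma phi_linear: "linear_map U UR (phi g)"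
 by (rule alg_antihom_linear[OF phi_antihom]) simp

theorem extension_maps: "scalar_extension g H p u extension_maps"
proof unfold_locales
 let ?T = "tensor_over EL0 K K" and ?t = "ten_over EL0 K K"
 have b1: "bilin H H ?T (%x z. ?t (lm a *[K] iH x) (iH z))" if "a :. U" for a
  using that by (intro bilinI lin_comp[OF ten_right] lin_comp[OF ten_left] iH_linear lin_fun_mult_left) simp_all
 have b2: "bilin U H ?T (%a f. lift2 ?T (%x z. ?t (lm a *[K] iH x) (iH z)) (comult H f))"
  by (intro bilinI H_tl_fun_linear lin_comp[OF ten_left] lin_fun_mult_right lm_linear
    lin_comp[OF lift_linear[OF H_vspace H_vspace bal_maps_empty _ b1 balanced_empty] H_comult_linear]) simp_all
 show "linear_map K (tensor_over (balL K UR extension_maps) K K) (DeltaL extension_maps)"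
  unfolding extension_maps_def algebroid_maps.simps
  by (intro lin_comp[OF lift_linear[OF env_vspace H_vspace bal_maps_empty _ b2 balanced_empty] JUi_linear]) simp_all
 show "DeltaL extension_maps (iY D *[K] iH h) = tensor_lift (tensor_over (balL K UR extension_maps) K K)
   (%(h1, h2). ten_over (balL K UR extension_maps) K K (iY D *[K] iH h1) (iH h2)) (comult H h)"
  if "D :. UR" "h :. H" for D h
  unfolding extension_maps_def algebroid_maps.simps using that
  by (simp add: JUi_iY lift_ten[OF _ _ _ _ b2]) (simp add: iY_def)
 let ?T' = "tensor_over ER0 K K" and ?t' = "ten_over ER0 K K"
 have c1: "bilin H H ?T' (%x z. ?t' (iH x) (iH z *[K] iX a))" if "a :. U" for a
  using that by (intro bilinI lin_comp[OF ten_right] lin_comp[OF ten_left] iH_linear lin_fun_mult_right) simp_all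
 have c2: "bilin H U ?T' (%f a. lift2 ?T' (%x z. ?t' (iH x) (iH z *[K] iX a)) (comult H f))"
  by (intro bilinI H_tl_fun_linear lin_comp[OF ten_right] lin_fun_mult_left iX_linear
    lin_comp[OF lift_linear[OF H_vspace H_vspace bal_maps_empty _ c1 balanced_empty] H_comult_linear]) simp_all
 show "linear_map K (tensor_over (balR K U extension_maps) K K) (DeltaR extension_maps)"
  unfolding extension_maps_def algebroid_maps.simps K_lin
  by (intro lift_linear[OF H_vspace env_vspace bal_maps_empty _ c2 balanced_empty]) simp
 show "DeltaR extension_maps (iH h *[K] iX D) = tensor_lift (tensor_over (balR K U extension_maps) K K)
   (%(h1, h2). ten_over (balR K U extension_maps) K K (iH h1) (iH h2 *[K] iX D)) (comult H h)"
  if "D :. U" "h :. H" for D h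
  unfolding extension_maps_def algebroid_maps.simps using that
  by (simp add: lift_ten[OF _ _ _ _ c2] flip: ten_eq_mult)
 have e1: "bilin U H UR (%a f. counit H f .[UR] phi g a)"
  by (intro bilinI lin_fun_scalar H_counit_linear lin_fun_smult phi_linear) simp_all
 show "linear_map K UR (epsL extension_maps)"
  unfolding extension_maps_def algebroid_maps.simps
  by (intro lin_comp[OF lift_linear[OF env_vspace H_vspace bal_maps_empty _ e1 balanced_empty] JUi_linear]) simp_all
 show "epsL extension_maps (iY D *[K] iH h) = counit H h .[UR] D" if "D :. UR" "h :. H" for D h
  unfolding extension_maps_def algebroid_maps.simps using that
  by (simp add: JUi_iY lift_ten[OF _ _ _ _ e1] phi_psi)
 have e2: "bilin H U U (%f a. counit H f .[U] a)"
  by (intro bilinI lin_fun_scalar H_counit_linear lin_fun_smult lin_id) simp_all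
 show "linear_map K U (epsR extension_maps)"
  unfolding extension_maps_def algebroid_maps.simps K_lin
  by (intro lift_linear[OF H_vspace env_vspace bal_maps_empty _ e2 balanced_empty]) simp
 show "epsR extension_maps (iH h *[K] iX D) = counit H h .[U] D" if "D :. U" "h :. H" for D h
  unfolding extension_maps_def algebroid_maps.simps using that
  by (simp add: lift_ten[OF _ _ _ _ e2] flip: ten_eq_mult)
qed (simp_all add: extension_maps_def betaL0_anti lm_antihom ta_antihom ta_lm ta_iH, simp_all add: betaL0_def psi_gen shift_gen iX_simps)

section \<open>The isomorphism with the smash product on the other side\<close>

lemma smash_left_iso:
 assumes l: "!!f b. f :. H ==> b :. UR ==> l f b = phi g (act (psi g b) (S f))"
  and q: "!!b f. b :. UR ==> f :. H ==> q b f = iY b *[K] iH f"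
 shows "alg_iso (smash_left UR H l) K (lift2 K (%b f. q b f))"
proof -
 let ?W = "tensor UR H" and ?J = "lift2 K (%b f. q b f)" and ?A = "smash_left UR H l"
 have A: "carrier ?A = carrier ?W" "add ?A = add ?W" "zero ?A = zero ?W" "module.smult ?A = module.smult ?W"
   "\<one>[?A] = ten UR H \<one>[UR] \<one>[H]" by (simp_all add: smash_left_def)
 have qb: "bilin UR H K q"
 proof (intro bilinI)
  show "linear_map H K (q b)" if "b :. UR" for b
   using lin_cong[of H "q b" "%f. iY b *[K] iH f" K] that by (simp add: q lin_fun_mult_left iH_linear)
  show "linear_map UR K (%b. q b f)" if "f :. H" for f
   using lin_cong[of UR "%b. q b f" "%b. iY b *[K] iH f" K] that
   by (simp add: q lin_fun_mult_right alg_hom_linear[OF iY_hom])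
 qed
 note Jlin = lift_linear[OF env_vspace H_vspace bal_maps_empty K_vspace qb balanced_empty]
 have Jten: "?J (ten UR H b f) = iY b *[K] iH f" if "b :. UR" "f :. H" for b f
  using that by (simp add: lift_ten[OF _ _ _ _ qb] q)
 have lcl: "l f b :. UR" if "f :. H" "b :. UR" for f b using that by (simp add: l)
 have inner: "?J (lift2 ?W (%x z. ten UR H (b *[UR] l x b') (z *[H] f')) (comult H f)) =
   (iY b *[K] iH f) *[K] (iY b' *[K] iH f')"
  if *: "b :. UR" "b' :. UR" "f :. H" "f' :. H" for b b' f f'
 proof -
  have "?J (lift2 ?W (%x z. ten UR H (b *[UR] l x b') (z *[H] f')) (comult H f)) =
    lift2 K (%x z. iY b *[K] (lm (act (psi g b') (S x)) *[K] iH z) *[K] iH f') (comult H f)"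
   using * lcl by (subst H_tl_linear[OF _ Jlin]) (auto simp: Jten l iY_simps iY_phi iH_simps K.m_assoc intro!: H_tl_cong)
  also have "... = iY b *[K] lift2 K (%x z. lm (act (psi g b') (S x)) *[K] iH z) (comult H f) *[K] iH f'"
   using * by (intro H_tl_linear[OF _ lin_fun_mult_right[OF K_algebra _ lin_mult_left], symmetric]) simp_all
  also have "... = iY b *[K] (iH f *[K] lm (psi g b')) *[K] iH f'"
   using * by (simp add: iH_lm)
  finally show ?thesis using * by (simp add: iY_def K.m_assoc)
 qed
 have incl: "lift2 ?W (%x z. ten UR H (b *[UR] l x b') (z *[H] f')) (comult H f) :. ?W"
  if "b :. UR" "b' :. UR" "f :. H" "f' :. H" for b b' f f'
  using that lcl by (intro H_tl_closed) simp_all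
 note Wcl = tl2_closed[OF env_vspace H_vspace bal_maps_empty] and Wlin = tl2_linear[OF env_vspace H_vspace bal_maps_empty]
  and Wcong = tl2_cong[OF env_vspace H_vspace bal_maps_empty]
 have mult: "?J (s *[?A] t) = ?J s *[K] ?J t" if st: "s :. ?W" "t :. ?W" for s t
 proof -
  let ?M = "%b f b' f'. lift2 ?W (%x z. ten UR H (b *[UR] l x b') (z *[H] f')) (comult H f)"
  have qcl: "q b f :. K" if "b :. UR" "f :. H" for b f using that by (simp add: q)
  have Jt: "?J t :. K" using st by (simp add: lin_closed[OF Jlin])
  have in1: "?J (lift2 ?W (%b' f'. ?M b f b' f') t) = q b f *[K] ?J t" if bf: "b :. UR" "f :. H" for b f
  proof -
   have "?J (lift2 ?W (%b' f'. ?M b f b' f') t) = lift2 K (%b' f'. ?J (?M b f b' f')) t"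
    using st bf incl by (intro Wlin[OF _ Jlin]) simp_all
   also have "... = lift2 K (%b' f'. q b f *[K] q b' f') t"
   proof (intro Wcong)
    fix b' f' assume b': "b' :. UR" and f': "f' :. H"
    show "?J (?M b f b' f') = q b f *[K] q b' f'"
     unfolding q[OF bf] q[OF b' f'] by (rule inner[OF bf(1) b' bf(2) f'])
    show "q b f *[K] q b' f' :. K" using qcl[OF bf] qcl[OF b' f'] by simp
   qed (use st in simp_all)
   also have "... = q b f *[K] ?J t"
    using st bf qcl by (intro Wlin[OF _ lin_mult_left, symmetric]) simp_all
   finally show ?thesis .
  qed
  have "?J (s *[?A] t) = ?J (lift2 ?W (%b f. lift2 ?W (%b' f'. ?M b f b' f') t) s)"
   by (simp add: smash_left_def)
  also have "... = lift2 K (%b f. ?J (lift2 ?W (%b' f'. ?M b f b' f') t)) s"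
   using st incl by (intro Wlin[OF _ Jlin] Wcl) simp_all
  also have "... = lift2 K (%b f. q b f *[K] ?J t) s"
  proof (intro Wcong)
   fix b f assume b: "b :. UR" and f: "f :. H"
   show "?J (lift2 ?W (%b' f'. ?M b f b' f') t) = q b f *[K] ?J t" by (rule in1[OF b f])
   show "q b f *[K] ?J t :. K" using qcl[OF b f] Jt by simp
  qed (use st in simp_all)
  also have "... = ?J s *[K] ?J t"
   using st Jt qcl by (intro Wlin[OF _ lin_mult_right, symmetric]) simp_all
  finally show ?thesis .
 qed
 define G where "G k = lift2 ?W (%a f. ten UR H (phi g a) f) (JUi k)" for k
 have Gb: "bilin U H ?W (%a f. ten UR H (phi g a) f)"
  by (intro bilinI ten_right lin_comp[OF ten_left phi_linear]) simp_all
 have Glin: "linear_map K ?W G" unfolding G_def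
  by (intro lin_comp[OF lift_linear[OF env_vspace H_vspace bal_maps_empty _ Gb balanced_empty] JUi_linear]) simp
 have Gmul: "G (iY b *[K] iH f) = ten UR H b f" if "b :. UR" "f :. H" for b f
  unfolding G_def using that by (simp add: JUi_iY lift_ten[OF _ _ _ _ Gb] phi_psi)
 have GJ: "G (?J t) = t" if "t :. ?W" for t
  by (rule tensor_ext[where E="{}" and M=UR and N=H and B="?W" and f="%t. G (?J t)" and g="%t. t"])
   (use that in \<open>simp_all add: lin_comp[OF Glin Jlin] lin_id Jten Gmul\<close>)
 have JG: "?J (G k) = k" if "k :. K" for k using that
  by (induction rule: K_induct_left)
   (simp_all add: Gmul Jten lin_add[OF Glin] lin_add[OF Jlin] lin_closed[OF Glin])
 have bij: "bij_betw ?J (carrier ?W) (carrier K)"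
  by (rule bij_betwI[where g=G]) (use GJ JG lin_closed[OF Glin] lin_closed[OF Jlin] in auto)
 have lin: "linear_map ?A K ?J" using Jlin by (simp add: linear_map_def A)
 show ?thesis
  unfolding alg_iso_def alg_hom_def using lin mult bij
  by (simp add: A Jten iY_simps iH_simps)
qed

end

section \<open>Spaces of functions\<close>

definition pointwise :: "('k::field, 'x => 'k, 'm) module_scheme => bool" where
 "pointwise V \<longleftrightarrow> add V = (%f h x. f x + h x) \<and> zero V = (%x. 0) \<and> module.smult V = (%c f x. c * f x)"

lemma pointwise_simps:
 assumes "pointwise V"
 shows "f +[V] h = (%x. f x + h x)" "\<zero>[V] = (%x. 0)" "c .[V] f = (%x. c * f x)"
 using assms by (simp_all add: pointwise_def)

lemma pointwise_vspace:
 fixes V :: "('k::field, 'x => 'k, 'm) module_scheme"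
 assumes V: "pointwise V" and zero: "(%x. 0) :. V"
  and add: "!!f h. f :. V ==> h :. V ==> (%x. f x + h x) :. V"
  and smult: "!!c f. f :. V ==> (%x. c * f x) :. V"
 shows "vspace V"
proof (rule vspaceI)
 note [simp] = pointwise_simps[OF V]
 show "abelian_group V"
 proof (rule abelian_groupI)
  show "\<exists>h\<in>carrier V. h +[V] f = \<zero>[V]" if "f :. V" for f
   using smult[OF that, of "- 1"] by (intro bexI[of _ "%x. - 1 * f x"]) simp_all
 qed (auto simp: zero add algebra_simps)
qed (auto simp: pointwise_simps[OF V] zero add smult algebra_simps)

lemma pointwise_finsum:
 fixes V :: "('k::field, 'x => 'k, 'm) module_scheme"
 assumes V: "pointwise V" "vspace V" and f: "!!i. i \<in> A ==> f i :. V" and A: "finite A"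
 shows "finsum V f A = (%x. \<Sum>i\<in>A. f i x)"
 using A f
proof (induction A rule: finite_induct)
 case empty
 then show ?case using V by (simp add: pointwise_simps[OF V(1)])
next
 case (insert i A)
 have "finsum V f (insert i A) = f i +[V] finsum V f A"
  using insert by (intro vs_finsum_insert V(2)) auto
 then show ?case using insert by (simp add: pointwise_simps[OF V(1)])
qed

lemma eval_linear: "pointwise V ==> linear_map V scalars (%f. f x)"
 by (simp add: linear_map_def pointwise_simps)

lemma eval_bilin: "pointwise V ==> pointwise W ==> bilin V W scalars (%f h. f x * h y)"
 by (simp add: bilin_def linear_map_def pointwise_simps algebra_simps)

lemma tensor_lift_finsum_ten:
 fixes V :: "('k::field, 'a, 'm) module_scheme" and W :: "('k, 'b, 'n) module_scheme" and B :: "('k, 'z, 'r) module_scheme"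
 assumes V: "vspace V" "vspace W" and B: "vspace B" and b: "bilin V W B b"
  and a: "!!k. k \<in> A ==> a k :. V" "!!k. k \<in> A ==> c k :. W"
 shows "lift2 B (%x y. b x y) (finsum (tensor V W) (%k. ten V W (a k) (c k)) A) = finsum B (%k. b (a k) (c k)) A"
proof -
 have "lift2 B (%x y. b x y) (finsum (tensor V W) (%k. ten V W (a k) (c k)) A) =
   finsum B (%k. lift2 B (%x y. b x y) (ten V W (a k) (c k))) A"
  using a V B b by (intro lin_finsum lift_linear) simp_all
 also have "... = finsum B (%k. b (a k) (c k)) A"
  using a V B b by (intro vs_finsum_cong) (auto simp: lift_ten intro: bilin_closed)
 finally show ?thesis .
qed

lemma tensor_cong:
 assumes "carrier V' = carrier V" "add V' = add V" "module.smult V' = module.smult V"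
  "carrier W' = carrier W" "add W' = add W" "module.smult W' = module.smult W"
 shows "tensor V' W' = tensor V W" "ten V' W' = ten V W"
 using assms by (simp_all add: tensor_over_def ten_over_def tensor_rels_def lin_rels_def fun_eq_iff)

section \<open>The matrix algebra and the adjoint representation\<close>

definition mat_alg :: "nat set => ('k::field, nat \<times> nat => 'k) module" where
 "mat_alg I = \<lparr>carrier = {A. \<forall>x. x \<notin> I \<times> I \<longrightarrow> A x = 0},
  monoid.mult = (%A B (i, j). \<Sum>k\<in>I. A (i, k) * B (k, j)),
  one = (%(i, j). if i = j \<and> i \<in> I then 1 else 0), zero = (%x. 0), add = (%A B x. A x + B x),
  module.smult = (%c A x. c * A x)\<rparr>"

lemma mat_pointwise: "pointwise (mat_alg I)" by (simp add: pointwise_def mat_alg_def)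

lemma mat_alg_k_algebra:
 assumes I: "finite I"
 shows "k_algebra (mat_alg I :: ('k::field, nat \<times> nat => 'k) module)"
proof (rule k_algebraI)
 let ?M = "mat_alg I :: ('k::field, nat \<times> nat => 'k) module"
 have cl: "A *[?M] B :. ?M" if "A :. ?M" "B :. ?M" for A B
  using that by (auto simp: mat_alg_def intro!: sum.neutral)
 show "vspace ?M" by (rule pointwise_vspace[OF mat_pointwise]) (auto simp: mat_alg_def)
 show "\<one>[?M] :. ?M" by (auto simp: mat_alg_def)
 show "A *[?M] B :. ?M" if "A :. ?M" "B :. ?M" for A B using that by (rule cl)
 show "\<one>[?M] *[?M] A = A" if "A :. ?M" for A
 proof
  fix x :: "nat \<times> nat"
  obtain i j where x: "x = (i, j)" by (cases x)
  have "(\<Sum>k\<in>I. (if i = k \<and> i \<in> I then 1 else 0) * A (k, j)) = (\<Sum>k\<in>I. if k = i then A (k, j) else 0)"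
   by (intro sum.cong) auto
  then show "(\<one>[?M] *[?M] A) x = A x" using that I by (auto simp: mat_alg_def x)
 qed
 show "A *[?M] \<one>[?M] = A" if "A :. ?M" for A
 proof
  fix x :: "nat \<times> nat"
  obtain i j where x: "x = (i, j)" by (cases x)
  have "(\<Sum>k\<in>I. A (i, k) * (if k = j \<and> k \<in> I then 1 else 0)) = (\<Sum>k\<in>I. if k = j then A (i, k) else 0)"
   by (intro sum.cong) auto
  then show "(A *[?M] \<one>[?M]) x = A x" using that I by (auto simp: mat_alg_def x)
 qed
 show "(A *[?M] B) *[?M] C = A *[?M] (B *[?M] C)" for A B C
 proof
  fix x :: "nat \<times> nat"
  obtain i j where x: "x = (i, j)" by (cases x)
  have "(\<Sum>k\<in>I. (\<Sum>l\<in>I. A (i, l) * B (l, k)) * C (k, j)) = (\<Sum>l\<in>I. \<Sum>k\<in>I. A (i, l) * (B (l, k) * C (k, j)))"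
   by (subst sum.swap) (simp add: sum_distrib_right mult.assoc)
  then show "((A *[?M] B) *[?M] C) x = (A *[?M] (B *[?M] C)) x"
   by (simp add: mat_alg_def x sum_distrib_left)
 qed
 show "linear_map ?M ?M (%x. A *[?M] x)" if "A :. ?M" for A
  using cl that by (intro linear_mapI) (auto simp: mat_alg_def fun_eq_iff distrib_left sum.distrib sum_distrib_left mult_ac)
 show "linear_map ?M ?M (%x. x *[?M] A)" if "A :. ?M" for A
  using cl that by (intro linear_mapI) (auto simp: mat_alg_def fun_eq_iff distrib_left distrib_right sum.distrib sum_distrib_left mult_ac)
qed

context
 fixes g :: "('k::field, 'g::ab_group_add) based_lie"
 assumes g: "based_lie_algebra g"
begin

lemma ad_bracket:
 "(\<Sum>r\<in>idx g. struct_const g k r i * struct_const g l j r) =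
 (\<Sum>r\<in>idx g. struct_const g l r i * struct_const g k j r) + (\<Sum>m\<in>idx g. struct_const g k l m * struct_const g m j i)"
proof -
 interpret lie_algebra "lie_scale g" "lie_bracket g" using g by (simp add: based_lie_algebra_def)
 let ?C = "struct_const g"
 have C: "coef g (lie_bracket g (lie_basis g i) (lie_bracket g (lie_basis g k) (lie_basis g j))) m =
   (\<Sum>l\<in>idx g. ?C k j l * ?C i l m)" for i k j m
  by (subst coef_bracket[OF g]) (simp add: struct_const_coef[OF g])
 have "(\<Sum>r\<in>idx g. ?C l j r * ?C k r i) + (\<Sum>r\<in>idx g. ?C j k r * ?C l r i) + (\<Sum>r\<in>idx g. ?C k l r * ?C j r i) = 0"
  using arg_cong[OF jacobi[of "lie_basis g k" "lie_basis g l" "lie_basis g j"], of "%x. coef g x i"] coef_scale[OF g, of 0 0 i]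
  by (simp add: coef_add[OF g] C)
 moreover have "(\<Sum>r\<in>idx g. ?C j k r * ?C l r i) = - (\<Sum>r\<in>idx g. ?C l r i * ?C k j r)"
  by (simp add: struct_const_antisym[OF g, of j k] sum_negf mult.commute)
 moreover have "(\<Sum>r\<in>idx g. ?C k l r * ?C j r i) = - (\<Sum>r\<in>idx g. ?C k l r * ?C r j i)"
  by (simp add: struct_const_antisym[OF g, of j] sum_negf)
 ultimately show ?thesis by (simp add: mult.commute algebra_simps)
qed

definition ad_mat :: "nat => nat \<times> nat => 'k" where
 "ad_mat k = (%(i, j). if i \<in> idx g \<and> j \<in> idx g then struct_const g k j i else 0)"

lemma adjoint_representation: "\<exists>F. alg_hom (env g) (mat_alg (idx g)) F \<and> (\<forall>k\<in>idx g. F (env_gen g k) = ad_mat k)"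
proof (rule env_universal_basis[OF g mat_alg_k_algebra, of "idx g" ad_mat])
 let ?M = "mat_alg (idx g) :: ('k::field, nat \<times> nat => 'k) module"
 show cl: "ad_mat k :. ?M" for k by (auto simp: ad_mat_def mat_alg_def)
 have V: "vspace ?M" by (intro k_algebra_vspace mat_alg_k_algebra) simp
 fix k l
 have s: "finsum ?M (%m. struct_const g k l m .[?M] ad_mat m) (idx g) = (%x. \<Sum>m\<in>idx g. struct_const g k l m * ad_mat m x)"
  using pointwise_finsum[OF mat_pointwise V, of "idx g" "%m. struct_const g k l m .[?M] ad_mat m"] vs_closed(2)[OF V cl]
  by (simp add: pointwise_simps[OF mat_pointwise])
 show "ad_mat k *[?M] ad_mat l = ad_mat l *[?M] ad_mat k +[?M] finsum ?M (%m. struct_const g k l m .[?M] ad_mat m) (idx g)"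
  unfolding s
  by (simp add: mat_alg_def ad_mat_def fun_eq_iff, intro allI, rename_tac a b, case_tac "a \<in> idx g"; case_tac "b \<in> idx g")
   (simp_all add: ad_bracket[of k _ l])
qed (simp, blast)

end

section \<open>The finite dual of an enveloping algebra\<close>

context
 fixes g :: "('k::field, 'g::ab_group_add) based_lie"
 assumes g: "based_lie_algebra g"
begin

abbreviation (input) DA where "DA \<equiv> dual_algebra (env g)"
abbreviation (input) FA where "FA \<equiv> finite_dual_algebra (env g)"

lemma DA_pointwise: "pointwise DA" by (simp add: pointwise_def dual_algebra_def)
lemma FA_pointwise: "pointwise FA" by (simp add: pointwise_def finite_dual_algebra_def dual_algebra_def)

lemma DA_carrier: "f :. DA \<longleftrightarrow> linear_map (env g) scalars f \<and> (\<forall>D. D \<notin> carrier (env g) \<longrightarrow> f D = 0)"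
 by (simp add: dual_algebra_def)

lemma DA_vspace: "vspace DA"
 by (rule pointwise_vspace[OF DA_pointwise]) (auto simp: DA_carrier linear_map_def algebra_simps)

lemma splits_iff: "splits (env g) f t \<longleftrightarrow> (\<forall>D\<in>carrier (env g). \<forall>E\<in>carrier (env g).
  f (D *[env g] E) = lift2 scalars (%x y. x D * y E) t)"
 by (simp add: splits_def)

lemma FA_carrier: "f :. FA \<longleftrightarrow> f :. DA \<and> (\<exists>t\<in>carrier (tensor DA DA). splits (env g) f t)"
 by (simp add: finite_dual_algebra_def)

lemma FA_I: "f :. DA ==> t :. (tensor DA DA) ==> splits (env g) f t ==> f :. FA"
 unfolding FA_carrier by (intro conjI bexI)

lemma split_linear: "linear_map (tensor DA DA) scalars (lift2 scalars (%x y. x D * y E))"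
 using DA_vspace by (intro lift_linear eval_bilin DA_pointwise) simp_all

lemma FA_vspace: "vspace FA"
proof (rule pointwise_vspace[OF FA_pointwise])
 note V = vspace_tensor_over[of "{}" DA DA]
 show "(%x. 0) :. FA"
 proof -
  have "splits (env g) (%x. 0) \<zero>[tensor DA DA]"
   using lin_zero[OF V vspace_scalars split_linear] by (simp add: splits_iff)
  moreover have "(%x. 0) :. DA"
   using vs_closed(5)[OF DA_vspace] pointwise_simps(2)[OF DA_pointwise] by simp
  ultimately show ?thesis using vs_closed(5)[OF V] by (intro FA_I)
 qed
 show "(%x. f x + h x) :. FA" if fh: "f :. FA" "h :. FA" for f h
 proof -
  from fh obtain s t where st: "s :. (tensor DA DA)" "splits (env g) f s" "t :. (tensor DA DA)" "splits (env g) h t"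
   unfolding FA_carrier by blast
  then have "splits (env g) (%x. f x + h x) (s +[tensor DA DA] t)"
   by (simp add: splits_iff lin_add[OF split_linear])
  moreover have "(%x. f x + h x) :. DA"
   using vs_closed(1)[OF DA_vspace, of f h] fh by (simp add: FA_carrier pointwise_simps[OF DA_pointwise])
  ultimately show ?thesis using vs_closed(1)[OF V st(1,3)] by (intro FA_I)
 qed
 show "(%x. c * f x) :. FA" if f: "f :. FA" for f c
 proof -
  from f obtain s where st: "s :. (tensor DA DA)" "splits (env g) f s"
   unfolding FA_carrier by blast
  then have "splits (env g) (%x. c * f x) (c .[tensor DA DA] s)"
   by (simp add: splits_iff lin_smult[OF split_linear])
  moreover have "(%x. c * f x) :. DA"
   using vs_closed(2)[OF DA_vspace, of f c] f by (simp add: FA_carrier pointwise_simps[OF DA_pointwise])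
  ultimately show ?thesis using vs_closed(2)[OF V st(1)] by (intro FA_I)
 qed
qed

text \<open>So the comultiplication of the finite dual, a choice, can be computed from any splitting.\<close>

lemma splits_unique:
 assumes "s :. (tensor FA FA)" "splits (env g) f s" "t :. (tensor FA FA)" "splits (env g) f t"
 shows "s = t"
proof (rule tensor_separate[OF FA_vspace FA_vspace, where p="%D f. f D" and q="%D f. f D" and S="carrier (env g)" and T="carrier (env g)"])
 show "v = \<zero>[FA]" if "v :. FA" "!!D. D :. (env g) ==> v D = 0" for v
  using that by (auto simp: FA_carrier DA_carrier pointwise_simps[OF FA_pointwise] fun_eq_iff)
 then show "v = \<zero>[FA]" if "v :. FA" "!!D. D :. (env g) ==> v D = 0" for v using that .
qed (use assms in \<open>auto simp: eval_linear FA_pointwise splits_iff\<close>)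

abbreviation (input) FD where "FD \<equiv> finite_dual (env g)"

lemma FD_simps:
 "carrier FD = carrier FA" "add FD = add FA" "zero FD = zero FA" "module.smult FD = module.smult FA"
 "counit FD f = f \<one>[env g]" "antipode FD f = (%D. if D :. (env g) then f (antipode (env g) D) else 0)"
 by (simp_all add: finite_dual_def module.defs hopf.defs)

lemma FD_tensor: "tensor FD FD = tensor FA FA" "ten FD FD = ten FA FA"
 by (intro tensor_cong; simp add: FD_simps)+

lemma FD_comult:
 assumes "t :. (tensor FA FA)" "splits (env g) f t"
 shows "comult FD f = t"
proof -
 have "comult FD f = (SOME t. t :. (tensor FA FA) \<and> splits (env g) f t)"
  by (simp add: finite_dual_def module.defs hopf.defs)
 moreover have "(SOME t. t :. (tensor FA FA) \<and> splits (env g) f t) = t"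
  using assms splits_unique by (intro some_equality) auto
 ultimately show ?thesis by simp
qed

lemma finsum_splits:
 assumes V: "pointwise V" "vspace V" and ac: "!!k. k \<in> idx g ==> a k :. V" "!!k. k \<in> idx g ==> c k :. V"
 shows "splits (env g) f (finsum (tensor V V) (%k. ten V V (a k) (c k)) (idx g)) \<longleftrightarrow>
  (\<forall>D\<in>carrier (env g). \<forall>E\<in>carrier (env g). f (D *[env g] E) = (\<Sum>k\<in>idx g. a k D * c k E))"
 using assms by (simp add: splits_iff tensor_lift_finsum_ten[OF V(2) V(2) vspace_scalars eval_bilin[OF V(1) V(1)]])

text \<open>Matrix coefficients of the adjoint representation and their composites with the antipode.\<close>

lemma adjoint_functionals_exist: "\<exists>a b. adjoint_functionals g a b"
proof -
 obtain F where F: "alg_hom (env g) (mat_alg (idx g)) F" and Fg: "!!k. k \<in> idx g ==> F (env_gen g k) = ad_mat g k"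
  using adjoint_representation[OF g] by blast
 let ?S = "antipode (env g)"
 define a where "a i j D = (if D :. (env g) then F D (i, j) else 0)" for i j D
 define b where "b i j D = (if D :. (env g) then F (?S D) (i, j) else 0)" for i j D
 note Fs = alg_hom_add[OF F] alg_hom_smult[OF F] alg_hom_mult[OF F] alg_hom_one[OF F]
 have Scl: "?S D :. (env g)" if "D :. (env g)" for D using that by (rule antipode_simps(4)[OF g])
 have m: "F (D *[env g] E) (i, j) = (\<Sum>k\<in>idx g. F D (i, k) * F E (k, j))" if "D :. (env g)" "E :. (env g)" for D E i j
  using that by (simp add: Fs mat_alg_def)
 have DE: "D *[env g] E :. (env g)" if "D :. (env g)" "E :. (env g)" for D E using that by simp
 have aDA: "a i j :. DA" for i j
  unfolding DA_carrier by (auto simp: a_def linear_map_def Fs mat_alg_def)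
 have bDA: "b i j :. DA" for i j
  unfolding DA_carrier using lin_add[OF antipode_linear[OF g]] lin_smult[OF antipode_linear[OF g]]
  by (auto simp: b_def linear_map_def Fs Scl mat_alg_def)
 have asplit: "a i j (D *[env g] E) = (\<Sum>k\<in>idx g. a i k D * a k j E)" if "D :. (env g)" "E :. (env g)" for i j D E
  using that by (simp add: a_def m)
 have bsplit: "b i j (D *[env g] E) = (\<Sum>k\<in>idx g. b k j D * b i k E)" if "D :. (env g)" "E :. (env g)" for i j D E
  using that by (simp add: b_def m Scl antipode_simps(3)[OF g] mult.commute)
 have sumcl: "finsum (tensor V V) (%k. ten V V (x k) (y k)) (idx g) :. (tensor V V)"
  if "!!k. k \<in> idx g ==> x k :. V" "!!k. k \<in> idx g ==> y k :. V" for V :: "('k, ('k, 'g) functional) module" and x y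
  using that by (intro vs_finsum_closed) simp_all
 have aFA: "a i j :. FA" for i j
  by (rule FA_I[OF aDA sumcl[of "%k. a i k" DA "%k. a k j"]])
   (simp_all add: aDA asplit finsum_splits[OF DA_pointwise DA_vspace])
 have bFA: "b i j :. FA" for i j
  by (rule FA_I[OF bDA sumcl[of "%k. b k j" DA "%k. b i k"]])
   (simp_all add: bDA bsplit finsum_splits[OF DA_pointwise DA_vspace])
 have ca: "comult FD (a i j) = finsum (tensor FD FD) (%k. ten FD FD (a i k) (a k j)) (idx g)" for i j
  unfolding FD_tensor using aFA asplit
  by (intro FD_comult sumcl) (simp_all add: finsum_splits[OF FA_pointwise FA_vspace])
 have cb: "comult FD (b i j) = finsum (tensor FD FD) (%k. ten FD FD (b k j) (b i k)) (idx g)" for i j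
  unfolding FD_tensor using bFA bsplit
  by (intro FD_comult sumcl) (simp_all add: finsum_splits[OF FA_pointwise FA_vspace])
 have one: "F \<one>[env g] (i, j) = (if i = j then 1 else 0)" if "i \<in> idx g" for i j
  using that by (simp add: Fs mat_alg_def)
 have "adjoint_functionals g a b"
  unfolding adjoint_functionals_def Let_def
 proof (intro ballI conjI)
  fix i j assume ij: "i \<in> idx g" "j \<in> idx g"
  show "a i j :. FD" "b i j :. FD" by (simp_all only: FD_simps aFA bFA)
  show "a i j (env_gen g k) = struct_const g k j i" if "k \<in> idx g" for k
   using that ij by (simp add: a_def Fg ad_mat_def[OF g])
  show "comult FD (a i j) = finsum (tensor FD FD) (%k. ten FD FD (a i k) (a k j)) (idx g)" by (rule ca)
  show "comult FD (b i j) = finsum (tensor FD FD) (%k. ten FD FD (b k j) (b i k)) (idx g)" by (rule cb)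
  show "counit FD (a i j) = (if i = j then 1 else 0)" "counit FD (b i j) = (if i = j then 1 else 0)"
   using ij by (simp_all only: FD_simps a_def b_def env_one_closed if_True antipode_simps(1)[OF g] one)
  show "antipode FD (a i j) = b i j"
   by (rule ext) (simp add: FD_simps(6) a_def b_def Scl)
  show "antipode FD (b i j) = a i j"
   by (rule ext) (simp add: FD_simps(6) a_def b_def Scl antipode_antipode[OF g])
 qed
 then show ?thesis by blast
qed

lemma adjoint_functionals_adj: "adjoint_functionals g (adj g) (adj_bar g)"
proof -
 obtain a b where ab: "adjoint_functionals g a b" using adjoint_functionals_exist by blast
 have "case adjoint_pair g of (a, b) => adjoint_functionals g a b"
  unfolding adjoint_pair_def by (rule someI[of _ "(a, b)"]) (simp only: case_prod_conv ab)
 then show ?thesis unfolding adj_def adj_bar_def by (cases "adjoint_pair g") simp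
qed

end

section \<open>Compatibility of the antiisomorphism with the Hopf structure\<close>

context
 fixes g :: "('k::field, 'g::ab_group_add) based_lie"
 assumes g: "based_lie_algebra g"
begin

lemma opp_g: "based_lie_algebra (opp g)" by (rule based_lie_algebra_opp[OF g])

lemma psi_linear: "linear_map (env (opp g)) (env g) (psi g)" by (rule alg_antihom_linear[OF psi_antihom[OF g]])

lemmas psi_simps = alg_antihom_add[OF psi_antihom[OF g]] alg_antihom_smult[OF psi_antihom[OF g]]
  alg_antihom_mult[OF psi_antihom[OF g]] alg_antihom_one[OF psi_antihom[OF g]]

lemma counit_psi:
 assumes D: "D :. (env (opp g))"
 shows "counit (env g) (psi g D) = counit (env (opp g)) D"
 using opp_g D
 by (induction rule: env_induct)
  (simp_all add: g psi_simps psi_gen counit_simps[OF g] counit_simps[OF opp_g]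
   lin_add[OF counit_linear[OF g]] lin_add[OF counit_linear[OF opp_g]]
   lin_smult[OF counit_linear[OF g]] lin_smult[OF counit_linear[OF opp_g]] mult.commute)

lemma antipode_psi:
 assumes D: "D :. (env (opp g))"
 shows "antipode (env g) (psi g D) = psi g (antipode (env (opp g)) D)"
proof (rule env_hom_unique[OF opp_g alg_antihom_comp_anti[OF antipode_antihom psi_antihom[OF g]]
   alg_antihom_comp_anti[OF psi_antihom[OF g] antipode_antihom] _ D])
 fix j assume "j \<in> idx (opp g)"
 then show "antipode (env g) (psi g (env_gen (opp g) j)) = psi g (antipode (env (opp g)) (env_gen (opp g) j))"
  by (simp add: g psi_gen antipode_simps[OF g] antipode_simps[OF opp_g] lin_minus[OF env_vspace env_vspace psi_linear])
qed

lemma comult_psi: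
 assumes D: "D :. (env (opp g))" and b: "bilin (env g) (env g) scalars b"
 shows "lift2 scalars (%x y. b x y) (comult (env g) (psi g D)) =
  lift2 scalars (%x y. b (psi g x) (psi g y)) (comult (env (opp g)) D)"
proof -
 interpret U: ring "env g" by (rule k_algebra_ring) simp
 have pb: "bilin (env (opp g)) (env (opp g)) scalars (%x y. b (psi g x) (psi g y))" if "bilin (env g) (env g) scalars b" for b
  using that g by (intro bilinI lin_comp[OF bilin_left[OF that] psi_linear] lin_comp[OF bilin_right[OF that] psi_linear]) simp_all
 have "\<forall>b. bilin (env g) (env g) scalars b \<longrightarrow> lift2 scalars (%x y. b x y) (comult (env g) (psi g D)) =
   lift2 scalars (%x y. b (psi g x) (psi g y)) (comult (env (opp g)) D)"
  using opp_g D
 proof (induction rule: env_induct_left)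
  case one
  show ?case by (auto simp: psi_simps lift_comult_one[OF g] lift_comult_one[OF opp_g _ pb])
 next
  case (gen j D)
  show ?case
  proof (intro allI impI)
   fix b assume b: "bilin (env g) (env g) scalars b"
   let ?b = "%x y. b (x *[env g] env_gen g j) y + b x (y *[env g] env_gen g j)"
   have b': "bilin (env g) (env g) scalars ?b"
   proof (intro bilinI)
    show "linear_map (env g) scalars (%y. ?b x y)" if x: "x :. (env g)" for x
     using lin_fun_add[OF env_vspace vspace_scalars bilin_right[OF b, of "x *[env g] env_gen g j"]
       lin_comp[OF bilin_right[OF b x] lin_mult_right[OF k_algebra_env env_gen_closed]]] x by simp
    show "linear_map (env g) scalars (%x. ?b x y)" if y: "y :. (env g)" for y
     using lin_fun_add[OF env_vspace vspace_scalars lin_comp[OF bilin_left[OF b y] lin_mult_right[OF k_algebra_env env_gen_closed]]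
       bilin_left[OF b, of "y *[env g] env_gen g j"]] y by simp
   qed
   have j: "j \<in> idx g" using gen(1) by simp
   have pc: "psi g x :. (env g)" if "x :. (env (opp g))" for x using that g by simp
   have "lift2 scalars (%x y. b x y) (comult (env g) (psi g (env_gen (opp g) j *[env (opp g)] D))) =
     lift2 scalars (%x y. ?b x y) (comult (env g) (psi g D))"
    using lift_comult_gen_mult(2)[OF g vspace_scalars b, of "psi g D" j] gen(2) j
    by (simp add: psi_simps psi_gen[OF g] pc)
   also have "... = lift2 scalars (%x y. ?b (psi g x) (psi g y)) (comult (env (opp g)) D)"
    using gen(3) b' by blast
   also have "... = lift2 scalars (%x y. b (psi g (env_gen (opp g) j *[env (opp g)] x)) (psi g y) +[scalars]
     b (psi g x) (psi g (env_gen (opp g) j *[env (opp g)] y))) (comult (env (opp g)) D)"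
    using gen(2) j by (intro env_tl_cong) (simp_all add: psi_simps psi_gen[OF g])
   also have "... = lift2 scalars (%x y. b (psi g x) (psi g y)) (comult (env (opp g)) (env_gen (opp g) j *[env (opp g)] D))"
    using lift_comult_gen_mult(1)[OF opp_g vspace_scalars pb[OF b] gen(2), of j] by simp
   finally show "lift2 scalars (%x y. b x y) (comult (env g) (psi g (env_gen (opp g) j *[env (opp g)] D))) =
     lift2 scalars (%x y. b (psi g x) (psi g y)) (comult (env (opp g)) (env_gen (opp g) j *[env (opp g)] D))" .
  qed
 next
  case (add D E)
  have l: "linear_map (env g') scalars (%D. lift2 scalars (%x y. b x y) (comult (env g') D))"
   if "based_lie_algebra g'" "bilin (env g') (env g') scalars b" for b and g' :: "('k, 'g) based_lie"
   by (rule lin_comp[OF lift_comult_linear[OF that(1) vspace_scalars that(2)] comult_linear[OF that(1)]])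
  show ?case using add g by (auto simp: psi_simps lin_add[OF l[OF g]] lin_add[OF l[OF opp_g pb]])
 next
  case (smult c D)
  have l: "linear_map (env g') scalars (%D. lift2 scalars (%x y. b x y) (comult (env g') D))"
   if "based_lie_algebra g'" "bilin (env g') (env g') scalars b" for b and g' :: "('k, 'g) based_lie"
   by (rule lin_comp[OF lift_comult_linear[OF that(1) vspace_scalars that(2)] comult_linear[OF that(1)]])
  show ?case using smult g by (auto simp: psi_simps lin_smult[OF l[OF g]] lin_smult[OF l[OF opp_g pb]])
 qed
 then show ?thesis using b by blast
qed

end

section \<open>The homomorphism between the two smash products\<close>

locale opposite_pairs = A: dual_pair g H p u + B: dual_pair "opp g" H' p' u'
 for g :: "('k::field, 'g::ab_group_add) based_lie" and H H' :: "('k, 'h) hopf" and p p' u u' +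
 assumes same: "carrier H' = carrier H" "add H' = add H" "module.smult H' = module.smult H"
   "monoid.mult H' = monoid.mult H" "one H' = one H"
  and lt_rt: "f :. H ==> j \<in> idx g ==> B.lt j f = A.rt j f"
begin

definition change :: "('k, 'h \<times> ('k, 'g) env) formal => ('k, 'h \<times> ('k, 'g) env) formal" where
 "change t = lift2 B.K (%f a. B.iH f *[B.K] B.lm (phi g a)) t"

lemma lmphi_hom: "alg_hom A.U B.K (%a. B.lm (phi g a))"
 by (rule alg_antihom_comp_anti[OF B.lm_antihom phi_antihom]) simp

lemmas lmphi = alg_hom_add[OF lmphi_hom] alg_hom_smult[OF lmphi_hom] alg_hom_mult[OF lmphi_hom] alg_hom_one[OF lmphi_hom]

lemma lmphi_closed [simp]: "a :. A.U ==> B.lm (phi g a) :. B.K"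
 by (rule alg_hom_closed[OF lmphi_hom])

lemma BiH_closed [simp]: "f :. H ==> B.iH f :. B.K" by (rule B.iH_closed) (simp add: same)

lemma BiH_linear: "linear_map H B.K B.iH" using B.iH_linear by (simp add: linear_map_def same)

lemma BiH_mult: "f :. H ==> h :. H ==> B.iH (f *[H] h) = B.iH f *[B.K] B.iH h"
 using B.iH_simps(3)[of f h] by (simp add: same)

lemma BiH_one: "B.iH \<one>[H] = \<one>[B.K]" using B.iH_simps(4) by (simp add: same)

lemma change_bilin: "bilin H A.U B.K (%f a. B.iH f *[B.K] B.lm (phi g a))"
 by (intro bilinI lin_fun_mult_left lin_fun_mult_right BiH_linear alg_hom_linear[OF lmphi_hom]) simp_all

lemma change_linear: "linear_map A.K B.K change"
 unfolding change_def A.K_lin by (intro lift_linear change_bilin) simp_all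

lemma change_mult_iH_iX: "f :. H ==> a :. A.U ==> change (A.iH f *[A.K] A.iX a) = B.iH f *[B.K] B.lm (phi g a)"
 unfolding change_def by (simp add: lift_ten[OF _ _ _ _ change_bilin] flip: A.ten_eq_mult)

lemma change_closed [simp]: "k :. A.K ==> change k :. B.K"
 by (rule lin_closed[OF change_linear])

lemma change_iH: "f :. H ==> change (A.iH f) = B.iH f"
 using change_mult_iH_iX[of f "\<one>[A.U]"] by (simp add: A.iX_simps lmphi)

lemma change_iX: "a :. A.U ==> change (A.iX a) = B.lm (phi g a)"
 using change_mult_iH_iX[of "\<one>[H]" a] by (simp add: A.iH_simps BiH_one)

lemma change_iH_mult:
 assumes f: "f :. H" and k: "k :. A.K"
 shows "change (A.iH f *[A.K] k) = B.iH f *[B.K] change k"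
 using k
proof (induction rule: A.K_induct)
 case (mult a h)
 have "change (A.iH f *[A.K] (A.iH h *[A.K] A.iX a)) = change (A.iH (f *[H] h) *[A.K] A.iX a)"
  using mult f by (simp add: A.iH_simps A.K.m_assoc)
 then show ?case using mult f by (simp add: change_mult_iH_iX BiH_mult B.K.m_assoc)
qed (use f in \<open>simp add: A.K.r_distr B.K.r_distr lin_add[OF change_linear]\<close>)

text \<open>A left translation in the co-opposite is a right translation, so a generator on one side and the
  left multiplication on the other one move past \<open>f\<close> by the same rule.\<close>

lemma change_gen_mult:
 assumes j: "j \<in> idx g" and k: "k :. A.K"
 shows "change (A.iX (env_gen g j) *[A.K] k) = change (A.iX (env_gen g j)) *[B.K] change k"
 using k
proof (induction rule: A.K_induct)
 case (mult a f)
 have "A.iX (env_gen g j) *[A.K] (A.iH f *[A.K] A.iX a) = (A.iX (env_gen g j) *[A.K] A.iH f) *[A.K] A.iX a"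
  using mult by (simp add: A.K.m_assoc)
 also have "... = A.iH f *[A.K] A.iX (env_gen g j *[A.U] a) +[A.K] A.iH (A.rt j f) *[A.K] A.iX a"
  using mult by (simp add: A.iX_iH A.K.l_distr A.K.m_assoc A.iX_simps)
 finally have "change (A.iX (env_gen g j) *[A.K] (A.iH f *[A.K] A.iX a)) =
   B.iH f *[B.K] (B.lm (phi g (env_gen g j)) *[B.K] B.lm (phi g a)) +[B.K] B.iH (A.rt j f) *[B.K] B.lm (phi g a)"
  using mult by (simp add: lin_add[OF change_linear] change_mult_iH_iX lmphi)
 also have "... = (B.iH f *[B.K] B.lm (phi g (env_gen g j)) +[B.K] B.iH (A.rt j f)) *[B.K] B.lm (phi g a)"
  using mult by (simp add: B.K.l_distr B.K.m_assoc)
 also have "B.iH f *[B.K] B.lm (phi g (env_gen g j)) +[B.K] B.iH (A.rt j f) = B.lm (phi g (env_gen g j)) *[B.K] B.iH f"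
  using mult j B.lm_iH[of f j] by (simp add: phi_gen same lt_rt)
 finally show ?case using mult by (simp add: change_iX change_mult_iH_iX B.K.m_assoc)
qed (simp add: A.K.r_distr B.K.r_distr lin_add[OF change_linear])

lemma change_iX_mult:
 assumes a: "a :. A.U"
 shows "\<forall>k\<in>carrier A.K. change (A.iX a *[A.K] k) = change (A.iX a) *[B.K] change k"
 using A.g a
proof (induction rule: env_induct)
 case one
 show ?case by (simp add: change_iX lmphi, simp add: A.iX_simps)
next
 case (gen j)
 then show ?case using change_gen_mult by blast
next
 case (add a b)
 then show ?case by (simp add: A.iX_simps A.K.l_distr B.K.l_distr lin_add[OF change_linear])
next
 case (smult c a)
 then show ?case by (simp add: A.iX_simps alg_smult lin_smult[OF change_linear])
next
 case (mult a b)
 then show ?case by (simp add: A.iX_simps A.K.m_assoc B.K.m_assoc)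
qed

lemma change_hom: "alg_hom A.K B.K change"
 unfolding alg_hom_def
proof (intro conjI ballI change_linear)
 show "change \<one>[A.K] = \<one>[B.K]" using change_iH[of "\<one>[H]"] by (simp add: A.iH_simps BiH_one)
 show "change (k *[A.K] k') = change k *[B.K] change k'" if k: "k :. A.K" "k' :. A.K" for k k'
  using k(1)
 proof (induction rule: A.K_induct)
  case (mult a f)
  then show ?case using k(2) change_iX_mult
   by (simp add: A.K.m_assoc change_iH_mult B.K.m_assoc)
 qed (use k(2) in \<open>simp add: A.K.l_distr B.K.l_distr lin_add[OF change_linear]\<close>)
qed

end

section \<open>Hopf algebras of functionals\<close>

locale functional_hopf =
 fixes g :: "('k::field, 'g::ab_group_add) based_lie" and H :: "('k, ('k, 'g) functional) hopf"
 assumes g: "based_lie_algebra g"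
  and sub: "k_subalgebra (carrier H) (dual_algebra (env g))"
  and trunc: "module.truncate H = (dual_algebra (env g))\<lparr>carrier := carrier H\<rparr>"
  and hopf: "hopf_algebra H"
  and pairing: "hopf_pairing (env g) H (%D f. f D)"
  and min: "env_min g \<subseteq> carrier H"
begin

abbreviation DA where "DA \<equiv> dual_algebra (env g)"
abbreviation FA where "FA \<equiv> finite_dual_algebra (env g)"
abbreviation FD where "FD \<equiv> finite_dual (env g)"

lemma H_ops: "add H = add DA" "zero H = zero DA" "module.smult H = module.smult DA" "monoid.mult H = monoid.mult DA" "one H = one DA"
proof -
 have "f (module.truncate H) = f (DA\<lparr>carrier := carrier H\<rparr>)" for f :: "_ => 'x" by (simp only: trunc)
 note t = this
 show "add H = add DA" "zero H = zero DA" "module.smult H = module.smult DA" "monoid.mult H = monoid.mult DA" "one H = one DA"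
  using t[of add] t[of zero] t[of module.smult] t[of monoid.mult] t[of one] by (simp_all add: module.defs)
qed

lemma H_pointwise: "pointwise H"
 using DA_pointwise[OF g] by (simp add: pointwise_def H_ops)

lemma H_DA: "f :. H ==> f :. DA"
 using sub subringE(1)[of "carrier H" DA] by (auto simp: k_subalgebra_def)

lemma H_functional: "f :. H ==> linear_map (env g) scalars f" "f :. H ==> D \<notin> carrier (env g) ==> f D = 0"
 using H_DA[of f] by (simp_all add: DA_carrier[OF g])

lemma H_algebra: "k_algebra H" using hopf by (simp add: hopf_algebra_def)

lemma H_space: "vspace H" using H_algebra by simp

lemma comult_H: "f :. H ==> comult H f :. (tensor H H)"
 using hopf lin_closed[OF alg_hom_linear[of H "tensor_alg H H" "comult H"], of f] H_algebra
 by (simp add: hopf_algebra_def)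

lemma antipode_H: "f :. H ==> antipode H f :. H"
 using hopf lin_closed[of H H "antipode H" f] by (simp add: hopf_algebra_def)

lemma comult_H_splits: "f :. H ==> splits (env g) f (comult H f)"
 using pairing by (simp add: hopf_pairing_def splits_def)

lemma antipode_H_value: "f :. H ==> antipode H f = (%D. if D :. (env g) then f (antipode (env g) D) else 0)"
 using pairing H_functional(2)[OF antipode_H] by (auto simp: hopf_pairing_def fun_eq_iff)

text \<open>The pairing shows that the comultiplication of \<open>H\<close> splits a functional; hence it can be split within
  any space of functionals that contains \<open>H\<close>, in particular within the finite dual.\<close>

lemma split_through:
 fixes V :: "('k, ('k, 'g) functional) module"
 assumes V: "pointwise V" "vspace V" and HV: "carrier H \<subseteq> carrier V" and f: "f :. H"
 shows "\<exists>t\<in>carrier (tensor V V). splits (env g) f t"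
proof
 let ?t = "lift2 (tensor V V) (%x y. ten V V x y) (comult H f)"
 show "?t :. (tensor V V)"
  using HV by (intro tl2_closed[OF H_space H_space bal_maps_empty comult_H[OF f]] ten_closed) auto
 show "splits (env g) f ?t"
  unfolding splits_def
 proof (intro ballI)
  fix D E assume DE: "D :. (env g)" "E :. (env g)"
  have b: "bilin V V scalars (%x y. x D * y E)" by (intro eval_bilin V)
  note lin = lift_linear[OF V(2) V(2) bal_maps_empty vspace_scalars b balanced_empty]
  have "lift2 scalars (%x y. x D * y E) ?t =
    lift2 scalars (%x y. lift2 scalars (%x y. x D * y E) (ten V V x y)) (comult H f)"
   using HV by (intro tl2_linear[OF H_space H_space bal_maps_empty comult_H[OF f] lin]) (auto intro!: ten_closed)
  also have "... = lift2 scalars (%x y. x D * y E) (comult H f)"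
   using subsetD[OF HV] by (intro tl2_cong[OF H_space H_space bal_maps_empty comult_H[OF f]])
    (simp_all add: lift_ten[OF V(2) V(2) bal_maps_empty vspace_scalars b balanced_empty])
  finally show "f (D *[env g] E) = lift2 scalars (%x y. x D * y E) ?t"
   using comult_H_splits[OF f] DE by (simp add: splits_def)
 qed
qed

lemma H_FA: "carrier H \<subseteq> carrier FA"
 using split_through[OF DA_pointwise[OF g] DA_vspace[OF g]] H_DA FA_I[OF g] by blast

lemma splits_comult_FD:
 assumes f: "f :. H"
 shows "splits (env g) f (comult FD f)"
proof -
 obtain t where t: "t :. (tensor FA FA)" "splits (env g) f t"
  using split_through[OF FA_pointwise[OF g] FA_vspace[OF g] H_FA f] by blast
 then show ?thesis using FD_comult[OF g t] by simp
qed

subsection \<open>The adjoint functionals\<close>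

lemma adj_mem: "i \<in> idx g ==> j \<in> idx g ==> adj g i j :. H"
 and adj_bar_mem: "i \<in> idx g ==> j \<in> idx g ==> adj_bar g i j :. H"
 using min unfolding env_min_def by blast+

lemmas adj_facts = adjoint_functionals_adj[OF g, unfolded adjoint_functionals_def Let_def]

lemma adj_bar_eq: "i \<in> idx g ==> j \<in> idx g ==> antipode H (adj g i j) = adj_bar g i j"
 and adj_eq: "i \<in> idx g ==> j \<in> idx g ==> antipode H (adj_bar g i j) = adj g i j"
proof -
 assume ij: "i \<in> idx g" "j \<in> idx g"
 have "antipode FD (adj g i j) = adj_bar g i j" "antipode FD (adj_bar g i j) = adj g i j" using adj_facts ij by blast+
 then show "antipode H (adj g i j) = adj_bar g i j" "antipode H (adj_bar g i j) = adj g i j"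
  using ij by (simp_all add: antipode_H_value adj_mem adj_bar_mem FD_simps(6)[OF g])
qed

lemma adj_gen: "i \<in> idx g ==> j \<in> idx g ==> k \<in> idx g ==> adj g i j (env_gen g k) = struct_const g k j i"
 using adj_facts by blast

lemma adj_one: "i \<in> idx g ==> j \<in> idx g ==> adj g i j \<one>[env g] = (if i = j then 1 else 0)"
 and adj_bar_one: "i \<in> idx g ==> j \<in> idx g ==> adj_bar g i j \<one>[env g] = (if i = j then 1 else 0)"
 using adj_facts by (simp_all add: FD_simps(5)[OF g])

lemma adj_mult:
 assumes ij: "i \<in> idx g" "j \<in> idx g" and DE: "D :. (env g)" "E :. (env g)"
 shows "adj g i j (D *[env g] E) = (\<Sum>k\<in>idx g. adj g i k D * adj g k j E)"
proof -
 have c: "comult FD (adj g i j) = finsum (tensor FA FA) (%k. ten FA FA (adj g i k) (adj g k j)) (idx g)"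
  using adj_facts ij unfolding FD_tensor[OF g] by blast
 have "splits (env g) (adj g i j) (finsum (tensor FA FA) (%k. ten FA FA (adj g i k) (adj g k j)) (idx g))"
  using splits_comult_FD[OF adj_mem[OF ij]] unfolding c .
 then have "\<forall>D\<in>carrier (env g). \<forall>E\<in>carrier (env g). adj g i j (D *[env g] E) = (\<Sum>k\<in>idx g. adj g i k D * adj g k j E)"
  by (subst (asm) finsum_splits[OF g FA_pointwise[OF g] FA_vspace[OF g]])
   (use ij adj_mem H_FA in auto)
 then show ?thesis using DE by blast
qed

lemma adj_bar_value: "i \<in> idx g ==> j \<in> idx g ==> D :. (env g) ==> adj_bar g i j D = adj g i j (antipode (env g) D)"
 using antipode_H_value[OF adj_mem, of i j] by (simp flip: adj_bar_eq)

lemma adj_bar_mult: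
 assumes ij: "i \<in> idx g" "j \<in> idx g" and DE: "D :. (env g)" "E :. (env g)"
 shows "adj_bar g i j (D *[env g] E) = (\<Sum>k\<in>idx g. adj_bar g k j D * adj_bar g i k E)"
 using ij DE by (simp add: adj_bar_value antipode_simps[OF g] adj_mult mult.commute)

lemma adj_bar_gen: "i \<in> idx g ==> j \<in> idx g ==> k \<in> idx g ==> adj_bar g i j (env_gen g k) = struct_const (opp g) k j i"
 using lin_minus[OF env_vspace vspace_scalars H_functional(1)[OF adj_mem], of i j "env_gen g k"]
 by (simp add: adj_bar_value antipode_simps[OF g] adj_gen struct_const_opp[OF g] vs_minus_eq_smult[OF vspace_scalars])

subsection \<open>The two dual pairs\<close>

sublocale A: dual_pair g H "%D f. f D" "adj g"
proof unfold_locales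
 note P = pairing[unfolded hopf_pairing_def]
 show "linear_map H scalars (%f. f D)" for D by (rule eval_linear[OF H_pointwise])
 show "D :. (env g) ==> E :. (env g) ==> f :. H ==>
   f (D *[env g] E) = lift2 scalars (%x y. x D * y E) (comult H f)" for D E f
  using P by blast
 show "D :. (env g) ==> f :. H ==> h :. H ==>
   (f *[H] h) D = lift2 scalars (%x y. f x * h y) (comult (env g) D)" for D f h
  using P by blast
 show "D :. (env g) ==> f :. H ==> antipode H f D = f (antipode (env g) D)" for D f
  by (simp add: antipode_H_value)
 show "f :. H ==> f \<one>[env g] = counit H f" for f using P by blast
 show "D :. (env g) ==> \<one>[H] D = counit (env g) D" for D using P by blast
 show "f = \<zero>[H]" if "f :. H" "!!D. D :. (env g) ==> f D = 0" for f
  using that H_functional(2)[OF that(1)] by (auto simp: pointwise_simps[OF H_pointwise] fun_eq_iff)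
qed (simp_all add: g H_algebra comult_H antipode_H H_functional adj_mem adj_mult adj_one adj_gen)

lemma coop_simps [simp]: "carrier (coop H) = carrier H" "add (coop H) = add H" "zero (coop H) = zero H"
  "module.smult (coop H) = module.smult H" "monoid.mult (coop H) = monoid.mult H" "one (coop H) = one H" "counit (coop H) = counit H"
 by (simp_all add: coop_def)

lemma coop_tensor [simp]: "tensor (coop H) (coop H) = tensor H H" "ten (coop H) (coop H) = ten H H"
 by (intro tensor_cong; simp)+

lemma coop_lift_space [simp]: "tensor_lift (coop H) b t = tensor_lift H b t"
 by (simp add: tensor_lift_def finsum_def finprod_def)

lemma coop_antipode: "f :. H ==> antipode (coop H) f = antipode H f"
proof -
 assume f: "f :. H"
 have "inj_on (antipode H) (carrier H)" by (rule inj_on_inverseI[of _ "antipode H"]) (rule A.S_S)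
 then have "inv_into (carrier H) (antipode H) (antipode H (antipode H f)) = antipode H f"
  using f by (intro inv_into_f_f) simp_all
 then show ?thesis using f by (simp add: coop_def A.S_S)
qed

lemma coop_comult_flip: "comult (coop H) f = flip H H (comult H f)"
 by (simp add: coop_def flip_def)

lemma coop_comult:
 fixes B :: "('k, 'z, 'm) module_scheme"
 assumes B: "vspace B" and b: "bilin H H B b" and f: "f :. H"
 shows "lift2 B (%x y. b x y) (comult (coop H) f) = lift2 B (%x y. b y x) (comult H f)"
 unfolding coop_comult_flip flip_def using B f
 by (subst A.H_tl_linear[OF _ lift_linear[OF H_space H_space bal_maps_empty B b balanced_empty]])
  (auto simp: lift_ten[OF H_space H_space bal_maps_empty B b balanced_empty] bilin_closed[OF b] intro!: A.H_tl_cong)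

lemma coop_linear [simp]: "linear_map (coop H) B b = linear_map H B b" "linear_map B' (coop H) b' = linear_map B' H b'"
 by (simp_all add: linear_map_def)

lemma psi_cl: "Y :. (env (opp g)) ==> psi g Y :. (env g)" using g by simp

sublocale B: dual_pair "opp g" "coop H" "%Y f. f (psi g Y)" "adj_bar g"
proof unfold_locales
 show "based_lie_algebra (opp g)" by (rule opp_g[OF g])
 show "k_algebra (coop H)" by (rule k_algebra_cong[OF H_algebra]) simp_all
 show "comult (coop H) f :. (tensor (coop H) (coop H))" if "f :. (coop H)" for f
  using that lin_closed[OF flip_linear[OF H_space H_space], of "comult H f"] by (simp add: coop_comult_flip)
 show "linear_map (env (opp g)) scalars (%D. f (psi g D))" if "f :. (coop H)" for f
  using that by (intro lin_comp[OF H_functional(1) psi_linear[OF g]]) simp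
 show "linear_map (coop H) scalars (%f. f (psi g D))" for D by (simp add: eval_linear[OF H_pointwise])
 show "f (psi g (D *[env (opp g)] E)) = lift2 scalars (%x y. x (psi g D) * y (psi g E)) (comult (coop H) f)"
  if "D :. (env (opp g))" "E :. (env (opp g))" "f :. (coop H)" for D E f
  using that coop_comult[OF vspace_scalars eval_bilin[OF H_pointwise H_pointwise], of f "psi g D" "psi g E"]
   A.p_mult[of "psi g E" "psi g D" f]
  by (simp add: psi_simps[OF g] psi_cl mult.commute)
 show "(f *[coop H] h) (psi g D) = lift2 scalars (%x y. f (psi g x) * h (psi g y)) (comult (env (opp g)) D)"
  if "D :. (env (opp g))" "f :. (coop H)" "h :. (coop H)" for D f h
  using that comult_psi[OF g that(1) A.bilin_scalars[OF H_functional(1)[of f] H_functional(1)[of h]]] A.p_H_mult[of "psi g D" f h]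
  by (simp add: psi_cl)
 show "f (psi g \<one>[env (opp g)]) = counit (coop H) f" if "f :. (coop H)" for f
  using that A.p_one[of f] by (simp add: psi_simps[OF g])
 show "\<one>[coop H] (psi g D) = counit (env (opp g)) D" if "D :. (env (opp g))" for D
  using that A.p_H_one[of "psi g D"] by (simp add: psi_cl counit_psi[OF g])
 show "antipode (coop H) f (psi g D) = f (psi g (antipode (env (opp g)) D))"
  if "D :. (env (opp g))" "f :. (coop H)" for D f
  using that A.p_antipode[of "psi g D" f] by (simp add: coop_antipode psi_cl antipode_psi[OF g])
 show "f = \<zero>[coop H]" if "f :. (coop H)" "!!D. D :. (env (opp g)) ==> f (psi g D) = 0" for f
 proof -
  have "f D = 0" if D: "D :. (env g)" for D
   using \<open>!!D. D :. (env (opp g)) ==> f (psi g D) = 0\<close>[of "phi g D"] D g by (simp add: psi_phi)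
  then show ?thesis using that(1) A.nondegenerate[of f] by simp
 qed
 fix i j assume ij: "i \<in> idx (opp g)" "j \<in> idx (opp g)"
 then show "adj_bar g i j (psi g \<one>[env (opp g)]) = (if i = j then 1 else 0)"
  by (simp add: psi_simps[OF g] adj_bar_one)
 show "adj_bar g i j (psi g (env_gen (opp g) k)) = struct_const (opp g) k j i" if "k \<in> idx (opp g)" for k
  using ij that by (simp add: psi_gen[OF g] adj_bar_gen)
 show "adj_bar g i j (psi g (D *[env (opp g)] E)) = (\<Sum>k\<in>idx (opp g). adj_bar g i k (psi g D) * adj_bar g k j (psi g E))"
  if "D :. (env (opp g))" "E :. (env (opp g))" for D E
  using ij that by (simp add: psi_simps[OF g] psi_cl adj_bar_mult mult.commute)
qed (simp_all add: adj_bar_mem coop_antipode antipode_H)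

lemma coop_lt: "f :. H ==> j \<in> idx g ==> B.lt j f = A.rt j f"
 and coop_rt: "f :. H ==> j \<in> idx g ==> B.rt j f = A.lt j f"
proof -
 assume f: "f :. H" and j: "j \<in> idx g"
 have e: "linear_map H scalars (%f. f D)" for D by (rule eval_linear[OF H_pointwise])
 have b: "bilin H H H (%x y. x (env_gen g j) .[H] y)" "bilin H H H (%x y. y (env_gen g j) .[H] x)"
  by (intro bilinI lin_fun_scalar lin_fun_smult lin_id e; simp)+
 show "B.lt j f = A.rt j f"
  unfolding B.lt_def A.rt_def using coop_comult[OF H_space b(1) f] j by (simp add: psi_gen[OF g])
 show "B.rt j f = A.lt j f"
  unfolding B.rt_def A.lt_def using coop_comult[OF H_space b(2) f] j by (simp add: psi_gen[OF g])
qed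

end

context functional_hopf
begin

section \<open>The two scalar extensions\<close>

lemma KA: "H_UL g H = A.K" by (simp add: H_UL_def A.K_def act_L_def)
lemma KB: "Hco_UR g H = B.K" by (simp add: Hco_UR_def B.K_def act_R_def)

lemma lam_eq:
 assumes D: "D :. (env g)"
 shows "lam g H D = A.lm D"
proof -
 have gens: "A.lm (env_gen g j) = finsum A.K (%i. ten H (env g) (adj_bar g i j) (env_gen g i)) (idx g)" if "j \<in> idx g" for j
  unfolding A.lm_gen[OF that] using that
  by (intro vs_finsum_cong) (simp_all add: A.ten_eq_mult A.v_def adj_bar_eq adj_bar_mem)
 have l: "alg_antihom (env g) A.K (lam g H)" "!!j. j \<in> idx g ==> lam g H (env_gen g j) = A.lm (env_gen g j)"
  using antihom_ext_env[OF A.lm_antihom gens] gens by (simp_all add: lam_def KA)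
 show ?thesis
  by (rule env_antihom_unique[OF g l(1) A.lm_antihom _ D]) (simp add: l(2))
qed

lemma lam_R_eq:
 assumes D: "D :. (env (opp g))"
 shows "lam_R g H D = B.lm D"
proof -
 have gens: "B.lm (env_gen (opp g) j) = finsum B.K (%i. ten (coop H) (env (opp g)) (adj g i j) (env_gen (opp g) i)) (idx (opp g))"
  if "j \<in> idx (opp g)" for j
  unfolding B.lm_gen[OF that] using that
  by (intro vs_finsum_cong) (simp_all add: B.ten_eq_mult B.v_def coop_antipode adj_eq adj_mem adj_bar_mem)
 have l: "alg_antihom (env (opp g)) B.K (lam_R g H)" "!!j. j \<in> idx g ==> lam_R g H (env_gen (opp g) j) = B.lm (env_gen (opp g) j)"
  using antihom_ext_env[OF B.lm_antihom gens] gens by (simp_all add: lam_R_def KB)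
 show ?thesis
  by (rule env_antihom_unique[OF opp_g[OF g] l(1) B.lm_antihom _ D]) (simp add: l(2))
qed

lemma lam_psi: "D :. (env (opp g)) ==> lam g H (psi g D) = A.iY D"
 by (simp add: lam_eq A.iY_def psi_cl)

lemma psi_opp: "D :. (env g) ==> psi (opp g) D = phi g D"
 using psi_eq[OF opp_g[OF g], of D] by simp

lemma lam_R_phi: "D :. (env g) ==> lam_R g H (phi g D) = B.iY D"
 using g by (simp add: lam_R_eq B.iY_def psi_opp)

lemma structure_maps_A_iff: "structure_maps_A g H M \<longleftrightarrow> scalar_extension g H (%D f. f D) (adj g) M"
 unfolding scalar_extension_def scalar_extension_axioms_def structure_maps_A_def Let_def KA A.iH_def A.iX_def
 using A.dual_pair_axioms
 by (simp add: lam_psi A.iY_gen A.tr_def Ball_def imp_conjL)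

lemma B_tr: "B.tr j = - (\<Sum>i\<in>idx g. struct_const g i j i)"
 by (simp add: B.tr_def struct_const_opp[OF g] sum_negf)

lemma B_minus: "x :. B.K ==> x \<ominus>\<^bsub>B.K\<^esub> c .[B.K] \<one>[B.K] = x +[B.K] (- c) .[B.K] \<one>[B.K]"
 by (simp add: a_minus_def vs_minus_eq_smult)

lemma BiH_lin: "linear_map H B.K B.iH" using B.iH_linear by simp

lemma coop_left:
 assumes "D :. (env g)" "h :. H"
 shows "lift2 (tensor_over E B.K B.K) (%h1 h2. ten_over E B.K B.K (B.iY D *[B.K] B.iH h1) (B.iH h2)) (comult (coop H) h) =
  lift2 (tensor_over E B.K B.K) (%h1 h2. ten_over E B.K B.K (B.iY D *[B.K] B.iH h2) (B.iH h1)) (comult H h)"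
proof -
 have Y: "B.iY D :. B.K" using assms B.iY_closed[of D] by simp
 show ?thesis
  by (rule coop_comult[OF vspace_tensor_over _ assms(2)])
   (intro bilinI lin_comp[OF ten_left] lin_comp[OF ten_right] lin_fun_mult_left BiH_lin; simp add: Y)
qed

lemma coop_right:
 assumes "D :. (env (opp g))" "h :. H"
 shows "lift2 (tensor_over E B.K B.K) (%h1 h2. ten_over E B.K B.K (B.iH h1) (B.iH h2 *[B.K] B.iX D)) (comult (coop H) h) =
  lift2 (tensor_over E B.K B.K) (%h1 h2. ten_over E B.K B.K (B.iH h2) (B.iH h1 *[B.K] B.iX D)) (comult H h)"
 by (rule coop_comult[OF vspace_tensor_over _ assms(2)])
  (intro bilinI lin_comp[OF ten_left] lin_comp[OF ten_right] lin_fun_mult_right BiH_lin; simp add: assms)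

lemma B_iH: "ten (coop H) (env (opp g)) h \<one>[env (opp g)] = B.iH h"
 and B_iX: "ten (coop H) (env (opp g)) \<one>[H] a = B.iX a"
 by (simp_all add: B.iH_def B.iX_def)

lemma B_iY_gen: "j \<in> idx g ==> B.iY (env_gen g j) = B.lm (env_gen (opp g) j)"
 using B.iY_gen[of j] by simp

lemma structure_maps_B_iff: "structure_maps_B g H M \<longleftrightarrow> scalar_extension (opp g) (coop H) (%Y f. f (psi g Y)) (adj_bar g) M"
 unfolding scalar_extension_def scalar_extension_axioms_def structure_maps_B_def Let_def KB B_iH B_iX
 using B.dual_pair_axioms
 by (simp add: lam_R_phi B_iY_gen B_tr B_minus coop_left coop_right coop_antipode Ball_def imp_conjL)

section \<open>The isomorphisms\<close>

lemma iso_A: "alg_iso (UR_H g H) (H_UL g H)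
  (lift2 (H_UL g H) (%y f. lam g H (psi g y) *[H_UL g H] ten H (env g) f \<one>[env g]))"
 unfolding UR_H_def KA
 by (rule A.smash_left_iso) (simp_all add: left_act_on_R_def act_L_def lam_psi A.iH_def)

lemma iso_B: "alg_iso (UL_Hco g H) (Hco_UR g H)
  (lift2 (Hco_UR g H) (%x f. lam_R g H (phi g x) *[Hco_UR g H] ten (coop H) (env (opp g)) f \<one>[env (opp g)]))"
proof -
 have "alg_iso (smash_left (env (opp (opp g))) (coop H) (left_act_on_L g H)) B.K
   (lift2 B.K (%x f. lam_R g H (phi g x) *[B.K] ten (coop H) (env (opp g)) f \<one>[env (opp g)]))"
 proof (rule B.smash_left_iso)
  fix f b assume f: "f :. (coop H)" and b: "b :. (env (opp (opp g)))"
  have c: "phi g b :. (env (opp g))" using b g by simp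
  have "B.act (phi g b) (antipode H f) :. (env (opp g))" using c f by (intro B.act_closed) simp_all
  then show "left_act_on_L g H f b = phi (opp g) (B.act (psi (opp g) b) (antipode (coop H) f))"
   using f b by (simp add: left_act_on_L_def act_R_def psi_opp coop_antipode psi_eq[OF g])
  show "lam_R g H (phi g b) *[B.K] ten (coop H) (env (opp g)) f \<one>[env (opp g)] = B.iY b *[B.K] B.iH f"
   using b by (simp add: lam_R_phi B.iH_def)
 qed
 then show ?thesis by (simp add: UL_Hco_def KB)
qed

lemma pairs: "opposite_pairs g H (coop H) (%D f. f D) (%Y f. f (psi g Y)) (adj g) (adj_bar g)"
 by unfold_locales (simp_all add: coop_lt)

lemma pairs_opp: "opposite_pairs (opp g) (coop H) H (%Y f. f (psi g Y)) (%D f. f D) (adj_bar g) (adj g)"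
 unfolding opposite_pairs_def opposite_pairs_axioms_def opp_simps
 using A.dual_pair_axioms B.dual_pair_axioms by (simp add: coop_rt)

text \<open>The homomorphisms in both directions are inverse to each other since this holds on generators: they
  interchange the expansions of \<open>\<lambda>(X\<^sub>j)\<close> and \<open>1 # X\<^sub>j\<close> in terms of each other.\<close>

lemma iso_AB:
 "\<exists>F. alg_iso (H_UL g H) (Hco_UR g H) F \<and>
  (\<forall>f\<in>carrier H. F (ten H (env g) f \<one>[env g]) = ten (coop H) (env (opp g)) f \<one>[env (opp g)]) \<and>
  (\<forall>j\<in>idx g. F (ten H (env g) \<one>[H] (env_gen g j)) =
   finsum (Hco_UR g H) (%i. ten (coop H) (env (opp g)) (adj g i j) (env_gen (opp g) i)) (idx g))"
proof -
 interpret AB: opposite_pairs g H "coop H" "%D f. f D" "%Y f. f (psi g Y)" "adj g" "adj_bar g" by (rule pairs)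
 define F where "F = AB.change"
 define G where "G = opposite_pairs.change (opp g) H (%D f. f D)"
 note FH = AB.change_hom[folded F_def]
 have GH: "alg_hom B.K A.K G"
  using opposite_pairs.change_hom[OF pairs_opp] by (simp add: G_def)
 have F_iH: "F (A.iH f) = B.iH f" if "f :. H" for f using AB.change_iH[OF that] by (simp add: F_def)
 have F_iX: "F (A.iX a) = B.lm (phi g a)" if "a :. (env g)" for a using AB.change_iX[OF that] by (simp add: F_def)
 have G_iH: "G (B.iH f) = A.iH f" if "f :. H" for f
  using opposite_pairs.change_iH[OF pairs_opp, of f] that by (simp add: G_def)
 have G_iX: "G (B.iX b) = A.lm (psi g b)" if "b :. (env (opp g))" for b
  using opposite_pairs.change_iX[OF pairs_opp, of b] that g by (simp add: G_def psi_eq)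
 note Fs = alg_hom_mult[OF FH] and Gs = alg_hom_mult[OF GH]
 have Fc: "F k :. B.K" if "k :. A.K" for k using that by (rule alg_hom_closed[OF FH])
 have Gc: "G k :. A.K" if "k :. B.K" for k using that by (rule alg_hom_closed[OF GH])
 have lmgen: "B.lm (env_gen (opp g) j) = finsum B.K (%i. B.iH (adj g i j) *[B.K] B.iX (env_gen (opp g) i)) (idx g)" if "j \<in> idx g" for j
 proof -
  have "B.lm (env_gen (opp g) j) = finsum B.K (%i. B.iH (B.v i j) *[B.K] B.iX (env_gen (opp g) i)) (idx g)"
   using B.lm_gen[of j] that by simp
  also have "... = finsum B.K (%i. B.iH (adj g i j) *[B.K] B.iX (env_gen (opp g) i)) (idx g)"
   using that by (intro vs_finsum_cong) (simp_all add: B.v_def coop_antipode adj_eq adj_mem adj_bar_mem)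
  finally show ?thesis .
 qed
 have GF_gen: "G (F (A.iX (env_gen g j))) = A.iX (env_gen g j)" if j: "j \<in> idx g" for j
 proof -
  have "G (F (A.iX (env_gen g j))) = finsum A.K (%i. G (B.iH (adj g i j) *[B.K] B.iX (env_gen (opp g) i))) (idx g)"
   using j by (simp add: F_iX phi_gen[OF g] lmgen) (intro lin_finsum alg_hom_linear[OF GH]; simp add: adj_mem)
  also have "... = finsum A.K (%i. A.iH (adj g i j) *[A.K] A.lm (env_gen g i)) (idx g)"
   using j by (intro vs_finsum_cong) (simp_all add: Gs G_iH G_iX adj_mem psi_gen[OF g])
  finally show ?thesis using A.iX_gen[OF j] by simp
 qed
 have FG_gen: "F (G (B.iX (env_gen (opp g) j))) = B.iX (env_gen (opp g) j)" if j: "j \<in> idx g" for j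
 proof -
  have "F (G (B.iX (env_gen (opp g) j))) = finsum B.K (%i. F (A.iH (A.v i j) *[A.K] A.iX (env_gen g i))) (idx g)"
   using j by (simp add: G_iX psi_gen[OF g] A.lm_gen) (intro lin_finsum alg_hom_linear[OF FH]; simp)
  also have "... = finsum B.K (%i. B.iH (adj_bar g i j) *[B.K] B.lm (env_gen (opp g) i)) (idx g)"
   using j by (intro vs_finsum_cong) (simp_all add: Fs F_iH F_iX A.v_def adj_bar_eq adj_bar_mem phi_gen[OF g])
  finally show ?thesis using B.iX_gen[of j] j by simp
 qed
 have GF_iX: "G (F (A.iX a)) = A.iX a" if "a :. (env g)" for a
  by (rule env_hom_unique[OF g alg_hom_comp[OF alg_hom_comp[OF GH FH] A.iX_hom] A.iX_hom GF_gen that])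
 have FG_iX: "F (G (B.iX b)) = B.iX b" if "b :. (env (opp g))" for b
  by (rule env_hom_unique[OF opp_g[OF g] alg_hom_comp[OF alg_hom_comp[OF FH GH] B.iX_hom] B.iX_hom _ that]) (simp add: FG_gen)
 have GF: "G (F k) = k" if "k :. A.K" for k using that
  by (induction rule: A.K_induct)
   (simp_all add: Fs Gs Fc F_iH G_iH GF_iX alg_hom_add[OF FH] alg_hom_add[OF GH])
 have FG: "F (G k) = k" if "k :. B.K" for k using that
  by (induction rule: B.K_induct)
   (simp_all add: Fs Gs Gc F_iH G_iH FG_iX alg_hom_add[OF FH] alg_hom_add[OF GH])
 have "bij_betw F (carrier A.K) (carrier B.K)"
  by (rule bij_betwI[where g=G]) (use GF FG Fc Gc in auto)
 then have "alg_iso A.K B.K F" using FH by (simp add: alg_iso_def)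
 moreover have "F (A.iX (env_gen g j)) = finsum B.K (%i. ten (coop H) (env (opp g)) (adj g i j) (env_gen (opp g) i)) (idx g)"
  if j: "j \<in> idx g" for j
  using j unfolding F_iX[OF env_gen_closed] phi_gen[OF g j] lmgen[OF j]
  by (intro vs_finsum_cong) (simp_all add: adj_mem B.ten_eq_mult)
 ultimately show ?thesis
  unfolding KA KB using F_iH by (intro exI[of _ F]) (simp add: A.iH_def B.iH_def A.iX_def)
qed

end

theorem corollary5p6:
  fixes g :: "('k::field, 'g::ab_group_add) based_lie"
    and H :: "('k, ('k, 'g) functional) hopf"
  assumes "based_lie_algebra g"
    and "k_subalgebra (carrier H) (dual_algebra (env g))"
    and "module.truncate H = (dual_algebra (env g))\<lparr>carrier := carrier H\<rparr>"
    and "hopf_algebra H"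
    and "hopf_pairing (env g) H (\<lambda>D f. f D)"
    and "env_min g \<subseteq> carrier H"
  shows
    "alg_iso (UR_H g H) (H_UL g H)
       (tensor_lift (H_UL g H)
         (\<lambda>(y, f). lam g H (psi g y) \<otimes>\<^bsub>H_UL g H\<^esub> ten H (env g) f \<one>\<^bsub>env g\<^esub>)) \<and>
     (\<exists>M. structure_maps_A g H M) \<and>
     (\<forall>M. structure_maps_A g H M \<longrightarrow> hopf_algebroid (H_UL g H) (env (opp g)) (env g) M) \<and>
     alg_iso (UL_Hco g H) (Hco_UR g H)
       (tensor_lift (Hco_UR g H)
         (\<lambda>(x, f). lam_R g H (phi g x) \<otimes>\<^bsub>Hco_UR g H\<^esub> ten (coop H) (env (opp g)) f \<one>\<^bsub>env (opp g)\<^esub>)) \<and>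
     (\<exists>F. alg_iso (H_UL g H) (Hco_UR g H) F \<and>
        (\<forall>f\<in>carrier H. F (ten H (env g) f \<one>\<^bsub>env g\<^esub>) = ten (coop H) (env (opp g)) f \<one>\<^bsub>env (opp g)\<^esub>) \<and>
        (\<forall>j\<in>idx g. F (ten H (env g) \<one>\<^bsub>H\<^esub> (env_gen g j)) =
           finsum (Hco_UR g H) (\<lambda>i. ten (coop H) (env (opp g)) (adj g i j) (env_gen (opp g) i)) (idx g))) \<and>
     (\<exists>M. structure_maps_B g H M) \<and>
     (\<forall>M. structure_maps_B g H M \<longrightarrow> hopf_algebroid (Hco_UR g H) (env g) (env (opp g)) M)"
proof -
 interpret functional_hopf g H using assms by (intro functional_hopf.intro)
 have A: "hopf_algebroid (H_UL g H) (env (opp g)) (env g) M" if "structure_maps_A g H M" for M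
  using scalar_extension.hopf_algebroid[of g H "%D f. f D" "adj g" M] that by (simp add: structure_maps_A_iff KA)
 have B: "hopf_algebroid (Hco_UR g H) (env g) (env (opp g)) M" if "structure_maps_B g H M" for M
  using scalar_extension.hopf_algebroid[of "opp g" "coop H" "%Y f. f (psi g Y)" "adj_bar g" M] that
  by (simp add: structure_maps_B_iff KB)
 have EA: "\<exists>M. structure_maps_A g H M" using A.extension_maps structure_maps_A_iff by blast
 have EB: "\<exists>M. structure_maps_B g H M" using B.extension_maps structure_maps_B_iff by blast
 show ?thesis using iso_A EA A iso_B iso_AB EB B by blast
qed

end
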